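(* Let $\mathcal{G}$ be a locally compact étale groupoid. The restriction of the map $\Theta:\mathcal{L}(L^2(\beta_{\mathrm{r}}\mathcal{G}\rtimes\mathcal{G}))^{\beta_{\mathrm{r}}\mathcal{G}\rtimes\mathcal{G}}\to\mathcal{L}(L^2(\mathcal{G}))$, $\Theta(T)=\kappa\circ T\circ\iota$, provides a $C^*$-isomorphism $$\Theta:C_{uq}^*(\beta_{\mathrm{r}}\mathcal{G}\rtimes\mathcal{G})^{\beta_{\mathrm{r}}\mathcal{G}\rtimes\mathcal{G}}\xrightarrow{\ \cong\ }C_{uq}^*(\mathcal{G}).$$
   Context: Locally compact spaces are assumed Hausdorff. A locally compact étale groupoid $\mathcal{H}$ is a topological groupoid with locally compact topology whose range map $\mathrm{r}$ (hence source map $\mathrm{s}$) is a local homeomorphism; $\mathcal{H}^{(0)}$ is its unit space and $\mathcal{H}_x=\mathrm{s}^{-1}(x)$. For $A,B\subseteq\mathcal{H}$, $A\cdot B=\{\alpha\beta:\alpha\in A,\beta\in B,\mathrm{s}(\alpha)=\mathrm{r}(\beta)\}$. For such $\mathcal{H}$: $L^2(\mathcal{H})$ is the Hilbert $C_0(\mathcal{H}^{(0)})$-module completing $C_c(\mathcal{H})$ for $\langle\eta,\xi\rangle(x)=\sum_{\gamma\in\mathcal{H}_x}\overline{\eta(\gamma)}\xi(\gamma)$, with $(\xi f)(\gamma)=\xi(\gamma)f(\mathrm{s}(\gamma))$; $\mathcal{L}(L^2(\mathcal{H}))$ is the $C^*$-algebra of adjointable operators; functions in $C_b(\mathcal{H})$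 act by pointwise multiplication. For $g\in C_c(\mathcal{H})$, $\rho(g)$ is the bounded operator $(\rho(g)\xi)(\gamma)=\sum_{\beta\in\mathcal{H}_{\mathrm{s}(\gamma)}}g(\beta)\xi(\gamma\beta^{-1})$ on $L^2(\mathcal{H})$; $T$ is $\mathcal{H}$-equivariant if $T\rho(g)=\rho(g)T$ for all $g\in C_c(\mathcal{H})$; $\mathcal{L}(L^2(\mathcal{H}))^{\mathcal{H}}$ is the algebra of equivariant operators. $f,g\in C_b(\mathcal{H})$ are $K$-separated ($K\subseteq\mathcal{H}$) if $(K\cdot\mathrm{supp}(f))\cap\mathrm{supp}(g)=\emptyset$ and $\mathrm{supp}(f)\cap(K\cdot\mathrm{supp}(g))=\emptyset$. $T$ is quasi-local if for any $\varepsilon>0$ there is a compact $K\subseteq\mathcal{H}$ with $\|gTf\|<\varepsilon\|g\|_\infty\|f\|_\infty$ (read as $\le$ when $f=0$ or $g=0$) for all $K$-separated $f,g\in C_b(\mathcal{H})$. $C_{uq}^*(\mathcal{H})$ is the $C^*$-algebra of quasi-local operators and $C_{uq}^*(\mathcal{H})^{\mathcal{H}}$ its subalgebra of $\mathcal{H}$-equivariant operators. Fibrewise Stone–Čech compactification: let $C_0(\mathcal{G},\mathrm{r})\subseteq C_b(\mathcal{G})$ be the norm closure of the set of $g\in C_b(\mathcal{G})$ for which there is a compact $K\subseteq\mathcal{G}^{(0)}$ with $\mathrm{supp}(g)\subseteq\mathrm{r}^{-1}(K)$. $\beta_{\mathrm{r}}\mathcal{G}$ is its Gelfand spectrum; it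 contains $\mathcal{G}$ as an open dense subset, and $\mathrm{r}$ extends to a continuous proper map $\mathrm{r}_\beta:\beta_{\mathrm{r}}\mathcal{G}\to\mathcal{G}^{(0)}$. The left multiplication action of $\mathcal{G}$ on $(\mathcal{G},\mathrm{r})$ extends uniquely to a continuous $\mathcal{G}$-action $(\gamma,z)\mapsto\gamma z$ ($\mathrm{s}(\gamma)=\mathrm{r}_\beta(z)$) on $(\beta_{\mathrm{r}}\mathcal{G},\mathrm{r}_\beta)$. The semi-direct product $\beta_{\mathrm{r}}\mathcal{G}\rtimes\mathcal{G}=\{(z,\gamma)\in\beta_{\mathrm{r}}\mathcal{G}\times\mathcal{G}:\mathrm{r}_\beta(z)=\mathrm{r}(\gamma)\}$ is a locally compact étale groupoid with unit space $\beta_{\mathrm{r}}\mathcal{G}$, range $z$, source $\gamma^{-1}z$, product $(z,\gamma)(\gamma^{-1}z,\gamma')=(z,\gamma\gamma')$, inverse $(\gamma^{-1}z,\gamma^{-1})$. $\iota:L^2(\mathcal{G})\to L^2(\beta_{\mathrm{r}}\mathcal{G}\rtimes\mathcal{G})$ is the isometry extending $(\iota\xi)(z,\gamma)=\xi(\gamma)$, $\xi\in C_c(\mathcal{G})$; $\kappa:L^2(\beta_{\mathrm{r}}\mathcal{G}\rtimes\mathcal{G})\to L^2(\mathcal{G})$ is the contraction extending $(\kappa\eta)(\gamma)=\eta(\gamma,\gamma)$, $\eta\in C_c(\beta_{\mathrm{r}}\mathcal{G}\rtimes\mathcal{G})$. *)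

theory Defs
  imports "HOL-Analysis.Analysis"
begin

section \<open>Locally compact etale groupoids\<close>

text \<open>
  A groupoid is given by its space of arrows; the unit space is a subspace of it, and range and
  source take values in the arrows.  Only the values of the operations on arrows, resp.
  on composable pairs, are relevant.
\<close>

record 'a groupoid =
  gtop :: "'a topology"
  rg :: "'a \<Rightarrow> 'a"
  sr :: "'a \<Rightarrow> 'a"
  gmul :: "'a \<Rightarrow> 'a \<Rightarrow> 'a"
  ginv :: "'a \<Rightarrow> 'a"

abbreviation arr :: "('a, 'm) groupoid_scheme \<Rightarrow> 'a set"
  where "arr H \<equiv> topspace (gtop H)"

definition units :: "('a, 'm) groupoid_scheme \<Rightarrow> 'a set"
  where "units H = rg H ` arr H"

abbreviation unit_top :: "('a, 'm) groupoid_scheme \<Rightarrow> 'a topology"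
  where "unit_top H \<equiv> subtopology (gtop H) (units H)"

definition fibre :: "('a, 'm) groupoid_scheme \<Rightarrow> 'a \<Rightarrow> 'a set"
  where "fibre H x = {\<gamma> \<in> arr H. sr H \<gamma> = x}"

definition composable :: "('a, 'm) groupoid_scheme \<Rightarrow> ('a \<times> 'a) set"
  where "composable H = {(\<alpha>, \<beta>). \<alpha> \<in> arr H \<and> \<beta> \<in> arr H \<and> sr H \<alpha> = rg H \<beta>}"

definition set_mul :: "('a, 'm) groupoid_scheme \<Rightarrow> 'a set \<Rightarrow> 'a set \<Rightarrow> 'a set"
  where "set_mul H A B = {gmul H \<alpha> \<beta> |\<alpha> \<beta>. \<alpha> \<in> A \<and> \<beta> \<in> B \<and> sr H \<alpha> = rg H \<beta>}"

definition algebraic_groupoid :: "('a, 'm) groupoid_scheme \<Rightarrow> bool"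
  where "algebraic_groupoid H \<longleftrightarrow>
    (\<forall>\<gamma>\<in>arr H. rg H \<gamma> \<in> arr H \<and> sr H \<gamma> \<in> arr H \<and>
        rg H (rg H \<gamma>) = rg H \<gamma> \<and> sr H (rg H \<gamma>) = rg H \<gamma> \<and>
        rg H (sr H \<gamma>) = sr H \<gamma> \<and> sr H (sr H \<gamma>) = sr H \<gamma> \<and>
        gmul H (rg H \<gamma>) \<gamma> = \<gamma> \<and> gmul H \<gamma> (sr H \<gamma>) = \<gamma>) \<and>
    (\<forall>(\<alpha>, \<beta>)\<in>composable H. gmul H \<alpha> \<beta> \<in> arr H \<and>
        rg H (gmul H \<alpha> \<beta>) = rg H \<alpha> \<and> sr H (gmul H \<alpha> \<beta>) = sr H \<beta>) \<and>
    (\<forall>\<alpha> \<beta> \<gamma>. (\<alpha>, \<beta>) \<in> composable H \<and> (\<beta>, \<gamma>) \<in> composable H \<longrightarrow>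
        gmul H (gmul H \<alpha> \<beta>) \<gamma> = gmul H \<alpha> (gmul H \<beta> \<gamma>)) \<and>
    (\<forall>\<gamma>\<in>arr H. ginv H \<gamma> \<in> arr H \<and>
        rg H (ginv H \<gamma>) = sr H \<gamma> \<and> sr H (ginv H \<gamma>) = rg H \<gamma> \<and>
        gmul H \<gamma> (ginv H \<gamma>) = rg H \<gamma> \<and> gmul H (ginv H \<gamma>) \<gamma> = sr H \<gamma>)"

definition topological_groupoid :: "('a, 'm) groupoid_scheme \<Rightarrow> bool"
  where "topological_groupoid H \<longleftrightarrow> algebraic_groupoid H \<and>
    continuous_map (subtopology (prod_topology (gtop H) (gtop H)) (composable H)) (gtop H)
      (\<lambda>(\<alpha>, \<beta>). gmul H \<alpha> \<beta>) \<and>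
    continuous_map (gtop H) (gtop H) (ginv H)"

definition local_homeomorphism :: "'a topology \<Rightarrow> 'b topology \<Rightarrow> ('a \<Rightarrow> 'b) \<Rightarrow> bool"
  where "local_homeomorphism X Y f \<longleftrightarrow>
    (\<forall>x\<in>topspace X. \<exists>U. openin X U \<and> x \<in> U \<and> openin Y (f ` U) \<and>
        homeomorphic_map (subtopology X U) (subtopology Y (f ` U)) f)"

definition locally_compact_etale_groupoid :: "('a, 'm) groupoid_scheme \<Rightarrow> bool"
  where "locally_compact_etale_groupoid H \<longleftrightarrow> topological_groupoid H \<and>
    locally_compact_space (gtop H) \<and> Hausdorff_space (gtop H) \<and>
    local_homeomorphism (gtop H) (unit_top H) (rg H)"


section \<open>Functions on a groupoid\<close>

text \<open>
  Complex functions on \<open>H\<close> are represented by total functions vanishing off \<open>arr H\<close>, so that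
  suprema may be taken over the whole (nonempty) type.
\<close>

definition supp :: "('a, 'm) groupoid_scheme \<Rightarrow> ('a \<Rightarrow> complex) \<Rightarrow> 'a set"
  where "supp H f = gtop H closure_of {\<gamma>. f \<gamma> \<noteq> 0}"

definition Cb :: "('a, 'm) groupoid_scheme \<Rightarrow> ('a \<Rightarrow> complex) set"
  where "Cb H = {f. continuous_map (gtop H) euclidean f \<and> bounded (range f) \<and>
    (\<forall>\<gamma>. \<gamma> \<notin> arr H \<longrightarrow> f \<gamma> = 0)}"

definition Cc :: "('a, 'm) groupoid_scheme \<Rightarrow> ('a \<Rightarrow> complex) set"
  where "Cc H = {f. continuous_map (gtop H) euclidean f \<and> compactin (gtop H) (supp H f) \<and>
    (\<forall>\<gamma>. \<gamma> \<notin> arr H \<longrightarrow> f \<gamma> = 0)}"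

definition sup_norm :: "('a \<Rightarrow> complex) \<Rightarrow> real"
  where "sup_norm f = (SUP \<gamma>. cmod (f \<gamma>))"


section \<open>The Hilbert module \<open>L\<^sup>2(H)\<close> and its operators\<close>

definition L2_inner ::
    "('a, 'm) groupoid_scheme \<Rightarrow> ('a \<Rightarrow> complex) \<Rightarrow> ('a \<Rightarrow> complex) \<Rightarrow> 'a \<Rightarrow> complex"
  where "L2_inner H \<eta> \<xi> x = (\<Sum>\<^sub>\<infinity>\<gamma>\<in>fibre H x. cnj (\<eta> \<gamma>) * \<xi> \<gamma>)"

text \<open>The norm of a Hilbert \<open>C\<^sub>0(H\<^sup>0)\<close>-module; the inner product vanishes off \<open>units H\<close>.\<close>

definition L2_norm :: "('a, 'm) groupoid_scheme \<Rightarrow> ('a \<Rightarrow> complex) \<Rightarrow> real"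
  where "L2_norm H \<xi> = sqrt (sup_norm (L2_inner H \<xi> \<xi>))"

definition l2_fields :: "('a, 'm) groupoid_scheme \<Rightarrow> ('a \<Rightarrow> complex) set"
  where "l2_fields H = {\<xi>. (\<forall>\<gamma>. \<gamma> \<notin> arr H \<longrightarrow> \<xi> \<gamma> = 0) \<and>
    (\<forall>x. (\<lambda>\<gamma>. (cmod (\<xi> \<gamma>))\<^sup>2) summable_on fibre H x) \<and>
    bounded (range (L2_inner H \<xi> \<xi>))}"

text \<open>
  The completion of \<open>Cc H\<close>, realised as its closure in the Banach space \<open>l2_fields H\<close> of bounded
  families of elements of the spaces \<open>\<ell>\<^sup>2(H\<^sub>x)\<close>.  As the norm dominates point evaluations,
  elements of the completion are functions on \<open>H\<close>, and the maps given below by pointwise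
  formulas (inner product, multiplication operators, \<open>\<rho>(g)\<close>, \<open>\<iota>\<close>, \<open>\<kappa>\<close>) are the continuous
  extensions of the corresponding maps on compactly supported functions.
\<close>

definition L2 :: "('a, 'm) groupoid_scheme \<Rightarrow> ('a \<Rightarrow> complex) set"
  where "L2 H = {\<xi> \<in> l2_fields H. \<forall>\<epsilon>>0. \<exists>\<eta>\<in>Cc H. L2_norm H (\<lambda>\<gamma>. \<xi> \<gamma> - \<eta> \<gamma>) < \<epsilon>}"

type_synonym 'a L2_op = "('a \<Rightarrow> complex) \<Rightarrow> 'a \<Rightarrow> complex"

definition is_adjoint :: "('a, 'm) groupoid_scheme \<Rightarrow> 'a L2_op \<Rightarrow> 'a L2_op \<Rightarrow> bool"
  where "is_adjoint H T S \<longleftrightarrow> S \<in> L2 H \<rightarrow>\<^sub>E L2 H \<and>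
    (\<forall>\<xi>\<in>L2 H. \<forall>\<eta>\<in>L2 H. L2_inner H (T \<xi>) \<eta> = L2_inner H \<xi> (S \<eta>))"

text \<open>Adjointable maps are automatically linear, bounded and module maps.\<close>

definition adjointable :: "('a, 'm) groupoid_scheme \<Rightarrow> 'a L2_op set"
  where "adjointable H = {T \<in> L2 H \<rightarrow>\<^sub>E L2 H. \<exists>S. is_adjoint H T S}"

definition op_adj :: "('a, 'm) groupoid_scheme \<Rightarrow> 'a L2_op \<Rightarrow> 'a L2_op"
  where "op_adj H T = (THE S. is_adjoint H T S)"

definition op_zero :: "('a, 'm) groupoid_scheme \<Rightarrow> 'a L2_op"
  where "op_zero H = (\<lambda>\<xi>\<in>L2 H. \<lambda>\<gamma>. 0)"

definition op_add :: "('a, 'm) groupoid_scheme \<Rightarrow> 'a L2_op \<Rightarrow> 'a L2_op \<Rightarrow> 'a L2_op"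
  where "op_add H S T = (\<lambda>\<xi>\<in>L2 H. \<lambda>\<gamma>. S \<xi> \<gamma> + T \<xi> \<gamma>)"

definition op_scale :: "('a, 'm) groupoid_scheme \<Rightarrow> complex \<Rightarrow> 'a L2_op \<Rightarrow> 'a L2_op"
  where "op_scale H c T = (\<lambda>\<xi>\<in>L2 H. \<lambda>\<gamma>. c * T \<xi> \<gamma>)"

definition op_mul :: "('a, 'm) groupoid_scheme \<Rightarrow> 'a L2_op \<Rightarrow> 'a L2_op \<Rightarrow> 'a L2_op"
  where "op_mul H S T = compose (L2 H) S T"

definition op_norm :: "('a, 'm) groupoid_scheme \<Rightarrow> 'a L2_op \<Rightarrow> real"
  where "op_norm H T = (SUP \<xi>\<in>{\<xi> \<in> L2 H. L2_norm H \<xi> \<le> 1}. L2_norm H (T \<xi>))"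

definition mult_op :: "('a, 'm) groupoid_scheme \<Rightarrow> ('a \<Rightarrow> complex) \<Rightarrow> 'a L2_op"
  where "mult_op H f = (\<lambda>\<xi>\<in>L2 H. \<lambda>\<gamma>. f \<gamma> * \<xi> \<gamma>)"

definition rho :: "('a, 'm) groupoid_scheme \<Rightarrow> ('a \<Rightarrow> complex) \<Rightarrow> 'a L2_op"
  where "rho H g = (\<lambda>\<xi>\<in>L2 H. \<lambda>\<gamma>. if \<gamma> \<in> arr H
    then \<Sum>\<^sub>\<infinity>\<beta>\<in>fibre H (sr H \<gamma>). g \<beta> * \<xi> (gmul H \<gamma> (ginv H \<beta>)) else 0)"

definition equivariant :: "('a, 'm) groupoid_scheme \<Rightarrow> 'a L2_op \<Rightarrow> bool"
  where "equivariant H T \<longleftrightarrow> (\<forall>g\<in>Cc H. op_mul H T (rho H g) = op_mul H (rho H g) T)"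

definition adjointable_equivariant :: "('a, 'm) groupoid_scheme \<Rightarrow> 'a L2_op set"
  where "adjointable_equivariant H = {T \<in> adjointable H. equivariant H T}"

definition separated ::
    "('a, 'm) groupoid_scheme \<Rightarrow> 'a set \<Rightarrow> ('a \<Rightarrow> complex) \<Rightarrow> ('a \<Rightarrow> complex) \<Rightarrow> bool"
  where "separated H K f g \<longleftrightarrow>
    set_mul H K (supp H f) \<inter> supp H g = {} \<and> supp H f \<inter> set_mul H K (supp H g) = {}"

text \<open>The strict bound is unattainable when \<open>f\<close> or \<open>g\<close> vanishes, hence the case distinction.\<close>

definition quasi_local :: "('a, 'm) groupoid_scheme \<Rightarrow> 'a L2_op \<Rightarrow> bool"
  where "quasi_local H T \<longleftrightarrow> (\<forall>\<epsilon>>0. \<exists>K. compactin (gtop H) K \<and>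
    (\<forall>f\<in>Cb H. \<forall>g\<in>Cb H. separated H K f g \<longrightarrow>
      (if f = (\<lambda>_. 0) \<or> g = (\<lambda>_. 0)
       then op_norm H (op_mul H (mult_op H g) (op_mul H T (mult_op H f))) \<le> \<epsilon> * sup_norm g * sup_norm f
       else op_norm H (op_mul H (mult_op H g) (op_mul H T (mult_op H f))) < \<epsilon> * sup_norm g * sup_norm f)))"

definition Cuq :: "('a, 'm) groupoid_scheme \<Rightarrow> 'a L2_op set"
  where "Cuq H = {T \<in> adjointable H. quasi_local H T}"

definition Cuq_equivariant :: "('a, 'm) groupoid_scheme \<Rightarrow> 'a L2_op set"
  where "Cuq_equivariant H = {T \<in> Cuq H. equivariant H T}"


section \<open>Concrete \<open>C\<^sup>*\<close>-algebras and their isomorphisms\<close>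

definition cstar_subalgebra :: "('a, 'm) groupoid_scheme \<Rightarrow> 'a L2_op set \<Rightarrow> bool"
  where "cstar_subalgebra H A \<longleftrightarrow> A \<subseteq> adjointable H \<and> op_zero H \<in> A \<and>
    (\<forall>S\<in>A. \<forall>T\<in>A. op_add H S T \<in> A \<and> op_mul H S T \<in> A) \<and>
    (\<forall>c. \<forall>T\<in>A. op_scale H c T \<in> A) \<and> (\<forall>T\<in>A. op_adj H T \<in> A) \<and>
    (\<forall>T\<in>adjointable H. (\<forall>\<epsilon>>0. \<exists>S\<in>A. op_norm H (op_add H T (op_scale H (-1) S)) < \<epsilon>) \<longrightarrow> T \<in> A)"

text \<open>The isometry clause is automatic for bijective \<open>*\<close>-homomorphisms of \<open>C\<^sup>*\<close>-algebras.\<close>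

definition cstar_isomorphism :: "('a, 'm) groupoid_scheme \<Rightarrow> 'a L2_op set \<Rightarrow>
    ('b, 'n) groupoid_scheme \<Rightarrow> 'b L2_op set \<Rightarrow> ('a L2_op \<Rightarrow> 'b L2_op) \<Rightarrow> bool"
  where "cstar_isomorphism H A H' A' \<Phi> \<longleftrightarrow>
    cstar_subalgebra H A \<and> cstar_subalgebra H' A' \<and> bij_betw \<Phi> A A' \<and>
    (\<forall>S\<in>A. \<forall>T\<in>A. \<Phi> (op_add H S T) = op_add H' (\<Phi> S) (\<Phi> T)) \<and>
    (\<forall>c. \<forall>T\<in>A. \<Phi> (op_scale H c T) = op_scale H' c (\<Phi> T)) \<and>
    (\<forall>S\<in>A. \<forall>T\<in>A. \<Phi> (op_mul H S T) = op_mul H' (\<Phi> S) (\<Phi> T)) \<and>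
    (\<forall>T\<in>A. \<Phi> (op_adj H T) = op_adj H' (\<Phi> T)) \<and>
    (\<forall>T\<in>A. op_norm H' (\<Phi> T) = op_norm H T)"


section \<open>Groupoid actions and semi-direct products\<close>

definition action_domain ::
    "('a, 'm) groupoid_scheme \<Rightarrow> 'z topology \<Rightarrow> ('z \<Rightarrow> 'a) \<Rightarrow> ('a \<times> 'z) set"
  where "action_domain G Z p = {(\<gamma>, z). \<gamma> \<in> arr G \<and> z \<in> topspace Z \<and> sr G \<gamma> = p z}"

definition continuous_action ::
    "('a, 'm) groupoid_scheme \<Rightarrow> 'z topology \<Rightarrow> ('z \<Rightarrow> 'a) \<Rightarrow> ('a \<times> 'z \<Rightarrow> 'z) \<Rightarrow> bool"
  where "continuous_action G Z p a \<longleftrightarrow>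
    continuous_map Z (unit_top G) p \<and>
    continuous_map (subtopology (prod_topology (gtop G) Z) (action_domain G Z p)) Z a \<and>
    (\<forall>(\<gamma>, z)\<in>action_domain G Z p. p (a (\<gamma>, z)) = rg G \<gamma>) \<and>
    (\<forall>z\<in>topspace Z. a (p z, z) = z) \<and>
    (\<forall>\<gamma> \<gamma>' z. (\<gamma>, \<gamma>') \<in> composable G \<and> (\<gamma>', z) \<in> action_domain G Z p \<longrightarrow>
        a (gmul G \<gamma> \<gamma>', z) = a (\<gamma>, a (\<gamma>', z)))"

text \<open>The unit space \<open>Z\<close> of the semi-direct product is identified with the arrows \<open>(z, p z)\<close>.\<close>

definition semidirect :: "('a, 'm) groupoid_scheme \<Rightarrow> 'z topology \<Rightarrow> ('z \<Rightarrow> 'a) \<Rightarrow>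
    ('a \<times> 'z \<Rightarrow> 'z) \<Rightarrow> ('z \<times> 'a) groupoid"
  where "semidirect G Z p a = \<lparr>
    gtop = subtopology (prod_topology Z (gtop G)) {(z, \<gamma>). p z = rg G \<gamma>},
    rg = (\<lambda>(z, \<gamma>). (z, p z)),
    sr = (\<lambda>(z, \<gamma>). (a (ginv G \<gamma>, z), p (a (ginv G \<gamma>, z)))),
    gmul = (\<lambda>(z, \<gamma>) (z', \<gamma>'). (z, gmul G \<gamma> \<gamma>')),
    ginv = (\<lambda>(z, \<gamma>). (a (ginv G \<gamma>, z), ginv G \<gamma>)) \<rparr>"


section \<open>The fibrewise Stone-Cech compactification\<close>

definition C0r :: "('a, 'm) groupoid_scheme \<Rightarrow> ('a \<Rightarrow> complex) set"
  where "C0r G = {f \<in> Cb G. \<forall>\<epsilon>>0. \<exists>g\<in>Cb G.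
    (\<exists>K. compactin (unit_top G) K \<and> supp G g \<subseteq> {\<gamma> \<in> arr G. rg G \<gamma> \<in> K}) \<and>
    sup_norm (\<lambda>\<gamma>. f \<gamma> - g \<gamma>) < \<epsilon>}"

text \<open>Nonzero multiplicative linear functionals on an algebra of functions, with the topology of
  pointwise convergence.\<close>

definition gelfand_spectrum :: "('a \<Rightarrow> complex) set \<Rightarrow> (('a \<Rightarrow> complex) \<Rightarrow> complex) topology"
  where "gelfand_spectrum A = subtopology (product_topology (\<lambda>_. euclidean) A)
    {\<phi>. (\<exists>f\<in>A. \<phi> f \<noteq> 0) \<and>
        (\<forall>f\<in>A. \<forall>g\<in>A. \<phi> (\<lambda>\<gamma>. f \<gamma> + g \<gamma>) = \<phi> f + \<phi> g) \<and>
        (\<forall>c. \<forall>f\<in>A. \<phi> (\<lambda>\<gamma>. c * f \<gamma>) = c * \<phi> f) \<and>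
        (\<forall>f\<in>A. \<forall>g\<in>A. \<phi> (\<lambda>\<gamma>. f \<gamma> * g \<gamma>) = \<phi> f * \<phi> g)}"

type_synonym 'a beta = "('a \<Rightarrow> complex) \<Rightarrow> complex"

definition beta_r :: "('a, 'm) groupoid_scheme \<Rightarrow> 'a beta topology"
  where "beta_r G = gelfand_spectrum (C0r G)"

definition ev :: "('a, 'm) groupoid_scheme \<Rightarrow> 'a \<Rightarrow> 'a beta"
  where "ev G \<gamma> = (\<lambda>f\<in>C0r G. f \<gamma>)"

text \<open>
  The image of \<open>ev G\<close> is dense in \<open>beta_r G\<close>, so the two extensions below are unique once their
  values off their domains are fixed.
\<close>

definition r_beta :: "('a, 'm) groupoid_scheme \<Rightarrow> 'a beta \<Rightarrow> 'a"
  where "r_beta G = (THE p. p \<in> extensional (topspace (beta_r G)) \<and>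
    continuous_map (beta_r G) (unit_top G) p \<and> (\<forall>\<gamma>\<in>arr G. p (ev G \<gamma>) = rg G \<gamma>))"

definition beta_act :: "('a, 'm) groupoid_scheme \<Rightarrow> 'a \<times> 'a beta \<Rightarrow> 'a beta"
  where "beta_act G = (THE a. a \<in> extensional (action_domain G (beta_r G) (r_beta G)) \<and>
    continuous_action G (beta_r G) (r_beta G) a \<and>
    (\<forall>(\<gamma>, \<alpha>)\<in>composable G. a (\<gamma>, ev G \<alpha>) = ev G (gmul G \<gamma> \<alpha>)))"

definition beta_semidirect :: "('a, 'm) groupoid_scheme \<Rightarrow> ('a beta \<times> 'a) groupoid"
  where "beta_semidirect G = semidirect G (beta_r G) (r_beta G) (beta_act G)"


section \<open>The maps \<open>\<iota>\<close>, \<open>\<kappa>\<close> and \<open>\<Theta>\<close>\<close>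

definition iota :: "('a, 'm) groupoid_scheme \<Rightarrow> ('a \<Rightarrow> complex) \<Rightarrow> 'a beta \<times> 'a \<Rightarrow> complex"
  where "iota G = (\<lambda>\<xi>\<in>L2 G. \<lambda>(z, \<gamma>). if (z, \<gamma>) \<in> arr (beta_semidirect G) then \<xi> \<gamma> else 0)"

definition kappa :: "('a, 'm) groupoid_scheme \<Rightarrow> ('a beta \<times> 'a \<Rightarrow> complex) \<Rightarrow> 'a \<Rightarrow> complex"
  where "kappa G = (\<lambda>\<eta>\<in>L2 (beta_semidirect G). \<lambda>\<gamma>. if \<gamma> \<in> arr G then \<eta> (ev G \<gamma>, \<gamma>) else 0)"

definition Theta :: "('a, 'm) groupoid_scheme \<Rightarrow> ('a beta \<times> 'a) L2_op \<Rightarrow> 'a L2_op"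
  where "Theta G T = compose (L2 G) (kappa G) (compose (L2 G) T (iota G))"

end

theory Submission
  imports Defs
begin

text \<open>An adjointable operator on \<open>L\<^sup>2\<close> of an etale groupoid is determined by its kernel
  \<open>m(\<gamma>, \<beta>)\<close>, a continuous function on the pairs with equal source that defines uniformly bounded
  matrices on the fibres. Quasi-locality of the operator becomes smallness of the blocks of these
  matrices between \<open>K\<close>-separated subsets of a fibre, and equivariance becomes invariance of the
  kernel under right translation. Conversely every continuous bounded kernel which is quasi-local in
  this sense comes from an adjointable operator, since quasi-locality permits a cut-off to compact
  supports.

  On \<open>\<beta>G \<rtimes> G\<close> an invariant kernel is \<open>m(g, h) = t(g h\<inverse>)\<close> for a continuous function \<open>t\<close>, and
  \<open>\<Theta>\<close> restricts \<open>m\<close> to the fibres over \<open>G \<subseteq> \<beta>G\<close>, that is, \<open>\<Theta>(T)\<close> has the kernel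
  \<open>(\<gamma>, \<beta>) \<mapsto> t(\<gamma>, \<gamma> \<beta>\<inverse>)\<close>. As \<open>G\<close> is dense in \<open>\<beta>G\<close>, norm bounds and quasi-locality estimates on these
  fibres extend by continuity to all fibres, so \<open>\<Theta>\<close> is isometric. For surjectivity, the kernel of a
  given operator on \<open>L\<^sup>2(G)\<close>, written as a function of \<open>(\<gamma>, \<gamma> \<beta>\<inverse>)\<close>, is bounded and continuous and
  therefore extends continuously to \<open>\<beta>G \<rtimes> G\<close>.\<close>

section \<open>Continuous maps between abstract topologies\<close>

text \<open>Norm bounds and quasi-locality are stated for finite submatrices
  (\<open>formbd\<close>). Such a bound concerns finitely many kernel values, so it is a closed
  condition that can be moved along local sections from the fibres over G, which are dense, to every
  fibre. An operator norm, a supremum over global sections, gives no such access to a single fibre.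

  The obstacle in surjectivity is that a bounded continuous kernel need not define an operator: the
  image of a compactly supported function must be approximable by compactly supported functions
  uniformly over all fibres. Quasi-locality of the extended kernel supplies this, hence it is proved
  before the operator exists.

  The scales of quasi-locality in G and in the semi-direct product match for two reasons. Being
  apart depends only on the quotients f a\<inverse>, which the parametrisation \<gamma> \<mapsto>
  (\<gamma>z, \<gamma>) of the fibre over z respects. And the extended range map is proper: a
  compact K in G lifts to the compact set of all (z, \<gamma>) with \<gamma> in K, while compact
  sets of the semi-direct product project to compact sets of G.\<close>

lemma continuous_map_locally:
  assumes "\<And>x. x \<in> topspace X \<Longrightarrow> \<exists>W. openin X W \<and> x \<in> W \<and> continuous_map (subtopology X W) Y f"
  shows "continuous_map X Y f"
proof -
  obtain W where W: "\<And>x. x \<in> topspace X \<Longrightarrow>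
      openin X (W x) \<and> x \<in> W x \<and> continuous_map (subtopology X (W x)) Y f"
    using assms by metis
  show ?thesis
    by (rule pasting_lemma[where I="topspace X" and T=W and f="\<lambda>_. f"]) (use W in auto)
qed

lemma continuous_map_binop:
  fixes h :: "'b::topological_space \<Rightarrow> 'c::topological_space \<Rightarrow> 'd::topological_space"
  assumes "continuous_map X euclidean f" "continuous_map X euclidean g"
    and "continuous_on UNIV (\<lambda>p. h (fst p) (snd p))"
  shows "continuous_map X euclidean (\<lambda>x. h (f x) (g x))"
proof -
  have "continuous_map X (prod_topology euclidean euclidean) (\<lambda>x. (f x, g x))"
    using assms(1,2) by (simp only: continuous_map_paired)
  then have "continuous_map X euclidean (\<lambda>x. (f x, g x))"
    by simp
  then have "continuous_map X euclidean ((\<lambda>p. h (fst p) (snd p)) \<circ> (\<lambda>x. (f x, g x)))"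
    by (rule continuous_map_compose) (use assms(3) in simp)
  then show ?thesis by (simp add: o_def)
qed

lemma continuous_map_unop:
  fixes h :: "'b::topological_space \<Rightarrow> 'd::topological_space"
  assumes "continuous_map X euclidean f" "continuous_on UNIV h"
  shows "continuous_map X euclidean (\<lambda>x. h (f x))"
  using continuous_map_compose[OF assms(1), of euclidean h] assms(2) by (simp add: o_def)

lemma continuous_map_complex_mult [continuous_intros]:
  fixes f :: "'a \<Rightarrow> complex"
  assumes "continuous_map X euclidean f" "continuous_map X euclidean g"
  shows "continuous_map X euclidean (\<lambda>x. f x * g x)"
  by (rule continuous_map_binop[OF assms]) (intro continuous_intros)

lemma continuous_map_cnj [continuous_intros]:
  assumes "continuous_map X euclidean f"
  shows "continuous_map X euclidean (\<lambda>x. cnj (f x))"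
  by (rule continuous_map_unop[OF assms]) (intro continuous_intros)

lemma continuous_map_of_real [continuous_intros]:
  assumes "continuous_map X euclidean f"
  shows "continuous_map X euclidean (\<lambda>x. of_real (f x) :: complex)"
  by (rule continuous_map_unop[OF assms]) (intro continuous_intros)

lemma continuous_map_complex_divide:
  fixes f g :: "'a \<Rightarrow> complex"
  assumes "continuous_map X euclidean f" "continuous_map X euclidean g"
    "\<And>x. x \<in> topspace X \<Longrightarrow> g x \<noteq> 0"
  shows "continuous_map X euclidean (\<lambda>x. f x / g x)"
proof -
  have "continuous_map X (top_of_set (- {0})) g"
    using assms by (auto simp: continuous_map_in_subtopology)
  moreover have "continuous_map (top_of_set (- {0})) euclidean (inverse :: complex \<Rightarrow> complex)"
    unfolding continuous_map_iff_continuous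
    by (intro continuous_intros) auto
  ultimately have "continuous_map X euclidean (inverse \<circ> g)"
    by (rule continuous_map_compose)
  then have "continuous_map X euclidean (\<lambda>x. f x * inverse (g x))"
    by (intro continuous_map_complex_mult assms(1)) (simp add: o_def)
  then show ?thesis by (simp add: divide_inverse)
qed

lemma continuous_map_euclidean_uniform_limit:
  fixes f :: "'a \<Rightarrow> complex"
  assumes "\<And>\<epsilon>. \<epsilon> > 0 \<Longrightarrow> \<exists>g. continuous_map X euclidean g \<and> (\<forall>x\<in>topspace X. cmod (f x - g x) \<le> \<epsilon>)"
  shows "continuous_map X euclidean f"
proof -
  obtain g where g: "\<And>n::nat. continuous_map X euclidean (g n)"
      "\<And>(n::nat) x. x \<in> topspace X \<Longrightarrow> cmod (f x - g n x) \<le> inverse (Suc n)"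
  proof -
    have "\<forall>n::nat. \<exists>g. continuous_map X euclidean g \<and> (\<forall>x\<in>topspace X. cmod (f x - g x) \<le> inverse (Suc n))"
      by (intro allI assms) simp
    then show thesis using that by metis
  qed
  have "continuous_map X Met_TC.mtopology f"
  proof (rule Met_TC.continuous_map_uniform_limit[where F=sequentially and f=g])
    fix e :: real assume "e > 0"
    then have "eventually (\<lambda>n. inverse (real (Suc n)) < e) sequentially"
      using LIMSEQ_inverse_real_of_nat order_tendstoD(2) by blast
    then show "\<forall>\<^sub>F n in sequentially. \<forall>x\<in>topspace X. f x \<in> UNIV \<and> dist (g n x) (f x) < e"
    proof eventually_elim
      case (elim n)
      then show ?case
        using g(2)[of _ n] by (force simp: dist_norm norm_minus_commute)
    qed
  qed (use g in auto)
  then show ?thesis by simp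
qed

lemma disjoint_open_neighbourhoods:
  assumes "Hausdorff_space X" "finite A" "A \<subseteq> topspace X"
  obtains U where "\<And>a. a \<in> A \<Longrightarrow> openin X (U a) \<and> a \<in> U a"
    "\<And>a b. a \<in> A \<Longrightarrow> b \<in> A \<Longrightarrow> a \<noteq> b \<Longrightarrow> U a \<inter> U b = {}"
proof -
  have "\<forall>a b. \<exists>P Q. a \<in> A \<and> b \<in> A \<and> a \<noteq> b \<longrightarrow> openin X P \<and> openin X Q \<and> a \<in> P \<and> b \<in> Q \<and> P \<inter> Q = {}"
    using assms unfolding Hausdorff_space_def disjnt_def by (metis subsetD)
  then obtain P Q where PQ: "\<And>a b. a \<in> A \<and> b \<in> A \<and> a \<noteq> b \<Longrightarrow>
      openin X (P a b) \<and> openin X (Q a b) \<and> a \<in> P a b \<and> b \<in> Q a b \<and> P a b \<inter> Q a b = {}"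
    by metis
  \<comment> \<open>The sets chosen for (a, b) and for (b, a) are unrelated, so both are used: U a
    lies in P a b and U b lies in Q a b, which are disjoint. The factor \<open>topspace X\<close>
    covers the case of a single point, where the intersection is empty.\<close>
  define U where "U a = topspace X \<inter> (\<Inter>b\<in>A-{a}. P a b \<inter> Q b a)" for a
  show thesis
  proof
    show "openin X (U a) \<and> a \<in> U a" if "a \<in> A" for a
    proof
      have "openin X ((\<Inter>b\<in>A-{a}. P a b \<inter> Q b a) \<inter> topspace X)"
        by (rule openin_INT) (use PQ that \<open>finite A\<close> in auto)
      then show "openin X (U a)" by (simp add: U_def Int_commute)
      show "a \<in> U a"
        using PQ that assms(3) unfolding U_def by auto
    qed
    show "U a \<inter> U b = {}" if "a \<in> A" "b \<in> A" "a \<noteq> b" for a b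
      using PQ[of a b] that unfolding U_def by blast
  qed
qed

text \<open>Local compactness inside U yields an open V and a compact L with K \<subseteq> V
  \<subseteq> L \<subseteq> U. Urysohn's lemma is applied to K and the complement of V, so the
  function vanishes outside L.\<close>

lemma locally_compact_Hausdorff_bump:
  assumes "locally_compact_space X" "Hausdorff_space X" "compactin X K" "openin X U" "K \<subseteq> U"
  obtains f :: "'a \<Rightarrow> real" and C where "continuous_map X euclidean f" "\<And>x. 0 \<le> f x" "\<And>x. f x \<le> 1"
    "\<And>x. x \<in> K \<Longrightarrow> f x = 1" "compactin X C" "C \<subseteq> U" "\<And>x. x \<notin> C \<Longrightarrow> f x = 0"
proof -
  have creg: "completely_regular_space X"
    using assms locally_compact_regular_imp_completely_regular_space by blast
  obtain V L where VL: "openin X V" "compactin X L" "closedin X L" "K \<subseteq> V" "V \<subseteq> L" "L \<subseteq> U"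
  proof -
    have lc: "locally_compact_space (subtopology X U)"
      using assms locally_compact_space_open_subset by blast
    have hs: "Hausdorff_space (subtopology X U)"
      using assms Hausdorff_space_subtopology by blast
    have "compactin (subtopology X U) K"
      using assms compactin_subtopology by blast
    then obtain V L where VL: "openin (subtopology X U) V" "compactin (subtopology X U) L"
        "K \<subseteq> V" "V \<subseteq> L"
      using lc hs locally_compact_space_compact_closed_compact[of "subtopology X U"] by blast
    then have "openin X V" "compactin X L" "L \<subseteq> U"
      using assms(4) openin_trans_full by (auto simp: compactin_subtopology)
    then show thesis using VL assms(2) compactin_imp_closedin that by blast
  qed
  obtain g where g: "continuous_map X (top_of_set {0..1::real}) g"
      "g ` K \<subseteq> {0}" "g ` (topspace X - V) \<subseteq> {1}"
    by (rule Urysohn_completely_regular_closed_compact[of 0 1 X "topspace X - V" K])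
      (use creg assms VL in \<open>auto simp: disjnt_def\<close>)
  define f where "f x = 1 - g x" for x
  have f: "continuous_map X euclidean f" "\<And>x. x \<in> topspace X \<Longrightarrow> 0 \<le> f x \<and> f x \<le> 1"
      "f ` K \<subseteq> {1}" "f ` (topspace X - V) \<subseteq> {0}"
    using g by (auto simp: continuous_map_in_subtopology Pi_iff f_def[abs_def] image_subset_iff
        intro!: continuous_intros)
  \<comment> \<open>The Urysohn function is uncontrolled off \<open>topspace X\<close>, whereas the
    conclusion speaks about every element of the type.\<close>
  define h where "h x = (if x \<in> topspace X then f x else 0)" for x
  show thesis
  proof (rule that[of h L])
    have "continuous_map X euclidean f"
      by (rule f(1))
    then show "continuous_map X euclidean h"
      by (rule continuous_map_eq) (simp add: h_def)
    show "0 \<le> h x" "h x \<le> 1" for x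
      using f(2) by (auto simp: h_def)
    show "h x = 1" if "x \<in> K" for x
      using that f(3) VL openin_subset[OF VL(1)] by (auto simp: h_def)
    show "h x = 0" if "x \<notin> L" for x
      using that f(4) VL by (auto simp: h_def)
  qed (use VL in auto)
qed

section \<open>Etale groupoids\<close>

locale etale =
  fixes H :: "'a groupoid"
  assumes lceg: "locally_compact_etale_groupoid H"
begin

abbreviation "A \<equiv> arr H"
abbreviation "r \<equiv> rg H"
abbreviation "s \<equiv> sr H"
abbreviation mul (infixl "\<cdot>" 70) where "x \<cdot> y \<equiv> gmul H x y"
abbreviation "iv \<equiv> ginv H"
abbreviation "fib \<equiv> fibre H"

lemma top_groupoid: "topological_groupoid H" and loc_compact: "locally_compact_space (gtop H)"
  and Hausdorff: "Hausdorff_space (gtop H)" and loc_homeo: "local_homeomorphism (gtop H) (unit_top H) r"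
  using lceg unfolding locally_compact_etale_groupoid_def by auto

lemma algebraic: "algebraic_groupoid H"
  using top_groupoid unfolding topological_groupoid_def by auto

lemma range_source [simp]:
  assumes "\<gamma> \<in> A"
  shows "r \<gamma> \<in> A" "s \<gamma> \<in> A" "r (r \<gamma>) = r \<gamma>" "s (r \<gamma>) = r \<gamma>" "r (s \<gamma>) = s \<gamma>" "s (s \<gamma>) = s \<gamma>"
    "r \<gamma> \<cdot> \<gamma> = \<gamma>" "\<gamma> \<cdot> s \<gamma> = \<gamma>" "iv \<gamma> \<in> A" "r (iv \<gamma>) = s \<gamma>" "s (iv \<gamma>) = r \<gamma>"
    "\<gamma> \<cdot> iv \<gamma> = r \<gamma>" "iv \<gamma> \<cdot> \<gamma> = s \<gamma>"
  using algebraic assms unfolding algebraic_groupoid_def by auto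

lemma mul_closed [simp]:
  assumes "\<alpha> \<in> A" "\<beta> \<in> A" "s \<alpha> = r \<beta>"
  shows "\<alpha> \<cdot> \<beta> \<in> A" "r (\<alpha> \<cdot> \<beta>) = r \<alpha>" "s (\<alpha> \<cdot> \<beta>) = s \<beta>"
  using algebraic assms unfolding algebraic_groupoid_def composable_def by auto

lemma mul_assoc:
  assumes "\<alpha> \<in> A" "\<beta> \<in> A" "\<gamma> \<in> A" "s \<alpha> = r \<beta>" "s \<beta> = r \<gamma>"
  shows "(\<alpha> \<cdot> \<beta>) \<cdot> \<gamma> = \<alpha> \<cdot> (\<beta> \<cdot> \<gamma>)"
  using algebraic assms unfolding algebraic_groupoid_def composable_def by auto

lemma inverse_cancel [simp]:
  assumes "\<alpha> \<in> A" "\<beta> \<in> A"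
  shows "s \<alpha> = r \<beta> \<Longrightarrow> iv \<alpha> \<cdot> (\<alpha> \<cdot> \<beta>) = \<beta>" "r \<alpha> = r \<beta> \<Longrightarrow> \<alpha> \<cdot> (iv \<alpha> \<cdot> \<beta>) = \<beta>"
    "s \<alpha> = r \<beta> \<Longrightarrow> (\<alpha> \<cdot> \<beta>) \<cdot> iv \<beta> = \<alpha>" "s \<alpha> = s \<beta> \<Longrightarrow> (\<alpha> \<cdot> iv \<beta>) \<cdot> \<beta> = \<alpha>"
proof -
  show "s \<alpha> = r \<beta> \<Longrightarrow> iv \<alpha> \<cdot> (\<alpha> \<cdot> \<beta>) = \<beta>"
    using mul_assoc[of "iv \<alpha>" \<alpha> \<beta>] assms by simp
  show "r \<alpha> = r \<beta> \<Longrightarrow> \<alpha> \<cdot> (iv \<alpha> \<cdot> \<beta>) = \<beta>"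
    using mul_assoc[of \<alpha> "iv \<alpha>" \<beta>] assms by simp
  show "s \<alpha> = r \<beta> \<Longrightarrow> (\<alpha> \<cdot> \<beta>) \<cdot> iv \<beta> = \<alpha>"
    using mul_assoc[of \<alpha> \<beta> "iv \<beta>"] assms by (metis range_source(8,10,12,9))
  show "s \<alpha> = s \<beta> \<Longrightarrow> (\<alpha> \<cdot> iv \<beta>) \<cdot> \<beta> = \<alpha>"
    using mul_assoc[of \<alpha> "iv \<beta>" \<beta>] assms by (metis range_source(8,10,13,9,11))
qed

lemma left_cancel:
  assumes "\<alpha> \<in> A" "\<beta> \<in> A" "\<gamma> \<in> A" "s \<alpha> = r \<beta>" "s \<alpha> = r \<gamma>" "\<alpha> \<cdot> \<beta> = \<alpha> \<cdot> \<gamma>"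
  shows "\<beta> = \<gamma>"
  using assms inverse_cancel(1) by metis

lemma right_cancel:
  assumes "\<alpha> \<in> A" "\<beta> \<in> A" "\<gamma> \<in> A" "s \<beta> = r \<alpha>" "s \<gamma> = r \<alpha>" "\<beta> \<cdot> \<alpha> = \<gamma> \<cdot> \<alpha>"
  shows "\<beta> = \<gamma>"
  using assms inverse_cancel(3) by metis

lemma inverse_inverse [simp]: "\<gamma> \<in> A \<Longrightarrow> iv (iv \<gamma>) = \<gamma>"
  by (metis inverse_cancel(1) range_source(9,10,11,12,13,8))

lemma inverse_mul:
  assumes "\<alpha> \<in> A" "\<beta> \<in> A" "s \<alpha> = r \<beta>"
  shows "iv (\<alpha> \<cdot> \<beta>) = iv \<beta> \<cdot> iv \<alpha>"
proof (rule left_cancel[of "\<alpha> \<cdot> \<beta>"])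
  have "\<alpha> \<cdot> \<beta> \<cdot> (iv \<beta> \<cdot> iv \<alpha>) = \<alpha> \<cdot> (\<beta> \<cdot> (iv \<beta> \<cdot> iv \<alpha>))"
    by (rule mul_assoc) (use assms in auto)
  then show "\<alpha> \<cdot> \<beta> \<cdot> iv (\<alpha> \<cdot> \<beta>) = \<alpha> \<cdot> \<beta> \<cdot> (iv \<beta> \<cdot> iv \<alpha>)" using assms by simp
qed (use assms in auto)

lemma mul_inverse_inverse:
  assumes "\<alpha> \<in> A" "\<beta> \<in> A" "s \<alpha> = s \<beta>"
  shows "iv (\<alpha> \<cdot> iv \<beta>) = \<beta> \<cdot> iv \<alpha>"
  using assms by (simp add: inverse_mul)

lemma units_subset: "units H \<subseteq> A"
  unfolding units_def by auto

lemma units_iff: "u \<in> units H \<longleftrightarrow> u \<in> A \<and> r u = u"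
  unfolding units_def by force

lemma unit_source: "u \<in> units H \<Longrightarrow> s u = u"
  unfolding units_def by force

lemma range_in_units [simp]: "\<gamma> \<in> A \<Longrightarrow> r \<gamma> \<in> units H" "\<gamma> \<in> A \<Longrightarrow> s \<gamma> \<in> units H"
  by (auto simp: units_iff)

lemma arr_Int_units [simp]: "A \<inter> units H = units H"
  using units_subset by auto

lemma topspace_unit_top: "topspace (unit_top H) = units H"
  by simp

lemma fibre_iff: "\<gamma> \<in> fib x \<longleftrightarrow> \<gamma> \<in> A \<and> s \<gamma> = x"
  by (simp add: fibre_def)

section \<open>Continuity of the structure maps and local sections of the source map\<close>

lemma continuous_range: "continuous_map (gtop H) (unit_top H) r"
proof (rule continuous_map_locally)
  fix x assume "x \<in> A"
  then obtain U where U: "openin (gtop H) U" "x \<in> U" "openin (unit_top H) (r ` U)"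
      "homeomorphic_map (subtopology (gtop H) U) (subtopology (unit_top H) (r ` U)) r"
    using loc_homeo unfolding local_homeomorphism_def by blast
  then have "continuous_map (subtopology (gtop H) U) (unit_top H) r"
    using homeomorphic_imp_continuous_map continuous_map_into_fulltopology by blast
  then show "\<exists>W. openin (gtop H) W \<and> x \<in> W \<and> continuous_map (subtopology (gtop H) W) (unit_top H) r"
    using U by blast
qed

lemma continuous_inverse: "continuous_map (gtop H) (gtop H) iv"
  using top_groupoid unfolding topological_groupoid_def by auto

lemma continuous_source: "continuous_map (gtop H) (unit_top H) s"
  by (rule continuous_map_eq[OF continuous_map_compose[OF continuous_inverse continuous_range]]) auto

lemma continuous_range_arr: "continuous_map (gtop H) (gtop H) r"
  and continuous_source_arr: "continuous_map (gtop H) (gtop H) s"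
  using continuous_range continuous_source continuous_map_into_fulltopology by blast+

lemma continuous_mul:
  assumes "continuous_map X (gtop H) f" "continuous_map X (gtop H) g"
    "\<And>x. x \<in> topspace X \<Longrightarrow> s (f x) = r (g x)"
  shows "continuous_map X (gtop H) (\<lambda>x. f x \<cdot> g x)"
proof -
  have "continuous_map X (subtopology (prod_topology (gtop H) (gtop H)) (composable H)) (\<lambda>x. (f x, g x))"
    using assms continuous_map_funspace[OF assms(1)] continuous_map_funspace[OF assms(2)]
    by (auto simp: continuous_map_in_subtopology continuous_map_paired composable_def)
  moreover have "continuous_map (subtopology (prod_topology (gtop H) (gtop H)) (composable H)) (gtop H)
      (\<lambda>(\<alpha>, \<beta>). gmul H \<alpha> \<beta>)"
    using top_groupoid unfolding topological_groupoid_def by auto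
  ultimately have "continuous_map X (gtop H) ((\<lambda>(\<alpha>, \<beta>). gmul H \<alpha> \<beta>) \<circ> (\<lambda>x. (f x, g x)))"
    by (rule continuous_map_compose)
  then show ?thesis by (simp add: o_def)
qed

lemma continuous_inverse_comp:
  "continuous_map X (gtop H) f \<Longrightarrow> continuous_map X (gtop H) (\<lambda>x. iv (f x))"
  using continuous_map_compose[OF _ continuous_inverse] by (force simp: o_def)

lemma closedin_units: "closedin (gtop H) (units H)"
proof -
  have "units H = {x \<in> topspace (gtop H). r x = id x}" by (auto simp: units_iff)
  then show ?thesis
    using closedin_continuous_maps_eq[OF Hausdorff continuous_range_arr continuous_map_id] by simp
qed

lemma Hausdorff_units: "Hausdorff_space (unit_top H)"
  using Hausdorff Hausdorff_space_subtopology by blast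

lemma loc_compact_units: "locally_compact_space (unit_top H)"
  using loc_compact closedin_units locally_compact_space_closed_subset by blast

text \<open>The range map has a local inverse g near \<gamma>\<inverse>, and inversion exchanges
  range and source; so y \<mapsto> (g y)\<inverse> is a section of the source map through \<gamma>.
  Its image is an open bisection, the basic tool for moving points of one fibre to nearby
  fibres.\<close>

lemma source_section:
  assumes "\<gamma> \<in> A" "openin (gtop H) O'" "\<gamma> \<in> O'"
  obtains V \<sigma> where "openin (unit_top H) V" "s \<gamma> \<in> V" "continuous_map (subtopology (unit_top H) V) (gtop H) \<sigma>"
    "\<And>y. y \<in> V \<Longrightarrow> \<sigma> y \<in> O' \<and> s (\<sigma> y) = y" "\<sigma> (s \<gamma>) = \<gamma>" "openin (gtop H) (\<sigma> ` V)"
    "inj_on s (\<sigma> ` V)"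
proof -
  have "iv \<gamma> \<in> A" using assms by simp
  then obtain U where U: "openin (gtop H) U" "iv \<gamma> \<in> U" "openin (unit_top H) (r ` U)"
      "homeomorphic_map (subtopology (gtop H) U) (subtopology (unit_top H) (r ` U)) r"
    using loc_homeo unfolding local_homeomorphism_def by blast
  have UA: "U \<subseteq> A" using U openin_subset by blast
  obtain g where g: "homeomorphic_maps (subtopology (gtop H) U) (subtopology (unit_top H) (r ` U)) r g"
    using U(4) homeomorphic_map_maps by blast
  have top: "topspace (subtopology (gtop H) U) = U" "topspace (subtopology (unit_top H) (r ` U)) = r ` U"
    using UA by auto
  have gr: "\<And>x. x \<in> U \<Longrightarrow> g (r x) = x" and rg: "\<And>y. y \<in> r ` U \<Longrightarrow> r (g y) = y"
    and gU: "\<And>y. y \<in> r ` U \<Longrightarrow> g y \<in> U"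
    using g unfolding homeomorphic_maps_def top by auto
  have cg: "continuous_map (subtopology (unit_top H) (r ` U)) (gtop H) g"
    using g unfolding homeomorphic_maps_def using continuous_map_into_fulltopology by blast
  have cig: "continuous_map (subtopology (unit_top H) (r ` U)) (gtop H) (\<lambda>y. iv (g y))"
    using cg by (rule continuous_inverse_comp)
  \<comment> \<open>The domain is cut down so that the section stays in the prescribed neighbourhood
    \<open>O'\<close>.\<close>
  define V where "V = {y \<in> r ` U. iv (g y) \<in> O'}"
  have oV: "openin (unit_top H) V"
  proof -
    have "openin (subtopology (unit_top H) (r ` U)) V"
      using openin_continuous_map_preimage[OF cig assms(2)] unfolding V_def top by simp
    then show ?thesis using U(3) openin_trans_full by blast
  qed
  define \<sigma> where "\<sigma> y = iv (g y)" for y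
  \<comment> \<open>This describes the image as the inverse of U intersected with \<open>O'\<close>,
    which shows that it is open.\<close>
  have im: "\<sigma> ` V = {x \<in> A. iv x \<in> U} \<inter> O'"
  proof (intro equalityI subsetI)
    fix x assume "x \<in> \<sigma> ` V"
    then obtain y where y: "y \<in> r ` U" "iv (g y) \<in> O'" "x = iv (g y)" by (auto simp: V_def \<sigma>_def)
    then have "g y \<in> U" "g y \<in> A" using gU UA by auto
    then show "x \<in> {x \<in> A. iv x \<in> U} \<inter> O'" using y by simp
  next
    fix x assume x: "x \<in> {x \<in> A. iv x \<in> U} \<inter> O'"
    have "g (r (iv x)) = iv x" using x gr by blast
    then have "iv (g (r (iv x))) = x" using x by auto
    moreover have "r (iv x) \<in> r ` U" using x by blast
    ultimately have "r (iv x) \<in> V" using x by (simp add: V_def)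
    then show "x \<in> \<sigma> ` V" using \<open>iv (g (r (iv x))) = x\<close> unfolding \<sigma>_def by (metis imageI)
  qed
  show thesis
  proof (rule that[of V \<sigma>])
    have "s \<gamma> = r (iv \<gamma>)" using assms by simp
    moreover have gi: "g (r (iv \<gamma>)) = iv \<gamma>" using gr U by blast
    ultimately show "s \<gamma> \<in> V" unfolding V_def using U assms
      by (metis (mono_tags, lifting) image_eqI inverse_inverse mem_Collect_eq)
    show "\<sigma> (s \<gamma>) = \<gamma>" using gi assms by (simp add: \<sigma>_def)
    show "continuous_map (subtopology (unit_top H) V) (gtop H) \<sigma>"
      unfolding \<sigma>_def using cig by (rule continuous_map_from_subtopology_mono) (auto simp: V_def)
    show sig: "\<sigma> y \<in> O' \<and> s (\<sigma> y) = y" if "y \<in> V" for y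
      using that gU[of y] rg[of y] UA unfolding V_def \<sigma>_def by auto
    show "openin (gtop H) (\<sigma> ` V)"
      unfolding im using openin_continuous_map_preimage[OF continuous_inverse U(1)] assms(2) by blast
    show "inj_on s (\<sigma> ` V)"
      by (rule inj_onI) (use sig in auto)
  qed (use oV in auto)
qed

lemma open_source:
  assumes "openin (gtop H) U"
  shows "openin (unit_top H) (s ` U)"
proof (subst openin_subopen, intro ballI)
  fix x assume "x \<in> s ` U"
  then obtain \<gamma> where g: "\<gamma> \<in> U" "x = s \<gamma>" by auto
  then have "\<gamma> \<in> A" using assms openin_subset by blast
  from source_section[OF this assms g(1)] obtain V \<sigma> where
    "openin (unit_top H) V" "s \<gamma> \<in> V" "\<And>y. y \<in> V \<Longrightarrow> \<sigma> y \<in> U \<and> s (\<sigma> y) = y" by metis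
  then show "\<exists>T. openin (unit_top H) T \<and> x \<in> T \<and> T \<subseteq> s ` U"
    using g by (metis image_eqI subsetI)
qed

text \<open>Finitely many open sets on which the source map is injective cover C. Each of them meets
  a fibre at most once, so their number bounds the cardinality in all fibres at once.\<close>

lemma compact_fibre_card:
  assumes "compactin (gtop H) C"
  obtains n where "\<And>x. finite (fib x \<inter> C) \<and> card (fib x \<inter> C) \<le> n"
proof -
  have CA: "C \<subseteq> A" using assms compactin_subset_topspace by blast
  have "\<forall>\<gamma>\<in>A. \<exists>U. openin (gtop H) U \<and> \<gamma> \<in> U \<and> inj_on s U"
  proof
    fix \<gamma> assume g: "\<gamma> \<in> A"
    from source_section[OF g openin_topspace g] obtain V \<sigma> where
      "s \<gamma> \<in> V" "\<sigma> (s \<gamma>) = \<gamma>" "openin (gtop H) (\<sigma> ` V)" "inj_on s (\<sigma> ` V)" by metis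
    then show "\<exists>U. openin (gtop H) U \<and> \<gamma> \<in> U \<and> inj_on s U" by (metis imageI)
  qed
  then obtain U where U: "\<And>\<gamma>. \<gamma> \<in> A \<Longrightarrow> openin (gtop H) (U \<gamma>) \<and> \<gamma> \<in> U \<gamma> \<and> inj_on s (U \<gamma>)"
    by metis
  have "\<forall>W\<in>U ` C. openin (gtop H) W" "C \<subseteq> \<Union>(U ` C)" using U CA by auto
  then obtain F where F: "finite F" "F \<subseteq> U ` C" "C \<subseteq> \<Union>F"
    using assms unfolding compactin_def by metis
  have c1: "finite (fib x \<inter> W) \<and> card (fib x \<inter> W) \<le> 1" if "W \<in> F" for W x
  proof -
    have "inj_on s W" using that F U CA by auto
    then have inj: "inj_on s (fib x \<inter> W)" by (meson inf_le2 inj_on_subset)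
    have sub: "s ` (fib x \<inter> W) \<subseteq> {x}" by (auto simp: fibre_iff)
    then have "finite (fib x \<inter> W)" using inj finite_imageD finite_subset by (metis finite.emptyI finite.insertI)
    moreover have "card (fib x \<inter> W) \<le> card {x}" using card_inj_on_le[OF inj sub] by simp
    ultimately show ?thesis by simp
  qed
  have sub: "fib x \<inter> C \<subseteq> (\<Union>W\<in>F. fib x \<inter> W)" for x using F by auto
  have fin: "finite (\<Union>W\<in>F. fib x \<inter> W)" for x using F c1 by (intro finite_UN_I) auto
  show thesis
  proof (rule that[of "card F"])
    fix x
    have "card (fib x \<inter> C) \<le> card (\<Union>W\<in>F. fib x \<inter> W)" by (rule card_mono[OF fin sub])
    also have "\<dots> \<le> (\<Sum>W\<in>F. card (fib x \<inter> W))" by (rule card_UN_le) (rule F)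
    also have "\<dots> \<le> (\<Sum>W\<in>F. 1)" by (rule sum_mono) (use c1 in auto)
    finally show "finite (fib x \<inter> C) \<and> card (fib x \<inter> C) \<le> card F"
      using finite_subset[OF sub fin] by simp
  qed
qed

lemma finite_fibre_compact: "compactin (gtop H) C \<Longrightarrow> finite (fib x \<inter> C)"
  using compact_fibre_card by metis

text \<open>Sections are taken through all points of E at once and confined to disjoint
  neighbourhoods of these points, so that they stay distinct in every nearby fibre. A finite
  configuration in one fibre is thereby deformed into configurations in the neighbouring
  fibres.\<close>

lemma local_sections:
  assumes x: "x \<in> units H" and E: "finite E" "E \<subseteq> fib x"
    and W: "\<And>e. e \<in> E \<Longrightarrow> openin (gtop H) (W e) \<and> e \<in> W e"
  obtains V \<sigma> where "openin (unit_top H) V" "x \<in> V"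
    "\<forall>e\<in>E. continuous_map (subtopology (unit_top H) V) (gtop H) (\<sigma> e)"
    "\<forall>e\<in>E. \<forall>y\<in>V. \<sigma> e y \<in> fib y \<inter> W e" "\<forall>e\<in>E. \<sigma> e x = e"
    "\<forall>y\<in>V. inj_on (\<lambda>e. \<sigma> e y) E"
    "\<forall>e\<in>E. openin (gtop H) (\<sigma> e ` V)"
proof -
  have EA: "E \<subseteq> A" using E by (auto simp: fibre_iff)
  obtain U where U: "\<And>e. e \<in> E \<Longrightarrow> openin (gtop H) (U e) \<and> e \<in> U e"
    "\<And>a b. a \<in> E \<Longrightarrow> b \<in> E \<Longrightarrow> a \<noteq> b \<Longrightarrow> U a \<inter> U b = {}"
    using disjoint_open_neighbourhoods[OF Hausdorff E(1) EA] by metis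
  have "\<forall>e\<in>E. \<exists>V \<sigma>. openin (unit_top H) V \<and> x \<in> V \<and> continuous_map (subtopology (unit_top H) V) (gtop H) \<sigma> \<and>
    (\<forall>y\<in>V. \<sigma> y \<in> W e \<inter> U e \<and> s (\<sigma> y) = y) \<and> \<sigma> x = e"
  proof
    fix e assume e: "e \<in> E"
    then have "e \<in> A" "openin (gtop H) (W e \<inter> U e)" "e \<in> W e \<inter> U e" "s e = x"
      using EA U W E by (auto simp: fibre_iff)
    from source_section[OF this(1-3)] \<open>s e = x\<close> show "\<exists>V \<sigma>. openin (unit_top H) V \<and> x \<in> V \<and>
      continuous_map (subtopology (unit_top H) V) (gtop H) \<sigma> \<and>
      (\<forall>y\<in>V. \<sigma> y \<in> W e \<inter> U e \<and> s (\<sigma> y) = y) \<and> \<sigma> x = e" by metis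
  qed
  then obtain V \<sigma> where V: "\<And>e. e \<in> E \<Longrightarrow> openin (unit_top H) (V e) \<and> x \<in> V e \<and>
      continuous_map (subtopology (unit_top H) (V e)) (gtop H) (\<sigma> e) \<and>
    (\<forall>y\<in>V e. \<sigma> e y \<in> W e \<inter> U e \<and> s (\<sigma> e y) = y) \<and> \<sigma> e x = e" by metis
  \<comment> \<open>The intersection with \<open>units H\<close> is needed for empty E, where the
    other factor is everything.\<close>
  define V' where "V' = (\<Inter>e\<in>E. V e) \<inter> units H"
  have oV': "openin (unit_top H) V'"
    unfolding V'_def using openin_INT[of E "unit_top H" V] E(1) V unfolding topspace_unit_top by blast
  have sub: "V' \<subseteq> V e" if "e \<in> E" for e using that unfolding V'_def by auto
  have cont: "continuous_map (subtopology (unit_top H) V') (gtop H) (\<sigma> e)" if "e \<in> E" for e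
    using V[OF that] sub[OF that] continuous_map_from_subtopology_mono by blast
  have sig: "\<sigma> e y \<in> W e \<inter> U e" "s (\<sigma> e y) = y" "\<sigma> e y \<in> A" if "e \<in> E" "y \<in> V'" for e y
    using V[OF that(1)] sub[OF that(1)] that U(1)[OF that(1)] openin_subset by blast+
  show thesis
  proof (rule that[of V' \<sigma>])
    show "x \<in> V'" using V x unfolding V'_def by auto
    show "\<forall>y\<in>V'. inj_on (\<lambda>e. \<sigma> e y) E"
    proof (intro ballI inj_onI)
      fix y a b assume that: "y \<in> V'"
      assume "a \<in> E" "b \<in> E" "\<sigma> a y = \<sigma> b y"
      then show "a = b" using sig(1)[OF _ that] U(2) by (metis IntD2 IntI empty_iff)
    qed
    show "\<forall>e\<in>E. openin (gtop H) (\<sigma> e ` V')"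
    proof (intro ballI, subst openin_subopen, intro ballI)
      fix e z assume e: "e \<in> E"
      assume "z \<in> \<sigma> e ` V'"
      then obtain y where y: "y \<in> V'" "z = \<sigma> e y" by auto
      have "z \<in> A" "s z = y" using sig e y by auto
      from source_section[OF this(1) openin_topspace this(1)] obtain N \<tau> where N:
        "openin (unit_top H) N" "s z \<in> N" "continuous_map (subtopology (unit_top H) N) (gtop H) \<tau>"
        "\<And>y. y \<in> N \<Longrightarrow> \<tau> y \<in> A \<and> s (\<tau> y) = y" "\<tau> (s z) = z" "openin (gtop H) (\<tau> ` N)" "inj_on s (\<tau> ` N)"
        by metis
      define M where "M = {v \<in> V'. \<sigma> e v \<in> \<tau> ` N}"
      have "openin (subtopology (unit_top H) V') M"
      proof -
        have "topspace (subtopology (unit_top H) V') = V'" using openin_subset[OF oV'] by auto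
        then show ?thesis
          using openin_continuous_map_preimage[OF cont[OF e] N(6)] unfolding M_def by simp
      qed
      then have oM: "openin (unit_top H) M" using oV' openin_trans_full by blast
      have eq: "\<sigma> e ` M = \<tau> ` N \<inter> {z \<in> A. s z \<in> M}"
      proof (intro equalityI subsetI)
        fix w assume "w \<in> \<sigma> e ` M"
        then show "w \<in> \<tau> ` N \<inter> {z \<in> A. s z \<in> M}"
          using sig[OF e] unfolding M_def by (smt (verit, ccfv_threshold) IntI image_iff mem_Collect_eq)
      next
        fix w assume w: "w \<in> \<tau> ` N \<inter> {z \<in> A. s z \<in> M}"
        then have "\<sigma> e (s w) \<in> \<tau> ` N" "s (\<sigma> e (s w)) = s w" using sig[OF e] by (auto simp: M_def)
        then have "\<sigma> e (s w) = w" using N(7) IntD1[OF w] unfolding inj_on_def by blast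
        moreover have "s w \<in> M" using w by blast
        ultimately show "w \<in> \<sigma> e ` M" using imageI[of "s w" M "\<sigma> e"] by simp
      qed
      have "openin (gtop H) (\<sigma> e ` M)"
        unfolding eq using openin_continuous_map_preimage[OF continuous_source oM] N(6) by blast
      moreover have "z \<in> \<sigma> e ` M"
      proof -
        have "\<sigma> e y \<in> \<tau> ` N" using N(2,5) \<open>s z = y\<close> y(2) by (metis imageI)
        then have "y \<in> M" using y(1) unfolding M_def by simp
        then show ?thesis using y by simp
      qed
      moreover have "\<sigma> e ` M \<subseteq> \<sigma> e ` V'" unfolding M_def by auto
      ultimately show "\<exists>T. openin (gtop H) T \<and> z \<in> T \<and> T \<subseteq> \<sigma> e ` V'" by blast
    qed
  qed (use oV' cont sig V in \<open>auto simp: fibre_iff\<close>)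
qed

text \<open>Semicontinuity of y \<mapsto> fib y \<inter> C: the part of C outside U is compact, so
  its image under the source map is compact, hence closed in the unit space, and it misses
  x.\<close>

lemma compact_fibre_neighbourhood:
  assumes C: "compactin (gtop H) C" and x: "x \<in> units H"
    and U: "openin (gtop H) U" "fib x \<inter> C \<subseteq> U"
  obtains V where "openin (unit_top H) V" "x \<in> V" "\<And>y. y \<in> V \<Longrightarrow> fib y \<inter> C \<subseteq> U"
proof -
  have "closedin (gtop H) (A - U)" using U by blast
  then have "compactin (gtop H) ((A - U) \<inter> C)" using C closed_Int_compactin by blast
  then have "compactin (unit_top H) (s ` ((A - U) \<inter> C))" using continuous_source image_compactin by blast
  then have cl: "closedin (unit_top H) (s ` ((A - U) \<inter> C))"
    using Hausdorff_units compactin_imp_closedin by blast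
  show thesis
  proof (rule that[of "units H - s ` ((A - U) \<inter> C)"])
    show "openin (unit_top H) (units H - s ` ((A - U) \<inter> C))"
      using cl by (metis openin_diff openin_topspace topspace_unit_top)
    show "x \<in> units H - s ` ((A - U) \<inter> C)" using x U by (auto simp: fibre_iff)
  qed (auto simp: fibre_iff)
qed

text \<open>C meets the fibre over q y0 in a finite set E, and every point of C in a nearby fibre
  lies on one of the sections through E. Hence near y0 the sum runs over a fixed finite number of
  continuous terms. It is the source of continuity for operators, for \<rho>(g) and for the
  extension to characters.\<close>

lemma continuous_fibre_sum:
  fixes F :: "'y \<Rightarrow> 'a \<Rightarrow> complex"
  assumes q: "continuous_map Y (unit_top H) q" and C: "compactin (gtop H) C"
    and F: "continuous_map (subtopology (prod_topology Y (gtop H)) {(y, h). s h = q y}) euclidean (\<lambda>(y, h). F y h)"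
    and zero: "\<And>y h. y \<in> topspace Y \<Longrightarrow> h \<in> fib (q y) \<Longrightarrow> h \<notin> C \<Longrightarrow> F y h = 0"
  shows "continuous_map Y euclidean (\<lambda>y. \<Sum>\<^sub>\<infinity>h\<in>fib (q y). F y h)"
proof (rule continuous_map_locally)
  fix y0 assume y0: "y0 \<in> topspace Y"
  have qu: "q y \<in> units H" if "y \<in> topspace Y" for y
    using continuous_map_funspace[OF q] that topspace_unit_top by (metis PiE)
  define E where "E = fib (q y0) \<inter> C"
  have E: "finite E" "E \<subseteq> fib (q y0)" using finite_fibre_compact[OF C] by (auto simp: E_def)
  have EW: "openin (gtop H) A \<and> e \<in> A" if "e \<in> E" for e
    using that E(2) by (auto simp: fibre_iff)
  from local_sections[OF qu[OF y0] E EW] obtain V \<sigma> where V': "openin (unit_top H) V" "q y0 \<in> V"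
    "\<forall>e\<in>E. continuous_map (subtopology (unit_top H) V) (gtop H) (\<sigma> e)"
    "\<forall>e\<in>E. \<forall>y\<in>V. \<sigma> e y \<in> fib y \<inter> A" "\<forall>e\<in>E. \<sigma> e (q y0) = e"
    "\<forall>y\<in>V. inj_on (\<lambda>e. \<sigma> e y) E" "\<forall>e\<in>E. openin (gtop H) (\<sigma> e ` V)" .
  note V = V'(1,2) bspec[OF V'(3)] bspec[OF bspec[OF V'(4)]] bspec[OF V'(5)] bspec[OF V'(6)] bspec[OF V'(7)]
  have "openin (gtop H) (\<Union>e\<in>E. \<sigma> e ` V)" using V(7) by blast
  moreover have "fib (q y0) \<inter> C \<subseteq> (\<Union>e\<in>E. \<sigma> e ` V)"
  proof
    fix e assume "e \<in> fib (q y0) \<inter> C"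
    then have e: "e \<in> E" by (simp add: E_def)
    have "\<sigma> e (q y0) \<in> \<sigma> e ` V" by (rule imageI[OF V(2)])
    then show "e \<in> (\<Union>e\<in>E. \<sigma> e ` V)" using V(5)[OF e] e by auto
  qed
  ultimately obtain V2 where V2: "openin (unit_top H) V2" "q y0 \<in> V2"
    "\<And>y. y \<in> V2 \<Longrightarrow> fib y \<inter> C \<subseteq> (\<Union>e\<in>E. \<sigma> e ` V)"
    using compact_fibre_neighbourhood[OF C qu[OF y0]] by metis
  define N where "N = {y \<in> topspace Y. q y \<in> V \<inter> V2}"
  have oN: "openin Y N" unfolding N_def
    using openin_continuous_map_preimage[OF q openin_Int[OF V(1) V2(1)]] .
  have yN: "y0 \<in> N" using V V2 y0 unfolding N_def by auto
  have eq: "(\<Sum>\<^sub>\<infinity>h\<in>fib (q y). F y h) = (\<Sum>e\<in>E. F y (\<sigma> e (q y)))" if "y \<in> N" for y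
  proof -
    have y: "y \<in> topspace Y" "q y \<in> V" "q y \<in> V2" using that by (auto simp: N_def)
    have "(\<Sum>\<^sub>\<infinity>h\<in>fib (q y). F y h) = (\<Sum>\<^sub>\<infinity>h\<in>(\<lambda>e. \<sigma> e (q y)) ` E. F y h)"
    proof (rule infsum_cong_neutral)
      fix h assume h: "h \<in> fib (q y) - (\<lambda>e. \<sigma> e (q y)) ` E"
      show "F y h = 0"
      proof (rule zero)
        show "h \<notin> C"
        proof
          assume "h \<in> C"
          then obtain e v where "e \<in> E" "v \<in> V" "h = \<sigma> e v" using V2(3)[OF y(3)] h by blast
          then show False using V(4)[of e v] h by (auto simp: fibre_iff)
        qed
      qed (use y h in auto)
    next
      fix h assume "h \<in> (\<lambda>e. \<sigma> e (q y)) ` E - fib (q y)"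
      then show "F y h = 0" using V(4)[OF _ y(2)] by blast
    qed simp
    also have "\<dots> = (\<Sum>h\<in>(\<lambda>e. \<sigma> e (q y)) ` E. F y h)" using E by simp
    also have "\<dots> = (\<Sum>e\<in>E. F y (\<sigma> e (q y)))"
      using sum.reindex[OF V(6)[OF y(2)]] by (simp add: o_def)
    finally show ?thesis .
  qed
  have "continuous_map (subtopology Y N) euclidean (\<lambda>y. F y (\<sigma> e (q y)))" if e: "e \<in> E" for e
  proof -
    have "continuous_map (subtopology Y N) (subtopology (unit_top H) V) q"
      using continuous_map_from_subtopology[OF q, of N]
      by (subst continuous_map_in_subtopology) (auto simp: N_def)
    from continuous_map_compose[OF this V(3)[OF e]]
    have "continuous_map (subtopology Y N) (gtop H) (\<lambda>y. \<sigma> e (q y))" by (simp add: o_def)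
    moreover have "s (\<sigma> e (q y)) = q y" if "y \<in> N" for y
      using V(4)[OF e, of "q y"] that by (simp add: N_def fibre_iff)
    ultimately have "continuous_map (subtopology Y N) (subtopology (prod_topology Y (gtop H)) {(y, h). s h = q y})
       (\<lambda>y. (y, \<sigma> e (q y)))"
      unfolding continuous_map_in_subtopology
      by (simp add: continuous_map_paired continuous_map_from_subtopology subset_iff Pi_iff)
    from continuous_map_compose[OF this F] show ?thesis by (simp add: o_def)
  qed
  then have "continuous_map (subtopology Y N) euclidean (\<lambda>y. \<Sum>e\<in>E. F y (\<sigma> e (q y)))"
    using E(1) by (intro continuous_map_sum) auto
  then have "continuous_map (subtopology Y N) euclidean (\<lambda>y. \<Sum>\<^sub>\<infinity>h\<in>fib (q y). F y h)"
    by (rule continuous_map_eq) (use eq in auto)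
  then show "\<exists>W. openin Y W \<and> y0 \<in> W \<and> continuous_map (subtopology Y W) euclidean (\<lambda>y. \<Sum>\<^sub>\<infinity>h\<in>fib (q y). F y h)"
    using oN yN by blast
qed

end

section \<open>Square-summable families and bounded matrices\<close>

text \<open>\<open>le2 X v C\<close> says that \<open>v\<close> is square-summable on \<open>X\<close> with norm at most \<open>C\<close>;
  \<open>formbd m X Y C\<close> says that the matrix \<open>m\<close> defines an operator \<open>\<ell>\<^sup>2(X) \<rightarrow> \<ell>\<^sup>2(Y)\<close> of norm at
  most \<open>C\<close>, with rows in \<open>Y\<close>.\<close>

definition le2 :: "'a set \<Rightarrow> ('a \<Rightarrow> complex) \<Rightarrow> real \<Rightarrow> bool"
  where "le2 X v C \<longleftrightarrow> (\<forall>F. finite F \<and> F \<subseteq> X \<longrightarrow> L2_set (\<lambda>x. cmod (v x)) F \<le> C)"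

definition formbd :: "('b \<Rightarrow> 'a \<Rightarrow> complex) \<Rightarrow> 'a set \<Rightarrow> 'b set \<Rightarrow> real \<Rightarrow> bool"
  where "formbd m X Y C \<longleftrightarrow> (\<forall>F G a. finite F \<and> F \<subseteq> X \<and> finite G \<and> G \<subseteq> Y \<longrightarrow>
    L2_set (\<lambda>y. cmod (\<Sum>x\<in>F. m y x * a x)) G \<le> C * L2_set (\<lambda>x. cmod (a x)) F)"

text \<open>The product of a matrix with a vector. The default value 0 of a divergent sum does not
  interfere: for bounded matrices and square-summable vectors the rows are summable by
  \<open>app_summable\<close>.\<close>

definition app :: "('b \<Rightarrow> 'a \<Rightarrow> complex) \<Rightarrow> 'a set \<Rightarrow> ('a \<Rightarrow> complex) \<Rightarrow> 'b \<Rightarrow> complex"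
  where "app m X v y = (\<Sum>\<^sub>\<infinity>x\<in>X. m y x * v x)"

lemma infsum_finite_sum:
  fixes f :: "'i \<Rightarrow> 'b \<Rightarrow> complex"
  assumes "finite F" "\<And>i. i \<in> F \<Longrightarrow> f i summable_on Y"
  shows "(\<lambda>y. \<Sum>i\<in>F. f i y) summable_on Y" "(\<Sum>\<^sub>\<infinity>y\<in>Y. \<Sum>i\<in>F. f i y) = (\<Sum>i\<in>F. infsum (f i) Y)"
proof -
  have "((\<lambda>y. \<Sum>i\<in>F. f i y) has_sum (\<Sum>i\<in>F. infsum (f i) Y)) Y"
    using assms
  proof (induction F rule: finite_induct)
    case (insert a F)
    have "(f a has_sum infsum (f a) Y) Y" using insert.prems by (intro has_sum_infsum) auto
    moreover have "((\<lambda>y. \<Sum>i\<in>F. f i y) has_sum (\<Sum>i\<in>F. infsum (f i) Y)) Y" using insert by auto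
    ultimately show ?case using insert.hyps by (simp add: has_sum_add)
  qed simp
  then show "(\<lambda>y. \<Sum>i\<in>F. f i y) summable_on Y" "(\<Sum>\<^sub>\<infinity>y\<in>Y. \<Sum>i\<in>F. f i y) = (\<Sum>i\<in>F. infsum (f i) Y)"
    by (auto simp: has_sum_iff)
qed

lemma le2I: "(\<And>F. finite F \<Longrightarrow> F \<subseteq> X \<Longrightarrow> L2_set (\<lambda>x. cmod (v x)) F \<le> C) \<Longrightarrow> le2 X v C"
  by (simp add: le2_def)

lemma le2D: "le2 X v C \<Longrightarrow> finite F \<Longrightarrow> F \<subseteq> X \<Longrightarrow> L2_set (\<lambda>x. cmod (v x)) F \<le> C"
  by (simp add: le2_def)

lemma le2_nonneg: "le2 X v C \<Longrightarrow> 0 \<le> C"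
  using le2D[of X v C "{}"] by simp

lemma le2_point: "le2 X v C \<Longrightarrow> x \<in> X \<Longrightarrow> cmod (v x) \<le> C"
  using le2D[of X v C "{x}"] by simp

lemma le2_mono: "le2 X v C \<Longrightarrow> C \<le> D \<Longrightarrow> Y \<subseteq> X \<Longrightarrow> le2 Y v D"
  unfolding le2_def by (meson order_trans)

lemma le2_dominated:
  assumes "le2 X w C" "0 \<le> c" "\<And>x. x \<in> X \<Longrightarrow> cmod (v x) \<le> c * cmod (w x)"
  shows "le2 X v (c * C)"
proof (rule le2I)
  fix F assume F: "finite F" "F \<subseteq> X"
  have "L2_set (\<lambda>x. cmod (v x)) F \<le> L2_set (\<lambda>x. c * cmod (w x)) F"
    by (rule L2_set_mono) (use F assms(3) in auto)
  also have "\<dots> = c * L2_set (\<lambda>x. cmod (w x)) F"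
    by (simp add: L2_set_right_distrib assms(2))
  also have "\<dots> \<le> c * C"
    by (rule mult_left_mono[OF le2D[OF assms(1) F] assms(2)])
  finally show "L2_set (\<lambda>x. cmod (v x)) F \<le> c * C" .
qed

lemma le2_le:
  assumes "le2 X w C" "\<And>x. x \<in> X \<Longrightarrow> cmod (v x) \<le> cmod (w x)"
  shows "le2 X v C"
  using le2_dominated[OF assms(1), of 1 v] assms(2) by simp

lemma le2_cong: "le2 X w C \<Longrightarrow> (\<And>x. x \<in> X \<Longrightarrow> v x = w x) \<Longrightarrow> le2 X v C"
  by (rule le2_le) auto

lemma le2_cmult: "le2 X v C \<Longrightarrow> le2 X (\<lambda>x. c * v x) (cmod c * C)"
  by (rule le2_dominated) (auto simp: norm_mult)

lemma le2_add:
  assumes "le2 X v C" "le2 X w D"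
  shows "le2 X (\<lambda>x. v x + w x) (C + D)"
proof (rule le2I)
  fix F assume F: "finite F" "F \<subseteq> X"
  have "L2_set (\<lambda>x. cmod (v x + w x)) F \<le> L2_set (\<lambda>x. cmod (v x) + cmod (w x)) F"
    by (rule L2_set_mono) (auto simp: norm_triangle_ineq)
  also have "\<dots> \<le> L2_set (\<lambda>x. cmod (v x)) F + L2_set (\<lambda>x. cmod (w x)) F"
    by (rule L2_set_triangle_ineq)
  finally show "L2_set (\<lambda>x. cmod (v x + w x)) F \<le> C + D"
    using le2D[OF assms(1) F] le2D[OF assms(2) F] by linarith
qed

lemma le2_diff:
  assumes "le2 X v C" "le2 X w D"
  shows "le2 X (\<lambda>x. v x - w x) (C + D)"
  using le2_add[OF assms(1) le2_cmult[OF assms(2), of "-1"]] by simp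

lemma le2_sum:
  assumes "finite I" "\<And>i. i \<in> I \<Longrightarrow> le2 X (v i) (C i)"
  shows "le2 X (\<lambda>x. \<Sum>i\<in>I. v i x) (\<Sum>i\<in>I. C i)"
  using assms by (induction I rule: finite_induct) (auto intro: le2_add le2I simp: L2_set_def)

lemma le2_zero: "0 \<le> C \<Longrightarrow> le2 X (\<lambda>x. 0) C"
  by (rule le2I) (simp add: L2_set_def)

lemma le2_finite: "finite X \<Longrightarrow> le2 X v (L2_set (\<lambda>x. cmod (v x)) X)"
  unfolding le2_def L2_set_def by (auto intro!: sum_mono2)

lemma le2_support:
  assumes "le2 (X \<inter> {x. v x \<noteq> 0}) v C"
  shows "le2 X v C"
proof (rule le2I)
  fix F assume F: "finite F" "F \<subseteq> X"
  have "L2_set (\<lambda>x. cmod (v x)) F = L2_set (\<lambda>x. cmod (v x)) (F \<inter> {x. v x \<noteq> 0})"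
    unfolding L2_set_def
    by (intro arg_cong[where f=sqrt] sum.mono_neutral_right) (use F in auto)
  also have "\<dots> \<le> C" by (rule le2D[OF assms]) (use F in auto)
  finally show "L2_set (\<lambda>x. cmod (v x)) F \<le> C" .
qed

lemma le2_reindex:
  assumes "bij_betw h X Y" "le2 X (\<lambda>x. v (h x)) C"
  shows "le2 Y v C"
proof (rule le2I)
  fix F assume F: "finite F" "F \<subseteq> Y"
  define G where "G = {x \<in> X. h x \<in> F}"
  have inj: "inj_on h G" using assms(1) unfolding bij_betw_def G_def inj_on_def by auto
  have FG: "F = h ` G" using assms(1) F(2) unfolding bij_betw_def G_def by auto
  then have "finite G" using F inj finite_imageD by blast
  then have "L2_set (\<lambda>x. cmod (v (h x))) G \<le> C" using le2D[OF assms(2)] unfolding G_def by auto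
  then show "L2_set (\<lambda>x. cmod (v x)) F \<le> C"
    unfolding FG L2_set_def using sum.reindex[OF inj, of "\<lambda>i. (cmod (v i))\<^sup>2"] by (simp add: o_def)
qed

text \<open>This connects the formulation by finite subsets, which carries no summability
  conditions, with the infinite sums in \<open>l2_fields\<close> and
  \<open>L2_inner\<close>.\<close>

lemma le2_iff_infsum:
  assumes "0 \<le> C"
  shows "le2 X v C \<longleftrightarrow> (\<lambda>x. (cmod (v x))\<^sup>2) summable_on X \<and> (\<Sum>\<^sub>\<infinity>x\<in>X. (cmod (v x))\<^sup>2) \<le> C\<^sup>2"
proof
  assume l: "le2 X v C"
  have b: "(\<Sum>x\<in>F. (cmod (v x))\<^sup>2) \<le> C\<^sup>2" if "finite F" "F \<subseteq> X" for F
  proof -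
    have "(L2_set (\<lambda>x. cmod (v x)) F)\<^sup>2 \<le> C\<^sup>2" using le2D[OF l that] by (intro power_mono) auto
    then show ?thesis by (simp add: L2_set_def sum_nonneg)
  qed
  have s: "(\<lambda>x. (cmod (v x))\<^sup>2) summable_on X"
    by (rule nonneg_bdd_above_summable_on) (use b in \<open>auto simp: bdd_above_def\<close>)
  then show "(\<lambda>x. (cmod (v x))\<^sup>2) summable_on X \<and> (\<Sum>\<^sub>\<infinity>x\<in>X. (cmod (v x))\<^sup>2) \<le> C\<^sup>2"
    using infsum_le_finite_sums b by blast
next
  assume s: "(\<lambda>x. (cmod (v x))\<^sup>2) summable_on X \<and> (\<Sum>\<^sub>\<infinity>x\<in>X. (cmod (v x))\<^sup>2) \<le> C\<^sup>2"
  show "le2 X v C"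
  proof (rule le2I)
    fix F assume F: "finite F" "F \<subseteq> X"
    have "(\<Sum>x\<in>F. (cmod (v x))\<^sup>2) \<le> (\<Sum>\<^sub>\<infinity>x\<in>X. (cmod (v x))\<^sup>2)"
      by (rule finite_sum_le_infsum) (use s F in auto)
    then have "(\<Sum>x\<in>F. (cmod (v x))\<^sup>2) \<le> C\<^sup>2" using s by linarith
    then show "L2_set (\<lambda>x. cmod (v x)) F \<le> C"
      unfolding L2_set_def using assms real_le_lsqrt by (simp add: sum_nonneg)
  qed
qed

lemma le2_tail:
  assumes "le2 X v C" "\<epsilon> > 0"
  obtains F where "finite F" "F \<subseteq> X" "le2 (X - F) v \<epsilon>"
proof -
  let ?f = "\<lambda>x. (cmod (v x))\<^sup>2"
  have s: "?f summable_on X" using assms le2_iff_infsum le2_nonneg by metis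
  obtain F where F: "finite F" "F \<subseteq> X" "dist (sum ?f F) (infsum ?f X) \<le> \<epsilon>\<^sup>2"
    using infsum_finite_approximation[OF s, of "\<epsilon>\<^sup>2"] assms(2) by auto
  show thesis
  proof (rule that[OF F(1,2)], rule le2I)
    fix G assume G: "finite G" "G \<subseteq> X - F"
    have "sum ?f F + sum ?f G = sum ?f (F \<union> G)"
      by (rule sum.union_disjoint[symmetric]) (use F G in auto)
    also have "\<dots> \<le> infsum ?f X"
      by (rule finite_sum_le_infsum) (use s F G in auto)
    finally have "sum ?f G \<le> \<epsilon>\<^sup>2" using F(3) by (simp add: dist_real_def)
    then show "L2_set (\<lambda>x. cmod (v x)) G \<le> \<epsilon>"
      unfolding L2_set_def using assms(2) real_le_lsqrt by (simp add: sum_nonneg)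
  qed
qed

lemma le2_Cauchy_Schwarz:
  assumes "le2 X v C" "le2 X w D"
  shows "(\<lambda>x. v x * w x) summable_on X" "cmod (\<Sum>\<^sub>\<infinity>x\<in>X. v x * w x) \<le> C * D"
proof -
  have b: "(\<Sum>x\<in>F. norm (v x * w x)) \<le> C * D" if "finite F" "F \<subseteq> X" for F
  proof -
    have "(\<Sum>x\<in>F. norm (v x * w x)) \<le> L2_set (\<lambda>x. cmod (v x)) F * L2_set (\<lambda>x. cmod (w x)) F"
      using L2_set_mult_ineq[of "\<lambda>x. cmod (v x)" "\<lambda>x. cmod (w x)" F] by (simp add: norm_mult)
    also have "\<dots> \<le> C * D"
      by (rule mult_mono) (use le2D[OF assms(1) that] le2D[OF assms(2) that] le2_nonneg assms in auto)
    finally show ?thesis .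
  qed
  have s: "(\<lambda>x. norm (v x * w x)) summable_on X"
    by (rule nonneg_bdd_above_summable_on) (use b in \<open>auto simp: bdd_above_def\<close>)
  then show "(\<lambda>x. v x * w x) summable_on X" by (rule abs_summable_summable)
  have "cmod (\<Sum>\<^sub>\<infinity>x\<in>X. v x * w x) \<le> (\<Sum>\<^sub>\<infinity>x\<in>X. norm (v x * w x))"
    by (rule norm_infsum_bound) (rule s)
  also have "\<dots> \<le> C * D" using infsum_le_finite_sums[OF s] b by blast
  finally show "cmod (\<Sum>\<^sub>\<infinity>x\<in>X. v x * w x) \<le> C * D" .
qed

lemma le2_cnj: "le2 X v C \<Longrightarrow> le2 X (\<lambda>x. cnj (v x)) C"
  by (rule le2_le) auto

lemma formbdD:
  assumes "formbd m X Y C" "finite F" "F \<subseteq> X" "finite G" "G \<subseteq> Y"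
  shows "L2_set (\<lambda>y. cmod (\<Sum>x\<in>F. m y x * a x)) G \<le> C * L2_set (\<lambda>x. cmod (a x)) F"
  using assms unfolding formbd_def by blast

lemma formbdI:
  assumes "\<And>F G a. finite F \<Longrightarrow> F \<subseteq> X \<Longrightarrow> finite G \<Longrightarrow> G \<subseteq> Y \<Longrightarrow>
    L2_set (\<lambda>y. cmod (\<Sum>x\<in>F. m y x * a x)) G \<le> C * L2_set (\<lambda>x. cmod (a x)) F"
  shows "formbd m X Y C"
  using assms unfolding formbd_def by blast

lemma formbd_mono:
  assumes "formbd m X Y C" "C \<le> D" "X' \<subseteq> X" "Y' \<subseteq> Y"
  shows "formbd m X' Y' D"
proof (rule formbdI)
  fix F G a assume "finite F" "F \<subseteq> X'" "finite G" "G \<subseteq> Y'"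
  then have "L2_set (\<lambda>y. cmod (\<Sum>x\<in>F. m y x * a x)) G \<le> C * L2_set (\<lambda>x. cmod (a x)) F"
    using assms by (intro formbdD[OF assms(1)]) auto
  also have "\<dots> \<le> D * L2_set (\<lambda>x. cmod (a x)) F"
    by (intro mult_right_mono) (use assms in auto)
  finally show "L2_set (\<lambda>y. cmod (\<Sum>x\<in>F. m y x * a x)) G \<le> D * L2_set (\<lambda>x. cmod (a x)) F" .
qed

lemma formbd_cong:
  assumes "formbd m X Y C" "\<And>x y. x \<in> X \<Longrightarrow> y \<in> Y \<Longrightarrow> n y x = m y x"
  shows "formbd n X Y C"
proof (rule formbdI)
  fix F G a assume F: "finite F" "F \<subseteq> X" "finite G" "G \<subseteq> Y"
  have "L2_set (\<lambda>y. cmod (\<Sum>x\<in>F. n y x * a x)) G = L2_set (\<lambda>y. cmod (\<Sum>x\<in>F. m y x * a x)) G"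
    by (intro L2_set_cong arg_cong[where f=cmod] sum.cong) (use F assms(2) in auto)
  then show "L2_set (\<lambda>y. cmod (\<Sum>x\<in>F. n y x * a x)) G \<le> C * L2_set (\<lambda>x. cmod (a x)) F"
    using formbdD[OF assms(1) F] by simp
qed

lemma formbd_add:
  assumes "formbd m X Y C" "formbd n X Y D"
  shows "formbd (\<lambda>y x. m y x + n y x) X Y (C + D)"
proof (rule formbdI)
  fix F G a assume F: "finite F" "F \<subseteq> X" "finite G" "G \<subseteq> Y"
  have "L2_set (\<lambda>y. cmod (\<Sum>x\<in>F. (m y x + n y x) * a x)) G
    \<le> L2_set (\<lambda>y. cmod (\<Sum>x\<in>F. m y x * a x) + cmod (\<Sum>x\<in>F. n y x * a x)) G"
    by (rule L2_set_mono) (auto simp: algebra_simps sum.distrib norm_triangle_ineq)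
  also have "\<dots> \<le> L2_set (\<lambda>y. cmod (\<Sum>x\<in>F. m y x * a x)) G + L2_set (\<lambda>y. cmod (\<Sum>x\<in>F. n y x * a x)) G"
    by (rule L2_set_triangle_ineq)
  also have "\<dots> \<le> C * L2_set (\<lambda>x. cmod (a x)) F + D * L2_set (\<lambda>x. cmod (a x)) F"
    by (intro add_mono formbdD[OF assms(1)] formbdD[OF assms(2)] F)
  finally show "L2_set (\<lambda>y. cmod (\<Sum>x\<in>F. (m y x + n y x) * a x)) G \<le> (C + D) * L2_set (\<lambda>x. cmod (a x)) F"
    by (simp add: algebra_simps)
qed

lemma formbd_cmult:
  assumes "formbd m X Y C"
  shows "formbd (\<lambda>y x. c * m y x) X Y (cmod c * C)"
proof (rule formbdI)
  fix F G a assume F: "finite F" "F \<subseteq> X" "finite G" "G \<subseteq> Y"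
  have "L2_set (\<lambda>y. cmod (\<Sum>x\<in>F. c * m y x * a x)) G = cmod c * L2_set (\<lambda>y. cmod (\<Sum>x\<in>F. m y x * a x)) G"
    by (simp add: L2_set_right_distrib mult.assoc flip: sum_distrib_left norm_mult)
  also have "\<dots> \<le> cmod c * (C * L2_set (\<lambda>x. cmod (a x)) F)"
    by (intro mult_left_mono formbdD[OF assms] F) auto
  finally show "L2_set (\<lambda>y. cmod (\<Sum>x\<in>F. c * m y x * a x)) G \<le> cmod c * C * L2_set (\<lambda>x. cmod (a x)) F"
    by (simp add: algebra_simps)
qed

lemma formbd_adjoint:
  assumes "formbd m X Y C" "0 \<le> C"
  shows "formbd (\<lambda>x y. cnj (m y x)) Y X C"
proof (rule formbdI)
  fix G F b assume G: "finite G" "G \<subseteq> Y" and F: "finite F" "F \<subseteq> X"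
  define w where "w x = (\<Sum>y\<in>G. cnj (m y x) * b y)" for x
  define N where "N = L2_set (\<lambda>x. cmod (w x)) F"
  define B where "B = L2_set (\<lambda>y. cmod (b y)) G"
  define M where "M y = (\<Sum>x\<in>F. m y x * w x)" for y
  have N0: "N \<ge> 0" unfolding N_def by simp
  have "N\<^sup>2 = (\<Sum>x\<in>F. (cmod (w x))\<^sup>2)"
    unfolding N_def L2_set_def by (simp add: sum_nonneg)
  then have "complex_of_real (N\<^sup>2) = (\<Sum>x\<in>F. cnj (w x) * w x)"
    by (simp add: complex_norm_square mult.commute del: of_real_power)
  also have "\<dots> = (\<Sum>x\<in>F. \<Sum>y\<in>G. cnj (w x) * (cnj (m y x) * b y))"
    unfolding w_def[of _] by (simp add: sum_distrib_left)
  also have "\<dots> = (\<Sum>y\<in>G. \<Sum>x\<in>F. cnj (w x) * (cnj (m y x) * b y))"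
    by (rule sum.swap)
  also have "\<dots> = (\<Sum>y\<in>G. cnj (M y) * b y)"
    unfolding M_def by (simp add: sum_distrib_right sum_distrib_left algebra_simps)
  finally have "N\<^sup>2 = cmod (\<Sum>y\<in>G. cnj (M y) * b y)"
    by (metis N0 norm_of_real abs_of_nonneg zero_le_power)
  also have "\<dots> \<le> (\<Sum>y\<in>G. cmod (M y) * cmod (b y))"
    by (rule order_trans[OF norm_sum]) (simp add: norm_mult)
  also have "\<dots> \<le> L2_set (\<lambda>y. cmod (M y)) G * B"
    using L2_set_mult_ineq[of "\<lambda>y. cmod (M y)" "\<lambda>y. cmod (b y)" G] unfolding B_def by simp
  also have "\<dots> \<le> (C * N) * B"
    unfolding M_def N_def by (rule mult_right_mono[OF formbdD[OF assms(1) F G]]) (simp add: B_def)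
  finally have "N * N \<le> (C * B) * N" by (simp add: power2_eq_square algebra_simps)
  then have "N = 0 \<or> N \<le> C * B" using N0 by (metis mult_le_cancel_right antisym_conv2 less_le)
  moreover have "0 \<le> C * B" using assms(2) by (simp add: B_def)
  ultimately show "L2_set (\<lambda>x. cmod (\<Sum>y\<in>G. cnj (m y x) * b y)) F \<le> C * L2_set (\<lambda>y. cmod (b y)) G"
    unfolding N_def w_def B_def by auto
qed

text \<open>Up to conjugation a row is the image of a basis vector under the adjoint matrix.\<close>

lemma formbd_row:
  assumes "formbd m X Y C" "0 \<le> C" "y \<in> Y"
  shows "le2 X (m y) C"
proof (rule le2I)
  fix F assume F: "finite F" "F \<subseteq> X"
  show "L2_set (\<lambda>x. cmod (m y x)) F \<le> C"
    using formbdD[OF formbd_adjoint[OF assms(1,2)], of "{y}" F "\<lambda>_. 1"] F assms(3) by simp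
qed

lemma app_summable:
  assumes "formbd m X Y C" "0 \<le> C" "y \<in> Y" "le2 X v c"
  shows "(\<lambda>x. m y x * v x) summable_on X"
  using le2_Cauchy_Schwarz(1)[OF formbd_row[OF assms(1-3)] assms(4)] .

text \<open>For a finite set G of rows the norm is a continuous expression in finitely many row
  sums, so the bound for finite sets of columns passes to the limit along the net of finite subsets
  of X.\<close>

lemma app_bound:
  assumes m: "formbd m X Y C" "0 \<le> C" and v: "le2 X v c"
  shows "le2 Y (app m X v) (C * c)"
proof (rule le2I)
  fix G assume G: "finite G" "G \<subseteq> Y"
  let ?F = "finite_subsets_at_top X"
  have lim: "((\<lambda>F. \<Sum>x\<in>F. m y x * v x) \<longlongrightarrow> app m X v y) ?F" if "y \<in> G" for y
    using app_summable[OF m _ v, of y] that G unfolding app_def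
    by (intro infsum_tendsto) auto
  have "((\<lambda>F. L2_set (\<lambda>y. cmod (\<Sum>x\<in>F. m y x * v x)) G) \<longlongrightarrow> L2_set (\<lambda>y. cmod (app m X v y)) G) ?F"
    unfolding L2_set_def by (intro tendsto_intros lim)
  moreover have "eventually (\<lambda>F. L2_set (\<lambda>y. cmod (\<Sum>x\<in>F. m y x * v x)) G \<le> C * c) ?F"
  proof (rule eventually_finite_subsets_at_top_weakI)
    fix F assume F: "finite F" "F \<subseteq> X"
    have "L2_set (\<lambda>y. cmod (\<Sum>x\<in>F. m y x * v x)) G \<le> C * L2_set (\<lambda>x. cmod (v x)) F"
      by (rule formbdD[OF m(1) F G])
    also have "\<dots> \<le> C * c" by (intro mult_left_mono le2D[OF v F] m(2))
    finally show "L2_set (\<lambda>y. cmod (\<Sum>x\<in>F. m y x * v x)) G \<le> C * c" .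
  qed
  ultimately show "L2_set (\<lambda>y. cmod (app m X v y)) G \<le> C * c"
    using tendsto_upperbound finite_subsets_at_top_neq_bot by blast
qed

lemma app_restrict:
  assumes "Z \<subseteq> X" "\<And>x. x \<in> X - Z \<Longrightarrow> v x = 0" "\<And>x. x \<in> Z \<Longrightarrow> w x = v x"
  shows "app m X v y = app m Z w y"
  unfolding app_def by (rule infsum_cong_neutral) (use assms in auto)

lemma app_finite: "finite X \<Longrightarrow> app m X v y = (\<Sum>x\<in>X. m y x * v x)"
  by (simp add: app_def)

lemma app_add:
  assumes "formbd m X Y C" "0 \<le> C" "y \<in> Y" "le2 X v c" "le2 X w d"
  shows "app m X (\<lambda>x. v x + w x) y = app m X v y + app m X w y"
  unfolding app_def
  using infsum_add[OF app_summable[OF assms(1-4)] app_summable[OF assms(1-3,5)]]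
  by (simp add: algebra_simps)

text \<open>The double sum need not converge absolutely, so the order of summation cannot simply be
  exchanged. For finitely many x the exchange is elementary, and the remainder is controlled by the
  tail of v, the bound of m and Cauchy-Schwarz.\<close>

lemma app_adjoint:
  assumes m: "formbd m X Y C" "0 \<le> C" and v: "le2 X v c" and w: "le2 Y w d"
  shows "(\<Sum>\<^sub>\<infinity>y\<in>Y. cnj (app m X v y) * w y) = (\<Sum>\<^sub>\<infinity>x\<in>X. cnj (v x) * app (\<lambda>x y. cnj (m y x)) Y w x)"
proof -
  define u where "u = app (\<lambda>x y. cnj (m y x)) Y w"
  define B where "B = (\<Sum>\<^sub>\<infinity>y\<in>Y. cnj (app m X v y) * w y)"
  note m' = formbd_adjoint[OF m]
  have d: "0 \<le> d" using le2_nonneg w by blast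
  have fin: "(\<Sum>x\<in>F. cnj (v x) * u x) = (\<Sum>\<^sub>\<infinity>y\<in>Y. cnj (app m F v y) * w y)" if F: "finite F" "F \<subseteq> X" for F
  proof -
    have s: "(\<lambda>y. cnj (v x) * (cnj (m y x) * w y)) summable_on Y" if "x \<in> F" for x
      using app_summable[OF m' m(2) _ w, of x] that F by (intro summable_on_cmult_right) auto
    have "(\<Sum>x\<in>F. cnj (v x) * u x) = (\<Sum>x\<in>F. \<Sum>\<^sub>\<infinity>y\<in>Y. cnj (v x) * (cnj (m y x) * w y))"
      unfolding u_def app_def by (simp add: infsum_cmult_right')
    also have "\<dots> = (\<Sum>\<^sub>\<infinity>y\<in>Y. \<Sum>x\<in>F. cnj (v x) * (cnj (m y x) * w y))"
      using infsum_finite_sum[OF F(1) s] by simp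
    also have "\<dots> = (\<Sum>\<^sub>\<infinity>y\<in>Y. cnj (app m F v y) * w y)"
      unfolding app_finite[OF F(1)] cnj_sum sum_distrib_right
      by (intro infsum_cong sum.cong) (auto simp: algebra_simps)
    finally show ?thesis .
  qed
  have "((\<lambda>F. \<Sum>x\<in>F. cnj (v x) * u x) \<longlongrightarrow> B) (finite_subsets_at_top X)"
  proof (rule tendstoI)
    fix e :: real assume e: "e > 0"
    \<comment> \<open>The remainder is at most C \<epsilon> d, which this choice keeps below e; the
      summand 1 avoids a division by zero.\<close>
    define \<epsilon> where "\<epsilon> = e / (2 * (C * d + 1))"
    have Cd: "C * d \<ge> 0" using m d by simp
    have "\<epsilon> > 0" using e Cd by (simp add: \<epsilon>_def)
    from le2_tail[OF v this] obtain F0 where F0: "finite F0" "F0 \<subseteq> X" "le2 (X - F0) v \<epsilon>" .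
    have "dist (\<Sum>x\<in>F. cnj (v x) * u x) B < e" if F: "finite F" "F \<subseteq> X" "F0 \<subseteq> F" for F
    proof -
      have v1: "le2 X (\<lambda>x. if x \<in> F then v x else 0) c" by (rule le2_le[OF v]) auto
      have v2: "le2 X (\<lambda>x. if x \<in> F then 0 else v x) \<epsilon>"
        by (rule le2_support, rule le2_cong[of _ v], rule le2_mono[OF F0(3)]) (use F in auto)
      have a: "app m X v y = app m F v y + app m X (\<lambda>x. if x \<in> F then 0 else v x) y" if "y \<in> Y" for y
      proof -
        have "app m X v y = app m X (\<lambda>x. (if x \<in> F then v x else 0) + (if x \<in> F then 0 else v x)) y"
          unfolding app_def by (intro infsum_cong) auto
        also have "\<dots> = app m X (\<lambda>x. if x \<in> F then v x else 0) y + app m X (\<lambda>x. if x \<in> F then 0 else v x) y"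
          by (rule app_add[OF m that v1 v2])
        also have "app m X (\<lambda>x. if x \<in> F then v x else 0) y = app m F v y"
          by (rule app_restrict) (use F in auto)
        finally show ?thesis .
      qed
      have b1: "le2 Y (app m F v) (C * c)"
        by (rule app_bound[OF formbd_mono[OF m(1) order_refl F(2) order_refl] m(2) le2_mono[OF v order_refl F(2)]])
      note b2 = app_bound[OF m v2]
      note cs1 = le2_Cauchy_Schwarz[OF le2_cnj[OF b1] w]
      note cs2 = le2_Cauchy_Schwarz[OF le2_cnj[OF b2] w]
      have "B = (\<Sum>\<^sub>\<infinity>y\<in>Y. cnj (app m F v y) * w y + cnj (app m X (\<lambda>x. if x \<in> F then 0 else v x) y) * w y)"
        unfolding B_def by (intro infsum_cong) (simp add: a algebra_simps)
      also have "\<dots> = (\<Sum>x\<in>F. cnj (v x) * u x) + (\<Sum>\<^sub>\<infinity>y\<in>Y. cnj (app m X (\<lambda>x. if x \<in> F then 0 else v x) y) * w y)"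
        using infsum_add[OF cs1(1) cs2(1)] fin[OF F(1,2)] by simp
      finally have "dist (\<Sum>x\<in>F. cnj (v x) * u x) B \<le> C * \<epsilon> * d"
        using cs2(2) by (simp add: dist_norm)
      also have "\<dots> = (C * d) / (C * d + 1) * (e / 2)" using Cd by (simp add: \<epsilon>_def field_simps)
      also have "\<dots> \<le> 1 * (e / 2)" using Cd e by (intro mult_right_mono) (auto simp: divide_simps)
      also have "\<dots> < e" using e by simp
      finally show ?thesis .
    qed
    then show "\<forall>\<^sub>F F in finite_subsets_at_top X. dist (\<Sum>x\<in>F. cnj (v x) * u x) B < e"
      unfolding eventually_finite_subsets_at_top using F0(1,2) by blast
  qed
  then have "((\<lambda>x. cnj (v x) * u x) has_sum B) X"
    by (simp only: has_sum_def)
  from infsumI[OF this] show ?thesis by (simp only: u_def B_def)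
qed

section \<open>Function spaces on an etale groupoid\<close>

context etale
begin

text \<open>In a Hausdorff space the support is contained in every compact set outside of which f
  vanishes, so such a set can replace the closure in \<open>supp\<close>.\<close>

lemma Cc_iff: "f \<in> Cc H \<longleftrightarrow> continuous_map (gtop H) euclidean f \<and>
    (\<exists>C. compactin (gtop H) C \<and> (\<forall>\<gamma>. \<gamma> \<notin> C \<longrightarrow> f \<gamma> = 0))" (is "?l \<longleftrightarrow> ?r")
proof
  assume f: ?l
  have "{\<gamma>. f \<gamma> \<noteq> 0} \<subseteq> A" using f by (auto simp: Cc_def)
  then have "{\<gamma>. f \<gamma> \<noteq> 0} \<subseteq> supp H f" unfolding supp_def by (rule closure_of_subset)
  then have "compactin (gtop H) (supp H f) \<and> (\<forall>\<gamma>. \<gamma> \<notin> supp H f \<longrightarrow> f \<gamma> = 0)"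
    using f by (auto simp: Cc_def)
  then show ?r using f unfolding Cc_def by blast
next
  assume f: ?r
  then obtain C where C: "compactin (gtop H) C" "\<And>\<gamma>. \<gamma> \<notin> C \<Longrightarrow> f \<gamma> = 0" by blast
  have cl: "closedin (gtop H) C" using C Hausdorff compactin_imp_closedin by blast
  have "supp H f \<subseteq> C" unfolding supp_def by (rule closure_of_minimal) (use C cl in auto)
  then have "compactin (gtop H) (supp H f)"
    using C(1) closed_compactin closedin_closure_of unfolding supp_def by metis
  then show ?l using f C compactin_subset_topspace[OF C(1)] unfolding Cc_def by auto
qed

lemma Cc_continuous: "f \<in> Cc H \<Longrightarrow> continuous_map (gtop H) euclidean f"
  by (simp add: Cc_def)

lemma CbD:
  assumes "f \<in> Cb H"
  shows "continuous_map (gtop H) euclidean f" "\<And>\<gamma>. \<gamma> \<notin> A \<Longrightarrow> f \<gamma> = 0" "cmod (f \<gamma>) \<le> sup_norm f"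
proof -
  show "continuous_map (gtop H) euclidean f" "\<And>\<gamma>. \<gamma> \<notin> A \<Longrightarrow> f \<gamma> = 0"
    using assms by (auto simp: Cb_def)
  have "bounded (range f)" using assms by (simp add: Cb_def)
  then have "bdd_above (range (\<lambda>x. cmod (f x)))" by (auto simp: bounded_iff bdd_above_def)
  then show "cmod (f \<gamma>) \<le> sup_norm f" unfolding sup_norm_def by (rule cSUP_upper[rotated]) simp
qed

lemma sup_norm_le: "(\<And>\<gamma>. cmod (f \<gamma>) \<le> C) \<Longrightarrow> sup_norm f \<le> C"
  unfolding sup_norm_def by (rule cSUP_least) auto

lemma CbI:
  assumes "continuous_map (gtop H) euclidean f" "\<And>\<gamma>. cmod (f \<gamma>) \<le> C" "\<And>\<gamma>. \<gamma> \<notin> A \<Longrightarrow> f \<gamma> = 0"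
  shows "f \<in> Cb H"
  using assms by (auto simp: Cb_def bounded_iff)

lemma Cc_bounded:
  assumes "f \<in> Cc H"
  obtains B where "\<And>\<gamma>. cmod (f \<gamma>) \<le> B" "0 \<le> B"
proof -
  obtain C where C: "compactin (gtop H) C" "\<And>\<gamma>. \<gamma> \<notin> C \<Longrightarrow> f \<gamma> = 0" using assms Cc_iff by blast
  have "compact (f ` C)" using image_compactin[OF C(1) Cc_continuous[OF assms]] by simp
  then have "bounded (f ` C)" by (rule compact_imp_bounded)
  then obtain B where "\<And>\<gamma>. \<gamma> \<in> C \<Longrightarrow> cmod (f \<gamma>) \<le> B" by (auto simp: bounded_iff)
  then have "cmod (f \<gamma>) \<le> max B 0" for \<gamma> using C(2) by (cases "\<gamma> \<in> C") fastforce+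
  then show thesis using that[of "max B 0"] by simp
qed

lemma Cc_subset_Cb: "Cc H \<subseteq> Cb H"
proof
  fix f assume f: "f \<in> Cc H"
  then obtain B where "\<And>\<gamma>. cmod (f \<gamma>) \<le> B" using Cc_bounded by blast
  then show "f \<in> Cb H" by (rule CbI[rotated]) (use f in \<open>auto simp: Cc_def\<close>)
qed

lemma Cc_zero: "(\<lambda>_. 0) \<in> Cc H"
  unfolding Cc_iff using compactin_empty by force

lemma Cc_add:
  assumes "f \<in> Cc H" "g \<in> Cc H"
  shows "(\<lambda>\<gamma>. f \<gamma> + g \<gamma>) \<in> Cc H"
proof -
  obtain C D where "compactin (gtop H) C" "\<forall>\<gamma>. \<gamma> \<notin> C \<longrightarrow> f \<gamma> = 0"
    "compactin (gtop H) D" "\<forall>\<gamma>. \<gamma> \<notin> D \<longrightarrow> g \<gamma> = 0" using assms unfolding Cc_iff by blast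
  then have "compactin (gtop H) (C \<union> D)" "\<forall>\<gamma>. \<gamma> \<notin> C \<union> D \<longrightarrow> f \<gamma> + g \<gamma> = 0"
    by (auto intro: compactin_Un)
  then show ?thesis unfolding Cc_iff
    using continuous_map_add[OF Cc_continuous[OF assms(1)] Cc_continuous[OF assms(2)]] by blast
qed

lemma Cc_mult_continuous:
  assumes "continuous_map (gtop H) euclidean f" "g \<in> Cc H"
  shows "(\<lambda>\<gamma>. f \<gamma> * g \<gamma>) \<in> Cc H"
proof -
  obtain C where "compactin (gtop H) C" "\<forall>\<gamma>. \<gamma> \<notin> C \<longrightarrow> g \<gamma> = 0" using assms unfolding Cc_iff by blast
  moreover from this(2) have "\<forall>\<gamma>. \<gamma> \<notin> C \<longrightarrow> f \<gamma> * g \<gamma> = 0" by simp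
  ultimately show ?thesis unfolding Cc_iff
    using continuous_map_complex_mult[OF assms(1) Cc_continuous[OF assms(2)]] by blast
qed

lemma Cc_cmult: "f \<in> Cc H \<Longrightarrow> (\<lambda>\<gamma>. c * f \<gamma>) \<in> Cc H"
  by (rule Cc_mult_continuous) auto

lemma Cc_sum: "finite I \<Longrightarrow> (\<And>i. i \<in> I \<Longrightarrow> f i \<in> Cc H) \<Longrightarrow> (\<lambda>\<gamma>. \<Sum>i\<in>I. f i \<gamma>) \<in> Cc H"
  by (induction I rule: finite_induct) (auto intro: Cc_add Cc_zero)

lemma Cc_bump:
  assumes "compactin (gtop H) K" "openin (gtop H) U" "K \<subseteq> U"
  obtains f where "f \<in> Cc H" "\<And>x. cmod (f x) \<le> 1" "\<And>x. cmod (1 - f x) \<le> 1" "\<And>x. x \<in> K \<Longrightarrow> f x = 1"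
    "\<And>x. f x \<noteq> 0 \<Longrightarrow> x \<in> U" "supp H f \<subseteq> U"
proof -
  obtain f C where f: "continuous_map (gtop H) euclidean f" "\<And>x. 0 \<le> f x" "\<And>x. f x \<le> (1::real)"
    "\<And>x. x \<in> K \<Longrightarrow> f x = 1" "compactin (gtop H) C" "C \<subseteq> U" "\<And>x. x \<notin> C \<Longrightarrow> f x = 0"
    using locally_compact_Hausdorff_bump[OF loc_compact Hausdorff assms] by metis
  have cl: "closedin (gtop H) C" using f(5) Hausdorff compactin_imp_closedin by blast
  show thesis
  proof (rule that[of "\<lambda>x. of_real (f x)"])
    show "(\<lambda>x. complex_of_real (f x)) \<in> Cc H"
      unfolding Cc_iff using continuous_map_of_real[OF f(1)] f(5,7) by auto
    show "cmod (1 - complex_of_real (f x)) \<le> 1" for x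
      using f(2,3)[of x] by (metis abs_of_nonneg diff_ge_0_iff_ge diff_le_eq le_add_same_cancel1 norm_of_real of_real_1 of_real_diff)
    have "supp H (\<lambda>x. complex_of_real (f x)) \<subseteq> C"
      unfolding supp_def by (rule closure_of_minimal[OF _ cl]) (use f(7) in force)
    then show "supp H (\<lambda>x. complex_of_real (f x)) \<subseteq> U" using f by blast
  next
    show "x \<in> U" if "complex_of_real (f x) \<noteq> 0" for x
      using f(6) f(7)[of x] that by auto
  qed (use f(2,3,4) in \<open>auto simp: abs_of_nonneg\<close>)
qed

text \<open>A bounded number of terms of bounded size in each fibre. The resulting l1 bound later
  controls \<rho>(g).\<close>

lemma Cc_fibre_sum_bounded:
  assumes "f \<in> Cc H"
  obtains B where "0 \<le> B" "\<And>x F. finite F \<Longrightarrow> F \<subseteq> fib x \<Longrightarrow> (\<Sum>\<gamma>\<in>F. cmod (f \<gamma>)) \<le> B"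
proof -
  obtain C where C: "compactin (gtop H) C" "\<And>\<gamma>. \<gamma> \<notin> C \<Longrightarrow> f \<gamma> = 0" using assms Cc_iff by blast
  obtain n where n: "\<And>x. finite (fib x \<inter> C) \<and> card (fib x \<inter> C) \<le> n"
    using compact_fibre_card[OF C(1)] by blast
  obtain B where B: "\<And>\<gamma>. cmod (f \<gamma>) \<le> B" "0 \<le> B" using Cc_bounded[OF assms] by blast
  show thesis
  proof (rule that[of "n * B"])
    fix x F assume F: "finite F" "F \<subseteq> fib x"
    have "(\<Sum>\<gamma>\<in>F. cmod (f \<gamma>)) = (\<Sum>\<gamma>\<in>F \<inter> C. cmod (f \<gamma>))"
      by (rule sum.mono_neutral_right) (use F C in auto)
    also have "\<dots> \<le> (\<Sum>\<gamma>\<in>F \<inter> C. B)" by (rule sum_mono) (rule B)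
    also have "\<dots> \<le> card (fib x \<inter> C) * B"
    proof -
      have "card (F \<inter> C) \<le> card (fib x \<inter> C)" by (rule card_mono) (use n F in auto)
      then show ?thesis using B(2) by (simp add: mult_right_mono)
    qed
    also have "\<dots> \<le> n * B" using n[of x] B(2) by (simp add: mult_right_mono)
    finally show "(\<Sum>\<gamma>\<in>F. cmod (f \<gamma>)) \<le> n * B" .
  qed (use B in auto)
qed

lemma Cc_le2:
  assumes "f \<in> Cc H"
  obtains B where "\<And>x. le2 (fib x) f B"
proof -
  obtain B where B: "0 \<le> B" "\<And>x F. finite F \<Longrightarrow> F \<subseteq> fib x \<Longrightarrow> (\<Sum>\<gamma>\<in>F. cmod (f \<gamma>)) \<le> B"
    using Cc_fibre_sum_bounded[OF assms] by metis
  have "le2 (fib x) f B" for x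
    by (rule le2I, rule order_trans[OF L2_set_le_sum]) (use B in auto)
  then show thesis by (rule that)
qed

text \<open>Holds for arbitrary functions: if the squares are not summable, both sides take the
  default value 0.\<close>

lemma L2_inner_self: "L2_inner H \<xi> \<xi> x = of_real (\<Sum>\<^sub>\<infinity>\<gamma>\<in>fib x. (cmod (\<xi> \<gamma>))\<^sup>2)"
proof -
  have "(\<Sum>\<^sub>\<infinity>\<gamma>\<in>fib x. cnj (\<xi> \<gamma>) * \<xi> \<gamma>) = (\<Sum>\<^sub>\<infinity>\<gamma>\<in>fib x. complex_of_real ((cmod (\<xi> \<gamma>))\<^sup>2))"
    by (intro infsum_cong) (simp add: complex_norm_square mult.commute del: of_real_power)
  also have "\<dots> = of_real (\<Sum>\<^sub>\<infinity>\<gamma>\<in>fib x. (cmod (\<xi> \<gamma>))\<^sup>2)"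
  proof (cases "(\<lambda>\<gamma>. (cmod (\<xi> \<gamma>))\<^sup>2) summable_on fib x")
    case True
    then show ?thesis by (intro infsumI has_sum_of_real has_sum_infsum)
  next
    case False
    then have "\<not> (\<lambda>\<gamma>. complex_of_real ((cmod (\<xi> \<gamma>))\<^sup>2)) summable_on fib x"
      using summable_on_Re by fastforce
    then show ?thesis using False by (simp add: infsum_not_exists)
  qed
  finally show ?thesis by (simp add: L2_inner_def)
qed

lemma l2_fields_iff: "\<xi> \<in> l2_fields H \<longleftrightarrow> (\<forall>\<gamma>. \<gamma> \<notin> A \<longrightarrow> \<xi> \<gamma> = 0) \<and> (\<exists>C. \<forall>x. le2 (fib x) \<xi> C)"
  (is "?l \<longleftrightarrow> ?r")
proof
  assume l: ?l
  then obtain B where B: "\<And>x. cmod (L2_inner H \<xi> \<xi> x) \<le> B" by (auto simp: l2_fields_def bounded_iff)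
  have "0 \<le> B" using B order_trans norm_ge_zero by blast
  have "le2 (fib x) \<xi> (sqrt B)" for x
    using l B[of x] \<open>0 \<le> B\<close> by (subst le2_iff_infsum) (auto simp: l2_fields_def L2_inner_self)
  then show ?r using l by (auto simp: l2_fields_def)
next
  assume r: ?r
  then obtain C where C: "\<And>x. le2 (fib x) \<xi> C" by blast
  have C0: "0 \<le> C" using C le2_nonneg by blast
  have "cmod (L2_inner H \<xi> \<xi> x) \<le> C\<^sup>2" for x
    using C[of x] le2_iff_infsum[OF C0, of "fib x" \<xi>] infsum_nonneg[of "fib x" "\<lambda>\<gamma>. (cmod (\<xi> \<gamma>))\<^sup>2"]
    by (simp add: L2_inner_self)
  then have "bounded (range (L2_inner H \<xi> \<xi>))" by (auto simp: bounded_iff)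
  then show ?l using r C le2_iff_infsum[OF C0] by (auto simp: l2_fields_def)
qed

text \<open>All later norm estimates are made in the form on the right, fibre by fibre with a common
  constant. The supremum ranges over the whole type, but fibres over elements that are not units are
  empty and contribute 0; the boundedness in \<open>l2_fields\<close> makes it a genuine
  supremum.\<close>

lemma L2_norm_le_iff:
  assumes "\<xi> \<in> l2_fields H" "0 \<le> C"
  shows "L2_norm H \<xi> \<le> C \<longleftrightarrow> (\<forall>x. le2 (fib x) \<xi> C)"
proof -
  let ?n = "\<lambda>x. \<Sum>\<^sub>\<infinity>\<gamma>\<in>fib x. (cmod (\<xi> \<gamma>))\<^sup>2"
  have nn: "?n x \<ge> 0" for x by (rule infsum_nonneg) simp
  have sup: "sup_norm (L2_inner H \<xi> \<xi>) = (SUP x. ?n x)"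
    unfolding sup_norm_def L2_inner_self using nn by simp
  have "bounded (range (L2_inner H \<xi> \<xi>))" using assms by (simp add: l2_fields_def)
  then obtain B where "\<And>x. cmod (L2_inner H \<xi> \<xi> x) \<le> B" by (auto simp: bounded_iff)
  then have "?n x \<le> B" for x using nn[of x] unfolding L2_inner_self by (metis norm_of_real abs_of_nonneg)
  then have bdd: "bdd_above (range ?n)" by (rule bdd_aboveI2)
  have "L2_norm H \<xi> \<le> C \<longleftrightarrow> (SUP x. ?n x) \<le> C\<^sup>2"
    unfolding L2_norm_def sup using assms(2)
    by (meson real_sqrt_le_iff real_le_lsqrt sqrt_le_D real_le_rsqrt real_sqrt_le_mono order_trans)
  also have "\<dots> \<longleftrightarrow> (\<forall>x. ?n x \<le> C\<^sup>2)"
    using cSUP_le_iff[OF _ bdd] by simp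
  also have "\<dots> \<longleftrightarrow> (\<forall>x. le2 (fib x) \<xi> C)"
    using assms by (simp add: le2_iff_infsum l2_fields_def)
  finally show ?thesis .
qed

lemma L2_iff: "\<xi> \<in> L2 H \<longleftrightarrow> (\<forall>\<gamma>. \<gamma> \<notin> A \<longrightarrow> \<xi> \<gamma> = 0) \<and>
    (\<forall>\<epsilon>>0. \<exists>\<eta>\<in>Cc H. \<forall>x. le2 (fib x) (\<lambda>\<gamma>. \<xi> \<gamma> - \<eta> \<gamma>) \<epsilon>)" (is "?l \<longleftrightarrow> ?r")
proof -
  have diff: "(\<lambda>\<gamma>. \<xi> \<gamma> - \<eta> \<gamma>) \<in> l2_fields H" if f: "\<xi> \<in> l2_fields H" and g: "\<eta> \<in> Cc H" for \<eta>
  proof -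
    obtain C where "\<And>x. le2 (fib x) \<xi> C" using f unfolding l2_fields_iff by blast
    moreover obtain D where "\<And>x. le2 (fib x) \<eta> D" using Cc_le2[OF g] by metis
    ultimately have "\<And>x. le2 (fib x) (\<lambda>\<gamma>. \<xi> \<gamma> - \<eta> \<gamma>) (C + D)" by (rule le2_diff)
    moreover have "\<xi> \<gamma> - \<eta> \<gamma> = 0" if "\<gamma> \<notin> A" for \<gamma>
      using \<open>\<xi> \<in> l2_fields H\<close> \<open>\<eta> \<in> Cc H\<close> that by (simp add: l2_fields_def Cc_def)
    ultimately show ?thesis unfolding l2_fields_iff by blast
  qed
  show ?thesis
  proof
    assume l: ?l
    then have f: "\<xi> \<in> l2_fields H" by (simp add: L2_def)
    show ?r
    proof (intro conjI allI impI)
      fix \<epsilon> :: real assume "\<epsilon> > 0"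
      then obtain \<eta> where "\<eta> \<in> Cc H" "L2_norm H (\<lambda>\<gamma>. \<xi> \<gamma> - \<eta> \<gamma>) < \<epsilon>" using l by (auto simp: L2_def)
      then show "\<exists>\<eta>\<in>Cc H. \<forall>x. le2 (fib x) (\<lambda>\<gamma>. \<xi> \<gamma> - \<eta> \<gamma>) \<epsilon>"
        using L2_norm_le_iff[OF diff[OF f]] \<open>\<epsilon> > 0\<close> by (meson less_imp_le)
    qed (use f in \<open>simp add: l2_fields_def\<close>)
  next
    assume r: ?r
    then obtain \<eta> where \<eta>: "\<eta> \<in> Cc H" "\<And>x. le2 (fib x) (\<lambda>\<gamma>. \<xi> \<gamma> - \<eta> \<gamma>) 1" by (meson zero_less_one)
    obtain D where D: "\<And>x. le2 (fib x) \<eta> D" using Cc_le2[OF \<eta>(1)] by metis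
    have "le2 (fib x) \<xi> (1 + D)" for x
      using le2_add[OF \<eta>(2)[of x] D[of x]] by simp
    then have f: "\<xi> \<in> l2_fields H" using r unfolding l2_fields_iff by blast
    have "\<exists>\<eta>\<in>Cc H. L2_norm H (\<lambda>\<gamma>. \<xi> \<gamma> - \<eta> \<gamma>) < \<epsilon>" if "\<epsilon> > 0" for \<epsilon>
    proof -
      obtain \<eta> where "\<eta> \<in> Cc H" "\<forall>x. le2 (fib x) (\<lambda>\<gamma>. \<xi> \<gamma> - \<eta> \<gamma>) (\<epsilon> / 2)"
        using r \<open>\<epsilon> > 0\<close> half_gt_zero by blast
      then have "L2_norm H (\<lambda>\<gamma>. \<xi> \<gamma> - \<eta> \<gamma>) \<le> \<epsilon> / 2"
        using L2_norm_le_iff[OF diff[OF f]] \<open>\<epsilon> > 0\<close> by (meson half_gt_zero less_imp_le)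
      then show ?thesis using \<open>\<eta> \<in> Cc H\<close> \<open>\<epsilon> > 0\<close> by (intro bexI[of _ \<eta>]) auto
    qed
    then show ?l using f by (simp add: L2_def)
  qed
qed

lemma L2_l2_fields: "\<xi> \<in> L2 H \<Longrightarrow> \<xi> \<in> l2_fields H"
  by (simp add: L2_def)

lemma L2_outside: "\<xi> \<in> L2 H \<Longrightarrow> \<gamma> \<notin> A \<Longrightarrow> \<xi> \<gamma> = 0"
  by (simp add: L2_iff)

lemma L2_le2_norm:
  assumes "\<xi> \<in> L2 H"
  shows "le2 (fib x) \<xi> (L2_norm H \<xi>)" "0 \<le> L2_norm H \<xi>"
proof -
  have f: "\<xi> \<in> l2_fields H" using assms L2_l2_fields by blast
  have "bounded (range (L2_inner H \<xi> \<xi>))" using f by (simp add: l2_fields_def)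
  then have "bdd_above (range (\<lambda>x. cmod (L2_inner H \<xi> \<xi> x)))" by (auto simp: bounded_iff bdd_above_def)
  then have "0 \<le> sup_norm (L2_inner H \<xi> \<xi>)"
    unfolding sup_norm_def by (rule cSUP_upper2) auto
  then show "0 \<le> L2_norm H \<xi>" by (simp add: L2_norm_def)
  then show "le2 (fib x) \<xi> (L2_norm H \<xi>)" using L2_norm_le_iff[OF f] by blast
qed

lemma L2_norm_leI:
  assumes "\<xi> \<in> L2 H" "\<And>x. le2 (fib x) \<xi> C"
  shows "L2_norm H \<xi> \<le> C"
  using L2_norm_le_iff[OF L2_l2_fields[OF assms(1)]] assms(2) le2_nonneg by blast

lemma Cc_subset_L2: "Cc H \<subseteq> L2 H"
proof
  fix f assume f: "f \<in> Cc H"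
  have "\<exists>\<eta>\<in>Cc H. \<forall>x. le2 (fib x) (\<lambda>\<gamma>. f \<gamma> - \<eta> \<gamma>) \<epsilon>" if "\<epsilon> > 0" for \<epsilon>
    using that by (intro bexI[OF _ f]) (simp add: le2_zero)
  then show "f \<in> L2 H" unfolding L2_iff using f by (auto simp: Cc_def)
qed

lemma L2_closed:
  assumes "\<And>\<gamma>. \<gamma> \<notin> A \<Longrightarrow> \<xi> \<gamma> = 0"
    "\<And>\<epsilon>. \<epsilon> > 0 \<Longrightarrow> \<exists>\<eta>\<in>L2 H. \<forall>x. le2 (fib x) (\<lambda>\<gamma>. \<xi> \<gamma> - \<eta> \<gamma>) \<epsilon>"
  shows "\<xi> \<in> L2 H"
  unfolding L2_iff
proof (intro conjI allI impI assms(1))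
  fix \<epsilon> :: real assume "\<epsilon> > 0"
  then obtain \<eta> where \<eta>: "\<eta> \<in> L2 H" "\<And>x. le2 (fib x) (\<lambda>\<gamma>. \<xi> \<gamma> - \<eta> \<gamma>) (\<epsilon>/2)"
    using assms(2) half_gt_zero by meson
  then obtain \<zeta> where \<zeta>: "\<zeta> \<in> Cc H" "\<And>x. le2 (fib x) (\<lambda>\<gamma>. \<eta> \<gamma> - \<zeta> \<gamma>) (\<epsilon>/2)"
    using \<open>\<epsilon> > 0\<close> half_gt_zero unfolding L2_iff by meson
  have "le2 (fib x) (\<lambda>\<gamma>. \<xi> \<gamma> - \<zeta> \<gamma>) \<epsilon>" for x
    using le2_add[OF \<eta>(2) \<zeta>(2), of x] by simp
  then show "\<exists>\<eta>\<in>Cc H. \<forall>x. le2 (fib x) (\<lambda>\<gamma>. \<xi> \<gamma> - \<eta> \<gamma>) \<epsilon>" using \<zeta>(1) by blast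
qed auto

lemma L2_add:
  assumes "\<xi> \<in> L2 H" "\<eta> \<in> L2 H"
  shows "(\<lambda>\<gamma>. \<xi> \<gamma> + \<eta> \<gamma>) \<in> L2 H"
proof (rule L2_closed)
  fix \<epsilon> :: real assume "\<epsilon> > 0"
  then obtain a b where a: "a \<in> Cc H" "\<And>x. le2 (fib x) (\<lambda>\<gamma>. \<xi> \<gamma> - a \<gamma>) (\<epsilon>/2)"
    and b: "b \<in> Cc H" "\<And>x. le2 (fib x) (\<lambda>\<gamma>. \<eta> \<gamma> - b \<gamma>) (\<epsilon>/2)"
    using assms half_gt_zero unfolding L2_iff by meson
  have "le2 (fib x) (\<lambda>\<gamma>. \<xi> \<gamma> + \<eta> \<gamma> - (a \<gamma> + b \<gamma>)) \<epsilon>" for x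
    using le2_add[OF a(2) b(2), of x] by (simp add: algebra_simps)
  then show "\<exists>\<zeta>\<in>L2 H. \<forall>x. le2 (fib x) (\<lambda>\<gamma>. \<xi> \<gamma> + \<eta> \<gamma> - \<zeta> \<gamma>) \<epsilon>"
    using Cc_add[OF a(1) b(1)] Cc_subset_L2 by (intro bexI[of _ "\<lambda>\<gamma>. a \<gamma> + b \<gamma>"]) auto
qed (simp add: L2_outside[OF assms(1)] L2_outside[OF assms(2)])

lemma L2_mult_bounded:
  assumes f: "continuous_map (gtop H) euclidean f" "\<And>\<gamma>. cmod (f \<gamma>) \<le> B" and \<xi>: "\<xi> \<in> L2 H"
  shows "(\<lambda>\<gamma>. f \<gamma> * \<xi> \<gamma>) \<in> L2 H"
proof (rule L2_closed)
  have B: "0 \<le> B" using f(2) norm_ge_zero order_trans by blast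
  fix \<epsilon> :: real assume e: "\<epsilon> > 0"
  then obtain a where a: "a \<in> Cc H" "\<And>x. le2 (fib x) (\<lambda>\<gamma>. \<xi> \<gamma> - a \<gamma>) (\<epsilon>/(B+1))"
    using \<xi> B unfolding L2_iff by (metis add_nonneg_pos divide_pos_pos zero_less_one)
  have "le2 (fib x) (\<lambda>\<gamma>. f \<gamma> * \<xi> \<gamma> - f \<gamma> * a \<gamma>) \<epsilon>" for x
  proof -
    have "le2 (fib x) (\<lambda>\<gamma>. f \<gamma> * \<xi> \<gamma> - f \<gamma> * a \<gamma>) (B * (\<epsilon>/(B+1)))"
      by (rule le2_dominated[OF a(2) B])
        (simp add: norm_mult mult_right_mono f(2) flip: right_diff_distrib)
    moreover have "B * (\<epsilon>/(B+1)) \<le> \<epsilon>" using B e by (simp add: field_simps)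
    ultimately show ?thesis using le2_mono by blast
  qed
  then show "\<exists>\<eta>\<in>L2 H. \<forall>x. le2 (fib x) (\<lambda>\<gamma>. f \<gamma> * \<xi> \<gamma> - \<eta> \<gamma>) \<epsilon>"
    using Cc_mult_continuous[OF f(1) a(1)] Cc_subset_L2 by (intro bexI[of _ "\<lambda>\<gamma>. f \<gamma> * a \<gamma>"]) auto
qed (use L2_outside[OF \<xi>] in auto)

lemma L2_cmult: "\<xi> \<in> L2 H \<Longrightarrow> (\<lambda>\<gamma>. c * \<xi> \<gamma>) \<in> L2 H"
  by (rule L2_mult_bounded[of "\<lambda>_. c" "cmod c"]) auto

lemma L2_diff: "\<xi> \<in> L2 H \<Longrightarrow> \<eta> \<in> L2 H \<Longrightarrow> (\<lambda>\<gamma>. \<xi> \<gamma> - \<eta> \<gamma>) \<in> L2 H"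
  using L2_add[of \<xi> "\<lambda>\<gamma>. -1 * \<eta> \<gamma>"] L2_cmult[of \<eta> "-1"] by simp

lemma L2_zero: "(\<lambda>_. 0) \<in> L2 H"
  using Cc_zero Cc_subset_L2 by blast

text \<open>The norm dominates every point evaluation, so approximation by compactly supported
  functions in norm is uniform approximation.\<close>

lemma L2_continuous:
  assumes "\<xi> \<in> L2 H"
  shows "continuous_map (gtop H) euclidean \<xi>"
proof (rule continuous_map_euclidean_uniform_limit)
  fix \<epsilon> :: real assume "\<epsilon> > 0"
  then obtain a where a: "a \<in> Cc H" "\<And>x. le2 (fib x) (\<lambda>\<gamma>. \<xi> \<gamma> - a \<gamma>) \<epsilon>"
    using assms unfolding L2_iff by meson
  have "cmod (\<xi> \<gamma> - a \<gamma>) \<le> \<epsilon>" if "\<gamma> \<in> A" for \<gamma>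
    using le2_point[OF a(2)[of "s \<gamma>"], of \<gamma>] that by (simp add: fibre_iff)
  then show "\<exists>g. continuous_map (gtop H) euclidean g \<and> (\<forall>x\<in>A. cmod (\<xi> x - g x) \<le> \<epsilon>)"
    using a(1) Cc_continuous by blast
qed

text \<open>The extension is a combination of bump functions on disjoint bisections.\<close>

lemma lift_vector:
  fixes a :: "'a \<Rightarrow> complex"
  assumes E: "finite E" "E \<subseteq> fib x"
  obtains \<xi> where "\<xi> \<in> Cc H" "\<And>e. e \<in> E \<Longrightarrow> \<xi> e = a e" "\<And>\<gamma>. \<gamma> \<in> fib x \<Longrightarrow> \<gamma> \<notin> E \<Longrightarrow> \<xi> \<gamma> = 0"
    "\<And>y. le2 (fib y) \<xi> (L2_set (\<lambda>e. cmod (a e)) E)"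
proof (cases "E = {}")
  case True
  show thesis by (rule that[OF Cc_zero]) (use True in \<open>auto intro: le2_zero\<close>)
next
  case False
  then obtain e where "e \<in> E" by blast
  then have "e \<in> A" "s e = x" using E by (auto simp: fibre_iff)
  then have x: "x \<in> units H" using range_in_units(2) by blast
  have EW: "openin (gtop H) A \<and> e \<in> A" if "e \<in> E" for e
    using that E(2) by (auto simp: fibre_iff)
  from local_sections[OF x E EW] obtain V \<sigma> where V': "openin (unit_top H) V" "x \<in> V"
    "\<forall>e\<in>E. continuous_map (subtopology (unit_top H) V) (gtop H) (\<sigma> e)"
    "\<forall>e\<in>E. \<forall>y\<in>V. \<sigma> e y \<in> fib y \<inter> A" "\<forall>e\<in>E. \<sigma> e x = e"
    "\<forall>y\<in>V. inj_on (\<lambda>e. \<sigma> e y) E" "\<forall>e\<in>E. openin (gtop H) (\<sigma> e ` V)" .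
  note V = V'(1,2) bspec[OF V'(3)] bspec[OF bspec[OF V'(4)]] bspec[OF V'(5)] bspec[OF V'(6)] bspec[OF V'(7)]
  have "\<exists>f. f \<in> Cc H \<and> (\<forall>x. cmod (f x) \<le> 1) \<and> f e = 1 \<and> (\<forall>x. f x \<noteq> 0 \<longrightarrow> x \<in> \<sigma> e ` V)" if e: "e \<in> E" for e
  proof -
    have "compactin (gtop H) {e}" using EW[OF e] by simp
    moreover have "{e} \<subseteq> \<sigma> e ` V" using V(5)[OF e] V(2) by (metis empty_subsetI imageI insert_subset)
    ultimately obtain f where "f \<in> Cc H" "\<And>x. cmod (f x) \<le> 1" "\<And>x. x \<in> {e} \<Longrightarrow> f x = 1"
      "\<And>x. f x \<noteq> 0 \<Longrightarrow> x \<in> \<sigma> e ` V"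
      using Cc_bump[OF _ V(7)[OF e]] by metis
    then show ?thesis by auto
  qed
  then obtain \<phi> where \<phi>: "\<And>e. e \<in> E \<Longrightarrow> \<phi> e \<in> Cc H" "\<And>e x. e \<in> E \<Longrightarrow> cmod (\<phi> e x) \<le> 1"
    "\<And>e. e \<in> E \<Longrightarrow> \<phi> e e = 1" "\<And>e x. e \<in> E \<Longrightarrow> \<phi> e x \<noteq> 0 \<Longrightarrow> x \<in> \<sigma> e ` V"
    by metis
  define \<xi> where "\<xi> \<gamma> = (\<Sum>e\<in>E. a e * \<phi> e \<gamma>)" for \<gamma>
  \<comment> \<open>The bump at e lives on the image of the section \<open>\<sigma> e\<close>, so in
    the fibre over y it can only be nonzero at the point \<open>\<sigma> e y\<close>.\<close>
  have nz: "y \<in> V \<and> \<gamma> = \<sigma> e y" if "e \<in> E" "\<phi> e \<gamma> \<noteq> 0" "\<gamma> \<in> fib y" for e \<gamma> y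
  proof -
    have "\<gamma> \<in> \<sigma> e ` V" by (rule \<phi>(4)[OF that(1,2)])
    then obtain v where v: "v \<in> V" "\<gamma> = \<sigma> e v" by blast
    then have "v = y" using V(4)[OF that(1) v(1)] that(3) by (simp add: fibre_iff)
    then show ?thesis using v by simp
  qed
  have val: "\<xi> (\<sigma> e y) = a e * \<phi> e (\<sigma> e y)" if "e \<in> E" "y \<in> V" for e y
  proof -
    have "\<xi> (\<sigma> e y) = (\<Sum>e'\<in>{e}. a e' * \<phi> e' (\<sigma> e y))"
      unfolding \<xi>_def
    proof (rule sum.mono_neutral_right)
      show "\<forall>i\<in>E - {e}. a i * \<phi> i (\<sigma> e y) = 0"
      proof
        fix i assume i: "i \<in> E - {e}"
        have "\<phi> i (\<sigma> e y) = 0"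
        proof (rule ccontr)
          assume "\<phi> i (\<sigma> e y) \<noteq> 0"
          then have "\<sigma> e y = \<sigma> i y" using nz[of i "\<sigma> e y" y] i V(4)[OF that] by (auto simp: fibre_iff)
          then show False using V(6)[OF that(2)] i that(1) by (auto simp: inj_on_def)
        qed
        then show "a i * \<phi> i (\<sigma> e y) = 0" by simp
      qed
    qed (use E that in auto)
    then show ?thesis by simp
  qed
  have zero: "\<xi> \<gamma> = 0" if "\<gamma> \<in> fib y" "y \<notin> V \<or> \<gamma> \<notin> (\<lambda>e. \<sigma> e y) ` E" for \<gamma> y
    unfolding \<xi>_def using nz[OF _ _ that(1)] that(2) by (intro sum.neutral) auto
  show thesis
  proof (rule that[of \<xi>])
    show "\<xi> \<in> Cc H" unfolding \<xi>_def using E \<phi>(1) by (intro Cc_sum Cc_cmult) auto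
    show "\<xi> e = a e" if "e \<in> E" for e
      using val[OF that V(2)] V(5)[OF that] \<phi>(3)[OF that] by simp
    show "\<xi> \<gamma> = 0" if "\<gamma> \<in> fib x" "\<gamma> \<notin> E" for \<gamma>
    proof (rule zero[OF that(1)])
      have "(\<lambda>e. \<sigma> e x) ` E = E" using V(5) by simp
      then show "x \<notin> V \<or> \<gamma> \<notin> (\<lambda>e. \<sigma> e x) ` E" using that by simp
    qed
    \<comment> \<open>In the fibre over y the function has at most the values
      \<open>a e * \<phi> e (\<sigma> e y)\<close> at the distinct points
      \<open>\<sigma> e y\<close>. As the bumps are bounded by 1, the norm in any fibre is at most
      the norm of the prescribed vector.\<close>
    show "le2 (fib y) \<xi> (L2_set (\<lambda>e. cmod (a e)) E)" for y
    proof (cases "y \<in> V")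
      case True
      have "bij_betw (\<lambda>e. \<sigma> e y) E ((\<lambda>e. \<sigma> e y) ` E)" using V(6)[OF True] by (simp add: bij_betw_def)
      moreover have "le2 E (\<lambda>e. \<xi> (\<sigma> e y)) (L2_set (\<lambda>e. cmod (a e)) E)"
        by (rule le2_le[OF le2_finite[OF E(1)]])
          (simp add: val True norm_mult mult_left_le \<phi>(2))
      ultimately have "le2 ((\<lambda>e. \<sigma> e y) ` E) \<xi> (L2_set (\<lambda>e. cmod (a e)) E)" by (rule le2_reindex)
      moreover have "fib y \<inter> {\<gamma>. \<xi> \<gamma> \<noteq> 0} \<subseteq> (\<lambda>e. \<sigma> e y) ` E" using zero[of _ y] by blast
      ultimately have "le2 (fib y \<inter> {\<gamma>. \<xi> \<gamma> \<noteq> 0}) \<xi> (L2_set (\<lambda>e. cmod (a e)) E)"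
        by (rule le2_mono[OF _ order_refl])
      then show ?thesis by (rule le2_support)
    next
      case False
      show ?thesis by (rule le2_cong[OF le2_zero]) (use zero False in auto)
    qed
  qed
qed

text \<open>The point mass at an arrow is not continuous in general. The substitute is a compactly
  supported function that agrees with the point mass on the fibre of \<beta> and has norm at most 1
  in every fibre. Its values on other fibres are arbitrary, so it is evaluated only on the fibre of
  \<beta>.\<close>

definition dirac :: "'a \<Rightarrow> 'a \<Rightarrow> complex" where
  "dirac \<beta> = (SOME \<xi>. \<xi> \<in> Cc H \<and> (\<forall>\<gamma>\<in>fib (s \<beta>). \<xi> \<gamma> = (if \<gamma> = \<beta> then 1 else 0)) \<and> (\<forall>y. le2 (fib y) \<xi> 1))"

lemma dirac:
  assumes "\<beta> \<in> A"
  shows "dirac \<beta> \<in> Cc H" "\<And>\<gamma>. \<gamma> \<in> fib (s \<beta>) \<Longrightarrow> dirac \<beta> \<gamma> = (if \<gamma> = \<beta> then 1 else 0)" "le2 (fib y) (dirac \<beta>) 1"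
proof -
  have "\<exists>\<xi>. \<xi> \<in> Cc H \<and> (\<forall>\<gamma>\<in>fib (s \<beta>). \<xi> \<gamma> = (if \<gamma> = \<beta> then 1 else 0)) \<and> (\<forall>y. le2 (fib y) \<xi> 1)"
  proof -
    have "finite {\<beta>}" "{\<beta>} \<subseteq> fib (s \<beta>)" using assms by (auto simp: fibre_iff)
    from lift_vector[OF this, of "\<lambda>_. 1"] obtain \<xi> where "\<xi> \<in> Cc H" "\<And>e. e \<in> {\<beta>} \<Longrightarrow> \<xi> e = 1"
      "\<And>\<gamma>. \<gamma> \<in> fib (s \<beta>) \<Longrightarrow> \<gamma> \<notin> {\<beta>} \<Longrightarrow> \<xi> \<gamma> = 0" "\<And>y. le2 (fib y) \<xi> (L2_set (\<lambda>e. cmod 1) {\<beta>})" by metis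
    then show ?thesis by (intro exI[of _ \<xi>]) auto
  qed
  from someI_ex[OF this, folded dirac_def] show "dirac \<beta> \<in> Cc H"
    "\<And>\<gamma>. \<gamma> \<in> fib (s \<beta>) \<Longrightarrow> dirac \<beta> \<gamma> = (if \<gamma> = \<beta> then 1 else 0)" "le2 (fib y) (dirac \<beta>) 1" by auto
qed

lemma dirac_L2: "\<beta> \<in> A \<Longrightarrow> dirac \<beta> \<in> L2 H"
  using dirac(1) Cc_subset_L2 by blast

end

section \<open>Adjointable operators and their kernels\<close>

context etale
begin

lemma L2_summable:
  assumes "\<xi> \<in> L2 H" "\<eta> \<in> L2 H"
  shows "(\<lambda>\<gamma>. cnj (\<xi> \<gamma>) * \<eta> \<gamma>) summable_on fib x"
  using le2_Cauchy_Schwarz(1)[OF le2_cnj[OF L2_le2_norm(1)[OF assms(1)]] L2_le2_norm(1)[OF assms(2)]] .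

lemma L2_inner_cnj: "L2_inner H \<eta> \<xi> x = cnj (L2_inner H \<xi> \<eta> x)"
  unfolding L2_inner_def by (simp add: mult.commute flip: infsum_cnj)

lemma L2_inner_dirac:
  assumes "\<gamma> \<in> A"
  shows "L2_inner H (dirac \<gamma>) \<xi> (s \<gamma>) = \<xi> \<gamma>"
proof -
  have "L2_inner H (dirac \<gamma>) \<xi> (s \<gamma>) = (\<Sum>\<^sub>\<infinity>\<beta>\<in>{\<gamma>}. cnj (dirac \<gamma> \<beta>) * \<xi> \<beta>)"
    unfolding L2_inner_def
    by (rule infsum_cong_neutral) (use dirac(2)[OF assms] assms in \<open>auto simp: fibre_iff\<close>)
  then show ?thesis using dirac(2)[OF assms, of \<gamma>] assms by (simp add: fibre_iff)
qed

lemma is_adjointD: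
  assumes "is_adjoint H T S" "\<xi> \<in> L2 H"
  shows "S \<xi> \<in> L2 H" "\<And>\<eta>. \<eta> \<in> L2 H \<Longrightarrow> L2_inner H (T \<xi>) \<eta> x = L2_inner H \<xi> (S \<eta>) x"
  using assms by (auto simp: is_adjoint_def)

lemma is_adjoint_sym:
  assumes "is_adjoint H T S" "T \<in> L2 H \<rightarrow>\<^sub>E L2 H"
  shows "is_adjoint H S T"
  unfolding is_adjoint_def
proof (intro conjI ballI ext)
  fix \<xi> \<eta> x assume "\<xi> \<in> L2 H" "\<eta> \<in> L2 H"
  then show "L2_inner H (S \<xi>) \<eta> x = L2_inner H \<xi> (T \<eta>) x"
    using is_adjointD(2)[OF assms(1), of \<eta> \<xi>] L2_inner_cnj by metis
qed (rule assms)

text \<open>Matrix coefficients of the action of T on a fibre. They are meaningful only if \<gamma>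
  and \<beta> have the same source; otherwise the value depends on the choice made in
  \<open>dirac\<close>.\<close>

definition kernel :: "'a L2_op \<Rightarrow> 'a \<Rightarrow> 'a \<Rightarrow> complex" where "kernel T \<gamma> \<beta> = T (dirac \<beta>) \<gamma>"

lemma adjointable_L2: "T \<in> adjointable H \<Longrightarrow> \<xi> \<in> L2 H \<Longrightarrow> T \<xi> \<in> L2 H"
  by (auto simp: adjointable_def)

text \<open>Evaluation at \<gamma> is the inner product with \<open>dirac \<gamma>\<close>, which
  the adjoint moves to the other side. So the values of T \<xi> on a fibre depend only on \<xi> on
  that fibre, and T acts fibrewise.\<close>

lemma adjoint_apply:
  assumes "is_adjoint H T S" "T \<in> L2 H \<rightarrow>\<^sub>E L2 H" "\<xi> \<in> L2 H" "\<gamma> \<in> A"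
  shows "T \<xi> \<gamma> = (\<Sum>\<^sub>\<infinity>\<beta>\<in>fib (s \<gamma>). cnj (S (dirac \<gamma>) \<beta>) * \<xi> \<beta>)"
proof -
  have "T \<xi> \<gamma> = L2_inner H (dirac \<gamma>) (T \<xi>) (s \<gamma>)" by (simp add: L2_inner_dirac assms)
  also have "\<dots> = L2_inner H (S (dirac \<gamma>)) \<xi> (s \<gamma>)"
    using is_adjointD(2)[OF is_adjoint_sym[OF assms(1,2)] dirac_L2[OF assms(4)] assms(3)] by simp
  finally show ?thesis by (simp add: L2_inner_def)
qed

lemma kernel_adjoint:
  assumes "is_adjoint H T S" "T \<in> L2 H \<rightarrow>\<^sub>E L2 H" "\<gamma> \<in> A" "\<beta> \<in> A" "s \<gamma> = s \<beta>"
  shows "kernel S \<beta> \<gamma> = cnj (kernel T \<gamma> \<beta>)"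
proof -
  have "kernel T \<gamma> \<beta> = L2_inner H (S (dirac \<gamma>)) (dirac \<beta>) (s \<gamma>)"
    unfolding kernel_def using adjoint_apply[OF assms(1,2) dirac_L2[OF assms(4)] assms(3)]
    by (simp add: L2_inner_def)
  also have "\<dots> = cnj (S (dirac \<gamma>) \<beta>)"
    using L2_inner_dirac[OF assms(4), of "S (dirac \<gamma>)"] L2_inner_cnj assms(5) by metis
  finally show ?thesis by (simp add: kernel_def)
qed

lemma kernel_apply:
  assumes "T \<in> adjointable H" "\<xi> \<in> L2 H" "\<gamma> \<in> A"
  shows "T \<xi> \<gamma> = app (kernel T) (fib (s \<gamma>)) \<xi> \<gamma>"
proof -
  obtain S where S: "is_adjoint H T S" and T: "T \<in> L2 H \<rightarrow>\<^sub>E L2 H"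
    using assms(1) by (auto simp: adjointable_def)
  show ?thesis
    unfolding adjoint_apply[OF S T assms(2,3)] app_def
    using kernel_adjoint[OF S T assms(3)] by (intro infsum_cong) (auto simp: fibre_iff kernel_def)
qed

text \<open>Linearity is not part of the definition of adjointability; it is read off from the
  formula in \<open>adjoint_apply\<close>, which is linear in \<xi>.\<close>

lemma adjointable_linear:
  assumes T: "T \<in> adjointable H" and \<xi>: "\<xi> \<in> L2 H"
  shows "\<And>\<eta>. \<eta> \<in> L2 H \<Longrightarrow> T (\<lambda>\<gamma>. \<xi> \<gamma> + \<eta> \<gamma>) = (\<lambda>\<gamma>. T \<xi> \<gamma> + T \<eta> \<gamma>)"
    "T (\<lambda>\<gamma>. c * \<xi> \<gamma>) = (\<lambda>\<gamma>. c * T \<xi> \<gamma>)"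
proof -
  obtain S where S: "is_adjoint H T S" and TE: "T \<in> L2 H \<rightarrow>\<^sub>E L2 H"
    using assms(1) by (auto simp: adjointable_def)
  have SL: "S (dirac \<gamma>) \<in> L2 H" if "\<gamma> \<in> A" for \<gamma> using is_adjointD(1)[OF S dirac_L2[OF that]] .
  note out = L2_outside[OF adjointable_L2[OF T]]
  show "T (\<lambda>\<gamma>. \<xi> \<gamma> + \<eta> \<gamma>) = (\<lambda>\<gamma>. T \<xi> \<gamma> + T \<eta> \<gamma>)" if \<eta>: "\<eta> \<in> L2 H" for \<eta>
  proof
    fix \<gamma>
    show "T (\<lambda>\<gamma>. \<xi> \<gamma> + \<eta> \<gamma>) \<gamma> = T \<xi> \<gamma> + T \<eta> \<gamma>"
    proof (cases "\<gamma> \<in> A")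
      case True
      show ?thesis
        unfolding adjoint_apply[OF S TE L2_add[OF \<xi> \<eta>] True] adjoint_apply[OF S TE \<xi> True]
          adjoint_apply[OF S TE \<eta> True]
        using infsum_add[OF L2_summable[OF SL[OF True] \<xi>] L2_summable[OF SL[OF True] \<eta>]]
        by (simp add: algebra_simps)
    qed (simp add: out[OF L2_add[OF \<xi> \<eta>]] out[OF \<xi>] out[OF \<eta>])
  qed
  show "T (\<lambda>\<gamma>. c * \<xi> \<gamma>) = (\<lambda>\<gamma>. c * T \<xi> \<gamma>)"
  proof
    fix \<gamma>
    show "T (\<lambda>\<gamma>. c * \<xi> \<gamma>) \<gamma> = c * T \<xi> \<gamma>"
    proof (cases "\<gamma> \<in> A")
      case True
      show ?thesis
        unfolding adjoint_apply[OF S TE L2_cmult[OF \<xi>] True] adjoint_apply[OF S TE \<xi> True]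
        by (simp add: mult.left_commute flip: infsum_cmult_right')
    qed (simp add: out[OF L2_cmult[OF \<xi>]] out[OF \<xi>])
  qed
qed

lemma adjointable_diff:
  assumes "T \<in> adjointable H" "\<xi> \<in> L2 H" "\<eta> \<in> L2 H"
  shows "T (\<lambda>\<gamma>. \<xi> \<gamma> - \<eta> \<gamma>) = (\<lambda>\<gamma>. T \<xi> \<gamma> - T \<eta> \<gamma>)"
  using adjointable_linear(1)[OF assms(1,2) L2_cmult[OF assms(3), of "-1"]]
    adjointable_linear(2)[OF assms(1,3), of "-1"] by simp

text \<open>The ratio 1/3 is that of the gliding hump below, and 3/2 is the sum of the geometric
  series with this ratio. The limit is taken pointwise, and the tail bound survives it because it
  only concerns finite subsets of fibres.\<close>

lemma L2_complete:
  fixes w :: "nat \<Rightarrow> 'a \<Rightarrow> complex"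
  assumes w: "\<And>n. w n \<in> L2 H" and d: "\<And>n x. le2 (fib x) (\<lambda>\<gamma>. w (Suc n) \<gamma> - w n \<gamma>) ((1/3)^n)"
  obtains \<xi> where "\<xi> \<in> L2 H" "\<And>n x. le2 (fib x) (\<lambda>\<gamma>. \<xi> \<gamma> - w n \<gamma>) (3/2 * (1/3)^n)"
proof -
  have dm: "le2 (fib x) (\<lambda>\<gamma>. w (n + k) \<gamma> - w n \<gamma>) (3/2 * ((1/3)^n - (1/3)^(n+k)))" for n k x
  proof (induction k)
    case (Suc k)
    have "le2 (fib x) (\<lambda>\<gamma>. (w (n + k) \<gamma> - w n \<gamma>) + (w (Suc (n + k)) \<gamma> - w (n + k) \<gamma>))
       (3/2 * ((1/3)^n - (1/3)^(n+k)) + (1/3)^(n+k))"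
      by (rule le2_add[OF Suc d])
    moreover have "3/2 * (a - b) + b = 3/2 * (a - b/3)" for a b :: real
      by (simp add: field_simps)
    then have "3/2 * ((1/3)^n - (1/3)^(n+k)) + (1/3)^(n+k) = 3/2 * ((1/3)^n - (1/3::real)^(n + Suc k))"
      by (simp only: add_Suc_right power_Suc) simp
    moreover have "(\<lambda>\<gamma>. (w (n + k) \<gamma> - w n \<gamma>) + (w (Suc (n + k)) \<gamma> - w (n + k) \<gamma>))
        = (\<lambda>\<gamma>. w (n + Suc k) \<gamma> - w n \<gamma>)" by auto
    ultimately show ?case by metis
  qed (simp add: le2_zero)
  have dm': "le2 (fib x) (\<lambda>\<gamma>. w m \<gamma> - w n \<gamma>) (3/2 * (1/3)^n)" if "n \<le> m" for m n x
    using le2_mono[OF dm[of x n "m - n"], of "3/2 * (1/3)^n" "fib x"] that by simp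
  have small: "\<exists>n. 3/2 * (1/3)^n < (e::real)" if "e > 0" for e
    using real_arch_pow_inv[of "e * (2/3)" "1/3"] that by (auto simp: field_simps)
  have conv: "convergent (\<lambda>n. w n \<gamma>)" for \<gamma>
  proof (cases "\<gamma> \<in> A")
    case True
    have "Cauchy (\<lambda>n. w n \<gamma>)"
    proof (rule CauchyI')
      fix e :: real assume "e > 0"
      then obtain M where M: "3/2 * (1/3)^M < e / 2" using small half_gt_zero by blast
      have "cmod (w m \<gamma> - w M \<gamma>) < e / 2" if "m \<ge> M" for m
        using le2_point[OF dm'[OF that, of "s \<gamma>"], of \<gamma>] True M by (simp add: fibre_iff)
      then have "dist (w m \<gamma>) (w n \<gamma>) < e" if "m \<ge> M" "n > m" for m n
        using that dist_triangle_half_l[of "w m \<gamma>" "w M \<gamma>" e "w n \<gamma>"] by (simp add: dist_norm)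
      then show "\<exists>M. \<forall>m\<ge>M. \<forall>n>m. dist (w m \<gamma>) (w n \<gamma>) < e" by blast
    qed
    then show ?thesis by (rule Cauchy_convergent)
  next
    case False
    then show ?thesis using L2_outside[OF w] by (simp add: convergent_const)
  qed
  define \<xi> where "\<xi> \<gamma> = lim (\<lambda>n. w n \<gamma>)" for \<gamma>
  have lim: "(\<lambda>n. w n \<gamma>) \<longlonglongrightarrow> \<xi> \<gamma>" for \<gamma> using conv unfolding \<xi>_def by (simp add: convergent_LIMSEQ_iff)
  have bd: "le2 (fib x) (\<lambda>\<gamma>. \<xi> \<gamma> - w n \<gamma>) (3/2 * (1/3)^n)" for n x
  proof (rule le2I)
    fix F assume F: "finite F" "F \<subseteq> fib x"
    have "(\<lambda>m. L2_set (\<lambda>\<gamma>. cmod (w m \<gamma> - w n \<gamma>)) F) \<longlonglongrightarrow> L2_set (\<lambda>\<gamma>. cmod (\<xi> \<gamma> - w n \<gamma>)) F"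
      unfolding L2_set_def by (intro tendsto_intros lim)
    moreover have "\<forall>m\<ge>n. L2_set (\<lambda>\<gamma>. cmod (w m \<gamma> - w n \<gamma>)) F \<le> 3/2 * (1/3)^n"
      using le2D[OF dm' F] by blast
    ultimately show "L2_set (\<lambda>\<gamma>. cmod (\<xi> \<gamma> - w n \<gamma>)) F \<le> 3/2 * (1/3)^n"
      using LIMSEQ_le_const2 by blast
  qed
  have "\<xi> \<in> L2 H"
  proof (rule L2_closed)
    show "\<xi> \<gamma> = 0" if "\<gamma> \<notin> A" for \<gamma>
      using lim[of \<gamma>] L2_outside[OF w that] by (simp add: LIMSEQ_const_iff)
    fix \<epsilon> :: real assume "\<epsilon> > 0"
    then obtain n where "3/2 * (1/3)^n < \<epsilon>" using small by blast
    then have "le2 (fib x) (\<lambda>\<gamma>. \<xi> \<gamma> - w n \<gamma>) \<epsilon>" for x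
      by (intro le2_mono[OF bd[of x n]]) auto
    then show "\<exists>\<eta>\<in>L2 H. \<forall>x. le2 (fib x) (\<lambda>\<gamma>. \<xi> \<gamma> - \<eta> \<gamma>) \<epsilon>" using w by blast
  qed
  then show thesis using bd that by blast
qed

text \<open>Uniform boundedness, by the gliding hump: if \<open>T\<close> were unbounded, one could choose
  finite sets \<open>F\<^sub>n\<close> in fibres such that the seminorms \<open>\<xi> \<mapsto> \<parallel>T \<xi>\<parallel>\<close> restricted to \<open>F\<^sub>n\<close> have norms
  exceeding \<open>4\<^sup>n\<close>, and a series with steps of size \<open>3\<^sup>-\<^sup>n\<close> on which they are unbounded.\<close>

lemma adjointable_bounded:
  assumes T: "T \<in> adjointable H"
  obtains (bounded) C where "0 \<le> C" "\<And>\<xi> x. \<xi> \<in> L2 H \<Longrightarrow> L2_norm H \<xi> \<le> 1 \<Longrightarrow> le2 (fib x) (T \<xi>) C"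
proof (rule ccontr)
  assume "\<not> thesis"
  then have neg: "\<exists>\<xi> x. \<xi> \<in> L2 H \<and> L2_norm H \<xi> \<le> 1 \<and> \<not> le2 (fib x) (T \<xi>) C" if "0 \<le> C" for C
    using \<open>0 \<le> C\<close> bounded by blast
  define B where "B = {\<xi> \<in> L2 H. L2_norm H \<xi> \<le> 1}"
  define p where "p F \<xi> = L2_set (\<lambda>\<gamma>. cmod (T \<xi> \<gamma>)) F" for F \<xi>
  obtain S where S: "is_adjoint H T S" and TE: "T \<in> L2 H \<rightarrow>\<^sub>E L2 H"
    using assms(1) by (auto simp: adjointable_def)
  have B0: "(\<lambda>_. 0) \<in> B" using L2_zero L2_norm_leI[OF L2_zero, of 1] by (auto simp: B_def le2_zero)
  \<comment> \<open>For a fixed finite F boundedness on the unit ball is available: each value T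
    \<xi> \<gamma> is an inner product of \<xi> with the fixed vector
    \<open>S (dirac \<gamma>)\<close>. Only uniformity in F is at stake.\<close>
  have bddp: "bdd_above (p F ` B)" if F: "finite F" "F \<subseteq> A" for F
  proof (rule bdd_aboveI2)
    fix \<xi> assume \<xi>: "\<xi> \<in> B"
    have "p F \<xi> \<le> (\<Sum>\<gamma>\<in>F. cmod (T \<xi> \<gamma>))" unfolding p_def by (rule L2_set_le_sum) simp
    also have "\<dots> \<le> (\<Sum>\<gamma>\<in>F. L2_norm H (S (dirac \<gamma>)) * 1)"
    proof (rule sum_mono)
      fix \<gamma> assume "\<gamma> \<in> F"
      then have g: "\<gamma> \<in> A" using F by auto
      have "le2 (fib (s \<gamma>)) \<xi> 1" using \<xi> le2_mono[OF L2_le2_norm(1)] by (auto simp: B_def)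
      moreover have "le2 (fib (s \<gamma>)) (\<lambda>\<beta>. cnj (S (dirac \<gamma>) \<beta>)) (L2_norm H (S (dirac \<gamma>)))"
        by (intro le2_cnj L2_le2_norm(1) is_adjointD(1)[OF S] dirac_L2 g)
      ultimately have "cmod (\<Sum>\<^sub>\<infinity>\<beta>\<in>fib (s \<gamma>). cnj (S (dirac \<gamma>) \<beta>) * \<xi> \<beta>) \<le> L2_norm H (S (dirac \<gamma>)) * 1"
        by (rule le2_Cauchy_Schwarz(2)[rotated])
      then show "cmod (T \<xi> \<gamma>) \<le> L2_norm H (S (dirac \<gamma>)) * 1"
        using adjoint_apply[OF S TE _ g, of \<xi>] \<xi> by (simp add: B_def)
    qed
    finally show "p F \<xi> \<le> (\<Sum>\<gamma>\<in>F. L2_norm H (S (dirac \<gamma>)) * 1)" .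
  qed
  define N where "N F = (SUP \<xi>\<in>B. p F \<xi>)" for F
  have "\<exists>x F. finite F \<and> F \<subseteq> fib x \<and> N F > 4^n" for n :: nat
  proof -
    obtain \<xi> x where \<xi>: "\<xi> \<in> B" "\<not> le2 (fib x) (T \<xi>) (4^n)" using neg[of "4^n"] by (auto simp: B_def)
    then obtain F where F: "finite F" "F \<subseteq> fib x" "p F \<xi> > 4^n" by (auto simp: le2_def p_def not_le)
    moreover have "p F \<xi> \<le> N F" unfolding N_def
      by (rule cSUP_upper[OF \<xi>(1) bddp]) (use F in \<open>auto simp: fibre_iff\<close>)
    ultimately show ?thesis by (meson less_le_trans)
  qed
  then obtain X F where F: "\<And>n. finite (F n)" "\<And>n. F n \<subseteq> fib (X n)" "\<And>n::nat. N (F n) > 4^n" by metis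
  have FA: "F n \<subseteq> A" for n using F(2)[of n] by (auto simp: fibre_iff)
  \<comment> \<open>A vector of the unit ball that is nearly norming for the n-th seminorm. The
    factor 2/3 has to exceed the loss 1/2 caused by all later steps.\<close>
  have "\<exists>u\<in>B. p (F n) u > 2/3 * N (F n)" for n
  proof -
    have "(4::real)^n > 0" by simp
    then have "0 < N (F n)" using F(3)[of n] by linarith
    then have "2/3 * N (F n) < (SUP \<xi>\<in>B. p (F n) \<xi>)" unfolding N_def by simp
    then show ?thesis using less_cSUP_iff[OF _ bddp[OF F(1) FA]] B0 by blast
  qed
  then obtain u where u: "\<And>n. u n \<in> B" "\<And>n. p (F n) (u n) > 2/3 * N (F n)" by metis
  have padd: "p F (\<lambda>\<gamma>. \<xi> \<gamma> - \<eta> \<gamma>) \<le> p F \<xi> + p F \<eta>" if "\<xi> \<in> L2 H" "\<eta> \<in> L2 H" for F \<xi> \<eta>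
  proof -
    have "p F (\<lambda>\<gamma>. \<xi> \<gamma> - \<eta> \<gamma>) \<le> L2_set (\<lambda>\<gamma>. cmod (T \<xi> \<gamma>) + cmod (T \<eta> \<gamma>)) F"
      unfolding p_def adjointable_diff[OF T that] by (rule L2_set_mono) (auto intro: norm_triangle_ineq4)
    also have "\<dots> \<le> p F \<xi> + p F \<eta>" unfolding p_def by (rule L2_set_triangle_ineq)
    finally show ?thesis .
  qed
  have pscale: "p F (\<lambda>\<gamma>. c * \<xi> \<gamma>) = cmod c * p F \<xi>" if "\<xi> \<in> L2 H" for F c \<xi>
    unfolding p_def adjointable_linear(2)[OF T that] by (simp add: norm_mult L2_set_right_distrib)
  have pN: "p (F n) \<xi> \<le> c * N (F n)" if "\<xi> \<in> L2 H" "\<And>x. le2 (fib x) \<xi> c" "c > 0" for n \<xi> c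
  proof -
    define \<zeta> where "\<zeta> \<gamma> = of_real (1/c) * \<xi> \<gamma>" for \<gamma>
    have \<zeta>: "\<zeta> \<in> L2 H" unfolding \<zeta>_def using L2_cmult that by blast
    have "le2 (fib x) \<zeta> 1" for x
      unfolding \<zeta>_def using le2_cmult[OF that(2), of x "of_real (1/c)"] that(3)
      by (simp add: norm_divide)
    then have "\<zeta> \<in> B" using \<zeta> L2_norm_leI by (simp add: B_def)
    then have "p (F n) \<zeta> \<le> N (F n)" unfolding N_def by (intro cSUP_upper bddp F FA)
    moreover have "p (F n) \<zeta> = (1/c) * p (F n) \<xi>"
      unfolding \<zeta>_def pscale[OF that(1)] using that(3) by (simp add: norm_divide)
    ultimately show ?thesis using that(3) by (simp add: field_simps)
  qed
  \<comment> \<open>Of the two candidates w \<plusminus> 3^-n u the one with the larger seminorm is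
    kept. Their difference is 2 * 3^-n u, so the larger seminorm is at least 3^-n p(u), whatever w
    is.\<close>
  define step where "step n w = (let a = (\<lambda>\<gamma>. w \<gamma> + of_real ((1/3)^n) * u n \<gamma>); b = (\<lambda>\<gamma>. w \<gamma> - of_real ((1/3)^n) * u n \<gamma>)
    in if p (F n) a \<ge> p (F n) b then a else b)" for n and w :: "'a \<Rightarrow> complex"
  define w where "w = rec_nat (\<lambda>_. 0) step"
  have wS: "w (Suc n) = step n (w n)" for n by (simp add: w_def)
  have uL: "u n \<in> L2 H" for n using u(1) by (simp add: B_def)
  have stepL: "step n w' \<in> L2 H" if "w' \<in> L2 H" for n w'
    unfolding step_def Let_def using L2_add[OF that L2_cmult[OF uL]] L2_diff[OF that L2_cmult[OF uL]] by auto
  have wL: "w n \<in> L2 H" for n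
    by (induction n) (auto simp: wS stepL w_def L2_zero)
  have ule: "le2 (fib x) (u n) 1" for n x
    by (rule le2_mono[OF L2_le2_norm(1)[OF uL]]) (use u(1)[of n] in \<open>auto simp: B_def\<close>)
  have dist: "le2 (fib x) (\<lambda>\<gamma>. w (Suc n) \<gamma> - w n \<gamma>) ((1/3)^n)" for n x
  proof -
    have c1: "cmod (of_real ((1/3)^n)) * 1 = (1/3)^n" "cmod (- of_real ((1/3)^n)) * 1 = (1/3)^n"
      by (simp_all add: norm_power norm_divide)
    have e: "step n v \<gamma> - v \<gamma> = of_real ((1/3)^n) * u n \<gamma> \<or> step n v \<gamma> - v \<gamma> = - of_real ((1/3)^n) * u n \<gamma>" for v \<gamma>
      unfolding step_def Let_def by auto
    show ?thesis
      unfolding wS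
      by (rule le2_le[OF le2_cmult[OF ule[of x n], of "of_real ((1/3)^n)", unfolded c1]])
        (metis e norm_minus_cancel mult_minus_left order_refl)
  qed
  have hump: "p (F n) (w (Suc n)) \<ge> (1/3)^n * (2/3 * N (F n))" for n
  proof -
    let ?v = "\<lambda>\<gamma>. of_real ((1/3)^n) * u n \<gamma>"
    let ?a = "\<lambda>\<gamma>. w n \<gamma> + ?v \<gamma>" and ?b = "\<lambda>\<gamma>. w n \<gamma> - ?v \<gamma>"
    have vL: "?v \<in> L2 H" using L2_cmult uL by blast
    have aL: "?a \<in> L2 H" "?b \<in> L2 H" using L2_add[OF wL vL] L2_diff[OF wL vL] by auto
    have "p (F n) (\<lambda>\<gamma>. ?a \<gamma> - ?b \<gamma>) = 2 * (1/3)^n * p (F n) (u n)"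
    proof -
      have "(\<lambda>\<gamma>. ?a \<gamma> - ?b \<gamma>) = (\<lambda>\<gamma>. (2 * of_real ((1/3)^n)) * u n \<gamma>)" by auto
      then show ?thesis by (simp only: pscale[OF uL]) (simp add: norm_mult norm_power norm_divide)
    qed
    then have "2 * ((1/3)^n * p (F n) (u n)) \<le> p (F n) ?a + p (F n) ?b" using padd[OF aL, of "F n"] by simp
    moreover have "p (F n) (w (Suc n)) = max (p (F n) ?a) (p (F n) ?b)"
      unfolding wS step_def Let_def by (auto simp: max_def)
    ultimately have "(1/3)^n * p (F n) (u n) \<le> p (F n) (w (Suc n))" by linarith
    moreover have "(1/3)^n * (2/3 * N (F n)) \<le> (1/3)^n * p (F n) (u n)"
      using u(2)[of n] by (intro mult_left_mono) auto
    ultimately show ?thesis by linarith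
  qed
  obtain \<xi> where \<xi>: "\<xi> \<in> L2 H" "\<And>n x. le2 (fib x) (\<lambda>\<gamma>. \<xi> \<gamma> - w n \<gamma>) (3/2 * (1/3)^n)"
    using L2_complete[of w, OF wL dist] by blast
  \<comment> \<open>The steps after the n-th change the seminorm by at most 3/2 * 3^-(n+1) N = 1/2 *
    3^-n N, which leaves (2/3 - 1/2) 3^-n N = 1/6 * 3^-n N. Since N > 4^n this grows like (4/3)^n,
    although T \<xi> has finite norm.\<close>
  have low: "1/6 * (4/3)^n \<le> L2_norm H (T \<xi>)" for n :: nat
  proof -
    have "p (F n) (\<lambda>\<gamma>. \<xi> \<gamma> - w (Suc n) \<gamma>) \<le> (3/2 * (1/3)^(Suc n)) * N (F n)"
      by (rule pN[OF L2_diff[OF \<xi>(1) wL] \<xi>(2)]) simp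
    then have "p (F n) (\<lambda>\<gamma>. \<xi> \<gamma> - w (Suc n) \<gamma>) \<le> (1/3)^n * (1/2 * N (F n))" by simp
    moreover have "p (F n) (w (Suc n)) \<le> p (F n) \<xi> + p (F n) (\<lambda>\<gamma>. \<xi> \<gamma> - w (Suc n) \<gamma>)"
      using padd[OF \<xi>(1) L2_diff[OF \<xi>(1) wL], of "F n" "Suc n"] by simp
    ultimately have "(1/3)^n * (1/6 * N (F n)) \<le> p (F n) \<xi>"
      using hump[of n] by (simp add: algebra_simps)
    also have "\<dots> \<le> L2_norm H (T \<xi>)"
      unfolding p_def by (rule le2D[OF L2_le2_norm(1)[OF adjointable_L2[OF T \<xi>(1)]] F(1,2)])
    finally have "(1/3)^n * (1/6 * N (F n)) \<le> L2_norm H (T \<xi>)" .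
    moreover have "(1/3)^n * (1/6 * 4^n) \<le> (1/3)^n * (1/6 * N (F n))"
      using F(3)[of n] by (intro mult_left_mono) auto
    moreover have "(1/3)^n * (1/6 * 4^n) = 1/6 * (4/3::real)^n" by (simp add: power_divide)
    ultimately show ?thesis by linarith
  qed
  obtain n where "6 * L2_norm H (T \<xi>) < (4/3)^n" using real_arch_pow[of "4/3"] by auto
  then show False using low[of n] by simp
qed

text \<open>A vector on a finite subset of the fibre extends by \<open>lift_vector\<close> to a
  global section of no larger norm. Thus a bound of T on the unit ball of sections becomes a bound
  for the matrix on each fibre.\<close>

lemma unit_bound_formbd:
  assumes T: "T \<in> adjointable H" and C: "\<And>\<xi>. \<xi> \<in> L2 H \<Longrightarrow> L2_norm H \<xi> \<le> 1 \<Longrightarrow> le2 (fib x) (T \<xi>) C"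
  shows "formbd (kernel T) (fib x) (fib x) C"
proof (rule formbdI)
  fix E F and a :: "'a \<Rightarrow> complex" assume E: "finite E" "E \<subseteq> fib x" and F: "finite F" "F \<subseteq> fib x"
  define N where "N = L2_set (\<lambda>e. cmod (a e)) E"
  show "L2_set (\<lambda>y. cmod (\<Sum>x\<in>E. kernel T y x * a x)) F \<le> C * L2_set (\<lambda>x. cmod (a x)) E"
  proof (cases "N = 0")
    case True
    then have "\<forall>e\<in>E. a e = 0" using E by (simp add: N_def L2_set_eq_0_iff)
    then show ?thesis using True by (simp add: N_def L2_set_def)
  next
    case False
    then have N: "N > 0" unfolding N_def using L2_set_nonneg[of "\<lambda>e. cmod (a e)" E] by linarith
    \<comment> \<open>Normalised to a unit vector, since the hypothesis only concerns the unit
      ball.\<close>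
    define b where "b e = of_real (1/N) * a e" for e
    have "L2_set (\<lambda>e. cmod (b e)) E = L2_set (\<lambda>e. 1/N * cmod (a e)) E"
      using N by (simp add: b_def norm_divide)
    also have "\<dots> = 1/N * N"
      unfolding N_def by (rule L2_set_right_distrib[symmetric]) simp
    finally have b1: "L2_set (\<lambda>e. cmod (b e)) E = 1" using N by simp
    obtain \<xi> where \<xi>: "\<xi> \<in> Cc H" "\<And>e. e \<in> E \<Longrightarrow> \<xi> e = b e" "\<And>\<gamma>. \<gamma> \<in> fib x \<Longrightarrow> \<gamma> \<notin> E \<Longrightarrow> \<xi> \<gamma> = 0"
      "\<And>y. le2 (fib y) \<xi> (L2_set (\<lambda>e. cmod (b e)) E)"
      using lift_vector[OF E, of b] by metis
    have \<xi>L: "\<xi> \<in> L2 H" using \<xi>(1) Cc_subset_L2 by blast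
    have "T \<xi> \<gamma> = (\<Sum>e\<in>E. kernel T \<gamma> e * b e)" if "\<gamma> \<in> F" for \<gamma>
    proof -
      have "\<gamma> \<in> A" "s \<gamma> = x" using that F by (auto simp: fibre_iff)
      then have "T \<xi> \<gamma> = app (kernel T) (fib x) \<xi> \<gamma>" using kernel_apply[OF T \<xi>L] by blast
      also have "\<dots> = app (kernel T) E b \<gamma>" by (rule app_restrict) (use \<xi> E in auto)
      finally show ?thesis by (simp add: app_finite[OF E(1)])
    qed
    then have "L2_set (\<lambda>\<gamma>. cmod (\<Sum>e\<in>E. kernel T \<gamma> e * b e)) F = L2_set (\<lambda>\<gamma>. cmod (T \<xi> \<gamma>)) F"
      by (intro L2_set_cong) auto
    also have "\<dots> \<le> C"
      by (rule le2D[OF C F]) (use \<xi>L L2_norm_leI[OF \<xi>L \<xi>(4)] b1 in auto)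
    finally have "L2_set (\<lambda>\<gamma>. cmod (of_real (1/N) * (\<Sum>e\<in>E. kernel T \<gamma> e * a e))) F \<le> C"
      unfolding b_def by (simp add: sum_distrib_left mult.left_commute)
    moreover have "L2_set (\<lambda>\<gamma>. cmod (of_real (1/N) * (\<Sum>e\<in>E. kernel T \<gamma> e * a e))) F
        = L2_set (\<lambda>\<gamma>. 1/N * cmod (\<Sum>e\<in>E. kernel T \<gamma> e * a e)) F"
      using N by (simp add: norm_divide)
    moreover have "\<dots> = 1/N * L2_set (\<lambda>\<gamma>. cmod (\<Sum>e\<in>E. kernel T \<gamma> e * a e)) F"
      by (rule L2_set_right_distrib[symmetric]) (use N in simp)
    ultimately have "1/N * L2_set (\<lambda>\<gamma>. cmod (\<Sum>e\<in>E. kernel T \<gamma> e * a e)) F \<le> C" by linarith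
    then show ?thesis using N unfolding N_def[symmetric] by (simp add: field_simps)
  qed
qed

lemma formbd_bound:
  assumes T: "T \<in> adjointable H" and C: "formbd (kernel T) (fib x) (fib x) C" "0 \<le> C"
    and \<xi>: "\<xi> \<in> L2 H" "le2 (fib x) \<xi> c"
  shows "le2 (fib x) (T \<xi>) (C * c)"
  by (rule le2_cong[OF app_bound[OF C \<xi>(2)]]) (auto simp: kernel_apply[OF T \<xi>(1)] fibre_iff)

text \<open>Translates the operator norm into matrix bounds on the fibres. The supremum defining
  \<open>op_norm\<close> is over a bounded set by \<open>adjointable_bounded\<close>; without this
  it would carry no information.\<close>

lemma op_norm_le_iff:
  assumes T: "T \<in> adjointable H" and C: "0 \<le> C"
  shows "op_norm H T \<le> C \<longleftrightarrow> (\<forall>x. formbd (kernel T) (fib x) (fib x) C)"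
proof -
  let ?B = "{\<xi> \<in> L2 H. L2_norm H \<xi> \<le> 1}"
  have B0: "(\<lambda>_. 0) \<in> ?B" using L2_zero L2_norm_leI[OF L2_zero, of 1] by (auto simp: le2_zero)
  obtain D where D: "0 \<le> D" "\<And>\<xi> x. \<xi> \<in> L2 H \<Longrightarrow> L2_norm H \<xi> \<le> 1 \<Longrightarrow> le2 (fib x) (T \<xi>) D"
    using adjointable_bounded[OF T] by blast
  have "bdd_above ((\<lambda>\<xi>. L2_norm H (T \<xi>)) ` ?B)"
    by (rule bdd_aboveI2[of _ _ D]) (use L2_norm_leI[OF adjointable_L2[OF T]] D(2) in auto)
  then have eq: "op_norm H T \<le> C \<longleftrightarrow> (\<forall>\<xi>\<in>?B. L2_norm H (T \<xi>) \<le> C)"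
    unfolding op_norm_def using B0 by (intro cSUP_le_iff) auto
  show ?thesis
  proof
    assume "op_norm H T \<le> C"
    then have "le2 (fib x) (T \<xi>) C" if "\<xi> \<in> L2 H" "L2_norm H \<xi> \<le> 1" for \<xi> x
      using that eq L2_le2_norm(1)[OF adjointable_L2[OF T that(1)], of x] le2_mono by blast
    then show "\<forall>x. formbd (kernel T) (fib x) (fib x) C" using unit_bound_formbd[OF T] by blast
  next
    assume f: "\<forall>x. formbd (kernel T) (fib x) (fib x) C"
    show "op_norm H T \<le> C" unfolding eq
    proof
      fix \<xi> assume "\<xi> \<in> ?B"
      then have \<xi>: "\<xi> \<in> L2 H" "L2_norm H \<xi> \<le> 1" by auto
      have "le2 (fib x) (T \<xi>) C" for x
        using formbd_bound[OF T f[rule_format, of x] C \<xi>(1) le2_mono[OF L2_le2_norm(1)[OF \<xi>(1)] \<xi>(2) order_refl]]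
        by simp
      then show "L2_norm H (T \<xi>) \<le> C" using L2_norm_leI[OF adjointable_L2[OF T \<xi>(1)]] by blast
    qed
  qed
qed

lemma op_norm_formbd:
  assumes T: "T \<in> adjointable H"
  shows "0 \<le> op_norm H T" "formbd (kernel T) (fib x) (fib x) (op_norm H T)"
proof -
  obtain D where D: "0 \<le> D" "\<And>\<xi> x. \<xi> \<in> L2 H \<Longrightarrow> L2_norm H \<xi> \<le> 1 \<Longrightarrow> le2 (fib x) (T \<xi>) D"
    using adjointable_bounded[OF T] by blast
  have B0: "(\<lambda>_. 0) \<in> {\<xi> \<in> L2 H. L2_norm H \<xi> \<le> 1}"
    using L2_zero L2_norm_leI[OF L2_zero, of 1] by (auto simp: le2_zero)
  show "0 \<le> op_norm H T" unfolding op_norm_def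
  proof (rule cSUP_upper2[OF _ B0])
    show "bdd_above ((\<lambda>\<xi>. L2_norm H (T \<xi>)) ` {\<xi> \<in> L2 H. L2_norm H \<xi> \<le> 1})"
      by (rule bdd_aboveI2[of _ _ D]) (use L2_norm_leI[OF adjointable_L2[OF T]] D(2) in auto)
    show "0 \<le> L2_norm H (T (\<lambda>_. 0))" using L2_le2_norm(2)[OF adjointable_L2[OF T L2_zero]] .
  qed
  then show "formbd (kernel T) (fib x) (fib x) (op_norm H T)" using op_norm_le_iff[OF T] by blast
qed

section \<open>The operations on adjointable operators and their effect on kernels\<close>

lemma L2_inner_add_left:
  assumes "\<xi> \<in> L2 H" "\<eta> \<in> L2 H" "\<zeta> \<in> L2 H"
  shows "L2_inner H (\<lambda>\<gamma>. \<xi> \<gamma> + \<eta> \<gamma>) \<zeta> x = L2_inner H \<xi> \<zeta> x + L2_inner H \<eta> \<zeta> x"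
  unfolding L2_inner_def
  using infsum_add[OF L2_summable[OF assms(1,3)] L2_summable[OF assms(2,3)]] by (simp add: algebra_simps)

lemma L2_inner_add_right:
  assumes "\<xi> \<in> L2 H" "\<eta> \<in> L2 H" "\<zeta> \<in> L2 H"
  shows "L2_inner H \<zeta> (\<lambda>\<gamma>. \<xi> \<gamma> + \<eta> \<gamma>) x = L2_inner H \<zeta> \<xi> x + L2_inner H \<zeta> \<eta> x"
  unfolding L2_inner_def
  using infsum_add[OF L2_summable[OF assms(3,1)] L2_summable[OF assms(3,2)]] by (simp add: algebra_simps)

lemma L2_inner_cmult:
  "L2_inner H (\<lambda>\<gamma>. c * \<xi> \<gamma>) \<zeta> x = cnj c * L2_inner H \<xi> \<zeta> x"
  "L2_inner H \<zeta> (\<lambda>\<gamma>. c * \<xi> \<gamma>) x = c * L2_inner H \<zeta> \<xi> x"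
  unfolding L2_inner_def by (simp_all add: mult.assoc mult.left_commute flip: infsum_cmult_right')

lemma adjointableI:
  assumes "T \<in> L2 H \<rightarrow>\<^sub>E L2 H" "S \<in> L2 H \<rightarrow>\<^sub>E L2 H"
    "\<And>\<xi> \<eta> x. \<xi> \<in> L2 H \<Longrightarrow> \<eta> \<in> L2 H \<Longrightarrow> L2_inner H (T \<xi>) \<eta> x = L2_inner H \<xi> (S \<eta>) x"
  shows "is_adjoint H T S" "T \<in> adjointable H"
proof -
  show a: "is_adjoint H T S" using assms(2,3) unfolding is_adjoint_def by blast
  then show "T \<in> adjointable H" using assms(1) unfolding adjointable_def by blast
qed

lemma adjointable_ext: "T \<in> adjointable H \<Longrightarrow> T \<in> L2 H \<rightarrow>\<^sub>E L2 H"
  by (simp add: adjointable_def)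

lemma adjoint_unique:
  assumes "is_adjoint H T S" "is_adjoint H T S'" "T \<in> L2 H \<rightarrow>\<^sub>E L2 H"
  shows "S = S'"
proof
  fix \<eta>
  show "S \<eta> = S' \<eta>"
  proof (cases "\<eta> \<in> L2 H")
    case True
    show ?thesis
    proof
      fix \<gamma>
      show "S \<eta> \<gamma> = S' \<eta> \<gamma>"
      proof (cases "\<gamma> \<in> A")
        case g: True
        show ?thesis
          using is_adjointD(2)[OF assms(1) dirac_L2[OF g] True] is_adjointD(2)[OF assms(2) dirac_L2[OF g] True]
          by (metis L2_inner_dirac[OF g])
      next
        case False
        then show ?thesis
          using L2_outside[OF is_adjointD(1)[OF assms(1) True]] L2_outside[OF is_adjointD(1)[OF assms(2) True]] by simp
      qed
    qed
  next
    case False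
    then show ?thesis using assms(1,2) unfolding is_adjoint_def by (metis PiE_arb)
  qed
qed

lemma op_adj_eqI: "is_adjoint H T S \<Longrightarrow> T \<in> adjointable H \<Longrightarrow> op_adj H T = S"
  unfolding op_adj_def by (rule the_equality) (auto intro: adjoint_unique dest: adjointable_ext)

lemma op_adj:
  assumes "T \<in> adjointable H"
  shows "is_adjoint H T (op_adj H T)" "op_adj H T \<in> adjointable H"
    "\<And>\<gamma> \<beta>. \<gamma> \<in> A \<Longrightarrow> \<beta> \<in> A \<Longrightarrow> s \<gamma> = s \<beta> \<Longrightarrow> kernel (op_adj H T) \<beta> \<gamma> = cnj (kernel T \<gamma> \<beta>)"
proof -
  note T = adjointable_ext[OF assms]
  obtain S where S: "is_adjoint H T S" using assms by (auto simp: adjointable_def)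
  then have eq: "op_adj H T = S" using op_adj_eqI assms by blast
  show "is_adjoint H T (op_adj H T)" using S eq by simp
  show "op_adj H T \<in> adjointable H" unfolding eq
    using is_adjoint_sym[OF S T] S by (auto simp: adjointable_def is_adjoint_def)
  show "kernel (op_adj H T) \<beta> \<gamma> = cnj (kernel T \<gamma> \<beta>)" if "\<gamma> \<in> A" "\<beta> \<in> A" "s \<gamma> = s \<beta>" for \<gamma> \<beta>
    unfolding eq by (rule kernel_adjoint[OF S T that])
qed

lemma adjointable_inner:
  assumes "T \<in> adjointable H" "\<xi> \<in> L2 H" "\<eta> \<in> L2 H"
  shows "L2_inner H (T \<xi>) \<eta> x = L2_inner H \<xi> (op_adj H T \<eta>) x"
  by (rule is_adjointD(2)[OF op_adj(1)[OF assms(1)] assms(2,3)])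

lemma op_zero_adjointable: "op_zero H \<in> adjointable H"
proof -
  have z: "op_zero H \<in> L2 H \<rightarrow>\<^sub>E L2 H" unfolding op_zero_def using L2_zero by auto
  show ?thesis
    by (rule adjointableI(2)[OF z z]) (auto simp: op_zero_def L2_inner_def)
qed

lemma op_add_adjointable:
  assumes S: "S \<in> adjointable H" and T: "T \<in> adjointable H"
  shows "op_add H S T \<in> adjointable H"
proof (rule adjointableI(2))
  note L = adjointable_L2[OF S] adjointable_L2[OF T] adjointable_L2[OF op_adj(2)[OF S]]
    adjointable_L2[OF op_adj(2)[OF T]]
  show "op_add H S T \<in> L2 H \<rightarrow>\<^sub>E L2 H" "op_add H (op_adj H S) (op_adj H T) \<in> L2 H \<rightarrow>\<^sub>E L2 H"
    unfolding op_add_def restrict_PiE_iff by (simp_all add: L2_add L)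
  show "L2_inner H (op_add H S T \<xi>) \<eta> x = L2_inner H \<xi> (op_add H (op_adj H S) (op_adj H T) \<eta>) x"
    if "\<xi> \<in> L2 H" "\<eta> \<in> L2 H" for \<xi> \<eta> x
    unfolding op_add_def using that
    by (simp add: L2_inner_add_left L2_inner_add_right L adjointable_inner[OF S] adjointable_inner[OF T])
qed

lemma op_scale_adjointable:
  assumes T: "T \<in> adjointable H"
  shows "op_scale H c T \<in> adjointable H"
proof (rule adjointableI(2))
  note L = adjointable_L2[OF T] adjointable_L2[OF op_adj(2)[OF T]]
  show "op_scale H c T \<in> L2 H \<rightarrow>\<^sub>E L2 H" "op_scale H (cnj c) (op_adj H T) \<in> L2 H \<rightarrow>\<^sub>E L2 H"
    unfolding op_scale_def restrict_PiE_iff by (simp_all add: L2_cmult L)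
  show "L2_inner H (op_scale H c T \<xi>) \<eta> x = L2_inner H \<xi> (op_scale H (cnj c) (op_adj H T) \<eta>) x"
    if "\<xi> \<in> L2 H" "\<eta> \<in> L2 H" for \<xi> \<eta> x
    unfolding op_scale_def using that
    by (simp add: L2_inner_cmult L adjointable_inner[OF T])
qed

lemma op_mul_adjointable:
  assumes S: "S \<in> adjointable H" and T: "T \<in> adjointable H"
  shows "op_mul H S T \<in> adjointable H"
proof (rule adjointableI(2))
  note L = adjointable_L2[OF S] adjointable_L2[OF T] adjointable_L2[OF op_adj(2)[OF S]]
    adjointable_L2[OF op_adj(2)[OF T]]
  show "op_mul H S T \<in> L2 H \<rightarrow>\<^sub>E L2 H" "op_mul H (op_adj H T) (op_adj H S) \<in> L2 H \<rightarrow>\<^sub>E L2 H"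
    unfolding op_mul_def compose_def restrict_PiE_iff by (simp_all add: L)
  show "L2_inner H (op_mul H S T \<xi>) \<eta> x = L2_inner H \<xi> (op_mul H (op_adj H T) (op_adj H S) \<eta>) x"
    if "\<xi> \<in> L2 H" "\<eta> \<in> L2 H" for \<xi> \<eta> x
    unfolding op_mul_def compose_def using that
    by (simp add: L adjointable_inner[OF T] adjointable_inner[OF S])
qed

lemma L2_mult_Cb: "f \<in> Cb H \<Longrightarrow> \<xi> \<in> L2 H \<Longrightarrow> (\<lambda>\<gamma>. f \<gamma> * \<xi> \<gamma>) \<in> L2 H"
  using L2_mult_bounded CbD by blast

lemma mult_op_adjointable:
  assumes f: "f \<in> Cb H"
  shows "mult_op H f \<in> adjointable H"
proof (rule adjointableI(2))
  have f': "(\<lambda>\<gamma>. cnj (f \<gamma>)) \<in> Cb H"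
    by (rule CbI[of _ "sup_norm f"]) (use CbD[OF f] in \<open>auto intro: continuous_map_cnj\<close>)
  show "mult_op H f \<in> L2 H \<rightarrow>\<^sub>E L2 H" "mult_op H (\<lambda>\<gamma>. cnj (f \<gamma>)) \<in> L2 H \<rightarrow>\<^sub>E L2 H"
    unfolding mult_op_def restrict_PiE_iff by (simp_all add: L2_mult_Cb f f')
  show "L2_inner H (mult_op H f \<xi>) \<eta> x = L2_inner H \<xi> (mult_op H (\<lambda>\<gamma>. cnj (f \<gamma>)) \<eta>) x"
    if "\<xi> \<in> L2 H" "\<eta> \<in> L2 H" for \<xi> \<eta> x
    unfolding mult_op_def L2_inner_def using that by (simp add: mult_ac)
qed

lemma kernel_zero: "\<beta> \<in> A \<Longrightarrow> kernel (op_zero H) \<gamma> \<beta> = 0"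
  by (simp add: kernel_def op_zero_def dirac_L2)

lemma kernel_add: "\<beta> \<in> A \<Longrightarrow> kernel (op_add H S T) \<gamma> \<beta> = kernel S \<gamma> \<beta> + kernel T \<gamma> \<beta>"
  by (simp add: kernel_def op_add_def dirac_L2)

lemma kernel_scale: "\<beta> \<in> A \<Longrightarrow> kernel (op_scale H c T) \<gamma> \<beta> = c * kernel T \<gamma> \<beta>"
  by (simp add: kernel_def op_scale_def dirac_L2)

lemma kernel_mul:
  assumes "S \<in> adjointable H" "T \<in> adjointable H" "\<gamma> \<in> A" "\<beta> \<in> A"
  shows "kernel (op_mul H S T) \<gamma> \<beta> = app (kernel S) (fib (s \<gamma>)) (\<lambda>k. kernel T k \<beta>) \<gamma>"
  using kernel_apply[OF assms(1) adjointable_L2[OF assms(2) dirac_L2[OF assms(4)]] assms(3)]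
  by (simp add: kernel_def op_mul_def compose_def dirac_L2 assms app_def)

lemma kernel_cut:
  assumes T: "T \<in> adjointable H" and f: "f \<in> Cb H" and g: "g \<in> Cb H"
    and \<gamma>: "\<gamma> \<in> A" "\<beta> \<in> A" "s \<gamma> = s \<beta>"
  shows "kernel (op_mul H (mult_op H g) (op_mul H T (mult_op H f))) \<gamma> \<beta> = g \<gamma> * kernel T \<gamma> \<beta> * f \<beta>"
proof -
  have fd: "(\<lambda>\<gamma>. f \<gamma> * dirac \<beta> \<gamma>) \<in> L2 H" using L2_mult_Cb[OF f] dirac_L2 \<gamma> by blast
  have "T (\<lambda>\<gamma>. f \<gamma> * dirac \<beta> \<gamma>) \<gamma> = app (kernel T) (fib (s \<gamma>)) (\<lambda>\<gamma>. f \<gamma> * dirac \<beta> \<gamma>) \<gamma>"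
    by (rule kernel_apply[OF T fd \<gamma>(1)])
  also have "\<dots> = app (kernel T) {\<beta>} f \<gamma>"
    by (rule app_restrict) (use \<gamma> dirac(2)[OF \<gamma>(2)] in \<open>auto simp: fibre_iff\<close>)
  finally have "T (\<lambda>\<gamma>. f \<gamma> * dirac \<beta> \<gamma>) \<gamma> = kernel T \<gamma> \<beta> * f \<beta>" by (simp add: app_def)
  moreover have "kernel (op_mul H (mult_op H g) (op_mul H T (mult_op H f))) \<gamma> \<beta> = g \<gamma> * T (\<lambda>\<gamma>. f \<gamma> * dirac \<beta> \<gamma>) \<gamma>"
    using dirac_L2[OF \<gamma>(2)] fd adjointable_L2[OF T fd]
    by (simp add: kernel_def op_mul_def compose_def mult_op_def)
  ultimately show ?thesis by simp
qed

lemma adjointable_eqI: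
  assumes S: "S \<in> adjointable H" and T: "T \<in> adjointable H"
    and eq: "\<And>\<gamma> \<beta>. \<gamma> \<in> A \<Longrightarrow> \<beta> \<in> A \<Longrightarrow> s \<gamma> = s \<beta> \<Longrightarrow> kernel S \<gamma> \<beta> = kernel T \<gamma> \<beta>"
  shows "S = T"
proof (rule PiE_ext[OF adjointable_ext[OF S] adjointable_ext[OF T]], rule ext)
  fix \<xi> \<gamma> assume \<xi>: "\<xi> \<in> L2 H"
  show "S \<xi> \<gamma> = T \<xi> \<gamma>"
  proof (cases "\<gamma> \<in> A")
    case True
    show ?thesis
      unfolding kernel_apply[OF S \<xi> True] kernel_apply[OF T \<xi> True] app_def
      by (intro infsum_cong) (use eq[OF True] in \<open>auto simp: fibre_iff\<close>)
  qed (simp add: L2_outside[OF adjointable_L2[OF S \<xi>]] L2_outside[OF adjointable_L2[OF T \<xi>]])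
qed

text \<open>The function \<open>dirac \<beta>\<close> is chosen separately for each \<beta>, so
  continuity in \<beta> is not visible from the definition of the kernel. Near a given \<beta>0 a
  single bump \<phi> on a bisection serves for all \<beta>: it has only one nonzero value in the
  fibre, so T \<phi> \<gamma> is the kernel at (\<gamma>, \<beta>) times \<phi> \<beta>, and the
  kernel is a quotient of continuous functions.\<close>

lemma kernel_continuous:
  assumes T: "T \<in> adjointable H"
  shows "continuous_map (subtopology (prod_topology (gtop H) (gtop H)) {(\<gamma>, \<beta>). s \<gamma> = s \<beta>}) euclidean
    (\<lambda>(\<gamma>, \<beta>). kernel T \<gamma> \<beta>)" (is "continuous_map ?X _ _")
proof (rule continuous_map_locally)
  fix p assume p: "p \<in> topspace ?X"
  define \<beta>0 where "\<beta>0 = snd p"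
  have b: "\<beta>0 \<in> A" using p by (auto simp: \<beta>0_def)
  obtain V \<sigma> where V: "s \<beta>0 \<in> V" "\<sigma> (s \<beta>0) = \<beta>0" "openin (gtop H) (\<sigma> ` V)" "inj_on s (\<sigma> ` V)"
    using source_section[OF b openin_topspace b] by metis
  have b0: "{\<beta>0} \<subseteq> \<sigma> ` V" using imageI[OF V(1), of \<sigma>] V(2) by simp
  have cb: "compactin (gtop H) {\<beta>0}" using b by simp
  obtain \<phi> where \<phi>: "\<phi> \<in> Cc H" "\<And>x. x \<in> {\<beta>0} \<Longrightarrow> \<phi> x = 1" "\<And>x. \<phi> x \<noteq> 0 \<Longrightarrow> x \<in> \<sigma> ` V"
    using Cc_bump[OF cb V(3) b0] by metis
  define W where "W = {q \<in> topspace ?X. \<phi> (snd q) \<in> - {0}}"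
  have csnd: "continuous_map ?X (gtop H) snd"
    using continuous_map_from_subtopology continuous_map_snd by blast
  have cfst: "continuous_map ?X (gtop H) fst"
    using continuous_map_from_subtopology continuous_map_fst by blast
  have c\<phi>: "continuous_map ?X euclidean (\<lambda>q. \<phi> (snd q))"
    using continuous_map_compose[OF csnd Cc_continuous[OF \<phi>(1)]] by (simp add: o_def)
  have oW: "openin ?X W"
    unfolding W_def by (rule openin_continuous_map_preimage[OF c\<phi>]) (simp add: open_Compl)
  have \<phi>L: "\<phi> \<in> L2 H" using \<phi>(1) Cc_subset_L2 by blast
  have cT: "continuous_map ?X euclidean (\<lambda>q. T \<phi> (fst q))"
    using continuous_map_compose[OF cfst L2_continuous[OF adjointable_L2[OF T \<phi>L]]] by (simp add: o_def)
  have "continuous_map (subtopology ?X W) euclidean (\<lambda>q. T \<phi> (fst q) / \<phi> (snd q))"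
    by (rule continuous_map_complex_divide)
      (use cT c\<phi> continuous_map_from_subtopology in \<open>auto simp: W_def\<close>)
  then have "continuous_map (subtopology ?X W) euclidean (\<lambda>(\<gamma>, \<beta>). kernel T \<gamma> \<beta>)"
  proof (rule continuous_map_eq)
    fix q assume "q \<in> topspace (subtopology ?X W)"
    then obtain \<gamma> \<beta> where q: "q = (\<gamma>, \<beta>)" "\<gamma> \<in> A" "\<beta> \<in> A" "s \<gamma> = s \<beta>" "\<phi> \<beta> \<noteq> 0" by (auto simp: W_def)
    have "T \<phi> \<gamma> = app (kernel T) (fib (s \<gamma>)) \<phi> \<gamma>" by (rule kernel_apply[OF T \<phi>L q(2)])
    also have "\<dots> = app (kernel T) {\<beta>} \<phi> \<gamma>"
    proof (rule app_restrict)
      fix h assume h: "h \<in> fib (s \<gamma>) - {\<beta>}"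
      show "\<phi> h = 0"
      proof (rule ccontr)
        assume "\<phi> h \<noteq> 0"
        then have "h \<in> \<sigma> ` V" "\<beta> \<in> \<sigma> ` V" using \<phi>(3) q(5) by auto
        moreover have "s h = s \<beta>" using h q(4) by (simp add: fibre_iff)
        ultimately have "h = \<beta>" using V(4) by (auto simp: inj_on_def)
        then show False using h by simp
      qed
    qed (use q in \<open>auto simp: fibre_iff\<close>)
    finally show "T \<phi> (fst q) / \<phi> (snd q) = (case q of (\<gamma>, \<beta>) \<Rightarrow> kernel T \<gamma> \<beta>)"
      using q by (simp add: app_def)
  qed
  moreover have "p \<in> W" using p \<phi>(2)[of \<beta>0] by (simp add: W_def \<beta>0_def)
  ultimately show "\<exists>W. openin ?X W \<and> p \<in> W \<and>
      continuous_map (subtopology ?X W) euclidean (\<lambda>(\<gamma>, \<beta>). kernel T \<gamma> \<beta>)" using oW by blast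
qed

lemma closedin_composable:
  "closedin (prod_topology (gtop H) (gtop H)) {(\<alpha>, \<beta>) \<in> A \<times> A. s \<alpha> = r \<beta>}"
proof -
  have "closedin (prod_topology (gtop H) (gtop H))
      {p \<in> topspace (prod_topology (gtop H) (gtop H)). (s \<circ> fst) p = (r \<circ> snd) p}"
    by (rule closedin_continuous_maps_eq[OF Hausdorff])
      (rule continuous_map_compose continuous_map_fst continuous_map_snd continuous_source_arr continuous_range_arr)+
  moreover have "{p \<in> topspace (prod_topology (gtop H) (gtop H)). (s \<circ> fst) p = (r \<circ> snd) p}
     = {(\<alpha>, \<beta>) \<in> A \<times> A. s \<alpha> = r \<beta>}" by auto
  ultimately show ?thesis by simp
qed

text \<open>The composable pairs form a closed subset of the product, so those lying in K \<times> C
  form a compact set, on which multiplication is continuous.\<close>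

lemma compact_set_mul:
  assumes "compactin (gtop H) K" "compactin (gtop H) C"
  shows "compactin (gtop H) (set_mul H K C)"
proof -
  let ?P = "prod_topology (gtop H) (gtop H)" and ?D = "{(\<alpha>, \<beta>) \<in> A \<times> A. s \<alpha> = r \<beta>}"
  have "compactin ?P (K \<times> C)" using assms by (simp add: compactin_Times)
  then have "compactin ?P (?D \<inter> K \<times> C)" using closed_Int_compactin[OF closedin_composable] by blast
  then have c: "compactin (subtopology ?P ?D) (?D \<inter> K \<times> C)" by (simp add: compactin_subtopology)
  have "continuous_map (subtopology ?P ?D) (gtop H) (\<lambda>p. fst p \<cdot> snd p)"
    by (rule continuous_mul)
      (auto intro: continuous_map_from_subtopology continuous_map_fst continuous_map_snd)
  from image_compactin[OF c this] have "compactin (gtop H) ((\<lambda>p. fst p \<cdot> snd p) ` (?D \<inter> K \<times> C))" .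
  moreover have "(\<lambda>p. fst p \<cdot> snd p) ` (?D \<inter> K \<times> C) = set_mul H K C"
    using compactin_subset_topspace[OF assms(1)] compactin_subset_topspace[OF assms(2)]
    unfolding set_mul_def by force
  ultimately show ?thesis by simp
qed

lemma compact_inverse: "compactin (gtop H) K \<Longrightarrow> compactin (gtop H) (iv ` K)"
  using image_compactin continuous_inverse by blast

end

section \<open>Quasi-locality in terms of kernels\<close>

context etale
begin

text \<open>For arrows e and f with equal source, f e\<inverse> \<in> K means that f lies in K e. So
  this is K-separation for subsets of one fibre, written with quotients because these are what an
  invariant kernel depends on.\<close>

definition apart :: "'a set \<Rightarrow> 'a set \<Rightarrow> 'a set \<Rightarrow> bool" where
  "apart K E F \<longleftrightarrow> (\<forall>e\<in>E. \<forall>f\<in>F. f \<cdot> iv e \<notin> K \<and> e \<cdot> iv f \<notin> K)"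

definition ql_kernel :: "('a \<Rightarrow> 'a \<Rightarrow> complex) \<Rightarrow> bool" where
  "ql_kernel m \<longleftrightarrow> (\<forall>\<epsilon>>0. \<exists>K. compactin (gtop H) K \<and>
    (\<forall>x E F. E \<subseteq> fib x \<and> F \<subseteq> fib x \<and> apart K E F \<longrightarrow> formbd m E F \<epsilon>))"

text \<open>Finite sets suffice, because \<open>formbd\<close> only tests finite subsets and being
  apart passes to subsets.\<close>

lemma ql_kernelI:
  assumes "\<And>\<epsilon>. \<epsilon> > 0 \<Longrightarrow> \<exists>K. compactin (gtop H) K \<and>
    (\<forall>x E F. finite E \<and> E \<subseteq> fib x \<and> finite F \<and> F \<subseteq> fib x \<and> apart K E F \<longrightarrow> formbd m E F \<epsilon>)"
  shows "ql_kernel m"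
  unfolding ql_kernel_def
proof (intro allI impI)
  fix \<epsilon> :: real assume "\<epsilon> > 0"
  from assms[OF this] obtain K where K: "compactin (gtop H) K" and
    K2: "\<forall>x E F. finite E \<and> E \<subseteq> fib x \<and> finite F \<and> F \<subseteq> fib x \<and> apart K E F \<longrightarrow> formbd m E F \<epsilon>"
    by (elim exE conjE)
  have "formbd m E F \<epsilon>" if "E \<subseteq> fib x" "F \<subseteq> fib x" "apart K E F" for x E F
  proof (rule formbdI)
    fix E' F' a assume f: "finite E'" "E' \<subseteq> E" "finite F'" "F' \<subseteq> F"
    then have "apart K E' F'" using that(3) by (auto simp: apart_def)
    then have "formbd m E' F' \<epsilon>"
      by (intro K2[rule_format, of E' x F'] conjI) (use f that in auto)
    then show "L2_set (\<lambda>y. cmod (\<Sum>x\<in>E'. m y x * a x)) F' \<le> \<epsilon> * L2_set (\<lambda>x. cmod (a x)) E'"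
      by (rule formbdD) (use f in auto)
  qed
  then show "\<exists>K. compactin (gtop H) K \<and> (\<forall>x E F. E \<subseteq> fib x \<and> F \<subseteq> fib x \<and> apart K E F \<longrightarrow> formbd m E F \<epsilon>)"
    using K by blast
qed

lemma ql_kernelD:
  assumes "ql_kernel m" "\<epsilon> > 0"
  obtains K where "compactin (gtop H) K" "\<And>x E F. E \<subseteq> fib x \<Longrightarrow> F \<subseteq> fib x \<Longrightarrow> apart K E F \<Longrightarrow> formbd m E F \<epsilon>"
proof -
  from assms(1)[unfolded ql_kernel_def, rule_format, OF assms(2)] obtain K where K: "compactin (gtop H) K"
    "\<forall>x E F. E \<subseteq> fib x \<and> F \<subseteq> fib x \<and> apart K E F \<longrightarrow> formbd m E F \<epsilon>" by (elim exE conjE)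
  show thesis by (rule that[OF K(1)], rule K(2)[rule_format]) simp
qed

lemma apart_mono: "apart K E F \<Longrightarrow> K' \<subseteq> K \<Longrightarrow> apart K' E F"
  unfolding apart_def by blast

lemma apart_sym: "apart K E F \<Longrightarrow> apart K F E"
  unfolding apart_def by blast

lemma ql_kernel_cong:
  assumes "ql_kernel m" "\<And>x \<gamma> \<beta>. \<gamma> \<in> fib x \<Longrightarrow> \<beta> \<in> fib x \<Longrightarrow> n \<gamma> \<beta> = m \<gamma> \<beta>"
  shows "ql_kernel n"
  unfolding ql_kernel_def
proof (intro allI impI)
  fix \<epsilon> :: real assume "\<epsilon> > 0"
  then obtain K where K: "compactin (gtop H) K" "\<And>x E F. E \<subseteq> fib x \<Longrightarrow> F \<subseteq> fib x \<Longrightarrow> apart K E F \<Longrightarrow> formbd m E F \<epsilon>"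
    using ql_kernelD[OF assms(1)] by metis
  have "formbd n E F \<epsilon>" if "E \<subseteq> fib x" "F \<subseteq> fib x" "apart K E F" for x E F
    by (rule formbd_cong[OF K(2)[OF that]]) (use assms(2) that in blast)
  then show "\<exists>K. compactin (gtop H) K \<and> (\<forall>x E F. E \<subseteq> fib x \<and> F \<subseteq> fib x \<and> apart K E F \<longrightarrow> formbd n E F \<epsilon>)"
    using K(1) by blast
qed

text \<open>The bump g is chosen first, with support away from the closed set of points K-near to E;
  then f is chosen with support away from the points K-near to the compact support of g. Nearness in
  the sense of N is symmetric, so the choice of f yields both conditions of
  \<open>separated\<close>.\<close>

lemma separating_bumps:
  assumes K: "compactin (gtop H) K" and E: "finite E" "E \<subseteq> fib x" and F: "finite F" "F \<subseteq> fib x"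
    and sp: "apart K E F"
  obtains f g where "f \<in> Cb H" "g \<in> Cb H" "\<And>e. e \<in> E \<Longrightarrow> f e = 1" "\<And>e. e \<in> F \<Longrightarrow> g e = 1"
    "sup_norm f \<le> 1" "sup_norm g \<le> 1" "separated H K f g"
proof -
  have EA: "E \<subseteq> A" "F \<subseteq> A" using E F by (auto simp: fibre_iff)
  have KA: "K \<subseteq> A" using K compactin_subset_topspace by blast
  have cE: "compactin (gtop H) E" "compactin (gtop H) F"
    using E F EA by (simp_all add: finite_imp_compactin)
  \<comment> \<open>Inverses are included to make the relation symmetric: e is in N {c} exactly if c
    is in N {e}. For compact C the set is compact, hence closed.\<close>
  define N where "N C = set_mul H K C \<union> set_mul H (iv ` K) C" for C
  have cN: "closedin (gtop H) (N C)" if "compactin (gtop H) C" for C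
    unfolding N_def using that K compact_set_mul compact_inverse compactin_Un compactin_imp_closedin[OF Hausdorff]
    by metis
  have Nsym: "c \<in> N {e}" if "e \<in> N {c}" "c \<in> A" for c e
  proof -
    from that(1) consider k where "k \<in> K" "e = k \<cdot> c" "s k = r c" | k where "k \<in> K" "e = iv k \<cdot> c" "s (iv k) = r c"
      unfolding N_def set_mul_def by blast
    then show ?thesis
    proof cases
      case 1
      then have "k \<in> A" using KA by auto
      then have "c = iv k \<cdot> e" "s (iv k) = r e" using 1 that(2) by auto
      then show ?thesis using 1(1) unfolding N_def set_mul_def by blast
    next
      case 2
      then have "k \<in> A" using KA by auto
      then have "c = k \<cdot> e" "s k = r e" using 2 that(2) by auto
      then show ?thesis using 2(1) unfolding N_def set_mul_def by blast
    qed
  qed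
  have Nmem: "e \<in> N C \<longleftrightarrow> (\<exists>c\<in>C. e \<in> N {c})" for e C
    unfolding N_def set_mul_def by blast
  have disj1: "F \<subseteq> A - N E"
  proof
    fix f assume f: "f \<in> F"
    have "f \<notin> N {e}" if e: "e \<in> E" for e
    proof
      assume "f \<in> N {e}"
      then consider k where "k \<in> K" "f = k \<cdot> e" "s k = r e" | k where "k \<in> K" "f = iv k \<cdot> e" "s (iv k) = r e"
        unfolding N_def set_mul_def by blast
      then show False
      proof cases
        case 1
        then have "k \<in> A" "e \<in> A" using KA EA e by auto
        then have "f \<cdot> iv e = k" using 1 by simp
        then show False using 1 sp e f unfolding apart_def by blast
      next
        case 2
        then have kA: "k \<in> A" "e \<in> A" "r k = r e" using KA EA e by auto
        then have "e = k \<cdot> f" "s k = r f" using 2 by auto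
        then have "e \<cdot> iv f = k" using kA EA f by auto
        then show False using 2 sp e f unfolding apart_def by blast
      qed
    qed
    then show "f \<in> A - N E" using f EA Nmem[of f E] by blast
  qed
  have op1: "openin (gtop H) (A - N E)" using cN[OF cE(1)] by blast
  obtain g where g: "g \<in> Cc H" "\<And>x. cmod (g x) \<le> 1" "\<And>x. x \<in> F \<Longrightarrow> g x = 1" "supp H g \<subseteq> A - N E"
    using Cc_bump[OF cE(2) op1 disj1] by metis
  have cg: "compactin (gtop H) (supp H g)" using g(1) by (simp add: Cc_def)
  have op2: "openin (gtop H) (A - N (supp H g))" using cN[OF cg] by blast
  have disj2: "E \<subseteq> A - N (supp H g)"
  proof
    fix e assume e: "e \<in> E"
    have "e \<notin> N {c}" if c: "c \<in> supp H g" for c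
    proof
      assume "e \<in> N {c}"
      then have "c \<in> N {e}" using Nsym c g(4) by blast
      then show False using c g(4) Nmem e by blast
    qed
    then show "e \<in> A - N (supp H g)" using e EA Nmem[of e "supp H g"] by blast
  qed
  obtain f where f: "f \<in> Cc H" "\<And>x. cmod (f x) \<le> 1" "\<And>x. x \<in> E \<Longrightarrow> f x = 1" "supp H f \<subseteq> A - N (supp H g)"
    using Cc_bump[OF cE(1) op2 disj2] by metis
  have "separated H K f g"
    unfolding separated_def
  proof
    show "set_mul H K (supp H f) \<inter> supp H g = {}"
    proof (rule ccontr)
      assume "\<not> ?thesis"
      then obtain d where d: "d \<in> N (supp H f)" "d \<in> supp H g" unfolding N_def by blast
      then obtain c where "c \<in> supp H f" "d \<in> N {c}" using Nmem by blast
      then have "c \<in> N {d}" using Nsym f(4) by blast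
      then show False using f(4) \<open>c \<in> supp H f\<close> d(2) Nmem by blast
    qed
    show "supp H f \<inter> set_mul H K (supp H g) = {}" using f(4) unfolding N_def by blast
  qed
  moreover have "f \<in> Cb H" "g \<in> Cb H" using f(1) g(1) Cc_subset_Cb by auto
  ultimately show thesis using that f(2,3) g(2,3) sup_norm_le by metis
qed

lemma sup_norm_nonneg: "f \<in> Cb H \<Longrightarrow> 0 \<le> sup_norm f"
  using CbD(3) norm_ge_zero order_trans by blast

lemma cut_adjointable:
  "T \<in> adjointable H \<Longrightarrow> f \<in> Cb H \<Longrightarrow> g \<in> Cb H \<Longrightarrow>
    op_mul H (mult_op H g) (op_mul H T (mult_op H f)) \<in> adjointable H"
  by (intro op_mul_adjointable mult_op_adjointable)

text \<open>Separated subsets of one fibre are separated by functions with disjoint translates of their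
  supports; conversely \<open>K\<close>-separated functions restrict to separated sets in every fibre.\<close>

lemma quasi_local_iff:
  assumes T: "T \<in> adjointable H"
  shows "quasi_local H T \<longleftrightarrow> ql_kernel (kernel T)"
proof
  assume q: "quasi_local H T"
  show "ql_kernel (kernel T)"
  proof (rule ql_kernelI)
    fix \<epsilon> :: real assume \<epsilon>: "\<epsilon> > 0"
    define cut where "cut f g = op_mul H (mult_op H g) (op_mul H T (mult_op H f))" for f g
    obtain K where K: "compactin (gtop H) K" "\<And>f g. f \<in> Cb H \<Longrightarrow> g \<in> Cb H \<Longrightarrow> separated H K f g \<Longrightarrow>
      op_norm H (cut f g) \<le> \<epsilon> * sup_norm g * sup_norm f"
      using q \<epsilon> unfolding quasi_local_def cut_def by (metis less_imp_le)
    have "formbd (kernel T) E F \<epsilon>" if h: "finite E" "E \<subseteq> fib x" "finite F" "F \<subseteq> fib x" "apart K E F" for x E F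
    proof -
      obtain f g where fg: "f \<in> Cb H" "g \<in> Cb H" "\<And>e. e \<in> E \<Longrightarrow> f e = 1" "\<And>e. e \<in> F \<Longrightarrow> g e = 1"
        "sup_norm f \<le> 1" "sup_norm g \<le> 1" "separated H K f g"
        using separating_bumps[OF K(1) h] by metis
      have ca: "cut f g \<in> adjointable H" unfolding cut_def by (rule cut_adjointable[OF T fg(1,2)])
      have "\<epsilon> * sup_norm g * sup_norm f \<le> \<epsilon> * 1 * 1"
        by (intro mult_mono) (use fg sup_norm_nonneg \<epsilon> in auto)
      then have "op_norm H (cut f g) \<le> \<epsilon>" using K(2)[OF fg(1,2,7)] by linarith
      then have "formbd (kernel (cut f g)) (fib x) (fib x) \<epsilon>" using op_norm_le_iff[OF ca] \<epsilon> by (meson less_imp_le)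
      then have fb: "formbd (kernel (cut f g)) E F \<epsilon>" by (rule formbd_mono[OF _ order_refl h(2,4)])
      show ?thesis
      proof (rule formbd_cong[OF fb])
        fix e \<gamma> assume m: "e \<in> E" "\<gamma> \<in> F"
        then have "\<gamma> \<in> fib x" "e \<in> fib x" using h by auto
        then have m': "\<gamma> \<in> A" "e \<in> A" "s \<gamma> = s e" by (simp_all add: fibre_iff)
        show "kernel T \<gamma> e = kernel (cut f g) \<gamma> e"
          unfolding cut_def kernel_cut[OF T fg(1,2) m'] using fg(3)[OF m(1)] fg(4)[OF m(2)] by simp
      qed
    qed
    then show "\<exists>K. compactin (gtop H) K \<and> (\<forall>x E F. finite E \<and> E \<subseteq> fib x \<and> finite F \<and> F \<subseteq> fib x \<and> apart K E F
        \<longrightarrow> formbd (kernel T) E F \<epsilon>)" using K(1) by blast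
  qed
next
  assume q: "ql_kernel (kernel T)"
  show "quasi_local H T"
    unfolding quasi_local_def
  proof (intro allI impI)
    fix \<epsilon> :: real assume \<epsilon>: "\<epsilon> > 0"
    \<comment> \<open>Halving \<epsilon> leaves room for the strict inequality demanded in
      \<open>quasi_local\<close>.\<close>
    then obtain K where K: "compactin (gtop H) K" "\<And>x E F. E \<subseteq> fib x \<Longrightarrow> F \<subseteq> fib x \<Longrightarrow> apart K E F \<Longrightarrow> formbd (kernel T) E F (\<epsilon>/2)"
      using ql_kernelD[OF q, of "\<epsilon>/2"] by (metis half_gt_zero)
    have le: "op_norm H (op_mul H (mult_op H g) (op_mul H T (mult_op H f))) \<le> \<epsilon>/2 * sup_norm g * sup_norm f"
      if f: "f \<in> Cb H" and g: "g \<in> Cb H" and sp: "separated H K f g" for f g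
    proof -
      have nn: "0 \<le> sup_norm f" "0 \<le> sup_norm g" using sup_norm_nonneg f g by auto
      have sub: "{\<gamma>. f \<gamma> \<noteq> 0} \<subseteq> supp H f" "{\<gamma>. g \<gamma> \<noteq> 0} \<subseteq> supp H g"
        unfolding supp_def using CbD(2)[OF f] CbD(2)[OF g] by (auto intro!: closure_of_subset)
      have "formbd (kernel (op_mul H (mult_op H g) (op_mul H T (mult_op H f)))) (fib x) (fib x) (\<epsilon>/2 * sup_norm g * sup_norm f)" for x
      proof (rule formbd_cong)
        show "kernel (op_mul H (mult_op H g) (op_mul H T (mult_op H f))) \<gamma> \<beta> = g \<gamma> * kernel T \<gamma> \<beta> * f \<beta>"
          if "\<beta> \<in> fib x" "\<gamma> \<in> fib x" for \<gamma> \<beta>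
          by (rule kernel_cut[OF T f g]) (use that in \<open>auto simp: fibre_iff\<close>)
        show "formbd (\<lambda>\<gamma> \<beta>. g \<gamma> * kernel T \<gamma> \<beta> * f \<beta>) (fib x) (fib x) (\<epsilon>/2 * sup_norm g * sup_norm f)"
        proof (rule formbdI)
          fix E F a assume h: "finite E" "E \<subseteq> fib x" "finite F" "F \<subseteq> fib x"
          \<comment> \<open>Only points where f, respectively g, does not vanish contribute. They
            lie in the supports, and so the two remaining sets are K-apart.\<close>
          define E' where "E' = E \<inter> {\<gamma>. f \<gamma> \<noteq> 0}"
          define F' where "F' = F \<inter> {\<gamma>. g \<gamma> \<noteq> 0}"
          have h': "finite E'" "E' \<subseteq> fib x" "finite F'" "F' \<subseteq> fib x" "E' \<subseteq> E" using h by (auto simp: E'_def F'_def)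
          have "apart K E' F'"
            unfolding apart_def
          proof (intro ballI conjI notI)
            fix e \<gamma> assume e: "e \<in> E'" "\<gamma> \<in> F'"
            have "e \<in> fib x" "\<gamma> \<in> fib x" using e h' by auto
            then have eA: "e \<in> A" "\<gamma> \<in> A" "s e = s \<gamma>" by (simp_all add: fibre_iff)
            have su: "e \<in> supp H f" "\<gamma> \<in> supp H g" using e sub by (auto simp: E'_def F'_def)
            show False if "\<gamma> \<cdot> iv e \<in> K"
            proof -
              have "\<gamma> = (\<gamma> \<cdot> iv e) \<cdot> e" "s (\<gamma> \<cdot> iv e) = r e" using eA by auto
              then have "\<gamma> \<in> set_mul H K (supp H f)" unfolding set_mul_def using that su by blast
              then show False using sp su unfolding separated_def by blast
            qed
            show False if "e \<cdot> iv \<gamma> \<in> K"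
            proof -
              have "e = (e \<cdot> iv \<gamma>) \<cdot> \<gamma>" "s (e \<cdot> iv \<gamma>) = r \<gamma>" using eA by auto
              then have "e \<in> set_mul H K (supp H g)" unfolding set_mul_def using that su by blast
              then show False using sp su unfolding separated_def by blast
            qed
          qed
          then have fb: "formbd (kernel T) E' F' (\<epsilon>/2)" using K(2) h' by blast
          have "L2_set (\<lambda>y. cmod (\<Sum>x\<in>E. g y * kernel T y x * f x * a x)) F
             = L2_set (\<lambda>y. cmod (g y) * cmod (\<Sum>x\<in>E'. kernel T y x * (f x * a x))) F"
          proof (rule L2_set_cong[OF refl])
            fix y
            have "(\<Sum>x\<in>E. g y * kernel T y x * f x * a x) = (\<Sum>x\<in>E'. g y * kernel T y x * f x * a x)"
              by (rule sum.mono_neutral_right) (use h in \<open>auto simp: E'_def\<close>)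
            then show "cmod (\<Sum>x\<in>E. g y * kernel T y x * f x * a x) = cmod (g y) * cmod (\<Sum>x\<in>E'. kernel T y x * (f x * a x))"
              by (simp add: sum_distrib_left mult.assoc flip: norm_mult)
          qed
          also have "\<dots> = L2_set (\<lambda>y. cmod (g y) * cmod (\<Sum>x\<in>E'. kernel T y x * (f x * a x))) F'"
            unfolding L2_set_def
            by (intro arg_cong[where f=sqrt] sum.mono_neutral_right) (use h in \<open>auto simp: F'_def\<close>)
          also have "\<dots> \<le> L2_set (\<lambda>y. sup_norm g * cmod (\<Sum>x\<in>E'. kernel T y x * (f x * a x))) F'"
            by (rule L2_set_mono) (auto intro: mult_right_mono CbD(3)[OF g])
          also have "\<dots> = sup_norm g * L2_set (\<lambda>y. cmod (\<Sum>x\<in>E'. kernel T y x * (f x * a x))) F'"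
            by (rule L2_set_right_distrib[symmetric]) (rule nn)
          also have "\<dots> \<le> sup_norm g * (\<epsilon>/2 * L2_set (\<lambda>x. cmod (f x * a x)) E')"
            by (intro mult_left_mono formbdD[OF fb] nn) (use h' in auto)
          also have "\<dots> \<le> sup_norm g * (\<epsilon>/2 * (sup_norm f * L2_set (\<lambda>x. cmod (a x)) E))"
          proof (intro mult_left_mono)
            have "L2_set (\<lambda>x. cmod (f x * a x)) E' \<le> L2_set (\<lambda>x. cmod (f x * a x)) E"
              unfolding L2_set_def by (intro real_sqrt_le_mono sum_mono2) (use h h' in auto)
            also have "\<dots> \<le> L2_set (\<lambda>x. sup_norm f * cmod (a x)) E"
              by (rule L2_set_mono) (auto simp: norm_mult intro: mult_right_mono CbD(3)[OF f])
            also have "\<dots> = sup_norm f * L2_set (\<lambda>x. cmod (a x)) E"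
              by (rule L2_set_right_distrib[symmetric]) (rule nn)
            finally show "L2_set (\<lambda>x. cmod (f x * a x)) E' \<le> sup_norm f * L2_set (\<lambda>x. cmod (a x)) E" .
          qed (use \<epsilon> nn in auto)
          finally show "L2_set (\<lambda>y. cmod (\<Sum>x\<in>E. g y * kernel T y x * f x * a x)) F
            \<le> \<epsilon>/2 * sup_norm g * sup_norm f * L2_set (\<lambda>x. cmod (a x)) E" by (simp add: mult_ac)
        qed
      qed
      moreover have "0 \<le> \<epsilon>/2 * sup_norm g * sup_norm f" using nn \<epsilon> by simp
      ultimately show ?thesis using op_norm_le_iff[OF cut_adjointable[OF T f g]] by blast
    qed
    have pos: "0 < sup_norm f" if f: "f \<in> Cb H" "f \<noteq> (\<lambda>_. 0)" for f
    proof -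
      obtain \<gamma> where "f \<gamma> \<noteq> 0" using f(2) by auto
      then have "0 < cmod (f \<gamma>)" by simp
      then show ?thesis using CbD(3)[OF f(1), of \<gamma>] by linarith
    qed
    show "\<exists>K. compactin (gtop H) K \<and> (\<forall>f\<in>Cb H. \<forall>g\<in>Cb H. separated H K f g \<longrightarrow>
      (if f = (\<lambda>_. 0) \<or> g = (\<lambda>_. 0)
       then op_norm H (op_mul H (mult_op H g) (op_mul H T (mult_op H f))) \<le> \<epsilon> * sup_norm g * sup_norm f
       else op_norm H (op_mul H (mult_op H g) (op_mul H T (mult_op H f))) < \<epsilon> * sup_norm g * sup_norm f))"
    proof (intro exI[of _ K] conjI K(1) ballI impI)
      fix f g assume f: "f \<in> Cb H" and g: "g \<in> Cb H" and sp: "separated H K f g"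
      have nn: "0 \<le> sup_norm g * sup_norm f" using sup_norm_nonneg f g by simp
      have l1: "\<epsilon>/2 * sup_norm g * sup_norm f \<le> \<epsilon> * sup_norm g * sup_norm f"
        using mult_right_mono[OF _ nn, of "\<epsilon>/2" \<epsilon>] \<epsilon> by (simp add: mult.assoc)
      have l2: "\<epsilon>/2 * sup_norm g * sup_norm f < \<epsilon> * sup_norm g * sup_norm f" if "f \<noteq> (\<lambda>_. 0)" "g \<noteq> (\<lambda>_. 0)"
        using mult_strict_right_mono[of "\<epsilon>/2" \<epsilon> "sup_norm g * sup_norm f"] pos[OF f that(1)] pos[OF g that(2)] \<epsilon>
        by (simp add: mult.assoc)
      show "if f = (\<lambda>_. 0) \<or> g = (\<lambda>_. 0)
       then op_norm H (op_mul H (mult_op H g) (op_mul H T (mult_op H f))) \<le> \<epsilon> * sup_norm g * sup_norm f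
       else op_norm H (op_mul H (mult_op H g) (op_mul H T (mult_op H f))) < \<epsilon> * sup_norm g * sup_norm f"
      proof (cases "f = (\<lambda>_. 0) \<or> g = (\<lambda>_. 0)")
        case True
        show ?thesis unfolding if_P[OF True] by (rule order_trans[OF le[OF f g sp] l1])
      next
        case False
        show ?thesis unfolding if_not_P[OF False]
          by (rule le_less_trans[OF le[OF f g sp] l2]) (use False in auto)
      qed
    qed
  qed
qed

section \<open>Stability of quasi-local kernels under the operations of a C*-algebra\<close>

lemma ql_kernel_zero: "ql_kernel (\<lambda>_ _. 0)"
  unfolding ql_kernel_def formbd_def
proof (intro allI impI exI conjI)
  show "compactin (gtop H) {}" by simp
qed (simp add: L2_set_def sum_nonneg)

lemma ql_kernel_add:
  assumes "ql_kernel m" "ql_kernel n"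
  shows "ql_kernel (\<lambda>\<gamma> \<beta>. m \<gamma> \<beta> + n \<gamma> \<beta>)"
  unfolding ql_kernel_def
proof (intro allI impI)
  fix \<epsilon> :: real assume "\<epsilon> > 0"
  then have e2: "\<epsilon> / 2 > 0" by simp
  from ql_kernelD[OF assms(1) this] obtain K where K: "compactin (gtop H) K"
    "\<And>x E F. E \<subseteq> fib x \<Longrightarrow> F \<subseteq> fib x \<Longrightarrow> apart K E F \<Longrightarrow> formbd m E F (\<epsilon>/2)" by metis
  from ql_kernelD[OF assms(2) e2] obtain K' where K': "compactin (gtop H) K'"
    "\<And>x E F. E \<subseteq> fib x \<Longrightarrow> F \<subseteq> fib x \<Longrightarrow> apart K' E F \<Longrightarrow> formbd n E F (\<epsilon>/2)" by metis
  have "formbd (\<lambda>\<gamma> \<beta>. m \<gamma> \<beta> + n \<gamma> \<beta>) E F \<epsilon>" if "E \<subseteq> fib x" "F \<subseteq> fib x" "apart (K \<union> K') E F" for x E F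
    using formbd_add[OF K(2)[OF that(1,2) apart_mono[OF that(3)]] K'(2)[OF that(1,2) apart_mono[OF that(3)]]] by simp
  then show "\<exists>K. compactin (gtop H) K \<and> (\<forall>x E F. E \<subseteq> fib x \<and> F \<subseteq> fib x \<and> apart K E F
      \<longrightarrow> formbd (\<lambda>\<gamma> \<beta>. m \<gamma> \<beta> + n \<gamma> \<beta>) E F \<epsilon>)"
    using compactin_Un[OF K(1) K'(1)] by blast
qed

lemma ql_kernel_cmult:
  assumes "ql_kernel m"
  shows "ql_kernel (\<lambda>\<gamma> \<beta>. c * m \<gamma> \<beta>)"
  unfolding ql_kernel_def
proof (intro allI impI)
  fix \<epsilon> :: real assume \<epsilon>: "\<epsilon> > 0"
  then have "\<epsilon> / (cmod c + 1) > 0" by (simp add: add_nonneg_pos)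
  from ql_kernelD[OF assms this] obtain K where K: "compactin (gtop H) K"
    "\<And>x E F. E \<subseteq> fib x \<Longrightarrow> F \<subseteq> fib x \<Longrightarrow> apart K E F \<Longrightarrow> formbd m E F (\<epsilon> / (cmod c + 1))" by metis
  have p: "0 < cmod c + 1" by (simp add: add_nonneg_pos)
  have "cmod c / (cmod c + 1) \<le> 1" by (subst pos_divide_le_eq[OF p]) simp
  from mult_left_mono[OF this, of \<epsilon>] have "cmod c * (\<epsilon> / (cmod c + 1)) \<le> \<epsilon>"
    using \<epsilon> by (simp add: mult.commute)
  then have "formbd (\<lambda>\<gamma> \<beta>. c * m \<gamma> \<beta>) E F \<epsilon>" if "E \<subseteq> fib x" "F \<subseteq> fib x" "apart K E F" for x E F
    by (rule formbd_mono[OF formbd_cmult[OF K(2)[OF that]]]) auto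
  then show "\<exists>K. compactin (gtop H) K \<and> (\<forall>x E F. E \<subseteq> fib x \<and> F \<subseteq> fib x \<and> apart K E F
      \<longrightarrow> formbd (\<lambda>\<gamma> \<beta>. c * m \<gamma> \<beta>) E F \<epsilon>)" using K(1) by blast
qed

lemma ql_kernel_adjoint:
  assumes "ql_kernel m"
  shows "ql_kernel (\<lambda>\<gamma> \<beta>. cnj (m \<beta> \<gamma>))"
  unfolding ql_kernel_def
proof (intro allI impI)
  fix \<epsilon> :: real assume \<epsilon>: "\<epsilon> > 0"
  from ql_kernelD[OF assms this] obtain K where K: "compactin (gtop H) K"
    "\<And>x E F. E \<subseteq> fib x \<Longrightarrow> F \<subseteq> fib x \<Longrightarrow> apart K E F \<Longrightarrow> formbd m E F \<epsilon>" by metis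
  have "formbd (\<lambda>\<gamma> \<beta>. cnj (m \<beta> \<gamma>)) E F \<epsilon>" if "E \<subseteq> fib x" "F \<subseteq> fib x" "apart K E F" for x E F
    by (rule formbd_adjoint[OF K(2)[OF that(2,1) apart_sym[OF that(3)]]]) (use \<epsilon> in simp)
  then show "\<exists>K. compactin (gtop H) K \<and> (\<forall>x E F. E \<subseteq> fib x \<and> F \<subseteq> fib x \<and> apart K E F
      \<longrightarrow> formbd (\<lambda>\<gamma> \<beta>. cnj (m \<beta> \<gamma>)) E F \<epsilon>)" using K(1) by blast
qed

lemma ql_kernel_limit:
  assumes "\<And>\<epsilon>. \<epsilon> > 0 \<Longrightarrow> \<exists>n. ql_kernel n \<and> (\<forall>x. formbd (\<lambda>\<gamma> \<beta>. m \<gamma> \<beta> - n \<gamma> \<beta>) (fib x) (fib x) \<epsilon>)"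
  shows "ql_kernel m"
  unfolding ql_kernel_def
proof (intro allI impI)
  fix \<epsilon> :: real assume \<epsilon>: "\<epsilon> > 0"
  then have e2: "\<epsilon> / 2 > 0" by simp
  then obtain n where n: "ql_kernel n" "\<And>x. formbd (\<lambda>\<gamma> \<beta>. m \<gamma> \<beta> - n \<gamma> \<beta>) (fib x) (fib x) (\<epsilon>/2)" using assms by blast
  from ql_kernelD[OF n(1) e2] obtain K where K: "compactin (gtop H) K"
    "\<And>x E F. E \<subseteq> fib x \<Longrightarrow> F \<subseteq> fib x \<Longrightarrow> apart K E F \<Longrightarrow> formbd n E F (\<epsilon>/2)" by metis
  have "formbd m E F \<epsilon>" if "E \<subseteq> fib x" "F \<subseteq> fib x" "apart K E F" for x E F
    using formbd_add[OF K(2)[OF that] formbd_mono[OF n(2) order_refl that(1,2)]] by simp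
  then show "\<exists>K. compactin (gtop H) K \<and> (\<forall>x E F. E \<subseteq> fib x \<and> F \<subseteq> fib x \<and> apart K E F
      \<longrightarrow> formbd m E F \<epsilon>)" using K(1) by blast
qed

text \<open>The intermediate points k of the product are split into the set B of points K'-near to
  the columns and the rest. The rest is K'-apart from the columns, so n is small there. A point of B
  that were K-near to a row would bring that row within L of a column; hence B is K-apart from the
  rows and m is small there.\<close>

lemma ql_kernel_mul:
  assumes m: "ql_kernel m" "\<And>x. formbd m (fib x) (fib x) C" "0 \<le> C"
    and n: "ql_kernel n" "\<And>x. formbd n (fib x) (fib x) D" "0 \<le> D"
  shows "ql_kernel (\<lambda>\<gamma> \<beta>. app m (fib (s \<gamma>)) (\<lambda>k. n k \<beta>) \<gamma>)" (is "ql_kernel ?p")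
proof (rule ql_kernelI)
  fix \<epsilon> :: real assume \<epsilon>: "\<epsilon> > 0"
  \<comment> \<open>The two parts contribute \<delta> D and C \<delta>, at most \<epsilon> in
    total.\<close>
  define \<delta> where "\<delta> = \<epsilon> / (C + D + 1)"
  have CD: "C + D + 1 > 0" using m n by simp
  then have \<delta>: "\<delta> > 0" using \<epsilon> by (simp add: \<delta>_def)
  from ql_kernelD[OF m(1) \<delta>] obtain K where K: "compactin (gtop H) K"
    "\<And>x E F. E \<subseteq> fib x \<Longrightarrow> F \<subseteq> fib x \<Longrightarrow> apart K E F \<Longrightarrow> formbd m E F \<delta>" by metis
  from ql_kernelD[OF n(1) \<delta>] obtain K' where K': "compactin (gtop H) K'"
    "\<And>x E F. E \<subseteq> fib x \<Longrightarrow> F \<subseteq> fib x \<Longrightarrow> apart K' E F \<Longrightarrow> formbd n E F \<delta>" by metis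
  \<comment> \<open>Contains every product of f k\<inverse> and k e\<inverse>. Inverses are added
    because nearness only says that a quotient or its inverse lies in the given set.\<close>
  define L where "L = set_mul H (K \<union> iv ` K) (K' \<union> iv ` K')"
  have cL: "compactin (gtop H) L"
    unfolding L_def by (intro compact_set_mul compactin_Un compact_inverse K K')
  have "formbd ?p E F \<epsilon>" if h: "finite E" "E \<subseteq> fib x" "finite F" "F \<subseteq> fib x" "apart L E F" for x E F
  proof (rule formbdI)
    fix E' F' and a :: "'a \<Rightarrow> complex" assume h': "finite E'" "E' \<subseteq> E" "finite F'" "F' \<subseteq> F"
    define B where "B = {k \<in> fib x. \<exists>e\<in>E'. k \<cdot> iv e \<in> K' \<or> e \<cdot> iv k \<in> K'}"
    have inK: "k \<cdot> iv e \<in> J \<union> iv ` J" if "k \<cdot> iv e \<in> J \<or> e \<cdot> iv k \<in> J" "k \<in> fib x" "e \<in> fib x" for k e J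
    proof -
      have "iv (e \<cdot> iv k) = k \<cdot> iv e" using that(2,3) mul_inverse_inverse by (auto simp: fibre_iff)
      then show ?thesis using that(1) by (metis UnI1 UnI2 imageI)
    qed
    have E'f: "E' \<subseteq> fib x" "F' \<subseteq> fib x" using h h' by auto
    have sepK: "apart K B F'"
      unfolding apart_def
    proof (intro ballI, rule ccontr)
      fix k f assume k: "k \<in> B" and f: "f \<in> F'" and neg: "\<not> (f \<cdot> iv k \<notin> K \<and> k \<cdot> iv f \<notin> K)"
      obtain e where e: "e \<in> E'" "k \<cdot> iv e \<in> K' \<or> e \<cdot> iv k \<in> K'" using k by (auto simp: B_def)
      have kx: "k \<in> fib x" "f \<in> fib x" "e \<in> fib x" using k f e E'f by (auto simp: B_def)
      have "f \<cdot> iv k \<in> K \<union> iv ` K" by (rule inK) (use neg kx in auto)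
      moreover have "k \<cdot> iv e \<in> K' \<union> iv ` K'" by (rule inK) (use e kx in auto)
      moreover have "f \<cdot> iv e = (f \<cdot> iv k) \<cdot> (k \<cdot> iv e)" "s (f \<cdot> iv k) = r (k \<cdot> iv e)"
      proof -
        have "(f \<cdot> iv k) \<cdot> (k \<cdot> iv e) = ((f \<cdot> iv k) \<cdot> k) \<cdot> iv e"
          by (rule mul_assoc[symmetric]) (use kx in \<open>auto simp: fibre_iff\<close>)
        then show "f \<cdot> iv e = (f \<cdot> iv k) \<cdot> (k \<cdot> iv e)" using kx by (simp add: fibre_iff)
        show "s (f \<cdot> iv k) = r (k \<cdot> iv e)" using kx by (simp add: fibre_iff)
      qed
      ultimately have "f \<cdot> iv e \<in> L" unfolding L_def set_mul_def by blast
      then show False using h(5) h' f e unfolding apart_def by blast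
    qed
    have sepK': "apart K' E' (fib x - B)" unfolding apart_def B_def by blast
    define w where "w k = (\<Sum>e\<in>E'. n k e * a e)" for k
    define N where "N = L2_set (\<lambda>e. cmod (a e)) E'"
    have w: "le2 Z w (c * N)" if "formbd n E' Z c" for Z c
      by (rule le2I) (use formbdD[OF that h'(1) order_refl] in \<open>simp add: w_def N_def\<close>)
    have w1: "le2 (fib x) w (D * N)" by (rule w[OF formbd_mono[OF n(2) order_refl E'f(1) order_refl]])
    have w2: "le2 (fib x - B) w (\<delta> * N)" by (rule w[OF K'(2)[OF E'f(1) _ sepK']]) auto
    define wB where "wB k = (if k \<in> B then w k else 0)" for k
    define wC where "wC k = (if k \<in> B then 0 else w k)" for k
    have Bx: "B \<subseteq> fib x" by (auto simp: B_def)
    have wBl: "le2 (fib x) wB (D * N)" by (rule le2_le[OF w1]) (simp add: wB_def)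
    have wCl: "le2 (fib x) wC (\<delta> * N)"
      by (rule le2_support, rule le2_cong[OF le2_mono[OF w2 order_refl]]) (auto simp: wC_def)
    have eq: "(\<Sum>e\<in>E'. ?p \<gamma> e * a e) = app m B w \<gamma> + app m (fib x) wC \<gamma>" if g: "\<gamma> \<in> F'" for \<gamma>
    proof -
      have gx: "\<gamma> \<in> fib x" "s \<gamma> = x" using g E'f by (auto simp: fibre_iff)
      have sm: "(\<lambda>k. m \<gamma> k * (n k e * a e)) summable_on fib x" if "e \<in> E'" for e
      proof (rule app_summable[OF m(2,3) gx(1)])
        have "le2 (fib x) ((\<lambda>x y. cnj (n y x)) e) D"
          by (rule formbd_row[OF formbd_adjoint[OF n(2,3)] n(3)]) (use that E'f in blast)
        then have "le2 (fib x) (\<lambda>k. n k e) D" by (rule le2_le) simp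
        from le2_cmult[OF this, of "a e"] show "le2 (fib x) (\<lambda>k. n k e * a e) (cmod (a e) * D)"
          by (simp add: mult.commute)
      qed
      have "(\<Sum>e\<in>E'. ?p \<gamma> e * a e) = (\<Sum>e\<in>E'. \<Sum>\<^sub>\<infinity>k\<in>fib x. m \<gamma> k * (n k e * a e))"
        unfolding app_def gx(2) by (simp add: mult.assoc flip: infsum_cmult_left')
      also have "\<dots> = (\<Sum>\<^sub>\<infinity>k\<in>fib x. \<Sum>e\<in>E'. m \<gamma> k * (n k e * a e))"
        by (rule infsum_finite_sum(2)[OF h'(1) sm, symmetric])
      also have "\<dots> = app m (fib x) (\<lambda>k. wB k + wC k) \<gamma>"
        unfolding app_def by (intro infsum_cong) (auto simp: wB_def wC_def w_def sum_distrib_left)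
      also have "\<dots> = app m (fib x) wB \<gamma> + app m (fib x) wC \<gamma>"
        by (rule app_add[OF m(2,3) gx(1) wBl wCl])
      also have "app m (fib x) wB \<gamma> = app m B w \<gamma>"
        by (rule app_restrict[OF Bx]) (auto simp: wB_def)
      finally show ?thesis .
    qed
    have b1: "le2 F' (app m B w) (\<delta> * (D * N))"
      by (rule app_bound[OF K(2)[OF Bx E'f(2) sepK] _ le2_mono[OF w1 order_refl Bx]]) (use \<delta> in simp)
    have b2: "le2 F' (app m (fib x) wC) (C * (\<delta> * N))"
      by (rule le2_mono[OF app_bound[OF m(2,3) wCl] order_refl E'f(2)])
    have "L2_set (\<lambda>\<gamma>. cmod (\<Sum>e\<in>E'. ?p \<gamma> e * a e)) F' = L2_set (\<lambda>\<gamma>. cmod (app m B w \<gamma> + app m (fib x) wC \<gamma>)) F'"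
      by (rule L2_set_cong) (auto simp: eq)
    also have "\<dots> \<le> \<delta> * (D * N) + C * (\<delta> * N)"
      by (rule le2D[OF le2_add[OF b1 b2]]) (use h' in auto)
    also have "\<dots> = \<delta> * (C + D) * N" by (simp add: algebra_simps)
    also have "\<dots> \<le> \<epsilon> * N"
    proof (rule mult_right_mono)
      show "\<delta> * (C + D) \<le> \<epsilon>"       proof -
        have "(C + D) / (C + D + 1) \<le> 1" by (subst pos_divide_le_eq[OF CD]) simp
        from mult_left_mono[OF this, of \<epsilon>] show ?thesis
          using \<epsilon> by (simp add: \<delta>_def)
      qed
    qed (simp add: N_def)
    finally show "L2_set (\<lambda>\<gamma>. cmod (\<Sum>e\<in>E'. ?p \<gamma> e * a e)) F' \<le> \<epsilon> * L2_set (\<lambda>x. cmod (a x)) E'"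
      unfolding N_def .
  qed
  then show "\<exists>K. compactin (gtop H) K \<and> (\<forall>x E F. finite E \<and> E \<subseteq> fib x \<and> finite F \<and> F \<subseteq> fib x \<and> apart K E F
    \<longrightarrow> formbd ?p E F \<epsilon>)" using cL by blast
qed

end

section \<open>Operators from quasi-local kernels\<close>

context etale
begin

definition kernel_op :: "('a \<Rightarrow> 'a \<Rightarrow> complex) \<Rightarrow> 'a L2_op" where
  "kernel_op m = (\<lambda>\<xi>\<in>L2 H. \<lambda>\<gamma>. if \<gamma> \<in> A then app m (fib (s \<gamma>)) \<xi> \<gamma> else 0)"

abbreviation pair_top :: "('a \<times> 'a) topology" where
  "pair_top \<equiv> subtopology (prod_topology (gtop H) (gtop H)) {(\<gamma>, \<beta>). s \<gamma> = s \<beta>}"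

lemma kernel_op_bound:
  assumes m: "\<And>x. formbd m (fib x) (fib x) C" "0 \<le> C" and \<xi>: "\<xi> \<in> L2 H" "le2 (fib x) \<xi> c"
  shows "le2 (fib x) (kernel_op m \<xi>) (C * c)"
  by (rule le2_cong[OF app_bound[OF m(1,2) \<xi>(2)]]) (use \<xi>(1) in \<open>auto simp: kernel_op_def fibre_iff\<close>)

text \<open>The image of a compactly supported section is continuous; quasi-locality makes it small
  outside a compact set, so that it can be cut off to a compactly supported section.\<close>

lemma kernel_op_Cc:
  assumes c: "continuous_map pair_top euclidean (\<lambda>(\<gamma>, \<beta>). m \<gamma> \<beta>)"
    and m: "\<And>x. formbd m (fib x) (fib x) C" "0 \<le> C" and q: "ql_kernel m" and \<xi>: "\<xi> \<in> Cc H"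
  shows "kernel_op m \<xi> \<in> L2 H"
proof (rule L2_closed)
  have \<xi>L: "\<xi> \<in> L2 H" using \<xi> Cc_subset_L2 by blast
  obtain D where D: "compactin (gtop H) D" "\<And>\<gamma>. \<gamma> \<notin> D \<Longrightarrow> \<xi> \<gamma> = 0" using \<xi> unfolding Cc_iff by blast
  show "kernel_op m \<xi> \<gamma> = 0" if "\<gamma> \<notin> A" for \<gamma> using that \<xi>L by (simp add: kernel_op_def)
  have "continuous_map (gtop H) euclidean (\<lambda>\<gamma>. \<Sum>\<^sub>\<infinity>h\<in>fib (s \<gamma>). m \<gamma> h * \<xi> h)"
  proof (rule continuous_fibre_sum[OF continuous_source D(1)])
    have "continuous_map pair_top euclidean (\<lambda>p. \<xi> (snd p))"
      using continuous_map_compose[OF continuous_map_from_subtopology[OF continuous_map_snd] Cc_continuous[OF \<xi>]]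
      by (simp add: o_def)
    from continuous_map_complex_mult[OF c this]
    have "continuous_map pair_top euclidean (\<lambda>(\<gamma>, h). m \<gamma> h * \<xi> h)" by (simp add: case_prod_unfold)
    moreover have "{(y, h). s h = s y} = {(\<gamma>, \<beta>). s \<gamma> = s \<beta>}" by auto
    ultimately show "continuous_map (subtopology (prod_topology (gtop H) (gtop H)) {(y, h). s h = s y})
      euclidean (\<lambda>(\<gamma>, h). m \<gamma> h * \<xi> h)" by simp
  qed (simp add: D(2))
  then have cont: "continuous_map (gtop H) euclidean (kernel_op m \<xi>)"
    by (rule continuous_map_eq) (simp add: kernel_op_def \<xi>L app_def)
  obtain N where N: "\<And>x. le2 (fib x) \<xi> N" using Cc_le2[OF \<xi>] by metis
  have N0: "0 \<le> N" using N le2_nonneg by blast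
  fix \<epsilon> :: real assume \<epsilon>: "\<epsilon> > 0"
  then have "\<epsilon> / (N + 1) > 0" using N0 by simp
  from ql_kernelD[OF q this] obtain K where K: "compactin (gtop H) K"
    "\<And>x E F. E \<subseteq> fib x \<Longrightarrow> F \<subseteq> fib x \<Longrightarrow> apart K E F \<Longrightarrow> formbd m E F (\<epsilon> / (N + 1))" by metis
  \<comment> \<open>An arrow outside L is K-apart from the arrows of D with the same source, hence
    from the support of \<xi>. So L is where the cut-off function has to equal 1.\<close>
  define L where "L = set_mul H (K \<union> iv ` K) D"
  have cL: "compactin (gtop H) L"
    unfolding L_def by (intro compact_set_mul compactin_Un compact_inverse K D)
  have "L \<subseteq> A" using cL compactin_subset_topspace by blast
  from Cc_bump[OF cL openin_topspace this] obtain u where u: "u \<in> Cc H" "\<And>x. cmod (1 - u x) \<le> 1"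
    "\<And>x. x \<in> L \<Longrightarrow> u x = 1" by metis
  have "(\<lambda>\<gamma>. kernel_op m \<xi> \<gamma> * u \<gamma>) \<in> Cc H" by (rule Cc_mult_continuous[OF cont u(1)])
  then have cut: "(\<lambda>\<gamma>. kernel_op m \<xi> \<gamma> * u \<gamma>) \<in> L2 H" using Cc_subset_L2 by blast
  have "le2 (fib x) (\<lambda>\<gamma>. kernel_op m \<xi> \<gamma> - kernel_op m \<xi> \<gamma> * u \<gamma>) \<epsilon>" for x
  proof -
    have sp: "apart K (fib x \<inter> D) (fib x - L)"
      unfolding apart_def
    proof (intro ballI, rule ccontr)
      fix e f assume e: "e \<in> fib x \<inter> D" and f: "f \<in> fib x - L" and neg: "\<not> (f \<cdot> iv e \<notin> K \<and> e \<cdot> iv f \<notin> K)"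
      have A: "e \<in> A" "f \<in> A" "s e = s f" using e f by (auto simp: fibre_iff)
      have "f \<cdot> iv e = iv (e \<cdot> iv f)" using mul_inverse_inverse[of e f] A by simp
      then have "f \<cdot> iv e \<in> K \<union> iv ` K" using neg by auto
      moreover have "f = (f \<cdot> iv e) \<cdot> e" "s (f \<cdot> iv e) = r e" using A by auto
      ultimately have "f \<in> L" unfolding L_def set_mul_def using e by blast
      then show False using f by blast
    qed
    have fb: "formbd m (fib x \<inter> D) (fib x - L) (\<epsilon> / (N + 1))" by (rule K(2)[OF _ _ sp]) auto
    have "le2 (fib x - L) (app m (fib x \<inter> D) \<xi>) (\<epsilon> / (N + 1) * N)"
      by (rule app_bound[OF fb _ le2_mono[OF N order_refl]]) (use \<epsilon> N0 in auto)
    then have "le2 (fib x - L) (kernel_op m \<xi>) (\<epsilon> / (N + 1) * N)"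
    proof (rule le2_cong)
      fix \<gamma> assume "\<gamma> \<in> fib x - L"
      then have "kernel_op m \<xi> \<gamma> = app m (fib x) \<xi> \<gamma>" by (simp add: kernel_op_def \<xi>L fibre_iff)
      also have "\<dots> = app m (fib x \<inter> D) \<xi> \<gamma>" by (rule app_restrict) (use D in auto)
      finally show "kernel_op m \<xi> \<gamma> = app m (fib x \<inter> D) \<xi> \<gamma>" .
    qed
    moreover have "\<epsilon> / (N + 1) * N \<le> \<epsilon>" using \<epsilon> N0 by (simp add: field_simps)
    ultimately have "le2 (fib x - L) (kernel_op m \<xi>) \<epsilon>" by (rule le2_mono) simp
    then have "le2 (fib x - L) (\<lambda>\<gamma>. kernel_op m \<xi> \<gamma> - kernel_op m \<xi> \<gamma> * u \<gamma>) \<epsilon>"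
    proof (rule le2_le)
      fix \<gamma>
      have "cmod (kernel_op m \<xi> \<gamma> - kernel_op m \<xi> \<gamma> * u \<gamma>) = cmod (kernel_op m \<xi> \<gamma>) * cmod (1 - u \<gamma>)"
        by (simp add: algebra_simps flip: norm_mult)
      also have "\<dots> \<le> cmod (kernel_op m \<xi> \<gamma>)" by (rule mult_left_le[OF u(2)]) simp
      finally show "cmod (kernel_op m \<xi> \<gamma> - kernel_op m \<xi> \<gamma> * u \<gamma>) \<le> cmod (kernel_op m \<xi> \<gamma>)" .
    qed
    then have "le2 (fib x \<inter> {\<gamma>. kernel_op m \<xi> \<gamma> - kernel_op m \<xi> \<gamma> * u \<gamma> \<noteq> 0}) (\<lambda>\<gamma>. kernel_op m \<xi> \<gamma> - kernel_op m \<xi> \<gamma> * u \<gamma>) \<epsilon>"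
      by (rule le2_mono[OF _ order_refl]) (use u(3) in auto)
    then show ?thesis by (rule le2_support)
  qed
  then show "\<exists>\<eta>\<in>L2 H. \<forall>x. le2 (fib x) (\<lambda>\<gamma>. kernel_op m \<xi> \<gamma> - \<eta> \<gamma>) \<epsilon>"
    by (intro bexI[OF _ cut]) blast
qed

lemma kernel_op_L2:
  assumes c: "continuous_map pair_top euclidean (\<lambda>(\<gamma>, \<beta>). m \<gamma> \<beta>)"
    and m: "\<And>x. formbd m (fib x) (fib x) C" "0 \<le> C" and q: "ql_kernel m" and \<xi>: "\<xi> \<in> L2 H"
  shows "kernel_op m \<xi> \<in> L2 H"
proof (rule L2_closed)
  show "kernel_op m \<xi> \<gamma> = 0" if "\<gamma> \<notin> A" for \<gamma> using that \<xi> by (simp add: kernel_op_def)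
  fix \<epsilon> :: real assume \<epsilon>: "\<epsilon> > 0"
  then have "\<epsilon> / (C + 1) > 0" using m(2) by simp
  then obtain \<eta> where \<eta>: "\<eta> \<in> Cc H" "\<forall>x. le2 (fib x) (\<lambda>\<gamma>. \<xi> \<gamma> - \<eta> \<gamma>) (\<epsilon> / (C + 1))"
    using \<xi> unfolding L2_iff by meson
  have \<eta>L: "\<eta> \<in> L2 H" using \<eta>(1) Cc_subset_L2 by blast
  have dL: "(\<lambda>\<gamma>. \<xi> \<gamma> - \<eta> \<gamma>) \<in> L2 H" by (rule L2_diff[OF \<xi> \<eta>L])
  have "le2 (fib x) (\<lambda>\<gamma>. kernel_op m \<xi> \<gamma> - kernel_op m \<eta> \<gamma>) \<epsilon>" for x
  proof -
    have "le2 (fib x) (kernel_op m (\<lambda>\<gamma>. \<xi> \<gamma> - \<eta> \<gamma>)) (C * (\<epsilon> / (C + 1)))"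
      by (rule kernel_op_bound[OF m dL \<eta>(2)[rule_format]])
    moreover have "C * (\<epsilon> / (C + 1)) \<le> \<epsilon>" using m(2) \<epsilon> by (simp add: field_simps)
    ultimately have "le2 (fib x) (kernel_op m (\<lambda>\<gamma>. \<xi> \<gamma> - \<eta> \<gamma>)) \<epsilon>" by (rule le2_mono) simp
    then show ?thesis
    proof (rule le2_cong)
      fix \<gamma> assume g: "\<gamma> \<in> fib x"
      have "app m (fib x) \<xi> \<gamma> = app m (fib x) (\<lambda>\<gamma>. (\<xi> \<gamma> - \<eta> \<gamma>) + \<eta> \<gamma>) \<gamma>" by simp
      also have "\<dots> = app m (fib x) (\<lambda>\<gamma>. \<xi> \<gamma> - \<eta> \<gamma>) \<gamma> + app m (fib x) \<eta> \<gamma>"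
        by (rule app_add[OF m g \<eta>(2)[rule_format] L2_le2_norm(1)[OF \<eta>L]])
      finally show "kernel_op m \<xi> \<gamma> - kernel_op m \<eta> \<gamma> = kernel_op m (\<lambda>\<gamma>. \<xi> \<gamma> - \<eta> \<gamma>) \<gamma>"
        using g dL \<xi> \<eta>L by (simp add: kernel_op_def fibre_iff)
    qed
  qed
  then show "\<exists>\<zeta>\<in>L2 H. \<forall>x. le2 (fib x) (\<lambda>\<gamma>. kernel_op m \<xi> \<gamma> - \<zeta> \<gamma>) \<epsilon>"
    using kernel_op_Cc[OF c m q \<eta>(1)] by blast
qed

text \<open>Continuity, boundedness and quasi-locality are preserved by conjugate transposition, so
  the transposed kernel also defines an operator, and \<open>app_adjoint\<close> on each fibre shows
  that it is the adjoint.\<close>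

lemma kernel_op_adjointable:
  assumes c: "continuous_map pair_top euclidean (\<lambda>(\<gamma>, \<beta>). m \<gamma> \<beta>)"
    and m: "\<And>x. formbd m (fib x) (fib x) C" "0 \<le> C" and q: "ql_kernel m"
  shows "kernel_op m \<in> adjointable H" "\<And>\<gamma> \<beta>. \<gamma> \<in> A \<Longrightarrow> \<beta> \<in> A \<Longrightarrow> s \<gamma> = s \<beta> \<Longrightarrow> kernel (kernel_op m) \<gamma> \<beta> = m \<gamma> \<beta>"
proof -
  define n where "n \<gamma> \<beta> = cnj (m \<beta> \<gamma>)" for \<gamma> \<beta>
  have n1: "formbd n (fib x) (fib x) C" for x
    unfolding n_def[abs_def] by (rule formbd_adjoint[OF m])
  have n2: "ql_kernel n" unfolding n_def[abs_def] by (rule ql_kernel_adjoint[OF q])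
  have n3: "continuous_map pair_top euclidean (\<lambda>(\<gamma>, \<beta>). n \<gamma> \<beta>)"
  proof -
    have "continuous_map pair_top pair_top (\<lambda>(\<gamma>, \<beta>). (\<beta>, \<gamma>))"
      by (auto simp: continuous_map_in_subtopology case_prod_unfold continuous_map_paired
          intro: continuous_map_from_subtopology continuous_map_fst continuous_map_snd)
    from continuous_map_cnj[OF continuous_map_compose[OF this c]]
    show ?thesis by (simp add: o_def case_prod_unfold n_def)
  qed
  note K = kernel_op_L2[OF c m q] kernel_op_L2[OF n3 n1 m(2) n2]
  show "kernel_op m \<in> adjointable H"
  proof (rule adjointableI(2))
    have ext: "kernel_op k \<in> extensional (L2 H)" for k by (simp add: kernel_op_def)
    show "kernel_op m \<in> L2 H \<rightarrow>\<^sub>E L2 H" "kernel_op n \<in> L2 H \<rightarrow>\<^sub>E L2 H" using K ext by (auto simp: PiE_def)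
    fix \<xi> \<eta> x assume \<xi>: "\<xi> \<in> L2 H" and \<eta>: "\<eta> \<in> L2 H"
    have "L2_inner H (kernel_op m \<xi>) \<eta> x = (\<Sum>\<^sub>\<infinity>\<gamma>\<in>fib x. cnj (app m (fib x) \<xi> \<gamma>) * \<eta> \<gamma>)"
      unfolding L2_inner_def by (intro infsum_cong) (use \<xi> in \<open>auto simp: kernel_op_def fibre_iff\<close>)
    also have "\<dots> = (\<Sum>\<^sub>\<infinity>\<gamma>\<in>fib x. cnj (\<xi> \<gamma>) * app n (fib x) \<eta> \<gamma>)"
      unfolding n_def[abs_def] by (rule app_adjoint[OF m L2_le2_norm(1)[OF \<xi>] L2_le2_norm(1)[OF \<eta>]])
    also have "\<dots> = L2_inner H \<xi> (kernel_op n \<eta>) x"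
      unfolding L2_inner_def by (intro infsum_cong) (use \<eta> in \<open>auto simp: kernel_op_def fibre_iff\<close>)
    finally show "L2_inner H (kernel_op m \<xi>) \<eta> x = L2_inner H \<xi> (kernel_op n \<eta>) x" .
  qed
  show "kernel (kernel_op m) \<gamma> \<beta> = m \<gamma> \<beta>" if h: "\<gamma> \<in> A" "\<beta> \<in> A" "s \<gamma> = s \<beta>" for \<gamma> \<beta>
  proof -
    have "kernel (kernel_op m) \<gamma> \<beta> = app m (fib (s \<gamma>)) (dirac \<beta>) \<gamma>" by (simp add: kernel_def kernel_op_def dirac_L2 h)
    also have "\<dots> = app m {\<beta>} (\<lambda>_. 1) \<gamma>"
      by (rule app_restrict) (use h dirac(2)[OF h(2)] in \<open>auto simp: fibre_iff\<close>)
    finally show ?thesis by (simp add: app_def)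
  qed
qed

subsection \<open>Equivariance\<close>

lemma rho_apply:
  assumes "\<xi> \<in> L2 H" "\<gamma> \<in> A"
  shows "rho H g \<xi> \<gamma> = (\<Sum>\<^sub>\<infinity>\<beta>\<in>fib (s \<gamma>). g \<beta> * \<xi> (\<gamma> \<cdot> iv \<beta>))"
  using assms by (simp add: rho_def)

lemma right_translate:
  assumes "b \<in> A"
  shows "bij_betw (\<lambda>h. h \<cdot> iv b) (fib (s b)) (fib (r b))"
proof (rule bij_betwI[where g="\<lambda>k. k \<cdot> b"])
  show "(\<lambda>h. h \<cdot> iv b) \<in> fib (s b) \<rightarrow> fib (r b)" "(\<lambda>k. k \<cdot> b) \<in> fib (r b) \<rightarrow> fib (s b)"
    using assms by (auto simp: fibre_iff)
  show "x \<cdot> iv b \<cdot> b = x" if "x \<in> fib (s b)" for x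
    using assms that by (simp add: fibre_iff)
  show "y \<cdot> b \<cdot> iv b = y" if "y \<in> fib (r b)" for y
    using assms that by (simp add: fibre_iff)
qed

lemma le2_right_translate:
  assumes "b \<in> A" "le2 (fib (r b)) \<xi> c"
  shows "le2 (fib (s b)) (\<lambda>h. \<xi> (h \<cdot> iv b)) c"
proof (rule le2_reindex[of "\<lambda>k. k \<cdot> b" "fib (r b)"])
  have "bij_betw (\<lambda>h. h \<cdot> iv (iv b)) (fib (s (iv b))) (fib (r (iv b)))"
    by (rule right_translate) (use assms in simp)
  then show "bij_betw (\<lambda>k. k \<cdot> b) (fib (r b)) (fib (s b))" using assms(1) by simp
  show "le2 (fib (r b)) (\<lambda>x. \<xi> (x \<cdot> b \<cdot> iv b)) c"
    by (rule le2_cong[OF assms(2)]) (use assms(1) in \<open>auto simp: fibre_iff\<close>)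
qed

text \<open>On a fixed fibre \<rho>(g) is a finite combination of right translations, over a set B
  that depends neither on the point nor on the vector. This allows it to be interchanged with the
  infinite sum of a kernel.\<close>

lemma rho_sum:
  assumes "g \<in> Cc H" "\<xi> \<in> L2 H"
  obtains B where "finite B" "B \<subseteq> fib x"
    "\<And>\<gamma> \<zeta>. \<gamma> \<in> fib x \<Longrightarrow> \<zeta> \<in> L2 H \<Longrightarrow> rho H g \<zeta> \<gamma> = (\<Sum>b\<in>B. g b * \<zeta> (\<gamma> \<cdot> iv b))"
proof -
  obtain D where D: "compactin (gtop H) D" "\<And>\<gamma>. \<gamma> \<notin> D \<Longrightarrow> g \<gamma> = 0" using assms(1) unfolding Cc_iff by blast
  have fin: "finite (fib x \<inter> D)" by (rule finite_fibre_compact[OF D(1)])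
  show thesis
  proof (rule that[OF fin])
    fix \<gamma> \<zeta> assume "\<gamma> \<in> fib x" and z: "\<zeta> \<in> L2 H"
    then have "\<gamma> \<in> A" "s \<gamma> = x" by (auto simp: fibre_iff)
    then have "rho H g \<zeta> \<gamma> = (\<Sum>\<^sub>\<infinity>\<beta>\<in>fib x. g \<beta> * \<zeta> (\<gamma> \<cdot> iv \<beta>))" using rho_apply[OF z] by simp
    also have "\<dots> = (\<Sum>\<^sub>\<infinity>\<beta>\<in>fib x \<inter> D. g \<beta> * \<zeta> (\<gamma> \<cdot> iv \<beta>))"
      by (rule infsum_cong_neutral) (use D(2) in auto)
    finally show "rho H g \<zeta> \<gamma> = (\<Sum>b\<in>fib x \<inter> D. g b * \<zeta> (\<gamma> \<cdot> iv b))" using fin by simp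
  qed auto
qed

text \<open>Right translations are isometries between fibres, so the l1 bound of g on fibres bounds
  \<rho>(g). This reduces the claim to compactly supported \<eta>, where the result is continuous
  and supported in the product of the two supports.\<close>

lemma rho_L2:
  assumes g: "g \<in> Cc H" and \<xi>: "\<xi> \<in> L2 H"
  shows "rho H g \<xi> \<in> L2 H"
proof (rule L2_closed)
  show "rho H g \<xi> \<gamma> = 0" if "\<gamma> \<notin> A" for \<gamma> using that \<xi> by (simp add: rho_def)
  obtain B where B: "0 \<le> B" "\<And>x F. finite F \<Longrightarrow> F \<subseteq> fib x \<Longrightarrow> (\<Sum>\<gamma>\<in>F. cmod (g \<gamma>)) \<le> B"
    using Cc_fibre_sum_bounded[OF g] by metis
  obtain D where D: "compactin (gtop H) D" "\<And>\<gamma>. \<gamma> \<notin> D \<Longrightarrow> g \<gamma> = 0" using g unfolding Cc_iff by blast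
  fix \<epsilon> :: real assume \<epsilon>: "\<epsilon> > 0"
  then have "\<epsilon> / (B + 1) > 0" using B by simp
  then obtain \<eta> where \<eta>: "\<eta> \<in> Cc H" "\<forall>x. le2 (fib x) (\<lambda>\<gamma>. \<xi> \<gamma> - \<eta> \<gamma>) (\<epsilon> / (B + 1))"
    using \<xi> unfolding L2_iff by meson
  have \<eta>L: "\<eta> \<in> L2 H" using \<eta>(1) Cc_subset_L2 by blast
  have dL: "(\<lambda>\<gamma>. \<xi> \<gamma> - \<eta> \<gamma>) \<in> L2 H" by (rule L2_diff[OF \<xi> \<eta>L])
  have "le2 (fib x) (\<lambda>\<gamma>. rho H g \<xi> \<gamma> - rho H g \<eta> \<gamma>) \<epsilon>" for x
  proof -
    obtain F where F: "finite F" "F \<subseteq> fib x"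
      "\<And>\<gamma> \<zeta>. \<gamma> \<in> fib x \<Longrightarrow> \<zeta> \<in> L2 H \<Longrightarrow> rho H g \<zeta> \<gamma> = (\<Sum>b\<in>F. g b * \<zeta> (\<gamma> \<cdot> iv b))"
      using rho_sum[OF g \<xi>] by metis
    have "le2 (fib x) (\<lambda>h. \<Sum>b\<in>F. g b * (\<xi> (h \<cdot> iv b) - \<eta> (h \<cdot> iv b))) (\<Sum>b\<in>F. cmod (g b) * (\<epsilon> / (B + 1)))"
    proof (rule le2_sum[OF F(1)], rule le2_cmult)
      fix b assume "b \<in> F"
      then have b: "b \<in> A" "s b = x" using F(2) by (auto simp: fibre_iff)
      then show "le2 (fib x) (\<lambda>h. \<xi> (h \<cdot> iv b) - \<eta> (h \<cdot> iv b)) (\<epsilon> / (B + 1))"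
        using le2_right_translate[OF b(1) \<eta>(2)[rule_format]] by simp
    qed
    then have "le2 (fib x) (\<lambda>\<gamma>. rho H g \<xi> \<gamma> - rho H g \<eta> \<gamma>) (\<Sum>b\<in>F. cmod (g b) * (\<epsilon> / (B + 1)))"
      by (rule le2_cong) (simp add: F(3) \<xi> \<eta>L sum_subtractf right_diff_distrib)
    moreover have "(\<Sum>b\<in>F. cmod (g b) * (\<epsilon> / (B + 1))) \<le> \<epsilon>"
    proof -
      have "(\<Sum>b\<in>F. cmod (g b) * (\<epsilon> / (B + 1))) = (\<Sum>b\<in>F. cmod (g b)) * (\<epsilon> / (B + 1))"
        by (rule sum_distrib_right[symmetric])
      also have "\<dots> \<le> B * (\<epsilon> / (B + 1))" by (rule mult_right_mono[OF B(2)[OF F(1,2)]]) (use \<epsilon> B in simp)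
      also have "\<dots> \<le> \<epsilon>" using \<epsilon> B by (simp add: field_simps)
      finally show ?thesis .
    qed
    ultimately show ?thesis by (rule le2_mono) simp
  qed
  moreover have "rho H g \<eta> \<in> L2 H"
  proof -
    obtain E where E: "compactin (gtop H) E" "\<And>\<gamma>. \<gamma> \<notin> E \<Longrightarrow> \<eta> \<gamma> = 0" using \<eta>(1) unfolding Cc_iff by blast
    have "continuous_map (gtop H) euclidean (\<lambda>\<gamma>. \<Sum>\<^sub>\<infinity>h\<in>fib (s \<gamma>). g h * \<eta> (\<gamma> \<cdot> iv h))"
    proof (rule continuous_fibre_sum[OF continuous_source D(1)])
      let ?P = "subtopology (prod_topology (gtop H) (gtop H)) {(y, h). s h = s y}"
      have c1: "continuous_map ?P (gtop H) fst" and c2: "continuous_map ?P (gtop H) snd"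
        by (auto intro: continuous_map_from_subtopology continuous_map_fst continuous_map_snd)
      have c3: "continuous_map ?P (gtop H) (\<lambda>p. fst p \<cdot> iv (snd p))"
        by (rule continuous_mul[OF c1 continuous_inverse_comp[OF c2]]) auto
      have "continuous_map ?P euclidean (\<lambda>p. g (snd p) * \<eta> (fst p \<cdot> iv (snd p)))"
        using continuous_map_complex_mult[OF continuous_map_compose[OF c2 Cc_continuous[OF g]]
            continuous_map_compose[OF c3 Cc_continuous[OF \<eta>(1)]]] by (simp add: o_def)
      then show "continuous_map ?P euclidean (\<lambda>(\<gamma>, h). g h * \<eta> (\<gamma> \<cdot> iv h))" by (simp add: case_prod_unfold)
    qed (simp add: D(2))
    then have cont: "continuous_map (gtop H) euclidean (rho H g \<eta>)"
      by (rule continuous_map_eq) (simp add: rho_def \<eta>L)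
    have "rho H g \<eta> \<gamma> = 0" if "\<gamma> \<notin> set_mul H E D" for \<gamma>
    proof (cases "\<gamma> \<in> A")
      case True
      have "g h * \<eta> (\<gamma> \<cdot> iv h) = 0" if h: "h \<in> fib (s \<gamma>)" for h
      proof (rule ccontr)
        assume "g h * \<eta> (\<gamma> \<cdot> iv h) \<noteq> 0"
        then have "h \<in> D" "\<gamma> \<cdot> iv h \<in> E" using D(2) E(2) by auto
        moreover have "\<gamma> = (\<gamma> \<cdot> iv h) \<cdot> h" "s (\<gamma> \<cdot> iv h) = r h" using h True by (auto simp: fibre_iff)
        ultimately have "\<gamma> \<in> set_mul H E D" unfolding set_mul_def by blast
        then show False using \<open>\<gamma> \<notin> set_mul H E D\<close> by blast
      qed
      then show ?thesis by (simp add: rho_apply[OF \<eta>L True] infsum_0)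
    qed (simp add: rho_def \<eta>L)
    then have "rho H g \<eta> \<in> Cc H" unfolding Cc_iff using cont compact_set_mul[OF E(1) D(1)] by blast
    then show ?thesis using Cc_subset_L2 by blast
  qed
  ultimately show "\<exists>\<zeta>\<in>L2 H. \<forall>x. le2 (fib x) (\<lambda>\<gamma>. rho H g \<xi> \<gamma> - \<zeta> \<gamma>) \<epsilon>" by blast
qed

lemma rho_dirac:
  assumes b: "b \<in> A" and \<xi>: "\<xi> \<in> L2 H" and h: "h \<in> fib (s b)"
  shows "rho H (dirac b) \<xi> h = \<xi> (h \<cdot> iv b)"
proof -
  have "rho H (dirac b) \<xi> h = (\<Sum>\<^sub>\<infinity>\<beta>\<in>fib (s b). dirac b \<beta> * \<xi> (h \<cdot> iv \<beta>))"
    using rho_apply[OF \<xi>, of h] h by (simp add: fibre_iff)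
  also have "\<dots> = (\<Sum>\<^sub>\<infinity>\<beta>\<in>{b}. \<xi> (h \<cdot> iv \<beta>))"
    by (rule infsum_cong_neutral) (use dirac(2)[OF b] b in \<open>auto simp: fibre_iff\<close>)
  finally show ?thesis by simp
qed

text \<open>On the fibre of b the operator \<rho>(\<open>dirac b\<close>) is the translation h
  \<mapsto> h b\<inverse> of the argument, and it sends \<open>dirac \<beta>\<close> to the point
  mass at \<beta> b; testing equivariance on it gives the invariance of the kernel. Conversely
  \<rho>(g) is a finite combination of translations on each fibre, and each of them passes through
  an invariant kernel by reindexing the sum.\<close>

lemma equivariant_iff:
  assumes T: "T \<in> adjointable H"
  shows "equivariant H T \<longleftrightarrow> (\<forall>\<gamma>\<in>A. \<forall>\<beta>\<in>A. \<forall>b\<in>A. s \<gamma> = r b \<and> s \<beta> = r b \<longrightarrow> kernel T (\<gamma> \<cdot> b) (\<beta> \<cdot> b) = kernel T \<gamma> \<beta>)"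
proof
  assume eq: "equivariant H T"
  show "\<forall>\<gamma>\<in>A. \<forall>\<beta>\<in>A. \<forall>b\<in>A. s \<gamma> = r b \<and> s \<beta> = r b \<longrightarrow> kernel T (\<gamma> \<cdot> b) (\<beta> \<cdot> b) = kernel T \<gamma> \<beta>"
  proof (intro ballI impI)
    fix \<gamma> \<beta> b assume A: "\<gamma> \<in> A" "\<beta> \<in> A" "b \<in> A" and "s \<gamma> = r b \<and> s \<beta> = r b"
    then have s: "s \<gamma> = r b" "s \<beta> = r b" by auto
    define \<zeta> where "\<zeta> = rho H (dirac b) (dirac \<beta>)"
    have \<zeta>L: "\<zeta> \<in> L2 H" unfolding \<zeta>_def by (rule rho_L2[OF dirac(1)[OF A(3)] dirac_L2[OF A(2)]])
    have "op_mul H T (rho H (dirac b)) (dirac \<beta>) = op_mul H (rho H (dirac b)) T (dirac \<beta>)"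
      using eq dirac(1)[OF A(3)] unfolding equivariant_def by metis
    then have e: "T \<zeta> = rho H (dirac b) (T (dirac \<beta>))"
      using dirac_L2[OF A(2)] by (simp add: op_mul_def compose_def \<zeta>_def)
    have val: "\<zeta> h = (if h = \<beta> \<cdot> b then 1 else 0)" if h: "h \<in> fib (s b)" for h
    proof -
      have "\<zeta> h = dirac \<beta> (h \<cdot> iv b)" unfolding \<zeta>_def by (rule rho_dirac[OF A(3) dirac_L2[OF A(2)] h])
      also have "\<dots> = (if h \<cdot> iv b = \<beta> then 1 else 0)"
        by (rule dirac(2)[OF A(2)]) (use h A s in \<open>auto simp: fibre_iff\<close>)
      also have "h \<cdot> iv b = \<beta> \<longleftrightarrow> h = \<beta> \<cdot> b"
        using h A s inverse_cancel(3)[of \<beta> b] inverse_cancel(4)[of h b] by (auto simp: fibre_iff)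
      finally show ?thesis .
    qed
    have "T \<zeta> (\<gamma> \<cdot> b) = app (kernel T) (fib (s b)) \<zeta> (\<gamma> \<cdot> b)"
      using kernel_apply[OF T \<zeta>L, of "\<gamma> \<cdot> b"] A s by simp
    also have "\<dots> = app (kernel T) {\<beta> \<cdot> b} (\<lambda>_. 1) (\<gamma> \<cdot> b)"
      by (rule app_restrict) (use val A s in \<open>auto simp: fibre_iff\<close>)
    finally have "T \<zeta> (\<gamma> \<cdot> b) = kernel T (\<gamma> \<cdot> b) (\<beta> \<cdot> b)" by (simp add: app_def)
    moreover have "rho H (dirac b) (T (dirac \<beta>)) (\<gamma> \<cdot> b) = kernel T \<gamma> \<beta>"
      using rho_dirac[OF A(3) adjointable_L2[OF T dirac_L2[OF A(2)]], of "\<gamma> \<cdot> b"] A s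
      by (simp add: fibre_iff kernel_def)
    ultimately show "kernel T (\<gamma> \<cdot> b) (\<beta> \<cdot> b) = kernel T \<gamma> \<beta>" using e by simp
  qed
next
  assume eq: "\<forall>\<gamma>\<in>A. \<forall>\<beta>\<in>A. \<forall>b\<in>A. s \<gamma> = r b \<and> s \<beta> = r b \<longrightarrow> kernel T (\<gamma> \<cdot> b) (\<beta> \<cdot> b) = kernel T \<gamma> \<beta>"
  show "equivariant H T"
    unfolding equivariant_def
  proof (intro ballI ext)
    fix g \<xi> \<gamma> assume g: "g \<in> Cc H"
    show "op_mul H T (rho H g) \<xi> \<gamma> = op_mul H (rho H g) T \<xi> \<gamma>"
    proof (cases "\<xi> \<in> L2 H")
      case \<xi>: True
      note R = rho_L2[OF g \<xi>]
      note TL = adjointable_L2[OF T \<xi>]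
      have "T (rho H g \<xi>) \<gamma> = rho H g (T \<xi>) \<gamma>"
      proof (cases "\<gamma> \<in> A")
        case ga: True
        define x where "x = s \<gamma>"
        have gx: "\<gamma> \<in> fib x" using ga by (simp add: x_def fibre_iff)
        obtain B where B: "finite B" "B \<subseteq> fib x"
          "\<And>\<gamma> \<zeta>. \<gamma> \<in> fib x \<Longrightarrow> \<zeta> \<in> L2 H \<Longrightarrow> rho H g \<zeta> \<gamma> = (\<Sum>b\<in>B. g b * \<zeta> (\<gamma> \<cdot> iv b))"
          using rho_sum[OF g \<xi>] by metis
        have sm: "(\<lambda>h. kernel T \<gamma> h * (g b * \<xi> (h \<cdot> iv b))) summable_on fib x"
          and tr: "T \<xi> (\<gamma> \<cdot> iv b) = (\<Sum>\<^sub>\<infinity>h\<in>fib x. kernel T \<gamma> h * \<xi> (h \<cdot> iv b))" if "b \<in> B" for b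
        proof -
          have b: "b \<in> A" "s b = x" using that B(2) by (auto simp: fibre_iff)
          have l: "le2 (fib x) (\<lambda>h. \<xi> (h \<cdot> iv b)) (L2_norm H \<xi>)"
            using le2_right_translate[OF b(1) L2_le2_norm(1)[OF \<xi>]] b by simp
          show "(\<lambda>h. kernel T \<gamma> h * (g b * \<xi> (h \<cdot> iv b))) summable_on fib x"
            by (rule app_summable[OF op_norm_formbd(2)[OF T] op_norm_formbd(1)[OF T] gx le2_cmult[OF l]])
          have gb: "\<gamma> \<cdot> iv b \<in> A" "s (\<gamma> \<cdot> iv b) = r b" using gx b by (auto simp: fibre_iff)
          have "T \<xi> (\<gamma> \<cdot> iv b) = (\<Sum>\<^sub>\<infinity>k\<in>fib (r b). kernel T (\<gamma> \<cdot> iv b) k * \<xi> k)"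
            using kernel_apply[OF T \<xi> gb(1)] gb(2) by (simp add: app_def)
          also have "\<dots> = (\<Sum>\<^sub>\<infinity>h\<in>fib (s b). kernel T (\<gamma> \<cdot> iv b) (h \<cdot> iv b) * \<xi> (h \<cdot> iv b))"
            by (rule infsum_reindex_bij_betw[OF right_translate[OF b(1)], symmetric])
          also have "\<dots> = (\<Sum>\<^sub>\<infinity>h\<in>fib x. kernel T \<gamma> h * \<xi> (h \<cdot> iv b))"
            unfolding b(2)
          proof (rule infsum_cong)
            fix h assume h: "h \<in> fib x"
            have "kernel T ((\<gamma> \<cdot> iv b) \<cdot> b) ((h \<cdot> iv b) \<cdot> b) = kernel T (\<gamma> \<cdot> iv b) (h \<cdot> iv b)"
              by (rule eq[rule_format]) (use h gx b in \<open>auto simp: fibre_iff\<close>)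
            then show "kernel T (\<gamma> \<cdot> iv b) (h \<cdot> iv b) * \<xi> (h \<cdot> iv b) = kernel T \<gamma> h * \<xi> (h \<cdot> iv b)"
              using h gx b by (simp add: fibre_iff)
          qed
          finally show "T \<xi> (\<gamma> \<cdot> iv b) = (\<Sum>\<^sub>\<infinity>h\<in>fib x. kernel T \<gamma> h * \<xi> (h \<cdot> iv b))" .
        qed
        have "T (rho H g \<xi>) \<gamma> = (\<Sum>\<^sub>\<infinity>h\<in>fib x. kernel T \<gamma> h * rho H g \<xi> h)"
          using kernel_apply[OF T R ga] by (simp add: app_def x_def)
        also have "\<dots> = (\<Sum>\<^sub>\<infinity>h\<in>fib x. \<Sum>b\<in>B. kernel T \<gamma> h * (g b * \<xi> (h \<cdot> iv b)))"
          by (intro infsum_cong) (simp add: B(3)[OF _ \<xi>] sum_distrib_left)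
        also have "\<dots> = (\<Sum>b\<in>B. \<Sum>\<^sub>\<infinity>h\<in>fib x. kernel T \<gamma> h * (g b * \<xi> (h \<cdot> iv b)))"
          by (rule infsum_finite_sum(2)[OF B(1) sm])
        also have "\<dots> = (\<Sum>b\<in>B. g b * T \<xi> (\<gamma> \<cdot> iv b))"
          by (intro sum.cong refl) (simp add: tr mult.left_commute flip: infsum_cmult_right')
        also have "\<dots> = rho H g (T \<xi>) \<gamma>" by (rule B(3)[OF gx TL, symmetric])
        finally show ?thesis .
      next
        case False
        show ?thesis
          using L2_outside[OF adjointable_L2[OF T R] False] L2_outside[OF rho_L2[OF g TL] False] by simp
      qed
      then show ?thesis using \<xi> by (simp add: op_mul_def compose_def)
    next
      case False
      then show ?thesis by (simp add: op_mul_def compose_def)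
    qed
  qed
qed

section \<open>Invariant kernels and the two C*-subalgebras\<close>

definition invariant_kernel :: "('a \<Rightarrow> 'a \<Rightarrow> complex) \<Rightarrow> bool" where
  "invariant_kernel m \<longleftrightarrow> (\<forall>\<gamma>\<in>A. \<forall>\<beta>\<in>A. \<forall>b\<in>A. s \<gamma> = r b \<and> s \<beta> = r b \<longrightarrow> m (\<gamma> \<cdot> b) (\<beta> \<cdot> b) = m \<gamma> \<beta>)"

lemma invariant_kernelD: "invariant_kernel m \<Longrightarrow> \<gamma> \<in> A \<Longrightarrow> \<beta> \<in> A \<Longrightarrow> b \<in> A \<Longrightarrow> s \<gamma> = r b \<Longrightarrow> s \<beta> = r b \<Longrightarrow> m (\<gamma> \<cdot> b) (\<beta> \<cdot> b) = m \<gamma> \<beta>"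
  unfolding invariant_kernel_def by blast

lemma Cuq_iff: "T \<in> Cuq H \<longleftrightarrow> T \<in> adjointable H \<and> ql_kernel (kernel T)"
  unfolding Cuq_def using quasi_local_iff by auto

lemma Cuq_equivariant_iff: "T \<in> Cuq_equivariant H \<longleftrightarrow> T \<in> adjointable H \<and> ql_kernel (kernel T) \<and> invariant_kernel (kernel T)"
  unfolding Cuq_equivariant_def invariant_kernel_def using Cuq_iff equivariant_iff by auto

lemma op_norm_diff_formbd:
  assumes "S \<in> adjointable H" "T \<in> adjointable H" "op_norm H (op_add H T (op_scale H (-1) S)) \<le> \<epsilon>" "0 \<le> \<epsilon>"
  shows "formbd (\<lambda>\<gamma> \<beta>. kernel T \<gamma> \<beta> - kernel S \<gamma> \<beta>) (fib x) (fib x) \<epsilon>"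
proof -
  have "op_add H T (op_scale H (-1) S) \<in> adjointable H"
    by (intro op_add_adjointable op_scale_adjointable assms)
  then have "formbd (kernel (op_add H T (op_scale H (-1) S))) (fib x) (fib x) \<epsilon>"
    using op_norm_le_iff assms(3,4) by blast
  then show ?thesis
    by (rule formbd_cong) (auto simp: kernel_add kernel_scale fibre_iff)
qed

lemma ql_kernel_kernel_add:
  assumes "ql_kernel (kernel S)" "ql_kernel (kernel T)"
  shows "ql_kernel (kernel (op_add H S T))"
  by (rule ql_kernel_cong[OF ql_kernel_add[OF assms]]) (simp add: kernel_add fibre_iff)

lemma ql_kernel_kernel_scale:
  assumes "ql_kernel (kernel T)"
  shows "ql_kernel (kernel (op_scale H c T))"
  by (rule ql_kernel_cong[OF ql_kernel_cmult[OF assms, of c]]) (simp add: kernel_scale fibre_iff)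

lemma ql_kernel_kernel_zero: "ql_kernel (kernel (op_zero H))"
  by (rule ql_kernel_cong[OF ql_kernel_zero]) (simp add: kernel_zero fibre_iff)

lemma ql_kernel_kernel_mul:
  assumes "S \<in> adjointable H" "T \<in> adjointable H" "ql_kernel (kernel S)" "ql_kernel (kernel T)"
  shows "ql_kernel (kernel (op_mul H S T))"
  by (rule ql_kernel_cong[OF ql_kernel_mul[OF assms(3) op_norm_formbd(2)[OF assms(1)] op_norm_formbd(1)[OF assms(1)]
        assms(4) op_norm_formbd(2)[OF assms(2)] op_norm_formbd(1)[OF assms(2)]]])
    (simp add: kernel_mul assms fibre_iff)

lemma ql_kernel_kernel_adj:
  assumes "T \<in> adjointable H" "ql_kernel (kernel T)"
  shows "ql_kernel (kernel (op_adj H T))"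
  by (rule ql_kernel_cong[OF ql_kernel_adjoint[OF assms(2)]]) (simp add: op_adj(3)[OF assms(1)] fibre_iff)

lemma ql_kernel_kernel_limit:
  assumes T: "T \<in> adjointable H"
    and lim: "\<And>\<epsilon>. \<epsilon> > 0 \<Longrightarrow> \<exists>S. S \<in> adjointable H \<and> ql_kernel (kernel S) \<and> op_norm H (op_add H T (op_scale H (-1) S)) < \<epsilon>"
  shows "ql_kernel (kernel T)"
proof (rule ql_kernel_limit)
  fix \<epsilon> :: real assume e: "\<epsilon> > 0"
  then obtain S where S: "S \<in> adjointable H" "ql_kernel (kernel S)" "op_norm H (op_add H T (op_scale H (-1) S)) < \<epsilon>"
    using lim by blast
  then have "formbd (\<lambda>\<gamma> \<beta>. kernel T \<gamma> \<beta> - kernel S \<gamma> \<beta>) (fib x) (fib x) \<epsilon>" for x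
    by (intro op_norm_diff_formbd T) (use e in auto)
  then show "\<exists>n. ql_kernel n \<and> (\<forall>x. formbd (\<lambda>\<gamma> \<beta>. kernel T \<gamma> \<beta> - n \<gamma> \<beta>) (fib x) (fib x) \<epsilon>)"
    using S(2) by blast
qed

text \<open>Translation by b\<inverse> maps the fibre over the source of b onto the fibre over its
  range, and it carries one sum over intermediate points into the other.\<close>

lemma invariant_kernel_kernel_mul:
  assumes S: "S \<in> adjointable H" and T: "T \<in> adjointable H" and "invariant_kernel (kernel S)" "invariant_kernel (kernel T)"
  shows "invariant_kernel (kernel (op_mul H S T))"
  unfolding invariant_kernel_def
proof (intro ballI impI)
  fix \<gamma> \<beta> b assume h: "\<gamma> \<in> A" "\<beta> \<in> A" "b \<in> A" "s \<gamma> = r b \<and> s \<beta> = r b"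
  have "kernel (op_mul H S T) (\<gamma> \<cdot> b) (\<beta> \<cdot> b) = (\<Sum>\<^sub>\<infinity>k\<in>fib (s b). kernel S (\<gamma> \<cdot> b) k * kernel T k (\<beta> \<cdot> b))"
    using h by (simp add: kernel_mul[OF S T] app_def)
  also have "\<dots> = (\<Sum>\<^sub>\<infinity>k\<in>fib (s b). kernel S \<gamma> (k \<cdot> iv b) * kernel T (k \<cdot> iv b) \<beta>)"
  proof (rule infsum_cong)
    fix k assume k: "k \<in> fib (s b)"
    have "kernel S (\<gamma> \<cdot> b) ((k \<cdot> iv b) \<cdot> b) = kernel S \<gamma> (k \<cdot> iv b)" "kernel T ((k \<cdot> iv b) \<cdot> b) (\<beta> \<cdot> b) = kernel T (k \<cdot> iv b) \<beta>"
      by (rule invariant_kernelD; use assms h k in \<open>simp add: fibre_iff\<close>)+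
    then show "kernel S (\<gamma> \<cdot> b) k * kernel T k (\<beta> \<cdot> b) = kernel S \<gamma> (k \<cdot> iv b) * kernel T (k \<cdot> iv b) \<beta>"
      using k h by (simp add: fibre_iff)
  qed
  also have "\<dots> = (\<Sum>\<^sub>\<infinity>k\<in>fib (r b). kernel S \<gamma> k * kernel T k \<beta>)"
    by (rule infsum_reindex_bij_betw[OF right_translate]) (use h in simp)
  also have "\<dots> = kernel (op_mul H S T) \<gamma> \<beta>" using h by (simp add: kernel_mul[OF S T] app_def)
  finally show "kernel (op_mul H S T) (\<gamma> \<cdot> b) (\<beta> \<cdot> b) = kernel (op_mul H S T) \<gamma> \<beta>" .
qed

text \<open>Each kernel entry is bounded by the operator norm, so invariance, an equation between
  entries, passes to norm limits.\<close>

lemma invariant_kernel_kernel_limit: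
  assumes T: "T \<in> adjointable H"
    and lim: "\<And>\<epsilon>. \<epsilon> > 0 \<Longrightarrow> \<exists>S. S \<in> adjointable H \<and> invariant_kernel (kernel S) \<and> op_norm H (op_add H T (op_scale H (-1) S)) < \<epsilon>"
  shows "invariant_kernel (kernel T)"
  unfolding invariant_kernel_def
proof (intro ballI impI)
  fix \<gamma> \<beta> b assume h: "\<gamma> \<in> A" "\<beta> \<in> A" "b \<in> A" "s \<gamma> = r b \<and> s \<beta> = r b"
  have "cmod (kernel T (\<gamma> \<cdot> b) (\<beta> \<cdot> b) - kernel T \<gamma> \<beta>) \<le> 0"
  proof (rule field_le_epsilon)
    fix e :: real assume e: "e > 0"
    then obtain S where S: "S \<in> adjointable H" "invariant_kernel (kernel S)" "op_norm H (op_add H T (op_scale H (-1) S)) < e/2"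
      using lim[of "e/2"] by auto
    have d: "cmod (kernel T \<gamma> \<beta> - kernel S \<gamma> \<beta>) \<le> e/2" if "\<gamma> \<in> A" "\<beta> \<in> A" "s \<gamma> = s \<beta>" for \<gamma> \<beta>
    proof -
      have "formbd (\<lambda>\<gamma> \<beta>. kernel T \<gamma> \<beta> - kernel S \<gamma> \<beta>) (fib (s \<gamma>)) (fib (s \<gamma>)) (e/2)"
        by (rule op_norm_diff_formbd[OF S(1) T]) (use S e in auto)
      then have "le2 (fib (s \<gamma>)) (\<lambda>\<beta>. kernel T \<gamma> \<beta> - kernel S \<gamma> \<beta>) (e/2)"
        by (rule formbd_row) (use e that in \<open>auto simp: fibre_iff\<close>)
      then show ?thesis by (rule le2_point) (use that in \<open>simp add: fibre_iff\<close>)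
    qed
    have eq: "kernel S (\<gamma> \<cdot> b) (\<beta> \<cdot> b) = kernel S \<gamma> \<beta>" by (rule invariant_kernelD[OF S(2)]) (use h in auto)
    have d1: "cmod (kernel T (\<gamma> \<cdot> b) (\<beta> \<cdot> b) - kernel S \<gamma> \<beta>) \<le> e/2"
      using d[of "\<gamma> \<cdot> b" "\<beta> \<cdot> b"] h eq by simp
    have d2: "cmod (kernel T \<gamma> \<beta> - kernel S \<gamma> \<beta>) \<le> e/2" using d[of \<gamma> \<beta>] h by simp
    have "cmod (kernel T (\<gamma> \<cdot> b) (\<beta> \<cdot> b) - kernel T \<gamma> \<beta>)
      = cmod ((kernel T (\<gamma> \<cdot> b) (\<beta> \<cdot> b) - kernel S \<gamma> \<beta>) - (kernel T \<gamma> \<beta> - kernel S \<gamma> \<beta>))" by simp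
    also have "\<dots> \<le> e/2 + e/2" by (rule order_trans[OF norm_triangle_ineq4 add_mono[OF d1 d2]])
    finally show "cmod (kernel T (\<gamma> \<cdot> b) (\<beta> \<cdot> b) - kernel T \<gamma> \<beta>) \<le> 0 + e" by simp
  qed
  then show "kernel T (\<gamma> \<cdot> b) (\<beta> \<cdot> b) = kernel T \<gamma> \<beta>" by simp
qed

lemma Cuq_cstar_subalgebra: "cstar_subalgebra H (Cuq H)"
  unfolding cstar_subalgebra_def
proof (intro conjI ballI allI impI)
  show "Cuq H \<subseteq> adjointable H" by (auto simp: Cuq_def)
  show "op_zero H \<in> Cuq H" using op_zero_adjointable ql_kernel_kernel_zero by (simp add: Cuq_iff)
  show "op_add H S T \<in> Cuq H" "op_mul H S T \<in> Cuq H" if "S \<in> Cuq H" "T \<in> Cuq H" for S T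
    using that by (simp_all add: Cuq_iff op_add_adjointable op_mul_adjointable ql_kernel_kernel_add ql_kernel_kernel_mul)
  show "op_scale H c T \<in> Cuq H" if "T \<in> Cuq H" for c T
    using that by (simp add: Cuq_iff op_scale_adjointable ql_kernel_kernel_scale)
  show "op_adj H T \<in> Cuq H" if "T \<in> Cuq H" for T
    using that by (simp add: Cuq_iff op_adj(2) ql_kernel_kernel_adj)
  show "T \<in> Cuq H" if T: "T \<in> adjointable H"
    and lim: "\<forall>\<epsilon>>0. \<exists>S\<in>Cuq H. op_norm H (op_add H T (op_scale H (-1) S)) < \<epsilon>" for T
    unfolding Cuq_iff using T ql_kernel_kernel_limit[OF T] lim unfolding Cuq_iff Bex_def by blast
qed

lemma Cuq_equivariant_cstar_subalgebra: "cstar_subalgebra H (Cuq_equivariant H)"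
  unfolding cstar_subalgebra_def
proof (intro conjI ballI allI impI)
  show "Cuq_equivariant H \<subseteq> adjointable H" by (auto simp: Cuq_equivariant_iff)
  show "op_zero H \<in> Cuq_equivariant H"
    using op_zero_adjointable ql_kernel_kernel_zero by (simp add: Cuq_equivariant_iff invariant_kernel_def kernel_zero)
  show "op_add H S T \<in> Cuq_equivariant H" if "S \<in> Cuq_equivariant H" "T \<in> Cuq_equivariant H" for S T
    using that by (simp add: Cuq_equivariant_iff op_add_adjointable ql_kernel_kernel_add invariant_kernel_def kernel_add)
  show "op_mul H S T \<in> Cuq_equivariant H" if "S \<in> Cuq_equivariant H" "T \<in> Cuq_equivariant H" for S T
    using that by (simp add: Cuq_equivariant_iff op_mul_adjointable ql_kernel_kernel_mul invariant_kernel_kernel_mul)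
  show "op_scale H c T \<in> Cuq_equivariant H" if "T \<in> Cuq_equivariant H" for c T
    using that by (simp add: Cuq_equivariant_iff op_scale_adjointable ql_kernel_kernel_scale invariant_kernel_def kernel_scale)
  show "op_adj H T \<in> Cuq_equivariant H" if "T \<in> Cuq_equivariant H" for T
    using that by (simp add: Cuq_equivariant_iff op_adj(2) ql_kernel_kernel_adj invariant_kernel_def op_adj(3))
  show "T \<in> Cuq_equivariant H" if T: "T \<in> adjointable H"
    and lim: "\<forall>\<epsilon>>0. \<exists>S\<in>Cuq_equivariant H. op_norm H (op_add H T (op_scale H (-1) S)) < \<epsilon>" for T
  proof -
    have "\<exists>S. S \<in> adjointable H \<and> ql_kernel (kernel S) \<and> op_norm H (op_add H T (op_scale H (-1) S)) < \<epsilon>"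
      "\<exists>S. S \<in> adjointable H \<and> invariant_kernel (kernel S) \<and> op_norm H (op_add H T (op_scale H (-1) S)) < \<epsilon>" if "\<epsilon> > 0" for \<epsilon>
      using lim that unfolding Cuq_equivariant_iff Bex_def by blast+
    then show ?thesis unfolding Cuq_equivariant_iff using T ql_kernel_kernel_limit[OF T] invariant_kernel_kernel_limit[OF T] by blast
  qed
qed

end

section \<open>The fibrewise Stone-Cech compactification\<close>

lemma closedin_ball:
  assumes "\<And>i. i \<in> I \<Longrightarrow> closedin X {x \<in> topspace X. Q i x}"
  shows "closedin X {x \<in> topspace X. \<forall>i\<in>I. Q i x}"
proof (cases "I = {}")
  case False
  have "{x \<in> topspace X. \<forall>i\<in>I. Q i x} = (\<Inter>i\<in>I. {x \<in> topspace X. Q i x})" using False by auto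
  then show ?thesis using closedin_INT[OF False, of X] assms by simp
qed simp

lemma openin_subtopology_topspace:
  "openin (subtopology X S) U \<Longrightarrow> \<exists>V. openin X V \<and> U = V \<inter> topspace (subtopology X S)"
  using openin_subset by (fastforce simp: openin_subtopology)

context etale
begin

section \<open>The algebra \<open>C0r H\<close> and its characters\<close>

definition Ccu :: "('a \<Rightarrow> complex) set" where
  "Ccu = {k. continuous_map (unit_top H) euclidean k \<and> (\<exists>C. compactin (unit_top H) C \<and> (\<forall>x. x \<notin> C \<longrightarrow> k x = 0))}"

definition pull :: "('a \<Rightarrow> complex) \<Rightarrow> 'a \<Rightarrow> complex" where
  "pull k \<gamma> = (if \<gamma> \<in> A then k (r \<gamma>) else 0)"

lemma unit_bump:
  assumes "compactin (unit_top H) K" "openin (unit_top H) U" "K \<subseteq> U"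
  obtains k where "k \<in> Ccu" "\<And>x. cmod (k x) \<le> 1" "\<And>x. cmod (1 - k x) \<le> 1"
    "\<And>x. x \<in> K \<Longrightarrow> k x = 1" "\<And>x. k x \<noteq> 0 \<Longrightarrow> x \<in> U"
proof -
  obtain f C where f: "continuous_map (unit_top H) euclidean f" "\<And>x. 0 \<le> f x" "\<And>x. f x \<le> (1::real)"
    "\<And>x. x \<in> K \<Longrightarrow> f x = 1" "compactin (unit_top H) C" "C \<subseteq> U" "\<And>x. x \<notin> C \<Longrightarrow> f x = 0"
    using locally_compact_Hausdorff_bump[OF loc_compact_units Hausdorff_units assms] by metis
  show thesis
  proof (rule that[of "\<lambda>x. of_real (f x)"])
    show "(\<lambda>x. complex_of_real (f x)) \<in> Ccu"
      unfolding Ccu_def using continuous_map_of_real[OF f(1)] f(5,7) by auto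
    show "cmod (1 - complex_of_real (f x)) \<le> 1" for x
      using f(2,3)[of x] by (metis abs_of_nonneg diff_ge_0_iff_ge diff_le_eq le_add_same_cancel1 norm_of_real of_real_1 of_real_diff)
    show "x \<in> U" if "complex_of_real (f x) \<noteq> 0" for x using f(6) f(7)[of x] that by auto
  qed (use f(2,3,4) in \<open>auto simp: abs_of_nonneg\<close>)
qed

lemma pull_Cb:
  assumes "k \<in> Ccu"
  shows "pull k \<in> Cb H"
proof -
  obtain C where C: "compactin (unit_top H) C" "\<And>x. x \<notin> C \<Longrightarrow> k x = 0" using assms unfolding Ccu_def by blast
  have ck: "continuous_map (unit_top H) euclidean k" using assms by (simp add: Ccu_def)
  have "compact (k ` C)" using image_compactin[OF C(1) ck] by simp
  then have "bounded (k ` C)" by (rule compact_imp_bounded)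
  then obtain B where B: "\<And>x. x \<in> C \<Longrightarrow> cmod (k x) \<le> B" by (auto simp: bounded_iff)
  have "cmod (k x) \<le> max B 0" for x using B C(2) by (cases "x \<in> C") fastforce+
  then have b: "cmod (pull k \<gamma>) \<le> max B 0" for \<gamma> by (simp add: pull_def)
  have "continuous_map (gtop H) euclidean (pull k)"
    by (rule continuous_map_eq[OF continuous_map_compose[OF continuous_range ck]]) (simp add: pull_def)
  then show ?thesis using b by (rule CbI) (simp add: pull_def)
qed

text \<open>Membership as vanishing at infinity in the direction of the unit space. In the
  nontrivial direction the approximating function is f multiplied by a bump that is pulled back from
  the unit space and equals 1 where f is not small.\<close>

lemma C0r_iff: "f \<in> C0r H \<longleftrightarrow> f \<in> Cb H \<and>
  (\<forall>\<epsilon>>0. \<exists>K. compactin (unit_top H) K \<and> (\<forall>\<gamma>\<in>A. r \<gamma> \<notin> K \<longrightarrow> cmod (f \<gamma>) < \<epsilon>))" (is "?l \<longleftrightarrow> ?R")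
proof
  assume l: ?l
  then have f: "f \<in> Cb H" by (simp add: C0r_def)
  show ?R
  proof (intro conjI allI impI f)
    fix \<epsilon> :: real assume e: "\<epsilon> > 0"
    then obtain g K where g: "g \<in> Cb H" "compactin (unit_top H) K" "supp H g \<subseteq> {\<gamma> \<in> A. r \<gamma> \<in> K}"
      "sup_norm (\<lambda>\<gamma>. f \<gamma> - g \<gamma>) < \<epsilon>" using l unfolding C0r_def by blast
    have sub: "{\<gamma>. g \<gamma> \<noteq> 0} \<subseteq> supp H g"
      unfolding supp_def using CbD(2)[OF g(1)] by (auto intro!: closure_of_subset)
    have "(\<lambda>\<gamma>. f \<gamma> - g \<gamma>) \<in> Cb H"
    proof (rule CbI)
      show "cmod (f \<gamma> - g \<gamma>) \<le> sup_norm f + sup_norm g" for \<gamma>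
        using CbD(3)[OF f, of \<gamma>] CbD(3)[OF g(1), of \<gamma>] norm_triangle_ineq4[of "f \<gamma>" "g \<gamma>"] by linarith
    qed (use CbD[OF f] CbD[OF g(1)] in \<open>auto intro: continuous_map_diff\<close>)
    then have le: "cmod (f \<gamma> - g \<gamma>) \<le> sup_norm (\<lambda>\<gamma>. f \<gamma> - g \<gamma>)" for \<gamma>
      using CbD(3)[of "\<lambda>\<gamma>. f \<gamma> - g \<gamma>" \<gamma>] by simp
    have "cmod (f \<gamma>) < \<epsilon>" if "\<gamma> \<in> A" "r \<gamma> \<notin> K" for \<gamma>
    proof -
      have "g \<gamma> = 0" using that sub g(3) by blast
      then show ?thesis using le[of \<gamma>] g(4) by simp
    qed
    then show "\<exists>K. compactin (unit_top H) K \<and> (\<forall>\<gamma>\<in>A. r \<gamma> \<notin> K \<longrightarrow> cmod (f \<gamma>) < \<epsilon>)" using g(2) by blast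
  qed
next
  assume R: ?R
  then have f: "f \<in> Cb H" by simp
  have "\<exists>g\<in>Cb H. (\<exists>K. compactin (unit_top H) K \<and> supp H g \<subseteq> {\<gamma> \<in> A. r \<gamma> \<in> K}) \<and> sup_norm (\<lambda>\<gamma>. f \<gamma> - g \<gamma>) < \<epsilon>"
    if e: "\<epsilon> > 0" for \<epsilon>
  proof -
    obtain K where K: "compactin (unit_top H) K" "\<And>\<gamma>. \<gamma> \<in> A \<Longrightarrow> r \<gamma> \<notin> K \<Longrightarrow> cmod (f \<gamma>) < \<epsilon>/2"
      using R e by (meson half_gt_zero)
    have "K \<subseteq> units H" using compactin_subset_topspace[OF K(1)] by simp
    then obtain k where k: "k \<in> Ccu" "\<And>x. cmod (k x) \<le> 1" "\<And>x. cmod (1 - k x) \<le> 1" "\<And>x. x \<in> K \<Longrightarrow> k x = 1"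
      using unit_bump[OF K(1) openin_topspace] by (metis topspace_unit_top)
    obtain C where C: "compactin (unit_top H) C" "\<And>x. x \<notin> C \<Longrightarrow> k x = 0" using k(1) unfolding Ccu_def by blast
    \<comment> \<open>Multiplying by k moves f only where r \<gamma> lies outside K; there f is
      small and |1 - k| \<le> 1.\<close>
    define g where "g \<gamma> = f \<gamma> * pull k \<gamma>" for \<gamma>
    have gCb: "g \<in> Cb H"
    proof (rule CbI)
      show "continuous_map (gtop H) euclidean g" unfolding g_def
        by (rule continuous_map_complex_mult[OF CbD(1)[OF f] CbD(1)[OF pull_Cb[OF k(1)]]])
      show "cmod (g \<gamma>) \<le> sup_norm f * 1" for \<gamma>
        unfolding g_def norm_mult
        by (rule mult_mono) (use CbD(3)[OF f] k(2) sup_norm_nonneg[OF f] in \<open>auto simp: pull_def\<close>)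
    qed (simp add: g_def pull_def)
    have "closedin (unit_top H) C" using C(1) Hausdorff_units compactin_imp_closedin by blast
    then have "closedin (gtop H) {\<gamma> \<in> A. r \<gamma> \<in> C}"
      by (rule closedin_continuous_map_preimage[OF continuous_range])
    then have "supp H g \<subseteq> {\<gamma> \<in> A. r \<gamma> \<in> C}" unfolding supp_def
      by (rule closure_of_minimal[rotated]) (use C(2) in \<open>auto simp: g_def pull_def split: if_splits\<close>)
    moreover have "sup_norm (\<lambda>\<gamma>. f \<gamma> - g \<gamma>) \<le> \<epsilon>/2"
    proof (rule sup_norm_le)
      fix \<gamma>
      show "cmod (f \<gamma> - g \<gamma>) \<le> \<epsilon>/2"
      proof (cases "\<gamma> \<in> A")
        case True
        have eq: "cmod (f \<gamma> - g \<gamma>) = cmod (f \<gamma>) * cmod (1 - k (r \<gamma>))"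
          using True by (simp add: g_def pull_def algebra_simps flip: norm_mult)
        show ?thesis
        proof (cases "r \<gamma> \<in> K")
          case True
          then show ?thesis using k(4) e by (simp add: eq)
        next
          case False
          then have "cmod (f \<gamma>) \<le> \<epsilon>/2" using K(2)[OF True] by simp
          moreover have "cmod (f \<gamma>) * cmod (1 - k (r \<gamma>)) \<le> cmod (f \<gamma>)" by (rule mult_left_le[OF k(3)]) simp
          ultimately show ?thesis using eq by linarith
        qed
      qed (use CbD(2)[OF f] CbD(2)[OF gCb] e in auto)
    qed
    ultimately show ?thesis using gCb C(1) e
      by (intro bexI[of _ g] conjI exI[of _ C]) auto
  qed
  then show ?l unfolding C0r_def using f by blast
qed

lemma C0rD:
  assumes "f \<in> C0r H"
  shows "f \<in> Cb H" "continuous_map (gtop H) euclidean f" "\<And>\<gamma>. \<gamma> \<notin> A \<Longrightarrow> f \<gamma> = 0" "cmod (f \<gamma>) \<le> sup_norm f"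
  using assms CbD unfolding C0r_iff by blast+

lemma C0rI_dominated:
  assumes f: "f \<in> C0r H" and g: "continuous_map (gtop H) euclidean g" "\<And>\<gamma>. \<gamma> \<notin> A \<Longrightarrow> g \<gamma> = 0"
    and le: "\<And>\<gamma>. \<gamma> \<in> A \<Longrightarrow> cmod (g \<gamma>) \<le> c * cmod (f \<gamma>)"
  shows "g \<in> C0r H"
  unfolding C0r_iff
proof (intro conjI allI impI)
  \<comment> \<open>Replacing c by max c 1 provides a positive constant to divide by.\<close>
  have le': "cmod (g \<gamma>) \<le> max c 1 * cmod (f \<gamma>)" for \<gamma>
  proof (cases "\<gamma> \<in> A")
    case True
    have "c * cmod (f \<gamma>) \<le> max c 1 * cmod (f \<gamma>)" by (intro mult_right_mono) auto
    then show ?thesis using le[OF True] by linarith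
  qed (use g(2) in auto)
  show "g \<in> Cb H"
  proof (rule CbI[OF g(1) _ g(2)])
    show "cmod (g \<gamma>) \<le> max c 1 * sup_norm f" for \<gamma>
      by (rule order_trans[OF le']) (intro mult_left_mono C0rD(4)[OF f], simp)
  qed
  fix \<epsilon> :: real assume "\<epsilon> > 0"
  then have "\<epsilon> / max c 1 > 0" by simp
  then obtain K where K: "compactin (unit_top H) K" "\<And>\<gamma>. \<gamma> \<in> A \<Longrightarrow> r \<gamma> \<notin> K \<Longrightarrow> cmod (f \<gamma>) < \<epsilon> / max c 1"
    using f unfolding C0r_iff by meson
  have "cmod (g \<gamma>) < \<epsilon>" if "\<gamma> \<in> A" "r \<gamma> \<notin> K" for \<gamma>
  proof -
    have p: "0 < max c 1" by simp
    have "max c 1 * cmod (f \<gamma>) < \<epsilon>" using K(2)[OF that] unfolding pos_less_divide_eq[OF p] by (simp add: mult.commute)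
    then show ?thesis using le'[of \<gamma>] by linarith
  qed
  then show "\<exists>K. compactin (unit_top H) K \<and> (\<forall>\<gamma>\<in>A. r \<gamma> \<notin> K \<longrightarrow> cmod (g \<gamma>) < \<epsilon>)" using K(1) by blast
qed

lemma C0rI_support:
  assumes "g \<in> Cb H" "compactin (unit_top H) C" "\<And>\<gamma>. \<gamma> \<in> A \<Longrightarrow> r \<gamma> \<notin> C \<Longrightarrow> g \<gamma> = 0"
  shows "g \<in> C0r H"
  unfolding C0r_iff using assms by auto

lemma pull_C0r:
  assumes "k \<in> Ccu"
  shows "pull k \<in> C0r H"
proof -
  obtain C where C: "compactin (unit_top H) C" "\<And>x. x \<notin> C \<Longrightarrow> k x = 0" using assms unfolding Ccu_def by blast
  show ?thesis by (rule C0rI_support[OF pull_Cb[OF assms] C(1)]) (simp add: pull_def C(2))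
qed

lemma C0r_zero: "(\<lambda>_. 0) \<in> C0r H"
  by (rule C0rI_support[of _ "{}"]) (auto intro: CbI[of _ 0])

lemma C0r_add:
  assumes "f \<in> C0r H" "g \<in> C0r H"
  shows "(\<lambda>\<gamma>. f \<gamma> + g \<gamma>) \<in> C0r H"
  unfolding C0r_iff
proof (intro conjI allI impI)
  have tri: "cmod (f \<gamma> + g \<gamma>) \<le> cmod (f \<gamma>) + cmod (g \<gamma>)" for \<gamma> by (rule norm_triangle_ineq)
  show "(\<lambda>\<gamma>. f \<gamma> + g \<gamma>) \<in> Cb H"
  proof (rule CbI)
    show "cmod (f \<gamma> + g \<gamma>) \<le> sup_norm f + sup_norm g" for \<gamma>
      using tri[of \<gamma>] C0rD(4)[OF assms(1), of \<gamma>] C0rD(4)[OF assms(2), of \<gamma>] by linarith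
  qed (use C0rD[OF assms(1)] C0rD[OF assms(2)] in \<open>auto intro: continuous_map_add\<close>)
  fix \<epsilon> :: real assume "\<epsilon> > 0"
  then have e: "\<epsilon> / 2 > 0" by simp
  obtain K where K: "compactin (unit_top H) K" "\<And>\<gamma>. \<gamma> \<in> A \<Longrightarrow> r \<gamma> \<notin> K \<Longrightarrow> cmod (f \<gamma>) < \<epsilon> / 2"
    using assms(1) e unfolding C0r_iff by meson
  obtain L where L: "compactin (unit_top H) L" "\<And>\<gamma>. \<gamma> \<in> A \<Longrightarrow> r \<gamma> \<notin> L \<Longrightarrow> cmod (g \<gamma>) < \<epsilon> / 2"
    using assms(2) e unfolding C0r_iff by meson
  have "cmod (f \<gamma> + g \<gamma>) < \<epsilon>" if "\<gamma> \<in> A" "r \<gamma> \<notin> K \<union> L" for \<gamma>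
    using K(2)[OF that(1)] L(2)[OF that(1)] that(2) tri[of \<gamma>] by fastforce
  then show "\<exists>K. compactin (unit_top H) K \<and> (\<forall>\<gamma>\<in>A. r \<gamma> \<notin> K \<longrightarrow> cmod (f \<gamma> + g \<gamma>) < \<epsilon>)"
    using compactin_Un[OF K(1) L(1)] by blast
qed

lemma C0r_mult_Cb:
  assumes "f \<in> C0r H" "continuous_map (gtop H) euclidean g" "\<And>\<gamma>. \<gamma> \<in> A \<Longrightarrow> cmod (g \<gamma>) \<le> B"
  shows "(\<lambda>\<gamma>. f \<gamma> * g \<gamma>) \<in> C0r H"
proof (rule C0rI_dominated[OF assms(1)])
  show "continuous_map (gtop H) euclidean (\<lambda>\<gamma>. f \<gamma> * g \<gamma>)"
    by (rule continuous_map_complex_mult[OF C0rD(2)[OF assms(1)] assms(2)])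
  show "cmod (f \<gamma> * g \<gamma>) \<le> B * cmod (f \<gamma>)" if "\<gamma> \<in> A" for \<gamma>
    using mult_right_mono[OF assms(3)[OF that], of "cmod (f \<gamma>)"] by (simp add: norm_mult mult.commute)
qed (simp add: C0rD(3)[OF assms(1)])

lemma C0r_mult: "f \<in> C0r H \<Longrightarrow> g \<in> C0r H \<Longrightarrow> (\<lambda>\<gamma>. f \<gamma> * g \<gamma>) \<in> C0r H"
  by (rule C0r_mult_Cb[OF _ C0rD(2) C0rD(4)])

lemma C0r_cmult: "f \<in> C0r H \<Longrightarrow> (\<lambda>\<gamma>. c * f \<gamma>) \<in> C0r H"
  using C0r_mult_Cb[of f "\<lambda>_. c" "cmod c"] by (simp add: mult.commute)

abbreviation "Z \<equiv> topspace (beta_r H)"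

lemma Z_iff: "\<phi> \<in> Z \<longleftrightarrow> \<phi> \<in> extensional (C0r H) \<and> (\<exists>f\<in>C0r H. \<phi> f \<noteq> 0) \<and>
    (\<forall>f\<in>C0r H. \<forall>g\<in>C0r H. \<phi> (\<lambda>\<gamma>. f \<gamma> + g \<gamma>) = \<phi> f + \<phi> g) \<and>
    (\<forall>c. \<forall>f\<in>C0r H. \<phi> (\<lambda>\<gamma>. c * f \<gamma>) = c * \<phi> f) \<and>
    (\<forall>f\<in>C0r H. \<forall>g\<in>C0r H. \<phi> (\<lambda>\<gamma>. f \<gamma> * g \<gamma>) = \<phi> f * \<phi> g)"
  unfolding beta_r_def gelfand_spectrum_def by (auto simp: PiE_def)

lemma ZD:
  assumes "\<phi> \<in> Z"
  shows "\<phi> \<in> extensional (C0r H)" "\<exists>f\<in>C0r H. \<phi> f \<noteq> 0"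
    "\<And>f g. f \<in> C0r H \<Longrightarrow> g \<in> C0r H \<Longrightarrow> \<phi> (\<lambda>\<gamma>. f \<gamma> + g \<gamma>) = \<phi> f + \<phi> g"
    "\<And>f c. f \<in> C0r H \<Longrightarrow> \<phi> (\<lambda>\<gamma>. c * f \<gamma>) = c * \<phi> f"
    "\<And>f g. f \<in> C0r H \<Longrightarrow> g \<in> C0r H \<Longrightarrow> \<phi> (\<lambda>\<gamma>. f \<gamma> * g \<gamma>) = \<phi> f * \<phi> g"
  using assms unfolding Z_iff by auto

lemma Z_sum:
  assumes "\<phi> \<in> Z" "finite I" "\<And>i. i \<in> I \<Longrightarrow> g i \<in> C0r H"
  shows "(\<lambda>\<gamma>. \<Sum>i\<in>I. g i \<gamma>) \<in> C0r H \<and> \<phi> (\<lambda>\<gamma>. \<Sum>i\<in>I. g i \<gamma>) = (\<Sum>i\<in>I. \<phi> (g i))"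
  using assms(2,3)
proof (induction I rule: finite_induct)
  case empty
  show ?case using C0r_zero ZD(4)[OF assms(1) C0r_zero, of 0] by simp
next
  case (insert a I)
  then have "g a \<in> C0r H" "(\<lambda>\<gamma>. \<Sum>i\<in>I. g i \<gamma>) \<in> C0r H" "\<phi> (\<lambda>\<gamma>. \<Sum>i\<in>I. g i \<gamma>) = (\<Sum>i\<in>I. \<phi> (g i))" by auto
  then show ?case using insert.hyps C0r_add ZD(3)[OF assms(1)] by simp
qed

text \<open>If no point of the groupoid were \<open>\<delta>\<close>-close to \<open>\<phi>\<close> on the finite set \<open>S\<close>, then \<open>D = \<Sum>\<bar>f - \<phi>(f)\<bar>\<^sup>2\<close> would be
  bounded below and every \<open>e = \<Sum>(f - \<phi>(f)) (e cnj(f - \<phi>(f)) / D)\<close> would be annihilated by \<open>\<phi>\<close>.\<close>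

lemma character_approx:
  assumes \<phi>: "\<phi> \<in> Z" and S: "finite S" "S \<subseteq> C0r H" and \<delta>: "\<delta> > 0"
  obtains (close) \<gamma> where "\<gamma> \<in> A" "\<And>f. f \<in> S \<Longrightarrow> cmod (f \<gamma> - \<phi> f) < \<delta>"
proof (rule ccontr)
  assume "\<not> thesis"
  then have far: "\<exists>f\<in>S. \<delta> \<le> cmod (f \<gamma> - \<phi> f)" if "\<gamma> \<in> A" for \<gamma>
    using close[OF \<open>\<gamma> \<in> A\<close>] \<open>\<not> thesis\<close> by (meson not_le)
  \<comment> \<open>The algebra need not contain the constant 1; a function on which the character
    does not vanish takes its place in the usual argument.\<close>
  obtain e where e: "e \<in> C0r H" "\<phi> e \<noteq> 0" using ZD(2)[OF \<phi>] by blast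
  define D where "D \<gamma> = (\<Sum>f\<in>S. (cmod (f \<gamma> - \<phi> f))\<^sup>2)" for \<gamma>
  have D: "\<delta>\<^sup>2 \<le> D \<gamma>" if "\<gamma> \<in> A" for \<gamma>
  proof -
    obtain f where f: "f \<in> S" "\<delta> \<le> cmod (f \<gamma> - \<phi> f)" using far[OF \<open>\<gamma> \<in> A\<close>] by blast
    have "\<delta>\<^sup>2 \<le> (cmod (f \<gamma> - \<phi> f))\<^sup>2" using f(2) \<delta> by (intro power_mono) auto
    also have "\<dots> \<le> D \<gamma>" unfolding D_def using member_le_sum[of f S "\<lambda>f. (cmod (f \<gamma> - \<phi> f))\<^sup>2"] f(1) S(1) by simp
    finally show ?thesis .
  qed
  have D0: "0 < D \<gamma>" if "\<gamma> \<in> A" for \<gamma>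
  proof -
    have "0 < \<delta>\<^sup>2" using \<delta> by simp
    then show ?thesis using D[OF that] by linarith
  qed
  define h where "h f \<gamma> = e \<gamma> * (cnj (f \<gamma> - \<phi> f) / of_real (D \<gamma>))" for f \<gamma>
  have hC: "h f \<in> C0r H" if f: "f \<in> S" for f
    unfolding h_def[abs_def]
  proof (rule C0r_mult_Cb[OF e(1)])
    have fC: "f \<in> C0r H" using f S by auto
    have cD: "continuous_map (gtop H) euclidean (\<lambda>\<gamma>. complex_of_real (D \<gamma>))"
      unfolding D_def
    proof (intro continuous_map_of_real continuous_map_sum S(1))
      fix i assume "i \<in> S"
      then have "i \<in> C0r H" using S by auto
      then show "continuous_map (gtop H) euclidean (\<lambda>\<gamma>. (cmod (i \<gamma> - \<phi> i))\<^sup>2)"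
        by (intro continuous_map_real_pow continuous_map_norm continuous_map_diff) (simp_all add: C0rD(2))
    qed
    show "continuous_map (gtop H) euclidean (\<lambda>\<gamma>. cnj (f \<gamma> - \<phi> f) / complex_of_real (D \<gamma>))"
    proof (rule continuous_map_complex_divide[OF _ cD])
      show "continuous_map (gtop H) euclidean (\<lambda>\<gamma>. cnj (f \<gamma> - \<phi> f))"
        by (intro continuous_map_cnj continuous_map_diff) (simp_all add: C0rD(2)[OF fC])
    qed (use D0 in force)
    show "cmod (cnj (f \<gamma> - \<phi> f) / complex_of_real (D \<gamma>)) \<le> (sup_norm f + cmod (\<phi> f)) / \<delta>\<^sup>2" if "\<gamma> \<in> A" for \<gamma>
    proof -
      have "cmod (f \<gamma> - \<phi> f) \<le> sup_norm f + cmod (\<phi> f)"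
        using norm_triangle_ineq4[of "f \<gamma>" "\<phi> f"] C0rD(4)[OF fC, of \<gamma>] by linarith
      moreover have "0 \<le> sup_norm f + cmod (\<phi> f)" using sup_norm_nonneg[OF C0rD(1)[OF fC]] by simp
      moreover have "0 < \<delta>\<^sup>2" using \<delta> by simp
      ultimately have "cmod (f \<gamma> - \<phi> f) / D \<gamma> \<le> (sup_norm f + cmod (\<phi> f)) / \<delta>\<^sup>2"
        using D[OF that] by (intro frac_le)
      then show ?thesis using D0[OF that] by (simp add: norm_divide flip: complex_cnj_diff)
    qed
  qed
  have "e = (\<lambda>\<gamma>. \<Sum>f\<in>S. f \<gamma> * h f \<gamma> + (- \<phi> f) * h f \<gamma>)"
  proof
    fix \<gamma>
    show "e \<gamma> = (\<Sum>f\<in>S. f \<gamma> * h f \<gamma> + (- \<phi> f) * h f \<gamma>)"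
    proof (cases "\<gamma> \<in> A")
      case True
      have "(\<Sum>f\<in>S. f \<gamma> * h f \<gamma> + (- \<phi> f) * h f \<gamma>) = (\<Sum>f\<in>S. (e \<gamma> / of_real (D \<gamma>)) * ((f \<gamma> - \<phi> f) * cnj (f \<gamma> - \<phi> f)))"
      proof (intro sum.cong refl)
        have "a * (e' * (c / d)) + (- b) * (e' * (c / d)) = (e' / d) * ((a - b) * c)" for a b c d e' :: complex
          by (simp add: divide_inverse algebra_simps)
        then show "f \<gamma> * h f \<gamma> + (- \<phi> f) * h f \<gamma> = (e \<gamma> / of_real (D \<gamma>)) * ((f \<gamma> - \<phi> f) * cnj (f \<gamma> - \<phi> f))" for f
          unfolding h_def by blast
      qed
      also have "\<dots> = (e \<gamma> / of_real (D \<gamma>)) * of_real (D \<gamma>)"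
      proof -
        have "complex_of_real (D \<gamma>) = (\<Sum>f\<in>S. (f \<gamma> - \<phi> f) * cnj (f \<gamma> - \<phi> f))"
          unfolding D_def of_real_sum by (intro sum.cong refl complex_norm_square)
        then show ?thesis by (simp only: sum_distrib_left)
      qed
      also have "\<dots> = e \<gamma>" using D0[OF True] by simp
      finally show ?thesis by simp
    next
      case False
      then show ?thesis using C0rD(3)[OF e(1)] by (simp add: h_def)
    qed
  qed
  then have "\<phi> e = \<phi> (\<lambda>\<gamma>. \<Sum>f\<in>S. f \<gamma> * h f \<gamma> + (- \<phi> f) * h f \<gamma>)" by (rule arg_cong)
  also have "\<dots> = (\<Sum>f\<in>S. \<phi> (\<lambda>\<gamma>. f \<gamma> * h f \<gamma> + (- \<phi> f) * h f \<gamma>))"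
  proof (rule Z_sum[OF \<phi> S(1), THEN conjunct2])
    fix f assume f: "f \<in> S"
    then have fC: "f \<in> C0r H" using S by auto
    show "(\<lambda>\<gamma>. f \<gamma> * h f \<gamma> + (- \<phi> f) * h f \<gamma>) \<in> C0r H"
      by (rule C0r_add[OF C0r_mult[OF fC hC[OF f]] C0r_cmult[OF hC[OF f]]])
  qed
  also have "\<dots> = (\<Sum>f\<in>S. 0)"
  proof (rule sum.cong[OF refl])
    fix f assume f: "f \<in> S"
    then have fC: "f \<in> C0r H" using S by auto
    have "\<phi> (\<lambda>\<gamma>. f \<gamma> * h f \<gamma> + (- \<phi> f) * h f \<gamma>) = \<phi> (\<lambda>\<gamma>. f \<gamma> * h f \<gamma>) + \<phi> (\<lambda>\<gamma>. (- \<phi> f) * h f \<gamma>)"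
      by (rule ZD(3)[OF \<phi> C0r_mult[OF fC hC[OF f]] C0r_cmult[OF hC[OF f]]])
    also have "\<dots> = \<phi> f * \<phi> (h f) + (- \<phi> f) * \<phi> (h f)"
      using ZD(5)[OF \<phi> fC hC[OF f]] ZD(4)[OF \<phi> hC[OF f], of "- \<phi> f"] by simp
    finally show "\<phi> (\<lambda>\<gamma>. f \<gamma> * h f \<gamma> + (- \<phi> f) * h f \<gamma>) = 0" by simp
  qed
  finally show False using e(2) by simp
qed

lemma ev_in_Z:
  assumes "\<gamma> \<in> A"
  shows "ev H \<gamma> \<in> Z"
proof -
  have "compactin (unit_top H) {r \<gamma>}" "{r \<gamma>} \<subseteq> topspace (unit_top H)" using assms by auto
  then obtain k where "k \<in> Ccu" "\<And>x. x \<in> {r \<gamma>} \<Longrightarrow> k x = 1"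
    using unit_bump[OF _ openin_topspace] by metis
  then have "\<exists>f\<in>C0r H. ev H \<gamma> f \<noteq> 0"
    using pull_C0r assms by (intro bexI[of _ "pull k"]) (auto simp: ev_def pull_def)
  then show ?thesis
    unfolding Z_iff using C0r_add C0r_cmult C0r_mult by (auto simp: ev_def)
qed

lemma continuous_eval:
  assumes "f \<in> C0r H"
  shows "continuous_map (beta_r H) euclidean (\<lambda>\<phi>. \<phi> f)"
  unfolding beta_r_def gelfand_spectrum_def
  using continuous_map_product_projection[OF assms] continuous_map_from_subtopology by blast

lemma continuous_into_beta:
  assumes "\<And>x. x \<in> topspace X \<Longrightarrow> F x \<in> Z" "\<And>f. f \<in> C0r H \<Longrightarrow> continuous_map X euclidean (\<lambda>x. F x f)"
  shows "continuous_map X (beta_r H) F"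
proof -
  have "continuous_map X (product_topology (\<lambda>_. euclidean) (C0r H)) F"
    using assms ZD(1) by (auto simp: continuous_map_componentwise)
  then show ?thesis
    using assms(1) unfolding beta_r_def gelfand_spectrum_def
    by (auto simp: continuous_map_in_subtopology)
qed

lemma continuous_ev: "continuous_map (gtop H) (beta_r H) (ev H)"
  by (rule continuous_into_beta[OF ev_in_Z]) (simp_all add: ev_def C0rD(2))

lemma Hausdorff_beta: "Hausdorff_space (beta_r H)"
  unfolding beta_r_def gelfand_spectrum_def
  by (intro Hausdorff_space_subtopology) (simp add: Hausdorff_space_product_topology)

text \<open>A basic neighbourhood in the topology of pointwise convergence restricts only finitely
  many coordinates, and \<open>character_approx\<close> matches these by a point of the
  groupoid.\<close>

lemma ev_dense:
  assumes U: "openin (beta_r H) U" and \<phi>: "\<phi> \<in> U"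
  obtains \<gamma> where "\<gamma> \<in> A" "ev H \<gamma> \<in> U"
proof -
  have \<phi>Z: "\<phi> \<in> Z" using assms openin_subset by blast
  have "\<exists>V. openin (product_topology (\<lambda>_. euclidean) (C0r H)) V \<and> U = V \<inter> Z"
    using U unfolding beta_r_def gelfand_spectrum_def by (rule openin_subtopology_topspace)
  then obtain V where V: "openin (product_topology (\<lambda>_. euclidean) (C0r H)) V" "U = V \<inter> Z" by blast
  have "\<phi> \<in> V" using \<phi> V(2) by blast
  with V(1) have "\<exists>W. finite {i \<in> C0r H. W i \<noteq> topspace (euclidean :: complex topology)} \<and>
      (\<forall>i\<in>C0r H. openin euclidean (W i)) \<and> \<phi> \<in> PiE (C0r H) W \<and> PiE (C0r H) W \<subseteq> V"
    unfolding openin_product_topology_alt by (elim bspec)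
  then obtain W where "finite {i \<in> C0r H. W i \<noteq> topspace (euclidean :: complex topology)}"
      "\<forall>i\<in>C0r H. openin euclidean (W i)" and W': "\<phi> \<in> PiE (C0r H) W" "PiE (C0r H) W \<subseteq> V"
    by (elim exE conjE)
  then have W: "finite {i \<in> C0r H. W i \<noteq> UNIV}" "\<And>i. i \<in> C0r H \<Longrightarrow> open (W i)"
      "\<phi> \<in> PiE (C0r H) W" "PiE (C0r H) W \<subseteq> V"
    by (simp_all flip: open_openin)
  define S where "S = {i \<in> C0r H. W i \<noteq> UNIV}"
  have "\<exists>d>0. ball (\<phi> f) d \<subseteq> W f" if "f \<in> S" for f
  proof -
    have "f \<in> C0r H" using that by (simp add: S_def)
    then have "open (W f)" "\<phi> f \<in> W f" using W(2) PiE_mem[OF W(3)] by auto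
    then show ?thesis unfolding open_contains_ball by (elim bspec)
  qed
  then obtain d where d: "\<And>f. f \<in> S \<Longrightarrow> d f > 0 \<and> ball (\<phi> f) (d f) \<subseteq> W f" by metis
  \<comment> \<open>The inserted 1 keeps the minimum defined when no coordinate is
    restricted.\<close>
  define \<delta> where "\<delta> = Min (insert 1 (d ` S))"
  have fS: "finite S" using W(1) by (simp add: S_def)
  have "\<delta> > 0" unfolding \<delta>_def using fS d by auto
  then obtain \<gamma> where \<gamma>: "\<gamma> \<in> A" "\<And>f. f \<in> S \<Longrightarrow> cmod (f \<gamma> - \<phi> f) < \<delta>"
    using character_approx[OF \<phi>Z fS, of \<delta>] by (auto simp: S_def)
  have "ev H \<gamma> \<in> PiE (C0r H) W"
  proof (rule PiE_I)
    fix f assume f: "f \<in> C0r H"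
    show "ev H \<gamma> f \<in> W f"
    proof (cases "f \<in> S")
      case True
      have "\<delta> \<le> d f" unfolding \<delta>_def using fS True by (intro Min_le) auto
      then have "f \<gamma> \<in> ball (\<phi> f) (d f)" using \<gamma>(2)[OF True] by (simp add: dist_norm norm_minus_commute)
      then show ?thesis using d[OF True] f by (auto simp: ev_def)
    qed (use f in \<open>auto simp: S_def\<close>)
  qed (simp add: ev_def)
  then have "ev H \<gamma> \<in> U" using V(2) W(4) ev_in_Z[OF \<gamma>(1)] by auto
  then show thesis by (rule that[OF \<gamma>(1)])
qed

text \<open>Characters are not assumed continuous. Approximation by point evaluations gives the
  bound directly.\<close>

lemma Z_bound:
  assumes \<phi>: "\<phi> \<in> Z" and f: "f \<in> C0r H" and B: "\<And>\<gamma>. \<gamma> \<in> A \<Longrightarrow> cmod (f \<gamma>) \<le> B"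
  shows "cmod (\<phi> f) \<le> B"
proof (rule field_le_epsilon)
  fix e :: real assume "e > 0"
  then obtain \<gamma> where "\<gamma> \<in> A" "cmod (f \<gamma> - \<phi> f) < e"
    using character_approx[OF \<phi>, of "{f}" e] f by auto
  then show "cmod (\<phi> f) \<le> B + e"
    using B[of \<gamma>] norm_triangle_ineq2[of "\<phi> f" "f \<gamma>"] by (simp add: norm_minus_commute)
qed

text \<open>By Tychonoff the product of the discs of radius \<open>sup_norm f\<close> is compact,
  and it contains all characters. The algebraic identities are closed conditions. Being nonzero is
  not, but it follows from the closed condition c \<le> |\<phi>(e)|.\<close>

lemma compact_superlevel:
  assumes e: "e \<in> C0r H" and c: "c > 0"
  shows "compactin (beta_r H) {\<phi> \<in> Z. c \<le> cmod (\<phi> e)}"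
proof -
  let ?P = "product_topology (\<lambda>_. euclidean) (C0r H) :: (('a \<Rightarrow> complex) \<Rightarrow> complex) topology"
  have pr: "continuous_map ?P euclidean (\<lambda>\<phi>. \<phi> f)" if "f \<in> C0r H" for f
    using continuous_map_product_projection[OF that] .
  have eqc: "closedin ?P {\<phi> \<in> topspace ?P. u \<phi> = v \<phi>}"
    if "continuous_map ?P euclidean u" "continuous_map ?P euclidean v" for u v :: "_ \<Rightarrow> complex"
    using closedin_continuous_maps_eq[OF _ that] by simp
  define S where "S = PiE (C0r H) (\<lambda>f. cball (0::complex) (sup_norm f))"
  have "compactin ?P S" unfolding S_def by (simp add: compactin_PiE)
  moreover have "closedin ?P {\<phi> \<in> topspace ?P. \<forall>f\<in>C0r H. \<forall>g\<in>C0r H. \<phi> (\<lambda>\<gamma>. f \<gamma> + g \<gamma>) = \<phi> f + \<phi> g}"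
    by (intro closedin_ball eqc continuous_map_add pr C0r_add)
  moreover have "closedin ?P {\<phi> \<in> topspace ?P. \<forall>c\<in>UNIV. \<forall>f\<in>C0r H. \<phi> (\<lambda>\<gamma>. c * f \<gamma>) = c * \<phi> f}"
    by (intro closedin_ball eqc continuous_map_complex_mult pr C0r_cmult) simp_all
  moreover have "closedin ?P {\<phi> \<in> topspace ?P. \<forall>f\<in>C0r H. \<forall>g\<in>C0r H. \<phi> (\<lambda>\<gamma>. f \<gamma> * g \<gamma>) = \<phi> f * \<phi> g}"
    by (intro closedin_ball eqc continuous_map_complex_mult pr C0r_mult)
  moreover have "closedin ?P {\<phi> \<in> topspace ?P. cmod (\<phi> e) \<in> {c..}}"
    by (rule closedin_continuous_map_preimage[OF continuous_map_norm[OF pr[OF e]]]) simp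
  ultimately have "compactin ?P ({\<phi> \<in> topspace ?P. \<forall>f\<in>C0r H. \<forall>g\<in>C0r H. \<phi> (\<lambda>\<gamma>. f \<gamma> + g \<gamma>) = \<phi> f + \<phi> g} \<inter>
     ({\<phi> \<in> topspace ?P. \<forall>c\<in>UNIV. \<forall>f\<in>C0r H. \<phi> (\<lambda>\<gamma>. c * f \<gamma>) = c * \<phi> f} \<inter>
     ({\<phi> \<in> topspace ?P. \<forall>f\<in>C0r H. \<forall>g\<in>C0r H. \<phi> (\<lambda>\<gamma>. f \<gamma> * g \<gamma>) = \<phi> f * \<phi> g} \<inter>
     ({\<phi> \<in> topspace ?P. cmod (\<phi> e) \<in> {c..}} \<inter> S))))" (is "compactin ?P ?S")
    by (intro closed_Int_compactin)
  moreover have "?S = {\<phi> \<in> Z. c \<le> cmod (\<phi> e)}"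
  proof (intro equalityI subsetI)
    fix \<phi> assume \<phi>: "\<phi> \<in> ?S"
    then have "\<phi> e \<noteq> 0" using c by auto
    then show "\<phi> \<in> {\<phi> \<in> Z. c \<le> cmod (\<phi> e)}" using \<phi> e unfolding Z_iff by (auto simp: PiE_def)
  next
    fix \<phi> assume \<phi>: "\<phi> \<in> {\<phi> \<in> Z. c \<le> cmod (\<phi> e)}"
    then have Zp: "\<phi> \<in> Z" by simp
    then have "\<phi> \<in> S" unfolding S_def
      using Z_bound[OF Zp _ C0rD(4)] ZD(1)[OF Zp] by (auto simp: PiE_def)
    then show "\<phi> \<in> ?S" using \<phi> ZD[OF Zp] by (auto simp: PiE_def)
  qed
  ultimately have "compactin ?P {\<phi> \<in> Z. c \<le> cmod (\<phi> e)}" by simp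
  then show ?thesis
    unfolding beta_r_def gelfand_spectrum_def by (auto simp: compactin_subtopology)
qed

lemma loc_compact_beta: "locally_compact_space (beta_r H)"
  unfolding locally_compact_space_def
proof
  fix \<phi> assume \<phi>: "\<phi> \<in> Z"
  then obtain e where e: "e \<in> C0r H" "\<phi> e \<noteq> 0" using ZD(2) by blast
  define c where "c = cmod (\<phi> e) / 2"
  have c: "c > 0" "c < cmod (\<phi> e)" using e(2) by (auto simp: c_def)
  have "openin (beta_r H) {\<psi> \<in> Z. cmod (\<psi> e) \<in> {c<..}}"
    by (rule openin_continuous_map_preimage[OF continuous_map_norm[OF continuous_eval[OF e(1)]]]) simp
  then show "\<exists>U K. openin (beta_r H) U \<and> compactin (beta_r H) K \<and> \<phi> \<in> U \<and> U \<subseteq> K"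
    using compact_superlevel[OF e(1) c(1)] \<phi> c(2)
    by (intro exI[of _ "{\<psi> \<in> Z. cmod (\<psi> e) \<in> {c<..}}"] exI[of _ "{\<phi> \<in> Z. c \<le> cmod (\<phi> e)}"]) auto
qed

end

lemma agree_on_dense:
  assumes "continuous_map X Y f" "continuous_map X Y g" "Hausdorff_space Y"
    and dense: "\<And>U. openin X U \<Longrightarrow> U \<noteq> {} \<Longrightarrow> \<exists>x\<in>U. f x = g x"
    and x: "x \<in> topspace X"
  shows "f x = g x"
proof (rule ccontr)
  assume ne: "f x \<noteq> g x"
  have "closedin X {x \<in> topspace X. f x = g x}" by (rule closedin_continuous_maps_eq[OF assms(3,1,2)])
  then have "openin X (topspace X - {x \<in> topspace X. f x = g x})" by (rule openin_diff[OF openin_topspace])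
  moreover have "x \<in> topspace X - {x \<in> topspace X. f x = g x}" using x ne by simp
  ultimately have "\<exists>y\<in>topspace X - {x \<in> topspace X. f x = g x}. f y = g y" by (intro dense) auto
  then show False by auto
qed

context etale
begin

section \<open>The extension of the range map to the characters\<close>

lemma Ccu_separate:
  assumes "x \<in> units H" "y \<in> units H" "x \<noteq> y"
  obtains k where "k \<in> Ccu" "k x = 1" "k y = 0"
proof -
  have cl: "closedin (unit_top H) {y}"
    by (rule closedin_Hausdorff_singleton[OF Hausdorff_units]) (use assms(2) in simp)
  have "openin (unit_top H) (topspace (unit_top H) - {y})"
    by (rule openin_diff[OF openin_topspace cl])
  moreover have "compactin (unit_top H) {x}" "{x} \<subseteq> topspace (unit_top H) - {y}" using assms by auto
  ultimately obtain k where k: "k \<in> Ccu" "\<And>z. z \<in> {x} \<Longrightarrow> k z = 1" "\<And>z. k z \<noteq> 0 \<Longrightarrow> z \<in> topspace (unit_top H) - {y}"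
    using unit_bump by metis
  have "k y = 0" using k(3)[of y] by auto
  then show thesis using that[OF k(1)] k(2) by auto
qed

lemma Ccu_point:
  assumes "x \<in> units H"
  obtains k where "k \<in> Ccu" "k x = 1"
proof -
  have "compactin (unit_top H) {x}" "{x} \<subseteq> topspace (unit_top H)" using assms by auto
  then obtain k where "k \<in> Ccu" "\<And>z. z \<in> {x} \<Longrightarrow> k z = 1" using unit_bump[OF _ openin_topspace] by metis
  then show thesis using that by auto
qed

lemma Ccu_eqI:
  assumes "x \<in> units H" "y \<in> units H" "\<And>k. k \<in> Ccu \<Longrightarrow> k x = k y"
  shows "x = y"
  using Ccu_separate[OF assms(1,2)] assms(3) by (metis zero_neq_one)

text \<open>On functions pulled back from the unit space a character should be evaluation at a point
  x. If every x failed on some function \<open>q x\<close>, finitely many of these would witness the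
  failure on the compact support C of k. A groupoid element \<gamma> that approximates \<phi> on
  these functions and on the pullback of k has r \<gamma> in C, where one of the witnesses
  contradicts the approximation.\<close>

lemma rb_exists:
  assumes \<phi>: "\<phi> \<in> Z"
  shows "\<exists>x\<in>units H. \<forall>k\<in>Ccu. \<phi> (pull k) = k x"
proof (rule ccontr)
  assume neg: "\<not> ?thesis"
  obtain e where e: "e \<in> C0r H" "\<phi> e \<noteq> 0" using ZD(2)[OF \<phi>] by blast
  define \<epsilon> where "\<epsilon> = cmod (\<phi> e) / 2"
  have \<epsilon>: "\<epsilon> > 0" "\<epsilon> < cmod (\<phi> e)" using e(2) by (auto simp: \<epsilon>_def)
  obtain K where K: "compactin (unit_top H) K" "\<And>\<gamma>. \<gamma> \<in> A \<Longrightarrow> r \<gamma> \<notin> K \<Longrightarrow> cmod (e \<gamma>) < \<epsilon>"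
    using e(1) \<epsilon>(1) unfolding C0r_iff by meson
  have "K \<subseteq> units H" using compactin_subset_topspace[OF K(1)] by simp
  then obtain k where k: "k \<in> Ccu" "\<And>x. cmod (1 - k x) \<le> 1" "\<And>x. x \<in> K \<Longrightarrow> k x = 1"
    using unit_bump[OF K(1) openin_topspace] by (metis topspace_unit_top)
  obtain C where C: "compactin (unit_top H) C" "\<And>x. x \<notin> C \<Longrightarrow> k x = 0" using k(1) unfolding Ccu_def by blast
  have pk: "pull k \<in> C0r H" by (rule pull_C0r[OF k(1)])
  \<comment> \<open>Otherwise \<phi> would take the same value on e and on e - e k. But k equals 1
    where e is not small, so the latter function is bounded by \<epsilon> < |\<phi>(e)|.\<close>
  have nz: "\<phi> (pull k) \<noteq> 0"
  proof
    assume z: "\<phi> (pull k) = 0"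
    define d where "d \<gamma> = e \<gamma> + (-1) * (e \<gamma> * pull k \<gamma>)" for \<gamma>
    have ep: "(\<lambda>\<gamma>. e \<gamma> * pull k \<gamma>) \<in> C0r H" by (rule C0r_mult[OF e(1) pk])
    have dC: "d \<in> C0r H" unfolding d_def[abs_def] by (rule C0r_add[OF e(1) C0r_cmult[OF ep]])
    have "\<phi> d = \<phi> e + \<phi> (\<lambda>\<gamma>. (-1) * (e \<gamma> * pull k \<gamma>))"
      unfolding d_def[abs_def] by (rule ZD(3)[OF \<phi> e(1) C0r_cmult[OF ep]])
    also have "\<phi> (\<lambda>\<gamma>. (-1) * (e \<gamma> * pull k \<gamma>)) = (-1) * \<phi> (\<lambda>\<gamma>. e \<gamma> * pull k \<gamma>)" by (rule ZD(4)[OF \<phi> ep])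
    also have "\<phi> (\<lambda>\<gamma>. e \<gamma> * pull k \<gamma>) = \<phi> e * \<phi> (pull k)" by (rule ZD(5)[OF \<phi> e(1) pk])
    finally have "\<phi> d = \<phi> e" using z by simp
    moreover have "cmod (\<phi> d) \<le> \<epsilon>"
    proof (rule Z_bound[OF \<phi> dC])
      fix \<gamma> assume g: "\<gamma> \<in> A"
      have eq: "cmod (d \<gamma>) = cmod (e \<gamma>) * cmod (1 - k (r \<gamma>))"
        using g by (simp add: d_def pull_def algebra_simps flip: norm_mult)
      show "cmod (d \<gamma>) \<le> \<epsilon>"
      proof (cases "r \<gamma> \<in> K")
        case True
        then show ?thesis using k(3) \<epsilon>(1) by (simp add: eq)
      next
        case False
        have "cmod (e \<gamma>) * cmod (1 - k (r \<gamma>)) \<le> cmod (e \<gamma>)" by (rule mult_left_le[OF k(2)]) simp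
        then show ?thesis using K(2)[OF g False] eq by linarith
      qed
    qed
    ultimately show False using \<epsilon>(2) by simp
  qed
  have "\<forall>x\<in>units H. \<exists>k. k \<in> Ccu \<and> \<phi> (pull k) \<noteq> k x" using neg by blast
  then obtain q where q: "\<And>x. x \<in> units H \<Longrightarrow> q x \<in> Ccu \<and> \<phi> (pull (q x)) \<noteq> q x x" by metis
  define \<delta> where "\<delta> x = cmod (q x x - \<phi> (pull (q x))) / 2" for x
  \<comment> \<open>At x itself the distance in question is 2 \<delta> x, so W x is an open
    neighbourhood on which \<open>q x\<close> stays more than \<delta> x away from the value of
    \<phi>.\<close>
  define W where "W x = {y \<in> topspace (unit_top H). cmod (q x y - \<phi> (pull (q x))) \<in> {\<delta> x<..}}" for x
  have \<delta>: "\<delta> x > 0" if "x \<in> units H" for x using q[OF that] by (simp add: \<delta>_def) metis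
  have CU: "C \<subseteq> units H" using compactin_subset_topspace[OF C(1)] by simp
  have W: "openin (unit_top H) (W x) \<and> x \<in> W x" if "x \<in> C" for x
  proof
    have xu: "x \<in> units H" using that CU by auto
    have "continuous_map (unit_top H) euclidean (q x)" using q[OF xu] by (simp add: Ccu_def)
    then have "continuous_map (unit_top H) euclidean (\<lambda>y. cmod (q x y - \<phi> (pull (q x))))"
      by (intro continuous_map_norm continuous_map_diff) simp_all
    then show "openin (unit_top H) (W x)" unfolding W_def by (rule openin_continuous_map_preimage) simp
    show "x \<in> W x" using xu \<delta>[OF xu] units_subset by (auto simp: W_def \<delta>_def)
  qed
  have "\<forall>U\<in>W ` C. openin (unit_top H) U" "C \<subseteq> \<Union>(W ` C)" using W by auto
  then obtain \<F> where F: "finite \<F>" "\<F> \<subseteq> W ` C" "C \<subseteq> \<Union>\<F>"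
    using C(1) unfolding compactin_def by metis
  then obtain X where X: "finite X" "X \<subseteq> C" "\<F> = W ` X" using finite_subset_image by metis
  define S where "S = insert (pull k) ((\<lambda>x. pull (q x)) ` X)"
  \<comment> \<open>The first entry forces the pullback of k to be nonzero at \<gamma>, hence r
    \<gamma> \<in> C; the others contradict r \<gamma> \<in> W x.\<close>
  define \<eta> where "\<eta> = Min (insert (cmod (\<phi> (pull k))) (\<delta> ` X))"
  have fS: "finite S" using X by (simp add: S_def)
  have XU: "X \<subseteq> units H" using X CU by auto
  have SC: "S \<subseteq> C0r H" unfolding S_def using pk q XU pull_C0r by auto
  have \<eta>0: "\<eta> > 0" unfolding \<eta>_def using X(1) nz \<delta> XU by auto
  obtain \<gamma> where \<gamma>: "\<gamma> \<in> A" "\<And>f. f \<in> S \<Longrightarrow> cmod (f \<gamma> - \<phi> f) < \<eta>"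
    using character_approx[OF \<phi> fS SC \<eta>0] by metis
  have "cmod (pull k \<gamma> - \<phi> (pull k)) < cmod (\<phi> (pull k))"
    using \<gamma>(2)[of "pull k"] X(1) unfolding S_def \<eta>_def by auto
  then have "pull k \<gamma> \<noteq> 0" by auto
  then have "r \<gamma> \<in> C" using C(2) by (auto simp: pull_def split: if_splits)
  then obtain x where x: "x \<in> X" "r \<gamma> \<in> W x" using F(3) X(3) by auto
  have "\<eta> \<le> \<delta> x" unfolding \<eta>_def using X(1) x(1) by (intro Min_le) auto
  moreover have "cmod (pull (q x) \<gamma> - \<phi> (pull (q x))) < \<eta>" using \<gamma>(2) x(1) by (auto simp: S_def)
  ultimately show False using x(2) \<gamma>(1) by (simp add: W_def pull_def)
qed

text \<open>The chosen point is unique by \<open>Ccu_eqI\<close>. Restricting to the spectrum fixes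
  the values elsewhere as in the unique description of \<open>r_beta\<close>, with which it is
  identified in \<open>r_beta_eq\<close>.\<close>

definition rb :: "'a beta \<Rightarrow> 'a" where
  "rb = (\<lambda>\<phi>\<in>Z. SOME x. x \<in> units H \<and> (\<forall>k\<in>Ccu. \<phi> (pull k) = k x))"

lemma rb:
  assumes "\<phi> \<in> Z"
  shows "rb \<phi> \<in> units H" "\<And>k. k \<in> Ccu \<Longrightarrow> \<phi> (pull k) = k (rb \<phi>)"
proof -
  have "\<exists>x. x \<in> units H \<and> (\<forall>k\<in>Ccu. \<phi> (pull k) = k x)" using rb_exists[OF assms] by blast
  from someI_ex[OF this] assms show "rb \<phi> \<in> units H" "\<And>k. k \<in> Ccu \<Longrightarrow> \<phi> (pull k) = k (rb \<phi>)"
    by (auto simp: rb_def)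
qed

lemma rb_ev: "\<gamma> \<in> A \<Longrightarrow> rb (ev H \<gamma>) = r \<gamma>"
proof (rule Ccu_eqI)
  assume g: "\<gamma> \<in> A"
  show "rb (ev H \<gamma>) \<in> units H" "r \<gamma> \<in> units H" using rb(1)[OF ev_in_Z[OF g]] g by auto
  fix k assume k: "k \<in> Ccu"
  have "k (rb (ev H \<gamma>)) = ev H \<gamma> (pull k)" by (rule rb(2)[OF ev_in_Z[OF g] k, symmetric])
  also have "\<dots> = k (r \<gamma>)" using g pull_C0r[OF k] by (simp add: ev_def pull_def)
  finally show "k (rb (ev H \<gamma>)) = k (r \<gamma>)" .
qed

lemma continuous_rb: "continuous_map (beta_r H) (unit_top H) rb"
  unfolding continuous_map_def
proof (intro conjI allI impI)
  show "rb \<in> Z \<rightarrow> topspace (unit_top H)" using rb(1) by auto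
  fix V assume V: "openin (unit_top H) V"
  show "openin (beta_r H) {\<phi> \<in> Z. rb \<phi> \<in> V}"
  proof (subst openin_subopen, intro ballI)
    fix \<phi> assume \<phi>: "\<phi> \<in> {\<phi> \<in> Z. rb \<phi> \<in> V}"
    have "compactin (unit_top H) {rb \<phi>}" "{rb \<phi>} \<subseteq> V" using \<phi> rb(1) units_subset by auto
    then obtain k where k: "k \<in> Ccu" "\<And>x. x \<in> {rb \<phi>} \<Longrightarrow> k x = 1" "\<And>x. k x \<noteq> 0 \<Longrightarrow> x \<in> V"
      using unit_bump[OF _ V] by metis
    have "openin (beta_r H) {\<psi> \<in> Z. \<psi> (pull k) \<in> - {0}}"
      by (rule openin_continuous_map_preimage[OF continuous_eval[OF pull_C0r[OF k(1)]]]) (simp add: open_Compl)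
    moreover have "\<phi> \<in> {\<psi> \<in> Z. \<psi> (pull k) \<in> - {0}}" using \<phi> k by (simp add: rb(2))
    moreover have "{\<psi> \<in> Z. \<psi> (pull k) \<in> - {0}} \<subseteq> {\<phi> \<in> Z. rb \<phi> \<in> V}" using k by (auto simp: rb(2))
    ultimately show "\<exists>T. openin (beta_r H) T \<and> \<phi> \<in> T \<and> T \<subseteq> {\<phi> \<in> Z. rb \<phi> \<in> V}" by blast
  qed
qed

lemma r_beta_eq: "r_beta H = rb"
  unfolding r_beta_def
proof (rule the_equality)
  show "rb \<in> extensional Z \<and> continuous_map (beta_r H) (unit_top H) rb \<and> (\<forall>\<gamma>\<in>A. rb (ev H \<gamma>) = r \<gamma>)"
    using continuous_rb rb_ev by (simp add: rb_def)
  fix p assume p: "p \<in> extensional Z \<and> continuous_map (beta_r H) (unit_top H) p \<and> (\<forall>\<gamma>\<in>A. p (ev H \<gamma>) = r \<gamma>)"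
  show "p = rb"
  proof (rule extensionalityI[of _ Z])
    fix z assume z: "z \<in> Z"
    show "p z = rb z"
    proof (rule agree_on_dense[OF _ continuous_rb Hausdorff_units _ z])
      fix U assume "openin (beta_r H) U" "U \<noteq> {}"
      then obtain \<gamma> where "\<gamma> \<in> A" "ev H \<gamma> \<in> U" using ev_dense by (metis ex_in_conv)
      then show "\<exists>x\<in>U. p x = rb x" using p rb_ev by (intro bexI[of _ "ev H \<gamma>"]) auto
    qed (use p in simp)
  qed (use p in \<open>auto simp: rb_def\<close>)
qed

text \<open>Properness of the extended range map: if k is a bump equal to 1 on K, characters over K
  take the value 1 on its pullback, so they form a closed part of a compact superlevel set.\<close>

lemma compact_rb_preimage:
  assumes K: "compactin (unit_top H) K"
  shows "compactin (beta_r H) {z \<in> Z. rb z \<in> K}"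
proof -
  have "K \<subseteq> units H" using compactin_subset_topspace[OF K] by simp
  then obtain k where k: "k \<in> Ccu" "\<And>x. x \<in> K \<Longrightarrow> k x = 1"
    using unit_bump[OF K openin_topspace] by (metis topspace_unit_top)
  have c: "compactin (beta_r H) {\<phi> \<in> Z. 1 \<le> cmod (\<phi> (pull k))}"
    by (rule compact_superlevel[OF pull_C0r[OF k(1)]]) simp
  have cl: "closedin (beta_r H) {z \<in> Z. rb z \<in> K}"
    by (rule closedin_continuous_map_preimage[OF continuous_rb compactin_imp_closedin[OF Hausdorff_units K]])
  have "{z \<in> Z. rb z \<in> K} \<subseteq> {\<phi> \<in> Z. 1 \<le> cmod (\<phi> (pull k))}" using k by (auto simp: rb(2))
  then show ?thesis using closed_compactin[OF c _ cl] by blast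
qed

subsection \<open>Extending functions of composable pairs\<close>

abbreviation "AD \<equiv> action_domain H (beta_r H) rb"
abbreviation "AZ \<equiv> subtopology (prod_topology (gtop H) (beta_r H)) AD"
abbreviation "CP \<equiv> subtopology (prod_topology (gtop H) (gtop H)) (composable H)"

lemma AD_iff: "(u, z) \<in> AD \<longleftrightarrow> u \<in> A \<and> z \<in> Z \<and> s u = rb z"
  by (auto simp: action_domain_def)

lemma topspace_AZ: "topspace AZ = AD"
  by (auto simp: action_domain_def)

text \<open>Replacing z by a nearby point evaluation at \<gamma> while keeping u would break the
  condition s u = r \<gamma>. As the source map is open, the points z that can be matched by some u
  in the given neighbourhood form an open set, so \<gamma> is chosen first and u afterwards.\<close>

lemma AZ_dense:
  assumes U: "openin AZ U" "U \<noteq> {}"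
  obtains u \<gamma> where "u \<in> A" "\<gamma> \<in> A" "s u = r \<gamma>" "(u, ev H \<gamma>) \<in> U"
proof -
  obtain u0 z0 where p: "(u0, z0) \<in> U" using U(2) by fastforce
  obtain T where T: "openin (prod_topology (gtop H) (beta_r H)) T" "U = T \<inter> AD"
    using U(1) by (auto simp: openin_subtopology)
  have "(u0, z0) \<in> T" using p T(2) by blast
  from T(1)[unfolded openin_prod_topology_alt, rule_format, OF this]
  obtain W V where WV: "openin (gtop H) W" "openin (beta_r H) V" "u0 \<in> W" "z0 \<in> V" "W \<times> V \<subseteq> T"
    by (elim exE conjE)
  have pd: "u0 \<in> A" "z0 \<in> Z" "s u0 = rb z0" using p T(2) by (auto simp: AD_iff)
  define N where "N = {z \<in> Z. rb z \<in> s ` W} \<inter> V"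
  have "openin (beta_r H) N" unfolding N_def
    using openin_continuous_map_preimage[OF continuous_rb open_source[OF WV(1)]] WV(2) by blast
  moreover have "z0 \<in> N" using pd WV(3,4) unfolding N_def by (metis (mono_tags, lifting) IntI image_eqI mem_Collect_eq)
  ultimately obtain \<gamma> where g: "\<gamma> \<in> A" "ev H \<gamma> \<in> N" using ev_dense by metis
  then obtain u where u: "u \<in> W" "s u = r \<gamma>" using rb_ev[OF g(1)] by (auto simp: N_def)
  have "u \<in> A" using u WV(1) openin_subset by blast
  moreover have "(u, ev H \<gamma>) \<in> U" using T(2) WV(5) u g ev_in_Z[OF g(1)] rb_ev[OF g(1)] \<open>u \<in> A\<close>
    by (auto simp: AD_iff N_def)
  ultimately show thesis using that g(1) u(2) by blast
qed

lemma AZ_agree: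
  assumes "continuous_map AZ Y f" "continuous_map AZ Y g" "Hausdorff_space Y"
    "\<And>u \<gamma>. u \<in> A \<Longrightarrow> \<gamma> \<in> A \<Longrightarrow> s u = r \<gamma> \<Longrightarrow> f (u, ev H \<gamma>) = g (u, ev H \<gamma>)" "p \<in> AD"
  shows "f p = g p"
proof (rule agree_on_dense[OF assms(1-3)])
  fix U assume U: "openin AZ U" "U \<noteq> {}"
  obtain u \<gamma> where "u \<in> A" "\<gamma> \<in> A" "s u = r \<gamma>" "(u, ev H \<gamma>) \<in> U" using AZ_dense[OF U] by metis
  then show "\<exists>x\<in>U. f x = g x" using assms(4) by blast
qed (use assms(5) topspace_AZ in simp)

lemma continuous_AZ_fst: "continuous_map AZ (gtop H) fst"
  and continuous_AZ_snd: "continuous_map AZ (beta_r H) snd"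
  by (auto intro: continuous_map_from_subtopology continuous_map_fst continuous_map_snd)

definition bisection_bump :: "('a \<Rightarrow> complex) \<Rightarrow> bool" where
  "bisection_bump \<phi> \<longleftrightarrow> \<phi> \<in> Cc H \<and> inj_on s {u. \<phi> u \<noteq> 0} \<and> (\<forall>u. cmod (\<phi> u) \<le> 1)"

definition cv :: "('a \<Rightarrow> complex) \<Rightarrow> ('a \<Rightarrow> 'a \<Rightarrow> complex) \<Rightarrow> 'a \<Rightarrow> complex" where
  "cv \<phi> F \<gamma> = (if \<gamma> \<in> A then \<Sum>\<^sub>\<infinity>u\<in>fib (r \<gamma>). \<phi> u * F u \<gamma> else 0)"

text \<open>A function \<open>F\<close> of composable pairs \<open>(u, \<gamma>)\<close> is extended to pairs \<open>(u, z)\<close> with \<open>z\<close> a character: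
  multiplying by a bump function \<open>\<phi>\<close> on a bisection through \<open>u\<close> and summing over \<open>u\<close> gives a function
  of \<open>\<gamma>\<close> alone, on which \<open>z\<close> can be evaluated; the value does not depend on \<open>\<phi>\<close>.\<close>

definition ext :: "('a \<Rightarrow> 'a \<Rightarrow> complex) \<Rightarrow> 'a \<times> 'a beta \<Rightarrow> complex" where
  "ext F p = snd p (cv (SOME \<phi>. bisection_bump \<phi> \<and> \<phi> (fst p) = 1) F)"

lemma bisection_bump_exists:
  assumes u: "u \<in> A"
  shows "\<exists>\<phi>. bisection_bump \<phi> \<and> \<phi> u = 1"
proof -
  obtain V \<sigma> where V: "s u \<in> V" "\<sigma> (s u) = u" "openin (gtop H) (\<sigma> ` V)" "inj_on s (\<sigma> ` V)"
    using source_section[OF u openin_topspace u] by metis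
  have "{u} \<subseteq> \<sigma> ` V" using imageI[OF V(1), of \<sigma>] V(2) by simp
  moreover have "compactin (gtop H) {u}" using u by simp
  ultimately obtain \<phi> where \<phi>: "\<phi> \<in> Cc H" "\<And>x. cmod (\<phi> x) \<le> 1" "\<And>x. x \<in> {u} \<Longrightarrow> \<phi> x = 1" "\<And>x. \<phi> x \<noteq> 0 \<Longrightarrow> x \<in> \<sigma> ` V"
    using Cc_bump[OF _ V(3)] by metis
  have "inj_on s {u. \<phi> u \<noteq> 0}" by (rule inj_on_subset[OF V(4)]) (use \<phi>(4) in auto)
  then show ?thesis using \<phi> unfolding bisection_bump_def by blast
qed

lemma cv_eq:
  assumes "bisection_bump \<phi>" "u \<in> A" "\<gamma> \<in> A" "s u = r \<gamma>" "\<phi> u \<noteq> 0"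
  shows "cv \<phi> F \<gamma> = \<phi> u * F u \<gamma>"
proof -
  have "(\<Sum>\<^sub>\<infinity>v\<in>fib (r \<gamma>). \<phi> v * F v \<gamma>) = (\<Sum>\<^sub>\<infinity>v\<in>{u}. \<phi> v * F v \<gamma>)"
  proof (rule infsum_cong_neutral)
    fix v assume v: "v \<in> fib (r \<gamma>) - {u}"
    then have "s v = s u" using assms(4) by (simp add: fibre_iff)
    then have "\<phi> v = 0" using assms(1,5) v unfolding bisection_bump_def inj_on_def by auto
    then show "\<phi> v * F v \<gamma> = 0" by simp
  qed (use assms in \<open>auto simp: fibre_iff\<close>)
  then show ?thesis using assms(3) by (simp add: cv_def)
qed

text \<open>Since \<phi> lives on a bisection, the sum has at most one nonzero term and inherits the
  bound of F. It vanishes unless r \<gamma> lies in the compact image of the support of \<phi> under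
  the source map.\<close>

lemma cv_C0r:
  assumes \<phi>: "bisection_bump \<phi>" and Fc: "continuous_map CP euclidean (\<lambda>(u, \<gamma>). F u \<gamma>)"
    and Fb: "\<And>u \<gamma>. u \<in> A \<Longrightarrow> \<gamma> \<in> A \<Longrightarrow> s u = r \<gamma> \<Longrightarrow> cmod (F u \<gamma>) \<le> B"
  shows "cv \<phi> F \<in> C0r H"
proof -
  have \<phi>C: "\<phi> \<in> Cc H" using \<phi> by (simp add: bisection_bump_def)
  obtain D where D: "compactin (gtop H) D" "\<And>u. u \<notin> D \<Longrightarrow> \<phi> u = 0" using \<phi>C unfolding Cc_iff by blast
  have zero: "cv \<phi> F \<gamma> = 0" if "\<gamma> \<in> A" "\<And>u. u \<in> fib (r \<gamma>) \<Longrightarrow> \<phi> u = 0" for \<gamma>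
    using that by (simp add: cv_def infsum_0)
  have "continuous_map (gtop H) euclidean (\<lambda>\<gamma>. \<Sum>\<^sub>\<infinity>u\<in>fib (r \<gamma>). \<phi> u * F u \<gamma>)"
  proof (rule continuous_fibre_sum[OF continuous_range D(1)])
    let ?P = "subtopology (prod_topology (gtop H) (gtop H)) {(y, h). s h = r y}"
    have c1: "continuous_map ?P (gtop H) fst" and c2: "continuous_map ?P (gtop H) snd"
      by (auto intro: continuous_map_from_subtopology continuous_map_fst continuous_map_snd)
    have "continuous_map ?P CP (\<lambda>p. (snd p, fst p))"
      by (auto simp: continuous_map_in_subtopology continuous_map_paired c1 c2 composable_def)
    from continuous_map_complex_mult[OF continuous_map_compose[OF c2 Cc_continuous[OF \<phi>C]] continuous_map_compose[OF this Fc]]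
    show "continuous_map ?P euclidean (\<lambda>(\<gamma>, u). \<phi> u * F u \<gamma>)" by (simp add: o_def case_prod_unfold)
  qed (simp add: D(2))
  then have c: "continuous_map (gtop H) euclidean (cv \<phi> F)"
    by (rule continuous_map_eq) (simp add: cv_def)
  show ?thesis
  proof (rule C0rI_support)
    show "cv \<phi> F \<in> Cb H"
    proof (rule CbI[OF c])
      fix \<gamma>
      show "cmod (cv \<phi> F \<gamma>) \<le> max B 0"
      proof (cases "\<gamma> \<in> A \<and> (\<exists>u\<in>fib (r \<gamma>). \<phi> u \<noteq> 0)")
        case True
        then obtain u where u: "\<gamma> \<in> A" "u \<in> A" "s u = r \<gamma>" "\<phi> u \<noteq> 0" by (auto simp: fibre_iff)
        have "cmod (cv \<phi> F \<gamma>) = cmod (F u \<gamma>) * cmod (\<phi> u)" using cv_eq[OF \<phi> u(2,1,3,4)] by (simp add: norm_mult)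
        also have "\<dots> \<le> cmod (F u \<gamma>)" by (rule mult_left_le) (use \<phi> in \<open>auto simp: bisection_bump_def\<close>)
        also have "\<dots> \<le> B" by (rule Fb[OF u(2,1,3)])
        finally show ?thesis by simp
      next
        case False
        then show ?thesis using zero by (cases "\<gamma> \<in> A") (auto simp: cv_def)
      qed
    qed (simp add: cv_def)
    show "compactin (unit_top H) (s ` D)" using image_compactin[OF D(1) continuous_source] .
    show "cv \<phi> F \<gamma> = 0" if "\<gamma> \<in> A" "r \<gamma> \<notin> s ` D" for \<gamma>
      by (rule zero[OF that(1)]) (use that(2) D(2) in \<open>force simp: fibre_iff\<close>)
  qed
qed

context
  fixes F :: "'a \<Rightarrow> 'a \<Rightarrow> complex" and B :: real
  assumes Fc: "continuous_map CP euclidean (\<lambda>(u, \<gamma>). F u \<gamma>)"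
    and Fb: "\<And>u \<gamma>. u \<in> A \<Longrightarrow> \<gamma> \<in> A \<Longrightarrow> s u = r \<gamma> \<Longrightarrow> cmod (F u \<gamma>) \<le> B"
begin

lemma cv_F: "bisection_bump \<phi> \<Longrightarrow> cv \<phi> F \<in> C0r H"
  by (rule cv_C0r[OF _ Fc]) (auto intro: Fb)

text \<open>Independence of the bump. Cleared of denominators, the claim is an equation between
  continuous functions of (u, z); at point evaluations both sides are \<phi> u * \<psi> u * F u
  \<gamma>.\<close>

lemma ext_eq:
  assumes \<phi>: "bisection_bump \<phi>" and uz: "(u, z) \<in> AD" and nz: "\<phi> u \<noteq> 0"
  shows "ext F (u, z) = z (cv \<phi> F) / \<phi> u"
proof -
  have uA: "u \<in> A" using uz by (simp add: AD_iff)
  define \<psi> where "\<psi> = (SOME \<phi>. bisection_bump \<phi> \<and> \<phi> u = 1)"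
  have \<psi>: "bisection_bump \<psi>" "\<psi> u = 1" using someI_ex[OF bisection_bump_exists[OF uA]] unfolding \<psi>_def by auto
  \<comment> \<open>The comparison is restricted to the open set where both bumps are nonzero, since
    \<open>cv_eq\<close> requires this.\<close>
  define N where "N = {p \<in> topspace AZ. \<phi> (fst p) * \<psi> (fst p) \<in> - {0}}"
  have cc: "continuous_map AZ euclidean (\<lambda>p. w (fst p))" if "bisection_bump w" for w
    using continuous_map_compose[OF continuous_AZ_fst Cc_continuous] that by (simp add: bisection_bump_def o_def)
  have ce: "continuous_map AZ euclidean (\<lambda>p. snd p (cv w F))" if "bisection_bump w" for w
    using continuous_map_compose[OF continuous_AZ_snd continuous_eval[OF cv_F[OF that]]] by (simp add: o_def)
  have oN: "openin AZ N" unfolding N_def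
    by (rule openin_continuous_map_preimage[OF continuous_map_complex_mult[OF cc[OF \<phi>] cc[OF \<psi>(1)]]])
      (simp add: open_Compl)
  have "(\<lambda>p. snd p (cv \<phi> F) * \<psi> (fst p)) (u, z) = (\<lambda>p. snd p (cv \<psi> F) * \<phi> (fst p)) (u, z)"
  proof (rule agree_on_dense[of "subtopology AZ N" euclidean])
    show "continuous_map (subtopology AZ N) euclidean (\<lambda>p. snd p (cv \<phi> F) * \<psi> (fst p))"
      "continuous_map (subtopology AZ N) euclidean (\<lambda>p. snd p (cv \<psi> F) * \<phi> (fst p))"
      by (intro continuous_map_from_subtopology continuous_map_complex_mult cc ce \<phi> \<psi>)+
    show "(u, z) \<in> topspace (subtopology AZ N)" using uz \<psi> nz by (auto simp: N_def action_domain_def)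
    fix U assume U: "openin (subtopology AZ N) U" "U \<noteq> {}"
    then have U': "openin AZ U" "U \<subseteq> N" using oN openin_trans_full openin_subset by (blast, fastforce)
    obtain v \<gamma> where v: "v \<in> A" "\<gamma> \<in> A" "s v = r \<gamma>" "(v, ev H \<gamma>) \<in> U" using AZ_dense[OF U'(1) U(2)] by metis
    have "\<phi> v \<noteq> 0" "\<psi> v \<noteq> 0" using v(4) U'(2) by (auto simp: N_def)
    then have "ev H \<gamma> (cv \<phi> F) * \<psi> v = ev H \<gamma> (cv \<psi> F) * \<phi> v"
      using cv_eq[OF \<phi> v(1-3)] cv_eq[OF \<psi>(1) v(1-3)] cv_F[OF \<phi>] cv_F[OF \<psi>(1)] by (simp add: ev_def)
    then show "\<exists>x\<in>U. (\<lambda>p. snd p (cv \<phi> F) * \<psi> (fst p)) x = (\<lambda>p. snd p (cv \<psi> F) * \<phi> (fst p)) x"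
      using v(4) by (intro bexI[of _ "(v, ev H \<gamma>)"]) simp_all
  qed simp
  then show ?thesis using \<psi>(2) nz by (simp add: ext_def \<psi>_def[symmetric] field_simps)
qed

lemma ext_ev:
  assumes "u \<in> A" "\<gamma> \<in> A" "s u = r \<gamma>"
  shows "ext F (u, ev H \<gamma>) = F u \<gamma>"
proof -
  obtain \<phi> where \<phi>: "bisection_bump \<phi>" "\<phi> u = 1" using bisection_bump_exists[OF assms(1)] by blast
  have "(u, ev H \<gamma>) \<in> AD" using assms by (simp add: AD_iff ev_in_Z rb_ev)
  then have "ext F (u, ev H \<gamma>) = ev H \<gamma> (cv \<phi> F) / \<phi> u" using ext_eq[OF \<phi>(1)] \<phi>(2) by simp
  then show ?thesis using cv_F[OF \<phi>(1)] cv_eq[OF \<phi>(1) assms] \<phi>(2) by (simp add: ev_def)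
qed

text \<open>The choice inside \<open>ext\<close> varies with u. By \<open>ext_eq\<close> one fixed
  bump may be used near a given point, which displays the extension as a quotient of continuous
  functions.\<close>

lemma continuous_ext: "continuous_map AZ euclidean (ext F)"
proof (rule continuous_map_locally)
  fix p assume p: "p \<in> topspace AZ"
  then have "fst p \<in> A" by auto
  then obtain \<phi> where \<phi>: "bisection_bump \<phi>" "\<phi> (fst p) = 1" using bisection_bump_exists by blast
  have cc: "continuous_map AZ euclidean (\<lambda>p. \<phi> (fst p))"
    using continuous_map_compose[OF continuous_AZ_fst Cc_continuous] \<phi>(1) by (simp add: bisection_bump_def o_def)
  have ce: "continuous_map AZ euclidean (\<lambda>p. snd p (cv \<phi> F))"
    using continuous_map_compose[OF continuous_AZ_snd continuous_eval[OF cv_F[OF \<phi>(1)]]] by (simp add: o_def)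
  define N where "N = {p \<in> topspace AZ. \<phi> (fst p) \<in> - {0}}"
  have oN: "openin AZ N" unfolding N_def
    by (rule openin_continuous_map_preimage[OF cc]) (simp add: open_Compl)
  have "continuous_map (subtopology AZ N) euclidean (\<lambda>p. snd p (cv \<phi> F) / \<phi> (fst p))"
    by (rule continuous_map_complex_divide) (use cc ce in \<open>auto simp: N_def intro: continuous_map_from_subtopology\<close>)
  then have "continuous_map (subtopology AZ N) euclidean (ext F)"
  proof (rule continuous_map_eq)
    fix q assume "q \<in> topspace (subtopology AZ N)"
    then have "q \<in> AD" "\<phi> (fst q) \<noteq> 0" using topspace_AZ by (auto simp: N_def)
    then show "snd q (cv \<phi> F) / \<phi> (fst q) = ext F q" using ext_eq[OF \<phi>(1), of "fst q" "snd q"] by simp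
  qed
  moreover have "p \<in> N" using p \<phi>(2) by (simp add: N_def)
  ultimately show "\<exists>W. openin AZ W \<and> p \<in> W \<and> continuous_map (subtopology AZ W) euclidean (ext F)" using oN by blast
qed

end

section \<open>The extension of left multiplication to the characters\<close>

definition trans :: "('a \<Rightarrow> complex) \<Rightarrow> 'a \<Rightarrow> 'a \<Rightarrow> complex" where
  "trans f u \<gamma> = f (u \<cdot> \<gamma>)"

text \<open>The character u z should send f to the value of z on \<gamma> \<mapsto> f(u \<gamma>).
  This function is defined only for r \<gamma> = s u, so it is not an element of the algebra and the
  extension to composable pairs is needed.\<close>

definition act :: "'a \<times> 'a beta \<Rightarrow> 'a beta" where
  "act = (\<lambda>p\<in>AD. \<lambda>f\<in>C0r H. ext (trans f) p)"

lemma trans_cont: "f \<in> C0r H \<Longrightarrow> continuous_map CP euclidean (\<lambda>(u, \<gamma>). trans f u \<gamma>)"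
proof -
  assume f: "f \<in> C0r H"
  have "continuous_map CP (gtop H) (\<lambda>p. fst p \<cdot> snd p)"
    by (rule continuous_mul)
      (auto simp: composable_def intro: continuous_map_from_subtopology continuous_map_fst continuous_map_snd)
  from continuous_map_compose[OF this C0rD(2)[OF f]]
  show ?thesis by (simp add: o_def case_prod_unfold trans_def)
qed

lemma trans_bound: "f \<in> C0r H \<Longrightarrow> cmod (trans f u \<gamma>) \<le> sup_norm f"
  by (simp add: trans_def C0rD(4))

lemma continuous_ext_trans: "f \<in> C0r H \<Longrightarrow> continuous_map AZ euclidean (ext (trans f))"
  using continuous_ext[OF trans_cont trans_bound] by blast

lemma ext_trans_ev:
  "f \<in> C0r H \<Longrightarrow> u \<in> A \<Longrightarrow> \<gamma> \<in> A \<Longrightarrow> s u = r \<gamma> \<Longrightarrow> ext (trans f) (u, ev H \<gamma>) = f (u \<cdot> \<gamma>)"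
proof -
  assume f: "f \<in> C0r H" and u: "u \<in> A" "\<gamma> \<in> A" "s u = r \<gamma>"
  have "ext (trans f) (u, ev H \<gamma>) = trans f u \<gamma>"
    by (rule ext_ev[OF trans_cont[OF f] trans_bound[OF f] u])
  then show "ext (trans f) (u, ev H \<gamma>) = f (u \<cdot> \<gamma>)" by (simp add: trans_def)
qed

text \<open>Since r(u \<gamma>) = r u, translating a function pulled back from the unit space leaves
  no dependence on \<gamma>. This yields both the nonvanishing of u z and its position over r
  u.\<close>

lemma ext_trans_pull:
  assumes k: "k \<in> Ccu" and p: "p \<in> AD"
  shows "ext (trans (pull k)) p = k (r (fst p))"
proof (rule AZ_agree[OF _ _ _ _ p])
  show "continuous_map AZ euclidean (ext (trans (pull k)))" by (rule continuous_ext_trans[OF pull_C0r[OF k]])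
  have ck: "continuous_map (unit_top H) euclidean k" using k by (simp add: Ccu_def)
  show "continuous_map AZ euclidean (\<lambda>p. k (r (fst p)))"
    using continuous_map_compose[OF continuous_map_compose[OF continuous_AZ_fst continuous_range] ck] by (simp add: o_def)
  show "ext (trans (pull k)) (u, ev H \<gamma>) = k (r (fst (u, ev H \<gamma>)))" if "u \<in> A" "\<gamma> \<in> A" "s u = r \<gamma>" for u \<gamma>
    using ext_trans_ev[OF pull_C0r[OF k] that] that by (simp add: pull_def)
qed simp

lemma act_apply: "p \<in> AD \<Longrightarrow> f \<in> C0r H \<Longrightarrow> act p f = ext (trans f) p"
  by (simp add: act_def)

text \<open>The algebraic identities hold when z is a point evaluation and extend by density.
  Nonvanishing does not pass to limits; it is witnessed by a pulled back function equal to 1 at the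
  range of u.\<close>

lemma act_Z:
  assumes p: "p \<in> AD"
  shows "act p \<in> Z"
  unfolding Z_iff
proof (intro conjI ballI allI)
  have pA: "r (fst p) \<in> units H" using p by (auto simp: action_domain_def)
  show "act p \<in> extensional (C0r H)" using p by (simp add: act_def)
  obtain k where k: "k \<in> Ccu" "k (r (fst p)) = 1" using Ccu_point[OF pA] by blast
  have "act p (pull k) \<noteq> 0" using act_apply[OF p pull_C0r[OF k(1)]] ext_trans_pull[OF k(1) p] k(2) by simp
  then show "\<exists>f\<in>C0r H. act p f \<noteq> 0" using pull_C0r[OF k(1)] by blast
  fix f assume f: "f \<in> C0r H"
  show "act p (\<lambda>\<gamma>. c * f \<gamma>) = c * act p f" for c
    unfolding act_apply[OF p C0r_cmult[OF f]] act_apply[OF p f]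
  proof (rule AZ_agree[OF continuous_ext_trans[OF C0r_cmult[OF f]] _ _ _ p])
    show "continuous_map AZ euclidean (\<lambda>p. c * ext (trans f) p)"
      by (intro continuous_map_complex_mult continuous_ext_trans f) simp
    show "ext (trans (\<lambda>\<gamma>. c * f \<gamma>)) (u, ev H \<gamma>) = c * ext (trans f) (u, ev H \<gamma>)"
      if "u \<in> A" "\<gamma> \<in> A" "s u = r \<gamma>" for u \<gamma>
      using ext_trans_ev[OF C0r_cmult[OF f] that] ext_trans_ev[OF f that] by simp
  qed simp
  fix g assume g: "g \<in> C0r H"
  show "act p (\<lambda>\<gamma>. f \<gamma> + g \<gamma>) = act p f + act p g"
    unfolding act_apply[OF p C0r_add[OF f g]] act_apply[OF p f] act_apply[OF p g]
  proof (rule AZ_agree[OF continuous_ext_trans[OF C0r_add[OF f g]] _ _ _ p])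
    show "continuous_map AZ euclidean (\<lambda>p. ext (trans f) p + ext (trans g) p)"
      by (intro continuous_map_add continuous_ext_trans f g)
    show "ext (trans (\<lambda>\<gamma>. f \<gamma> + g \<gamma>)) (u, ev H \<gamma>) = ext (trans f) (u, ev H \<gamma>) + ext (trans g) (u, ev H \<gamma>)"
      if "u \<in> A" "\<gamma> \<in> A" "s u = r \<gamma>" for u \<gamma>
      using ext_trans_ev[OF C0r_add[OF f g] that] ext_trans_ev[OF f that] ext_trans_ev[OF g that] by simp
  qed simp
  show "act p (\<lambda>\<gamma>. f \<gamma> * g \<gamma>) = act p f * act p g"
    unfolding act_apply[OF p C0r_mult[OF f g]] act_apply[OF p f] act_apply[OF p g]
  proof (rule AZ_agree[OF continuous_ext_trans[OF C0r_mult[OF f g]] _ _ _ p])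
    show "continuous_map AZ euclidean (\<lambda>p. ext (trans f) p * ext (trans g) p)"
      by (intro continuous_map_complex_mult continuous_ext_trans f g)
    show "ext (trans (\<lambda>\<gamma>. f \<gamma> * g \<gamma>)) (u, ev H \<gamma>) = ext (trans f) (u, ev H \<gamma>) * ext (trans g) (u, ev H \<gamma>)"
      if "u \<in> A" "\<gamma> \<in> A" "s u = r \<gamma>" for u \<gamma>
      using ext_trans_ev[OF C0r_mult[OF f g] that] ext_trans_ev[OF f that] ext_trans_ev[OF g that] by simp
  qed simp
qed

lemma continuous_act: "continuous_map AZ (beta_r H) act"
proof (rule continuous_into_beta)
  show "act p \<in> Z" if "p \<in> topspace AZ" for p using act_Z that topspace_AZ by simp
  show "continuous_map AZ euclidean (\<lambda>p. act p f)" if f: "f \<in> C0r H" for f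
    by (rule continuous_map_eq[OF continuous_ext_trans[OF f]]) (use topspace_AZ act_apply[OF _ f] in simp)
qed

lemma act_ev:
  assumes "u \<in> A" "\<gamma> \<in> A" "s u = r \<gamma>"
  shows "act (u, ev H \<gamma>) = ev H (u \<cdot> \<gamma>)"
proof -
  have p: "(u, ev H \<gamma>) \<in> AD" using assms by (simp add: AD_iff ev_in_Z rb_ev)
  show ?thesis
  proof (rule extensionalityI[OF ZD(1)[OF act_Z[OF p]]])
    show "ev H (u \<cdot> \<gamma>) \<in> extensional (C0r H)" by (simp add: ev_def)
    fix f assume f: "f \<in> C0r H"
    show "act (u, ev H \<gamma>) f = ev H (u \<cdot> \<gamma>) f"
      using act_apply[OF p f] ext_trans_ev[OF f assms] f by (simp add: ev_def)
  qed
qed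

lemma rb_act:
  assumes p: "(u, z) \<in> AD"
  shows "rb (act (u, z)) = r u"
proof (rule Ccu_eqI)
  show "rb (act (u, z)) \<in> units H" by (rule rb(1)[OF act_Z[OF p]])
  show "r u \<in> units H" using p by (simp add: AD_iff)
  fix k assume k: "k \<in> Ccu"
  have "k (rb (act (u, z))) = act (u, z) (pull k)" by (rule rb(2)[OF act_Z[OF p] k, symmetric])
  also have "\<dots> = k (r u)" using act_apply[OF p pull_C0r[OF k]] ext_trans_pull[OF k p] by simp
  finally show "k (rb (act (u, z))) = k (r u)" .
qed

lemma act_unit:
  assumes z: "z \<in> Z"
  shows "act (rb z, z) = z"
proof -
  have "continuous_map (beta_r H) AZ (\<lambda>z. (rb z, z))"
    using continuous_map_into_fulltopology[OF continuous_rb] rb(1)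
    by (auto simp: continuous_map_in_subtopology continuous_map_paired action_domain_def units_iff unit_source)
  from continuous_map_compose[OF this continuous_act]
  have c1: "continuous_map (beta_r H) (beta_r H) (\<lambda>z. act (rb z, z))" by (simp add: o_def)
  have c2: "continuous_map (beta_r H) (beta_r H) (\<lambda>z. z)" by (simp add: continuous_map_id[unfolded id_def])
  have "\<exists>x\<in>U. act (rb x, x) = x" if U: "openin (beta_r H) U" "U \<noteq> {}" for U
  proof -
    obtain \<gamma> where g: "\<gamma> \<in> A" "ev H \<gamma> \<in> U" using ev_dense U by (metis ex_in_conv)
    then have "act (rb (ev H \<gamma>), ev H \<gamma>) = ev H \<gamma>" using act_ev[of "r \<gamma>" \<gamma>] by (simp add: rb_ev)
    then show ?thesis using g(2) by blast
  qed
  from agree_on_dense[OF c1 c2 Hausdorff_beta this z] show ?thesis .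
qed

text \<open>Both sides are continuous in the triple (u, v, z) and agree by associativity when z is a
  point evaluation; it remains to see that such triples are dense among those satisfying both
  composability conditions.\<close>

lemma act_mul:
  assumes "u \<in> A" "v \<in> A" "s u = r v" "z \<in> Z" "s v = rb z"
  shows "act (u \<cdot> v, z) = act (u, act (v, z))"
proof -
  let ?P = "prod_topology (prod_topology (gtop H) (gtop H)) (beta_r H)"
  let ?D = "{((u, v), z). u \<in> A \<and> v \<in> A \<and> z \<in> Z \<and> s u = r v \<and> s v = rb z}"
  let ?T = "subtopology ?P ?D"
  have pu: "continuous_map ?T (gtop H) (\<lambda>p. fst (fst p))"
    using continuous_map_compose[OF continuous_map_from_subtopology[OF continuous_map_fst] continuous_map_fst] by (simp add: o_def)
  have pv: "continuous_map ?T (gtop H) (\<lambda>p. snd (fst p))"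
    using continuous_map_compose[OF continuous_map_from_subtopology[OF continuous_map_fst] continuous_map_snd] by (simp add: o_def)
  have pz: "continuous_map ?T (beta_r H) snd"
    by (rule continuous_map_from_subtopology[OF continuous_map_snd])
  have c1: "continuous_map ?T (beta_r H) (\<lambda>p. act (fst (fst p) \<cdot> snd (fst p), snd p))"
  proof -
    have "continuous_map ?T (gtop H) (\<lambda>p. fst (fst p) \<cdot> snd (fst p))"
      by (rule continuous_mul[OF pu pv]) auto
    then have "continuous_map ?T AZ (\<lambda>p. (fst (fst p) \<cdot> snd (fst p), snd p))"
      using pz by (auto simp: continuous_map_in_subtopology continuous_map_paired action_domain_def)
    from continuous_map_compose[OF this continuous_act] show ?thesis by (simp add: o_def)
  qed
  have c2: "continuous_map ?T (beta_r H) (\<lambda>p. act (fst (fst p), act (snd (fst p), snd p)))"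
  proof -
    have "continuous_map ?T AZ (\<lambda>p. (snd (fst p), snd p))"
      using pv pz by (auto simp: continuous_map_in_subtopology continuous_map_paired action_domain_def)
    from continuous_map_compose[OF this continuous_act]
    have c: "continuous_map ?T (beta_r H) (\<lambda>p. act (snd (fst p), snd p))" by (simp add: o_def)
    have d: "(fst (fst p), act (snd (fst p), snd p)) \<in> AD" if p: "p \<in> topspace ?T" for p
    proof -
      obtain u v z where q: "p = ((u, v), z)" "u \<in> A" "v \<in> A" "z \<in> Z" "s u = r v" "s v = rb z" using p by auto
      then have vz: "(v, z) \<in> AD" by (simp add: AD_iff)
      show ?thesis using q act_Z[OF vz] rb_act[OF vz] by (simp add: AD_iff)
    qed
    have "continuous_map ?T AZ (\<lambda>p. (fst (fst p), act (snd (fst p), snd p)))"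
      unfolding continuous_map_in_subtopology
    proof (intro conjI funcsetI)
      show "continuous_map ?T (prod_topology (gtop H) (beta_r H)) (\<lambda>p. (fst (fst p), act (snd (fst p), snd p)))"
        using pu c by (simp add: continuous_map_paired)
    qed (rule d)
    from continuous_map_compose[OF this continuous_act] show ?thesis by (simp add: o_def)
  qed
  have "act (fst (fst ((u, v), z)) \<cdot> snd (fst ((u, v), z)), snd ((u, v), z))
      = act (fst (fst ((u, v), z)), act (snd (fst ((u, v), z)), snd ((u, v), z)))"
  proof (rule agree_on_dense[OF c1 c2 Hausdorff_beta])
    show "((u, v), z) \<in> topspace ?T" using assms by auto
    fix U assume U: "openin ?T U" "U \<noteq> {}"
    obtain q where q: "q \<in> U" using U(2) by blast
    obtain u0 v0 z0 where qe: "q = ((u0, v0), z0)" by (metis prod.exhaust)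
    obtain N where N: "openin ?P N" "U = N \<inter> ?D" using U(1) by (auto simp: openin_subtopology)
    have "((u0, v0), z0) \<in> N" using q qe N(2) by blast
    from N(1)[unfolded openin_prod_topology_alt[of _ "beta_r H"], rule_format, OF this]
    obtain W V where WV: "openin (prod_topology (gtop H) (gtop H)) W" "openin (beta_r H) V" "(u0, v0) \<in> W" "z0 \<in> V" "W \<times> V \<subseteq> N"
      by (elim exE conjE)
    from WV(1)[unfolded openin_prod_topology_alt, rule_format, OF WV(3)]
    obtain W1 W2 where W12: "openin (gtop H) W1" "openin (gtop H) W2" "u0 \<in> W1" "v0 \<in> W2" "W1 \<times> W2 \<subseteq> W"
      by (elim exE conjE)
    have d0: "u0 \<in> A" "v0 \<in> A" "z0 \<in> Z" "s u0 = r v0" "s v0 = rb z0" using q qe N(2) by auto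
    \<comment> \<open>The approximating triple is found from right to left. X consists of the v in
      W2 that can follow some u in W1, and M of the characters on which some v in X can act. Both
      are open because the source map is open, so a point evaluation in M can be completed by v and
      then by u.\<close>
    define X where "X = W2 \<inter> {v \<in> A. r v \<in> s ` W1}"
    have oX: "openin (gtop H) X"
      unfolding X_def using W12(2) openin_continuous_map_preimage[OF continuous_range open_source[OF W12(1)]] by blast
    have "s u0 \<in> s ` W1" by (rule imageI[OF W12(3)])
    then have v0X: "v0 \<in> X" using d0 W12(4) by (simp add: X_def)
    define M where "M = V \<inter> {z \<in> Z. rb z \<in> s ` X}"
    have oM: "openin (beta_r H) M"
      unfolding M_def using WV(2) openin_continuous_map_preimage[OF continuous_rb open_source[OF oX]] by blast
    have "s v0 \<in> s ` X" by (rule imageI[OF v0X])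
    then have "z0 \<in> M" using d0 WV(4) by (simp add: M_def)
    then obtain \<gamma> where g: "\<gamma> \<in> A" "ev H \<gamma> \<in> M" using ev_dense[OF oM] by metis
    then obtain v1 where v1: "v1 \<in> X" "s v1 = r \<gamma>" using rb_ev[OF g(1)] by (auto simp: M_def)
    then obtain u1 where u1: "u1 \<in> W1" "s u1 = r v1" by (auto simp: X_def)
    have uv: "u1 \<in> A" "v1 \<in> A" using u1(1) v1(1) W12(1) openin_subset by (auto simp: X_def)
    have "((u1, v1), ev H \<gamma>) \<in> U"
      using N(2) WV(5) W12(5) u1 v1 g uv ev_in_Z[OF g(1)] rb_ev[OF g(1)] by (auto simp: X_def M_def)
    moreover have "act (u1 \<cdot> v1, ev H \<gamma>) = act (u1, act (v1, ev H \<gamma>))"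
      using act_ev[of "u1 \<cdot> v1" \<gamma>] act_ev[of v1 \<gamma>] act_ev[of u1 "v1 \<cdot> \<gamma>"] uv u1 v1 g(1) by (simp add: mul_assoc)
    ultimately show "\<exists>p\<in>U. act (fst (fst p) \<cdot> snd (fst p), snd p) = act (fst (fst p), act (snd (fst p), snd p))"
      by (intro bexI[of _ "((u1, v1), ev H \<gamma>)"]) simp_all
  qed
  then show ?thesis by simp
qed

lemma act_continuous_action: "continuous_action H (beta_r H) rb act"
  unfolding continuous_action_def
proof (intro conjI ballI allI impI)
  show "continuous_map (beta_r H) (unit_top H) rb" by (rule continuous_rb)
  show "continuous_map AZ (beta_r H) act" by (rule continuous_act)
  show "act (rb z, z) = z" if "z \<in> Z" for z by (rule act_unit[OF that])
  show "case p of (\<gamma>, z) \<Rightarrow> rb (act (\<gamma>, z)) = r \<gamma>" if "p \<in> AD" for p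
    using that rb_act by (cases p) simp
  show "act (\<gamma> \<cdot> \<gamma>', z) = act (\<gamma>, act (\<gamma>', z))" if "(\<gamma>, \<gamma>') \<in> composable H \<and> (\<gamma>', z) \<in> AD" for \<gamma> \<gamma>' z
    by (rule act_mul) (use that in \<open>auto simp: composable_def AD_iff\<close>)
qed

lemma beta_act_eq: "beta_act H = act"
  unfolding beta_act_def r_beta_eq
proof (rule the_equality)
  show "act \<in> extensional AD \<and> continuous_action H (beta_r H) rb act \<and>
    (\<forall>(\<gamma>, \<alpha>)\<in>composable H. act (\<gamma>, ev H \<alpha>) = ev H (\<gamma> \<cdot> \<alpha>))"
    using act_continuous_action act_ev by (auto simp: act_def composable_def)
  fix a assume a: "a \<in> extensional AD \<and> continuous_action H (beta_r H) rb a \<and>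
    (\<forall>(\<gamma>, \<alpha>)\<in>composable H. a (\<gamma>, ev H \<alpha>) = ev H (\<gamma> \<cdot> \<alpha>))"
  show "a = act"
  proof (rule extensionalityI[of _ AD])
    have ca: "continuous_map AZ (beta_r H) a" using a by (simp add: continuous_action_def)
    show "a p = act p" if "p \<in> AD" for p
    proof (rule AZ_agree[OF ca continuous_act Hausdorff_beta _ that])
      show "a (u, ev H \<gamma>) = act (u, ev H \<gamma>)" if "u \<in> A" "\<gamma> \<in> A" "s u = r \<gamma>" for u \<gamma>
      proof -
        have "(u, \<gamma>) \<in> composable H" using that by (simp add: composable_def)
        then show ?thesis using a act_ev[OF that] by auto
      qed
    qed
  qed (use a in \<open>auto simp: act_def\<close>)
qed

end

section \<open>Semi-direct products\<close>

context etale
begin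

lemma continuous_map_into_semidirect:
  assumes "continuous_map X Zt f" "continuous_map X (gtop H) g" "\<And>x. x \<in> topspace X \<Longrightarrow> p (f x) = r (g x)"
  shows "continuous_map X (gtop (semidirect H Zt p a)) (\<lambda>x. (f x, g x))"
  using assms by (auto simp: semidirect_def continuous_map_in_subtopology continuous_map_paired)

text \<open>The second arrow of a composable pair has first coordinate \<gamma>\<inverse> z, so the
  groupoid laws reduce to those of H and of the action. The space is a closed subspace of the
  product because it is an equaliser of maps into the Hausdorff unit space. A local inverse g of the
  range map of H gives the local inverse (z, p z) \<mapsto> (z, g (p z)).\<close>

lemma semidirect_etale:
  fixes Zt :: "'z topology"
  assumes act: "continuous_action H Zt p a" and lc: "locally_compact_space Zt" and hd: "Hausdorff_space Zt"
  shows "locally_compact_etale_groupoid (semidirect H Zt p a)"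
proof -
  let ?E = "semidirect H Zt p a"
  let ?P = "prod_topology Zt (gtop H)"
  let ?S = "{(z, \<gamma>). p z = r \<gamma>}"
  have cp: "continuous_map Zt (unit_top H) p" and ca: "continuous_map (subtopology (prod_topology (gtop H) Zt) (action_domain H Zt p)) Zt a"
    and pa: "\<And>\<gamma> z. (\<gamma>, z) \<in> action_domain H Zt p \<Longrightarrow> p (a (\<gamma>, z)) = r \<gamma>"
    and a1: "\<And>z. z \<in> topspace Zt \<Longrightarrow> a (p z, z) = z"
    and am: "\<And>\<gamma> \<gamma>' z. (\<gamma>, \<gamma>') \<in> composable H \<Longrightarrow> (\<gamma>', z) \<in> action_domain H Zt p \<Longrightarrow> a (\<gamma> \<cdot> \<gamma>', z) = a (\<gamma>, a (\<gamma>', z))"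
    using act unfolding continuous_action_def by auto
  have pu: "p z \<in> units H" if "z \<in> topspace Zt" for z
    using continuous_map_funspace[OF cp] that topspace_unit_top by (metis PiE)
  have pu': "p z \<in> A" "r (p z) = p z" "s (p z) = p z" if "z \<in> topspace Zt" for z
    using pu[OF that] units_iff unit_source by auto
  have aZ: "a (\<gamma>, z) \<in> topspace Zt" if "\<gamma> \<in> A" "z \<in> topspace Zt" "s \<gamma> = p z" for \<gamma> z
    using continuous_map_funspace[OF ca] that by (force simp: action_domain_def)
  have arrE: "arr ?E = {(z, \<gamma>). z \<in> topspace Zt \<and> \<gamma> \<in> A \<and> p z = r \<gamma>}"
    by (auto simp: semidirect_def)
  have pa': "p (a (\<gamma>, z)) = r \<gamma>" if "\<gamma> \<in> A" "z \<in> topspace Zt" "s \<gamma> = p z" for \<gamma> z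
    using pa that by (simp add: action_domain_def)
  have am': "a (\<gamma> \<cdot> \<gamma>', z) = a (\<gamma>, a (\<gamma>', z))" if "\<gamma> \<in> A" "\<gamma>' \<in> A" "s \<gamma> = r \<gamma>'" "z \<in> topspace Zt" "s \<gamma>' = p z" for \<gamma> \<gamma>' z
    using am that by (simp add: action_domain_def composable_def)
  have inv_act: "a (\<gamma>, a (iv \<gamma>, z)) = z" if "\<gamma> \<in> A" "z \<in> topspace Zt" "p z = r \<gamma>" for \<gamma> z
    using am'[of \<gamma> "iv \<gamma>" z] a1[of z] that by simp
  have compE: "composable ?E = {((z, \<gamma>), (z', \<gamma>')). z \<in> topspace Zt \<and> \<gamma> \<in> A \<and> p z = r \<gamma> \<and> \<gamma>' \<in> A \<and>
      s \<gamma> = r \<gamma>' \<and> z' = a (iv \<gamma>, z)}"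
    unfolding composable_def arrE by (auto simp: semidirect_def pa' aZ)
  have alg: "algebraic_groupoid ?E"
    unfolding algebraic_groupoid_def
  proof (intro conjI)
    show "\<forall>\<gamma>\<in>arr ?E. rg ?E \<gamma> \<in> arr ?E \<and> sr ?E \<gamma> \<in> arr ?E \<and>
        rg ?E (rg ?E \<gamma>) = rg ?E \<gamma> \<and> sr ?E (rg ?E \<gamma>) = rg ?E \<gamma> \<and>
        rg ?E (sr ?E \<gamma>) = sr ?E \<gamma> \<and> sr ?E (sr ?E \<gamma>) = sr ?E \<gamma> \<and>
        gmul ?E (rg ?E \<gamma>) \<gamma> = \<gamma> \<and> gmul ?E \<gamma> (sr ?E \<gamma>) = \<gamma>"
    proof
      fix x assume "x \<in> arr ?E"
      then obtain z \<gamma> where x: "x = (z, \<gamma>)" and h: "z \<in> topspace Zt" "\<gamma> \<in> A" "p z = r \<gamma>"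
        unfolding arrE by auto
      have w: "a (iv \<gamma>, z) \<in> topspace Zt" "p (a (iv \<gamma>, z)) = s \<gamma>"
        using aZ[of "iv \<gamma>" z] pa'[of "iv \<gamma>" z] h by auto
      \<comment> \<open>The source in the semi-direct product acts with the inverse of the second
        coordinate, so units must be recognised as their own inverses before \<open>a1\<close>
        applies.\<close>
      have ivu: "iv u = u" if "u \<in> units H" for u
      proof -
        have u: "u \<in> A" "r u = u" "s u = u" using that units_iff unit_source by auto
        have "iv u = iv u \<cdot> s (iv u)" by (rule range_source(8)[symmetric]) (use u in simp)
        also have "\<dots> = iv u \<cdot> u" using u by simp
        also have "\<dots> = u" using range_source(13)[OF u(1)] u(3) by simp
        finally show ?thesis .
      qed
      have e1: "a (iv (r \<gamma>), z) = z" using ivu[of "r \<gamma>"] a1[OF h(1)] h by simp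
      have e2: "a (iv (s \<gamma>), a (iv \<gamma>, z)) = a (iv \<gamma>, z)" using ivu[of "s \<gamma>"] a1[OF w(1)] w h by simp
      show "rg ?E x \<in> arr ?E \<and> sr ?E x \<in> arr ?E \<and>
        rg ?E (rg ?E x) = rg ?E x \<and> sr ?E (rg ?E x) = rg ?E x \<and>
        rg ?E (sr ?E x) = sr ?E x \<and> sr ?E (sr ?E x) = sr ?E x \<and>
        gmul ?E (rg ?E x) x = x \<and> gmul ?E x (sr ?E x) = x"
        unfolding x arrE
        using h w e1 e2 by (simp add: semidirect_def)
    qed
    show "\<forall>(\<alpha>, \<beta>)\<in>composable ?E. gmul ?E \<alpha> \<beta> \<in> arr ?E \<and> rg ?E (gmul ?E \<alpha> \<beta>) = rg ?E \<alpha> \<and> sr ?E (gmul ?E \<alpha> \<beta>) = sr ?E \<beta>"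
    proof
      fix x assume "x \<in> composable ?E"
      then obtain z \<gamma> \<gamma>' where x: "x = ((z, \<gamma>), (a (iv \<gamma>, z), \<gamma>'))" and
        h: "z \<in> topspace Zt" "\<gamma> \<in> A" "p z = r \<gamma>" "\<gamma>' \<in> A" "s \<gamma> = r \<gamma>'" unfolding compE by auto
      have "a (iv \<gamma>' \<cdot> iv \<gamma>, z) = a (iv \<gamma>', a (iv \<gamma>, z))" by (rule am') (use h in auto)
      then show "case x of (\<alpha>, \<beta>) \<Rightarrow> gmul ?E \<alpha> \<beta> \<in> arr ?E \<and> rg ?E (gmul ?E \<alpha> \<beta>) = rg ?E \<alpha> \<and> sr ?E (gmul ?E \<alpha> \<beta>) = sr ?E \<beta>"
        unfolding x arrE
        using h by (simp add: semidirect_def inverse_mul)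
    qed
    show "\<forall>\<alpha> \<beta> \<gamma>. (\<alpha>, \<beta>) \<in> composable ?E \<and> (\<beta>, \<gamma>) \<in> composable ?E \<longrightarrow>
        gmul ?E (gmul ?E \<alpha> \<beta>) \<gamma> = gmul ?E \<alpha> (gmul ?E \<beta> \<gamma>)"
      unfolding compE by (auto simp: semidirect_def mul_assoc)
    show "\<forall>\<gamma>\<in>arr ?E. ginv ?E \<gamma> \<in> arr ?E \<and> rg ?E (ginv ?E \<gamma>) = sr ?E \<gamma> \<and> sr ?E (ginv ?E \<gamma>) = rg ?E \<gamma> \<and>
        gmul ?E \<gamma> (ginv ?E \<gamma>) = rg ?E \<gamma> \<and> gmul ?E (ginv ?E \<gamma>) \<gamma> = sr ?E \<gamma>"
    proof
      fix x assume "x \<in> arr ?E"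
      then obtain z \<gamma> where x: "x = (z, \<gamma>)" and h: "z \<in> topspace Zt" "\<gamma> \<in> A" "p z = r \<gamma>"
        unfolding arrE by auto
      have w: "a (iv \<gamma>, z) \<in> topspace Zt" "p (a (iv \<gamma>, z)) = s \<gamma>"
        using aZ[of "iv \<gamma>" z] pa'[of "iv \<gamma>" z] h by auto
      show "ginv ?E x \<in> arr ?E \<and> rg ?E (ginv ?E x) = sr ?E x \<and> sr ?E (ginv ?E x) = rg ?E x \<and>
        gmul ?E x (ginv ?E x) = rg ?E x \<and> gmul ?E (ginv ?E x) x = sr ?E x"
        unfolding x arrE
        using h w inv_act[OF h(2,1,3)] by (simp add: semidirect_def)
    qed
  qed
  have gtE: "gtop ?E = subtopology ?P ?S" by (simp add: semidirect_def)
  have c1: "continuous_map (gtop ?E) Zt fst" and c2: "continuous_map (gtop ?E) (gtop H) snd"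
    unfolding gtE by (auto intro: continuous_map_from_subtopology continuous_map_fst continuous_map_snd)
  have topE: "topological_groupoid ?E"
    unfolding topological_groupoid_def
  proof (intro conjI alg)
    let ?C = "subtopology (prod_topology (gtop ?E) (gtop ?E)) (composable ?E)"
    have d1: "continuous_map ?C (gtop ?E) fst" and d2: "continuous_map ?C (gtop ?E) snd"
      by (auto intro: continuous_map_from_subtopology continuous_map_fst continuous_map_snd)
    have ef: "fst x \<in> arr ?E \<and> snd x \<in> arr ?E \<and> s (snd (fst x)) = r (snd (snd x))" if "x \<in> topspace ?C" for x
      using that compE by auto
    have "continuous_map ?C (gtop ?E) (\<lambda>x. (fst (fst x), snd (fst x) \<cdot> snd (snd x)))"
    proof (rule continuous_map_into_semidirect)
      show "continuous_map ?C Zt (\<lambda>x. fst (fst x))" using continuous_map_compose[OF d1 c1] by (simp add: o_def)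
      show "continuous_map ?C (gtop H) (\<lambda>x. snd (fst x) \<cdot> snd (snd x))"
        by (rule continuous_mul)
          (use continuous_map_compose[OF d1 c2] continuous_map_compose[OF d2 c2] ef in \<open>auto simp: o_def\<close>)
      show "p (fst (fst x)) = r (snd (fst x) \<cdot> snd (snd x))" if "x \<in> topspace ?C" for x
        using ef[OF that] arrE by auto
    qed
    then show "continuous_map ?C (gtop ?E) (\<lambda>(\<alpha>, \<beta>). gmul ?E \<alpha> \<beta>)"
      by (simp add: semidirect_def case_prod_unfold)
    have hE: "fst x \<in> topspace Zt \<and> snd x \<in> A \<and> p (fst x) = r (snd x)" if "x \<in> arr ?E" for x
      using that arrE by auto
    have ci: "continuous_map (gtop ?E) (gtop H) (\<lambda>x. iv (snd x))" by (rule continuous_inverse_comp[OF c2])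
    have "continuous_map (gtop ?E) (subtopology (prod_topology (gtop H) Zt) (action_domain H Zt p)) (\<lambda>x. (iv (snd x), fst x))"
      unfolding continuous_map_in_subtopology
    proof (intro conjI funcsetI)
      show "continuous_map (gtop ?E) (prod_topology (gtop H) Zt) (\<lambda>x. (iv (snd x), fst x))"
        using ci c1 by (simp add: continuous_map_paired)
    qed (use hE in \<open>auto simp: action_domain_def\<close>)
    from continuous_map_compose[OF this ca]
    have cz: "continuous_map (gtop ?E) Zt (\<lambda>x. a (iv (snd x), fst x))" by (simp add: o_def)
    have "continuous_map (gtop ?E) (gtop ?E) (\<lambda>x. (a (iv (snd x), fst x), iv (snd x)))"
    proof (rule continuous_map_into_semidirect[OF cz ci])
      fix x assume "x \<in> arr ?E"
      then show "p (a (iv (snd x), fst x)) = r (iv (snd x))" using hE[of x] by (intro pa') auto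
    qed
    then show "continuous_map (gtop ?E) (gtop ?E) (ginv ?E)"
      by (simp add: semidirect_def case_prod_unfold)
  qed
  have hausE: "Hausdorff_space (gtop ?E)"
    unfolding gtE using hd Hausdorff by (simp add: Hausdorff_space_subtopology Hausdorff_space_prod_topology)
  have lcE: "locally_compact_space (gtop ?E)"
  proof -
    have "closedin ?P {q \<in> topspace ?P. (p \<circ> fst) q = (r \<circ> snd) q}"
      by (rule closedin_continuous_maps_eq[OF Hausdorff_units])
        (rule continuous_map_compose continuous_map_fst continuous_map_snd cp continuous_range)+
    moreover have "locally_compact_space ?P"
      using lc loc_compact by (simp add: locally_compact_space_prod_topology)
    ultimately have "locally_compact_space (subtopology ?P {q \<in> topspace ?P. (p \<circ> fst) q = (r \<circ> snd) q})"
      using locally_compact_space_closed_subset by blast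
    moreover have "subtopology ?P {q \<in> topspace ?P. (p \<circ> fst) q = (r \<circ> snd) q} = gtop ?E"
    proof -
      have eq: "{q \<in> topspace ?P. (p \<circ> fst) q = (r \<circ> snd) q} = topspace ?P \<inter> ?S" by auto
      show ?thesis unfolding gtE eq by (rule subtopology_restrict)
    qed
    ultimately show ?thesis by simp
  qed
  have "local_homeomorphism (gtop ?E) (unit_top ?E) (rg ?E)"
    unfolding local_homeomorphism_def
  proof
    fix x0 assume "x0 \<in> arr ?E"
    then obtain z0 \<gamma>0 where x0: "x0 = (z0, \<gamma>0)" "z0 \<in> topspace Zt" "\<gamma>0 \<in> A" "p z0 = r \<gamma>0" using arrE by auto
    obtain U where U: "openin (gtop H) U" "\<gamma>0 \<in> U" "openin (unit_top H) (r ` U)"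
      "homeomorphic_map (subtopology (gtop H) U) (subtopology (unit_top H) (r ` U)) r"
      using loc_homeo x0(3) unfolding local_homeomorphism_def by blast
    have UA: "U \<subseteq> A" using U(1) openin_subset by blast
    obtain g where g: "homeomorphic_maps (subtopology (gtop H) U) (subtopology (unit_top H) (r ` U)) r g"
      using U(4) homeomorphic_map_maps by blast
    have top: "topspace (subtopology (gtop H) U) = U" "topspace (subtopology (unit_top H) (r ` U)) = r ` U"
      using UA by auto
    have gr: "\<And>x. x \<in> U \<Longrightarrow> g (r x) = x" and rg: "\<And>y. y \<in> r ` U \<Longrightarrow> r (g y) = y"
      and gU: "\<And>y. y \<in> r ` U \<Longrightarrow> g y \<in> U"
      using g unfolding homeomorphic_maps_def top by auto
    have cg: "continuous_map (subtopology (unit_top H) (r ` U)) (gtop H) g"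
      using g unfolding homeomorphic_maps_def using continuous_map_into_fulltopology by blast
    define U' where "U' = {x \<in> arr ?E. snd x \<in> U}"
    have oU': "openin (gtop ?E) U'" unfolding U'_def by (rule openin_continuous_map_preimage[OF c2 U(1)])
    have unitsE: "units ?E = {(z, p z) |z. z \<in> topspace Zt}"
    proof (intro equalityI subsetI)
      fix x assume "x \<in> units ?E"
      then show "x \<in> {(z, p z) |z. z \<in> topspace Zt}" unfolding units_def using arrE by (auto simp: semidirect_def)
    next
      fix x assume "x \<in> {(z, p z) |z. z \<in> topspace Zt}"
      then obtain z where z: "x = (z, p z)" "z \<in> topspace Zt" by auto
      then have "(z, p z) \<in> arr ?E" "rg ?E (z, p z) = x" using arrE pu' by (auto simp: semidirect_def)
      then show "x \<in> units ?E" unfolding units_def by (metis image_eqI)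
    qed
    have rE: "rg ?E x = (fst x, p (fst x))" for x by (simp add: semidirect_def case_prod_unfold)
    have im: "rg ?E ` U' = {x \<in> units ?E. p (fst x) \<in> r ` U}"
    proof (intro equalityI subsetI)
      fix x assume "x \<in> rg ?E ` U'"
      then show "x \<in> {x \<in> units ?E. p (fst x) \<in> r ` U}" using arrE unfolding U'_def unitsE by (auto simp: rE)
    next
      fix x assume "x \<in> {x \<in> units ?E. p (fst x) \<in> r ` U}"
      then obtain z \<gamma> where z: "x = (z, p z)" "z \<in> topspace Zt" "\<gamma> \<in> U" "p z = r \<gamma>" unfolding unitsE by auto
      then have "(z, \<gamma>) \<in> U'" using UA arrE by (auto simp: U'_def)
      moreover have "rg ?E (z, \<gamma>) = x" using z by (simp add: rE)
      ultimately show "x \<in> rg ?E ` U'" by (metis imageI)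
    qed
    have cpf: "continuous_map (unit_top ?E) (unit_top H) (\<lambda>x. p (fst x))"
      using continuous_map_compose[OF continuous_map_from_subtopology[OF c1] cp] by (simp add: o_def)
    have topu: "topspace (unit_top ?E) = units ?E" using unitsE arrE pu' by auto
    have o2: "openin (unit_top ?E) (rg ?E ` U')"
      unfolding im using openin_continuous_map_preimage[OF cpf U(3)] unfolding topu .
    have crE: "continuous_map (gtop ?E) (gtop ?E) (rg ?E)"
    proof -
      have "continuous_map (gtop ?E) (gtop ?E) (\<lambda>x. (fst x, p (fst x)))"
      proof (rule continuous_map_into_semidirect[OF c1])
        show "continuous_map (gtop ?E) (gtop H) (\<lambda>x. p (fst x))"
          using continuous_map_compose[OF c1 continuous_map_into_fulltopology[OF cp]] by (simp add: o_def)
        show "p (fst x) = r (p (fst x))" if "x \<in> arr ?E" for x using that arrE pu' by auto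
      qed
      then show ?thesis by (rule continuous_map_eq) (simp add: rE)
    qed
    have "homeomorphic_maps (subtopology (gtop ?E) U') (subtopology (unit_top ?E) (rg ?E ` U')) (rg ?E)
       (\<lambda>x. (fst x, g (p (fst x))))"
      unfolding homeomorphic_maps_def
    proof (intro conjI ballI)
      show "continuous_map (subtopology (gtop ?E) U') (subtopology (unit_top ?E) (rg ?E ` U')) (rg ?E)"
        unfolding continuous_map_in_subtopology
        using continuous_map_from_subtopology[OF crE] by (auto simp: units_def U'_def)
      let ?Y = "subtopology (unit_top ?E) (rg ?E ` U')"
      have cg2: "continuous_map ?Y (gtop H) (\<lambda>x. g (p (fst x)))"
      proof -
        have "continuous_map ?Y (subtopology (unit_top H) (r ` U)) (\<lambda>x. p (fst x))"
          by (subst continuous_map_in_subtopology) (use continuous_map_from_subtopology[OF cpf] im in auto)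
        from continuous_map_compose[OF this cg] show ?thesis by (simp add: o_def)
      qed
      have cf2: "continuous_map ?Y Zt fst" by (intro continuous_map_from_subtopology c1)
      have "continuous_map ?Y (gtop ?E) (\<lambda>x. (fst x, g (p (fst x))))"
        by (rule continuous_map_into_semidirect[OF cf2 cg2]) (use rg im in auto)
      then show "continuous_map ?Y (subtopology (gtop ?E) U') (\<lambda>x. (fst x, g (p (fst x))))"
      proof (subst continuous_map_in_subtopology, intro conjI funcsetI)
        fix x assume "x \<in> topspace ?Y"
        then have x: "x \<in> units ?E" "p (fst x) \<in> r ` U" using im by auto
        then have "fst x \<in> topspace Zt" unfolding unitsE by auto
        then show "(fst x, g (p (fst x))) \<in> U'" using x gU rg UA arrE unfolding U'_def by auto
      qed
      show "(fst (rg ?E x), g (p (fst (rg ?E x)))) = x" if "x \<in> topspace (subtopology (gtop ?E) U')" for x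
        using that arrE gr by (auto simp: U'_def rE)
      show "rg ?E (fst y, g (p (fst y))) = y" if "y \<in> topspace ?Y" for y
      proof -
        have "y \<in> units ?E" using that im by auto
        then show ?thesis unfolding unitsE by (auto simp: rE)
      qed
    qed
    then have "homeomorphic_map (subtopology (gtop ?E) U') (subtopology (unit_top ?E) (rg ?E ` U')) (rg ?E)"
      using homeomorphic_map_maps by blast
    moreover have "x0 \<in> U'" using x0 U(2) arrE by (simp add: U'_def)
    ultimately show "\<exists>U. openin (gtop ?E) U \<and> x0 \<in> U \<and> openin (unit_top ?E) (rg ?E ` U) \<and>
        homeomorphic_map (subtopology (gtop ?E) U) (subtopology (unit_top ?E) (rg ?E ` U)) (rg ?E)"
      using oU' o2 by blast
  qed
  then show ?thesis
    unfolding locally_compact_etale_groupoid_def using topE lcE hausE by blast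
qed

lemma beta_semidirect_eq: "beta_semidirect H = semidirect H (beta_r H) rb act"
  by (simp add: beta_semidirect_def r_beta_eq beta_act_eq)

lemma beta_semidirect_etale: "etale (beta_semidirect H)"
  unfolding beta_semidirect_eq
  by (rule etale.intro[OF semidirect_etale[OF act_continuous_action loc_compact_beta Hausdorff_beta]])

end

lemma formbd_reindex:
  fixes m :: "'c \<Rightarrow> 'b \<Rightarrow> complex" and j :: "'d \<Rightarrow> 'b" and k :: "'e \<Rightarrow> 'c"
  assumes j: "inj_on j X" and k: "inj_on k Y"
  shows "formbd m (j ` X) (k ` Y) C \<longleftrightarrow> formbd (\<lambda>y x. m (k y) (j x)) X Y C"
proof
  assume f: "formbd m (j ` X) (k ` Y) C"
  show "formbd (\<lambda>y x. m (k y) (j x)) X Y C"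
  proof (rule formbdI)
    fix F G and a :: "'d \<Rightarrow> complex" assume h: "finite F" "F \<subseteq> X" "finite G" "G \<subseteq> Y"
    have jF: "inj_on j F" and kG: "inj_on k G" using j k h inj_on_subset by blast+
    define b where "b x = a (inv_into F j x)" for x
    have b: "b (j x) = a x" if "x \<in> F" for x unfolding b_def using inv_into_f_f[OF jF that] by simp
    have "L2_set (\<lambda>y. cmod (\<Sum>x\<in>j ` F. m y x * b x)) (k ` G) \<le> C * L2_set (\<lambda>x. cmod (b x)) (j ` F)"
      by (rule formbdD[OF f]) (use h in auto)
    moreover have "(\<Sum>x\<in>j ` F. m y x * b x) = (\<Sum>x\<in>F. m y (j x) * a x)" for y
      unfolding sum.reindex[OF jF] by (intro sum.cong) (simp_all add: b)
    moreover have "L2_set (\<lambda>x. cmod (b x)) (j ` F) = L2_set (\<lambda>x. cmod (a x)) F"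
      unfolding L2_set_def sum.reindex[OF jF] by (intro arg_cong[where f=sqrt] sum.cong) (simp_all add: b)
    moreover have "L2_set w (k ` G) = L2_set (\<lambda>y. w (k y)) G" for w
      unfolding L2_set_def sum.reindex[OF kG] by simp
    ultimately show "L2_set (\<lambda>y. cmod (\<Sum>x\<in>F. m (k y) (j x) * a x)) G \<le> C * L2_set (\<lambda>x. cmod (a x)) F" by simp
  qed
next
  assume f: "formbd (\<lambda>y x. m (k y) (j x)) X Y C"
  show "formbd m (j ` X) (k ` Y) C"
  proof (rule formbdI)
    fix F' G' a assume h: "finite F'" "F' \<subseteq> j ` X" "finite G'" "G' \<subseteq> k ` Y"
    obtain F where F: "F \<subseteq> X" "finite F" "F' = j ` F" using finite_subset_image[OF h(1,2)] by blast
    obtain G where G: "G \<subseteq> Y" "finite G" "G' = k ` G" using finite_subset_image[OF h(3,4)] by blast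
    have jF: "inj_on j F" and kG: "inj_on k G" using j k F G inj_on_subset by blast+
    have "L2_set (\<lambda>y. cmod (\<Sum>x\<in>F. m (k y) (j x) * a (j x))) G \<le> C * L2_set (\<lambda>x. cmod (a (j x))) F"
      by (rule formbdD[OF f F(2,1) G(2,1)])
    then show "L2_set (\<lambda>y. cmod (\<Sum>x\<in>F'. m y x * a x)) G' \<le> C * L2_set (\<lambda>x. cmod (a x)) F'"
      unfolding F(3) G(3) L2_set_def sum.reindex[OF jF] sum.reindex[OF kG] by simp
  qed
qed

section \<open>The isomorphism \<open>\<Theta>\<close>\<close>

context etale
begin

abbreviation "BS \<equiv> beta_semidirect H"

interpretation E: etale BS
  by (rule beta_semidirect_etale)

no_notation E.mul (infixl "\<cdot>" 70)

lemma arrE: "arr BS = {(z, \<gamma>). z \<in> Z \<and> \<gamma> \<in> A \<and> rb z = r \<gamma>}"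
  by (auto simp: beta_semidirect_eq semidirect_def)

lemma arrE_iff: "(z, \<gamma>) \<in> arr BS \<longleftrightarrow> z \<in> Z \<and> \<gamma> \<in> A \<and> rb z = r \<gamma>"
  by (simp add: arrE)

lemma BS_ops:
  "rg BS (z, \<gamma>) = (z, rb z)" "gmul BS (z, \<gamma>) (z', \<gamma>') = (z, \<gamma> \<cdot> \<gamma>')" "ginv BS (z, \<gamma>) = (act (iv \<gamma>, z), iv \<gamma>)"
  by (simp_all add: beta_semidirect_eq semidirect_def)

lemma BS_source: "(z, \<gamma>) \<in> arr BS \<Longrightarrow> sr BS (z, \<gamma>) = (act (iv \<gamma>, z), s \<gamma>)"
  using rb_act[of "iv \<gamma>" z] by (simp add: beta_semidirect_eq semidirect_def AD_iff)

lemma gtop_BS: "gtop BS = subtopology (prod_topology (beta_r H) (gtop H)) {(z, \<gamma>). rb z = r \<gamma>}"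
  by (simp add: beta_semidirect_eq semidirect_def)

lemma continuous_BS_fst: "continuous_map (gtop BS) (beta_r H) fst"
  and continuous_BS_snd: "continuous_map (gtop BS) (gtop H) snd"
  unfolding gtop_BS by (auto intro: continuous_map_from_subtopology continuous_map_fst continuous_map_snd)

lemma act_inv: "u \<in> A \<Longrightarrow> z \<in> Z \<Longrightarrow> s u = rb z \<Longrightarrow> act (iv u, act (u, z)) = z"
  using act_mul[of "iv u" u z] act_unit[of z] by simp

text \<open>\<open>jw z\<close> parametrises the fibre of the semi-direct product over the unit \<open>(z, rb z)\<close>.\<close>

definition jw :: "'a beta \<Rightarrow> 'a \<Rightarrow> 'a beta \<times> 'a" where "jw z \<gamma> = (act (\<gamma>, z), \<gamma>)"

lemma inj_jw: "inj_on (jw z) X"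
  by (auto simp: jw_def inj_on_def)

lemma units_BS: "y \<in> units BS \<Longrightarrow> \<exists>z\<in>Z. y = (z, rb z)"
  unfolding units_def using arrE by (auto simp: BS_ops)

lemma jw_arr:
  assumes "z \<in> Z" "\<gamma> \<in> fib (rb z)"
  shows "jw z \<gamma> \<in> arr BS" "sr BS (jw z \<gamma>) = (z, rb z)"
proof -
  have g: "\<gamma> \<in> A" "s \<gamma> = rb z" using assms(2) by (auto simp: fibre_iff)
  then have d: "(\<gamma>, z) \<in> AD" using assms(1) by (simp add: AD_iff)
  show a: "jw z \<gamma> \<in> arr BS" unfolding jw_def arrE_iff using act_Z[OF d] rb_act[OF d] g by simp
  show "sr BS (jw z \<gamma>) = (z, rb z)"
    using BS_source[of "act (\<gamma>, z)" \<gamma>] a act_inv[of \<gamma> z] g assms(1) by (simp add: jw_def)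
qed

lemma fib_BS:
  assumes "z \<in> Z"
  shows "E.fib (z, rb z) = jw z ` fib (rb z)"
proof (intro equalityI subsetI)
  fix x assume "x \<in> E.fib (z, rb z)"
  then obtain w \<gamma> where x: "x = (w, \<gamma>)" "(w, \<gamma>) \<in> arr BS" "sr BS (w, \<gamma>) = (z, rb z)"
    by (metis E.fibre_iff prod.exhaust)
  then have w: "w \<in> Z" "\<gamma> \<in> A" "rb w = r \<gamma>" by (auto simp: arrE_iff)
  have e: "act (iv \<gamma>, w) = z" "s \<gamma> = rb z" using BS_source[OF x(2)] x(3) by auto
  have "w = act (iv (iv \<gamma>), act (iv \<gamma>, w))" using act_inv[of "iv \<gamma>" w] w by simp
  then have "w = act (\<gamma>, z)" using w e by simp
  then show "x \<in> jw z ` fib (rb z)" using x(1) w(2) e(2) by (auto simp: jw_def fibre_iff)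
next
  fix x assume "x \<in> jw z ` fib (rb z)"
  then show "x \<in> E.fib (z, rb z)" using jw_arr[OF assms] by (auto simp: E.fibre_iff)
qed

text \<open>A product keeps the first coordinate of its left factor, so a enters the quotient only
  through f a\<inverse>. This is the pair at which an invariant kernel is evaluated.\<close>

lemma jw_quot:
  assumes "z \<in> Z" "f \<in> fib (rb z)" "a \<in> fib (rb z)"
  shows "gmul BS (jw z f) (ginv BS (jw z a)) = (act (f, z), f \<cdot> iv a)"
  by (simp add: jw_def BS_ops)

lemma fib_BS_cases:
  assumes "x \<in> E.fib y"
  obtains z where "z \<in> Z" "y = (z, rb z)"
proof -
  have "y \<in> units BS" using assms E.range_in_units(2)[of x] by (auto simp: E.fibre_iff)
  then show thesis using units_BS that by blast
qed

lemma le2_fib_BS: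
  assumes "\<And>z. z \<in> Z \<Longrightarrow> le2 (fib (rb z)) (\<lambda>\<gamma>. v (jw z \<gamma>)) C" "0 \<le> C"
  shows "le2 (E.fib y) v C"
proof (cases "E.fib y = {}")
  case True
  then show ?thesis using assms(2) by (auto simp: le2_def)
next
  case False
  then obtain z where z: "z \<in> Z" "y = (z, rb z)" using fib_BS_cases by (metis ex_in_conv)
  have "bij_betw (jw z) (fib (rb z)) (jw z ` fib (rb z))" by (simp add: bij_betw_def inj_jw)
  then show ?thesis unfolding z(2) fib_BS[OF z(1)]
    by (rule le2_reindex[where h="jw z" and v=v]) (rule assms(1)[OF z(1)])
qed

lemma formbd_fib_BS:
  assumes "\<And>z. z \<in> Z \<Longrightarrow> formbd (\<lambda>f a. m (jw z f) (jw z a)) (fib (rb z)) (fib (rb z)) C"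
  shows "formbd m (E.fib y) (E.fib y) C"
proof (cases "E.fib y = {}")
  case True
  then show ?thesis by (auto simp: formbd_def)
next
  case False
  then obtain z where z: "z \<in> Z" "y = (z, rb z)" using fib_BS_cases by (metis ex_in_conv)
  show ?thesis unfolding z(2) fib_BS[OF z(1)] formbd_reindex[OF inj_jw inj_jw] by (rule assms[OF z(1)])
qed

section \<open>The fibres over H itself, and the effect of iota, kappa and Theta on kernels\<close>

abbreviation "evp \<gamma> \<equiv> (ev H \<gamma>, \<gamma>)"

lemma evp_arr: "\<gamma> \<in> A \<Longrightarrow> evp \<gamma> \<in> arr BS"
  by (simp add: arrE_iff ev_in_Z rb_ev)

lemma jw_ev:
  assumes "\<gamma> \<in> fib x"
  shows "jw (ev H x) \<gamma> = evp \<gamma>" "rb (ev H x) = x" "ev H x \<in> Z"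
proof -
  have g: "\<gamma> \<in> A" "s \<gamma> = x" "x \<in> A" using assms by (auto simp: fibre_iff)
  then have rx: "r x = x" by auto
  show "rb (ev H x) = x" "ev H x \<in> Z" using g rb_ev ev_in_Z rx by auto
  show "jw (ev H x) \<gamma> = evp \<gamma>" using act_ev[of \<gamma> x] g rx by (auto simp: jw_def)
qed

lemma fib_ev:
  assumes "x \<in> units H"
  shows "E.fib (ev H x, x) = evp ` fib x" "rb (ev H x) = x" "ev H x \<in> Z"
proof -
  have x: "x \<in> A" "r x = x" using assms units_iff by auto
  show b: "rb (ev H x) = x" "ev H x \<in> Z" using x rb_ev ev_in_Z by auto
  have "E.fib (ev H x, rb (ev H x)) = jw (ev H x) ` fib (rb (ev H x))" by (rule fib_BS[OF b(2)])
  then show "E.fib (ev H x, x) = evp ` fib x" unfolding b(1) using jw_ev(1) by auto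
qed

lemma evp_source: "\<gamma> \<in> A \<Longrightarrow> sr BS (evp \<gamma>) = (ev H (s \<gamma>), s \<gamma>)"
  using BS_source[OF evp_arr, of \<gamma>] act_ev[of "iv \<gamma>" \<gamma>] by simp

lemma bij_evp: "x \<in> units H \<Longrightarrow> bij_betw evp (fib x) (E.fib (ev H x, x))"
  by (auto simp: bij_betw_def fib_ev inj_on_def)

text \<open>The first coordinates that occur lie over the compact set r(C), hence in a compact set
  because the extended range map is proper. This makes iota preserve compact supports and transports
  the scales of quasi-locality upwards.\<close>

lemma compact_lift:
  assumes C: "compactin (gtop H) C"
  shows "compactin (gtop BS) {x \<in> arr BS. snd x \<in> C}"
proof -
  let ?P = "prod_topology (beta_r H) (gtop H)"
  have CA: "C \<subseteq> A" using C compactin_subset_topspace by blast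
  have "compactin (unit_top H) (r ` C)" using image_compactin[OF C continuous_range] .
  then have "compactin ?P ({z \<in> Z. rb z \<in> r ` C} \<times> C)" using compact_rb_preimage C by (simp add: compactin_Times)
  moreover have "closedin ?P {q \<in> topspace ?P. (rb \<circ> fst) q = (r \<circ> snd) q}"
    by (rule closedin_continuous_maps_eq[OF Hausdorff_units])
      (rule continuous_map_compose continuous_map_fst continuous_map_snd continuous_rb continuous_range)+
  ultimately have "compactin ?P ({q \<in> topspace ?P. (rb \<circ> fst) q = (r \<circ> snd) q} \<inter> ({z \<in> Z. rb z \<in> r ` C} \<times> C))"
    using closed_Int_compactin by blast
  moreover have "{q \<in> topspace ?P. (rb \<circ> fst) q = (r \<circ> snd) q} \<inter> ({z \<in> Z. rb z \<in> r ` C} \<times> C) = {x \<in> arr BS. snd x \<in> C}"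
    using CA by (auto simp: arrE)
  ultimately have "compactin ?P {x \<in> arr BS. snd x \<in> C}" by simp
  then show ?thesis unfolding gtop_BS compactin_subtopology using arrE by auto
qed

lemma iota_apply: "\<xi> \<in> L2 H \<Longrightarrow> x \<in> arr BS \<Longrightarrow> iota H \<xi> x = \<xi> (snd x)"
  by (simp add: iota_def case_prod_unfold)

lemma iota_outside: "\<xi> \<in> L2 H \<Longrightarrow> x \<notin> arr BS \<Longrightarrow> iota H \<xi> x = 0"
  by (simp add: iota_def case_prod_unfold)

lemma le2_iota:
  assumes "\<xi> \<in> L2 H" "\<And>x. le2 (fib x) \<xi> C"
  shows "le2 (E.fib y) (iota H \<xi>) C"
proof (rule le2_fib_BS)
  show "0 \<le> C" using assms(2) le2_nonneg by blast
  fix z assume z: "z \<in> Z"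
  show "le2 (fib (rb z)) (\<lambda>\<gamma>. iota H \<xi> (jw z \<gamma>)) C"
    by (rule le2_cong[OF assms(2)]) (use iota_apply[OF assms(1) jw_arr(1)[OF z]] in \<open>simp add: jw_def\<close>)
qed

lemma iota_L2:
  assumes \<xi>: "\<xi> \<in> L2 H"
  shows "iota H \<xi> \<in> L2 BS"
proof (rule E.L2_closed)
  show "iota H \<xi> x = 0" if "x \<notin> arr BS" for x by (rule iota_outside[OF \<xi> that])
  fix \<epsilon> :: real assume "\<epsilon> > 0"
  then obtain \<eta> where \<eta>: "\<eta> \<in> Cc H" "\<forall>x. le2 (fib x) (\<lambda>\<gamma>. \<xi> \<gamma> - \<eta> \<gamma>) \<epsilon>" using \<xi> unfolding L2_iff by meson
  have \<eta>L: "\<eta> \<in> L2 H" using \<eta>(1) Cc_subset_L2 by blast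
  obtain C where C: "compactin (gtop H) C" "\<And>\<gamma>. \<gamma> \<notin> C \<Longrightarrow> \<eta> \<gamma> = 0" using \<eta>(1) unfolding Cc_iff by blast
  have "continuous_map (gtop BS) euclidean (iota H \<eta>)"
    by (rule continuous_map_eq[OF continuous_map_compose[OF continuous_BS_snd Cc_continuous[OF \<eta>(1)]]])
      (simp add: iota_apply[OF \<eta>L])
  moreover have "iota H \<eta> x = 0" if "x \<notin> {x \<in> arr BS. snd x \<in> C}" for x
    using that C(2) iota_apply[OF \<eta>L] iota_outside[OF \<eta>L] by (cases "x \<in> arr BS") auto
  ultimately have "iota H \<eta> \<in> Cc BS" unfolding E.Cc_iff using compact_lift[OF C(1)] by blast
  then have "iota H \<eta> \<in> L2 BS" using E.Cc_subset_L2 by blast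
  moreover have "le2 (E.fib y) (\<lambda>x. iota H \<xi> x - iota H \<eta> x) \<epsilon>" for y
  proof (rule le2_cong[OF le2_iota[OF L2_diff[OF \<xi> \<eta>L]]])
    show "le2 (fib x) (\<lambda>\<gamma>. \<xi> \<gamma> - \<eta> \<gamma>) \<epsilon>" for x using \<eta>(2) by blast
    fix x assume "x \<in> E.fib y"
    then have "x \<in> arr BS" by (simp add: E.fibre_iff)
    then show "iota H \<xi> x - iota H \<eta> x = iota H (\<lambda>\<gamma>. \<xi> \<gamma> - \<eta> \<gamma>) x"
      using iota_apply[OF \<xi>] iota_apply[OF \<eta>L] iota_apply[OF L2_diff[OF \<xi> \<eta>L]] by simp
  qed
  ultimately show "\<exists>\<zeta>\<in>L2 BS. \<forall>y. le2 (E.fib y) (\<lambda>x. iota H \<xi> x - \<zeta> x) \<epsilon>" by blast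
qed

lemma kappa_apply: "\<eta> \<in> L2 BS \<Longrightarrow> kappa H \<eta> \<gamma> = (if \<gamma> \<in> A then \<eta> (evp \<gamma>) else 0)"
  by (simp add: kappa_def)

text \<open>The arrows (ev \<gamma>, \<gamma>) with \<gamma> of source x fill a whole fibre of the
  semi-direct product, so kappa does not increase norms; compact supports are preserved because they
  are projected to the second coordinate.\<close>

lemma kappa_L2:
  assumes \<eta>: "\<eta> \<in> L2 BS"
  shows "kappa H \<eta> \<in> L2 H"
proof (rule L2_closed)
  show "kappa H \<eta> \<gamma> = 0" if "\<gamma> \<notin> A" for \<gamma> using that \<eta> by (simp add: kappa_apply)
  fix \<epsilon> :: real assume e: "\<epsilon> > 0"
  then obtain \<zeta> where \<zeta>: "\<zeta> \<in> Cc BS" "\<forall>x. le2 (E.fib x) (\<lambda>\<gamma>. \<eta> \<gamma> - \<zeta> \<gamma>) \<epsilon>" using \<eta> unfolding E.L2_iff by meson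
  have \<zeta>L: "\<zeta> \<in> L2 BS" using \<zeta>(1) E.Cc_subset_L2 by blast
  obtain C where C: "compactin (gtop BS) C" "\<And>\<gamma>. \<gamma> \<notin> C \<Longrightarrow> \<zeta> \<gamma> = 0" using \<zeta>(1) unfolding E.Cc_iff by blast
  have "continuous_map (gtop H) (gtop BS) evp"
    unfolding gtop_BS using continuous_ev rb_ev by (auto simp: continuous_map_in_subtopology continuous_map_paired)
  from continuous_map_compose[OF this E.Cc_continuous[OF \<zeta>(1)]]
  have "continuous_map (gtop H) euclidean (kappa H \<zeta>)"
    by (rule continuous_map_eq) (simp add: kappa_apply \<zeta>L)
  moreover have "kappa H \<zeta> \<gamma> = 0" if "\<gamma> \<notin> snd ` C" for \<gamma>
    using that C(2)[of "evp \<gamma>"] by (force simp: kappa_apply \<zeta>L)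
  ultimately have "kappa H \<zeta> \<in> Cc H" unfolding Cc_iff using image_compactin[OF C(1) continuous_BS_snd] by blast
  then have "kappa H \<zeta> \<in> L2 H" using Cc_subset_L2 by blast
  moreover have "le2 (fib x) (\<lambda>\<gamma>. kappa H \<eta> \<gamma> - kappa H \<zeta> \<gamma>) \<epsilon>" for x
  proof (cases "x \<in> units H")
    case True
    have l: "le2 (evp ` fib x) (\<lambda>\<gamma>. \<eta> \<gamma> - \<zeta> \<gamma>) \<epsilon>" using \<zeta>(2) fib_ev(1)[OF True] by metis
    have "bij_betw snd (evp ` fib x) (fib x)" by (auto simp: bij_betw_def inj_on_def image_image)
    moreover have "le2 (evp ` fib x) (\<lambda>y. \<eta> (evp (snd y)) - \<zeta> (evp (snd y))) \<epsilon>"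
      by (rule le2_cong[OF l]) auto
    ultimately have "le2 (fib x) (\<lambda>\<gamma>. \<eta> (evp \<gamma>) - \<zeta> (evp \<gamma>)) \<epsilon>"
      by (rule le2_reindex[where h=snd and v="\<lambda>\<gamma>. \<eta> (evp \<gamma>) - \<zeta> (evp \<gamma>)"])
    then show ?thesis by (rule le2_cong) (simp add: kappa_apply \<eta> \<zeta>L fibre_iff)
  next
    case False
    then have "fib x = {}" using range_in_units(2) by (auto simp: fibre_iff)
    then show ?thesis using e by (auto simp: le2_def)
  qed
  ultimately show "\<exists>\<zeta>\<in>L2 H. \<forall>x. le2 (fib x) (\<lambda>\<gamma>. kappa H \<eta> \<gamma> - \<zeta> \<gamma>) \<epsilon>" by blast
qed

text \<open>Kappa acts as an adjoint of iota over the units coming from H. This makes Theta of the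
  adjoint an adjoint of Theta.\<close>

lemma L2_inner_kappa:
  assumes \<eta>: "\<eta> \<in> L2 BS" and \<xi>: "\<xi> \<in> L2 H" and x: "x \<in> units H"
  shows "L2_inner H (kappa H \<eta>) \<xi> x = L2_inner BS \<eta> (iota H \<xi>) (ev H x, x)"
proof -
  have "L2_inner BS \<eta> (iota H \<xi>) (ev H x, x) = (\<Sum>\<^sub>\<infinity>\<gamma>\<in>fib x. cnj (\<eta> (evp \<gamma>)) * iota H \<xi> (evp \<gamma>))"
    unfolding L2_inner_def by (rule infsum_reindex_bij_betw[OF bij_evp[OF x], symmetric])
  also have "\<dots> = L2_inner H (kappa H \<eta>) \<xi> x"
    unfolding L2_inner_def
    by (intro infsum_cong) (simp add: kappa_apply[OF \<eta>] iota_apply[OF \<xi> evp_arr] fibre_iff)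
  finally show ?thesis by simp
qed

lemma L2_inner_outside: "x \<notin> units H \<Longrightarrow> L2_inner H \<xi> \<eta> x = 0"
proof -
  assume "x \<notin> units H"
  then have "fib x = {}" using range_in_units(2) by (auto simp: fibre_iff)
  then show "L2_inner H \<xi> \<eta> x = 0" by (simp add: L2_inner_def)
qed

lemma Theta_apply: "\<xi> \<in> L2 H \<Longrightarrow> Theta H T \<xi> = kappa H (T (iota H \<xi>))"
  by (simp add: Theta_def compose_def)

lemma Theta_ext:
  assumes T: "T \<in> adjointable BS"
  shows "Theta H T \<in> L2 H \<rightarrow>\<^sub>E L2 H"
proof (rule PiE_I)
  show "Theta H T \<xi> \<in> L2 H" if "\<xi> \<in> L2 H" for \<xi>
    unfolding Theta_apply[OF that] by (intro kappa_L2 E.adjointable_L2[OF T] iota_L2 that)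
qed (simp add: Theta_def compose_def)

lemma Theta_adjointable:
  assumes T: "T \<in> adjointable BS"
  shows "Theta H T \<in> adjointable H"
proof (rule adjointableI(2)[OF Theta_ext[OF T] Theta_ext[OF E.op_adj(2)[OF T]]])
  fix \<xi> \<eta> x assume \<xi>: "\<xi> \<in> L2 H" and \<eta>: "\<eta> \<in> L2 H"
  note I = iota_L2[OF \<xi>] iota_L2[OF \<eta>]
  show "L2_inner H (Theta H T \<xi>) \<eta> x = L2_inner H \<xi> (Theta H (op_adj BS T) \<eta>) x"
  proof (cases "x \<in> units H")
    case x: True
    have "L2_inner H (Theta H T \<xi>) \<eta> x = L2_inner BS (T (iota H \<xi>)) (iota H \<eta>) (ev H x, x)"
      unfolding Theta_apply[OF \<xi>] by (rule L2_inner_kappa[OF E.adjointable_L2[OF T I(1)] \<eta> x])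
    also have "\<dots> = L2_inner BS (iota H \<xi>) (op_adj BS T (iota H \<eta>)) (ev H x, x)"
      by (rule E.adjointable_inner[OF T I])
    also have "\<dots> = cnj (L2_inner BS (op_adj BS T (iota H \<eta>)) (iota H \<xi>) (ev H x, x))"
      by (rule E.L2_inner_cnj)
    also have "\<dots> = cnj (L2_inner H (Theta H (op_adj BS T) \<eta>) \<xi> x)"
      unfolding Theta_apply[OF \<eta>] L2_inner_kappa[OF E.adjointable_L2[OF E.op_adj(2)[OF T] I(2)] \<xi> x] ..
    also have "\<dots> = L2_inner H \<xi> (Theta H (op_adj BS T) \<eta>) x"
      by (rule L2_inner_cnj[symmetric])
    finally show ?thesis .
  qed (simp add: L2_inner_outside)
qed

text \<open>On the fibre in question, iota turns \<open>dirac \<beta>\<close> into the point mass at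
  (ev \<beta>, \<beta>), and kappa evaluates the image at (ev \<gamma>, \<gamma>).\<close>

lemma kernel_Theta:
  assumes T: "T \<in> adjointable BS" and h: "\<gamma> \<in> A" "\<beta> \<in> A" "s \<gamma> = s \<beta>"
  shows "kernel (Theta H T) \<gamma> \<beta> = E.kernel T (evp \<gamma>) (evp \<beta>)"
proof -
  have x: "s \<gamma> \<in> units H" using h by simp
  note I = iota_L2[OF dirac_L2[OF h(2)]]
  have "kernel (Theta H T) \<gamma> \<beta> = T (iota H (dirac \<beta>)) (evp \<gamma>)"
    unfolding kernel_def Theta_apply[OF dirac_L2[OF h(2)]] kappa_apply[OF E.adjointable_L2[OF T I]] using h by simp
  also have "\<dots> = app (E.kernel T) (E.fib (sr BS (evp \<gamma>))) (iota H (dirac \<beta>)) (evp \<gamma>)"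
    by (rule E.kernel_apply[OF T I evp_arr[OF h(1)]])
  also have "\<dots> = app (E.kernel T) {evp \<beta>} (\<lambda>_. 1) (evp \<gamma>)"
  proof (rule app_restrict)
    have fe: "E.fib (sr BS (evp \<gamma>)) = evp ` fib (s \<gamma>)" unfolding evp_source[OF h(1)] by (rule fib_ev(1)[OF x])
    show "{evp \<beta>} \<subseteq> E.fib (sr BS (evp \<gamma>))" unfolding fe using h by (auto simp: fibre_iff)
    have val: "iota H (dirac \<beta>) (evp k) = (if k = \<beta> then 1 else 0)" if "k \<in> fib (s \<gamma>)" for k
      using iota_apply[OF dirac_L2[OF h(2)] evp_arr[of k]] dirac(2)[OF h(2), of k] that h(3) by (simp add: fibre_iff)
    show "iota H (dirac \<beta>) k = 0" if "k \<in> E.fib (sr BS (evp \<gamma>)) - {evp \<beta>}" for k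
      using that val unfolding fe by (auto split: if_splits)
    show "1 = iota H (dirac \<beta>) k" if "k \<in> {evp \<beta>}" for k
      using that val[of \<beta>] h by (simp add: fibre_iff)
  qed
  finally show ?thesis by (simp add: app_def)
qed

text \<open>Bounds for the matrices \<open>(t (ev f, f a\<inverse>))\<close> over the fibres of \<open>H\<close> pass to the matrices
  \<open>(t (f z, f a\<inverse>))\<close> for arbitrary \<open>z\<close>: the latter are limits of the former along local sections.\<close>

lemma formbd_transfer:
  assumes t: "continuous_map (gtop BS) euclidean t" and K: "compactin (gtop H) K"
    and bd: "\<And>x E F. finite E \<Longrightarrow> E \<subseteq> fib x \<Longrightarrow> finite F \<Longrightarrow> F \<subseteq> fib x \<Longrightarrow> apart K E F \<Longrightarrow>
      formbd (\<lambda>f a. t (ev H f, f \<cdot> iv a)) E F C"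
    and z: "z \<in> Z" and E: "finite E" "E \<subseteq> fib (rb z)" and F: "finite F" "F \<subseteq> fib (rb z)" and sp: "apart K E F"
  shows "formbd (\<lambda>f a. t (act (f, z), f \<cdot> iv a)) E F C"
proof -
  have xu: "rb z \<in> units H" by (rule rb(1)[OF z])
  have EF: "finite (E \<union> F)" "E \<union> F \<subseteq> fib (rb z)" using E F by auto
  have EW: "openin (gtop H) A \<and> e \<in> A" if "e \<in> E \<union> F" for e using that EF(2) by (auto simp: fibre_iff)
  from local_sections[OF xu EF EW] obtain V \<sigma> where V': "openin (unit_top H) V" "rb z \<in> V"
    "\<forall>e\<in>E \<union> F. continuous_map (subtopology (unit_top H) V) (gtop H) (\<sigma> e)"
    "\<forall>e\<in>E \<union> F. \<forall>y\<in>V. \<sigma> e y \<in> fib y \<inter> A" "\<forall>e\<in>E \<union> F. \<sigma> e (rb z) = e"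
    "\<forall>y\<in>V. inj_on (\<lambda>e. \<sigma> e y) (E \<union> F)" "\<forall>e\<in>E \<union> F. openin (gtop H) (\<sigma> e ` V)" .
  define N where "N = {w \<in> Z. rb w \<in> V}"
  have oN: "openin (beta_r H) N" unfolding N_def by (rule openin_continuous_map_preimage[OF continuous_rb V'(1)])
  let ?B = "subtopology (beta_r H) N"
  have NZ: "N \<subseteq> Z" by (auto simp: N_def)
  have topB: "topspace ?B = N" using NZ by auto
  have sig: "\<sigma> e (rb w) \<in> A" "s (\<sigma> e (rb w)) = rb w" if "e \<in> E \<union> F" "w \<in> N" for e w
  proof -
    have "\<sigma> e (rb w) \<in> fib (rb w) \<inter> A" using V'(4) that by (simp add: N_def)
    then show "\<sigma> e (rb w) \<in> A" "s (\<sigma> e (rb w)) = rb w" by (auto simp: fibre_iff)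
  qed
  have csig: "continuous_map ?B (gtop H) (\<lambda>w. \<sigma> e (rb w))" if "e \<in> E \<union> F" for e
  proof -
    have "continuous_map ?B (subtopology (unit_top H) V) rb"
      by (subst continuous_map_in_subtopology) (use continuous_map_from_subtopology[OF continuous_rb] in \<open>auto simp: N_def\<close>)
    from continuous_map_compose[OF this bspec[OF V'(3) that]] show ?thesis by (simp add: o_def)
  qed
  have cq: "continuous_map ?B (gtop H) (\<lambda>w. \<sigma> f (rb w) \<cdot> iv (\<sigma> e (rb w)))" if "f \<in> E \<union> F" "e \<in> E \<union> F" for e f
    by (rule continuous_mul[OF csig[OF that(1)] continuous_inverse_comp[OF csig[OF that(2)]]])
      (use sig that topB in simp)
  have ct: "continuous_map ?B euclidean (\<lambda>w. t (act (\<sigma> f (rb w), w), \<sigma> f (rb w) \<cdot> iv (\<sigma> e (rb w))))"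
    if f: "f \<in> E \<union> F" and e: "e \<in> E \<union> F" for e f
  proof -
    have "continuous_map ?B AZ (\<lambda>w. (\<sigma> f (rb w), w))"
      unfolding continuous_map_in_subtopology
    proof (intro conjI funcsetI)
      show "continuous_map ?B (prod_topology (gtop H) (beta_r H)) (\<lambda>w. (\<sigma> f (rb w), w))"
        using csig[OF f] continuous_map_from_subtopology[OF continuous_map_id]
        by (simp add: continuous_map_paired id_def)
      show "(\<sigma> f (rb w), w) \<in> AD" if "w \<in> topspace ?B" for w using sig[OF f] that topB NZ by (auto simp: AD_iff)
    qed
    from continuous_map_compose[OF this continuous_act]
    have ca: "continuous_map ?B (beta_r H) (\<lambda>w. act (\<sigma> f (rb w), w))" by (simp add: o_def)
    have "continuous_map ?B (gtop BS) (\<lambda>w. (act (\<sigma> f (rb w), w), \<sigma> f (rb w) \<cdot> iv (\<sigma> e (rb w))))"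
      unfolding gtop_BS continuous_map_in_subtopology
    proof (intro conjI funcsetI)
      show "continuous_map ?B (prod_topology (beta_r H) (gtop H)) (\<lambda>w. (act (\<sigma> f (rb w), w), \<sigma> f (rb w) \<cdot> iv (\<sigma> e (rb w))))"
        using ca cq[OF f e] by (simp add: continuous_map_paired)
      fix w assume "w \<in> topspace ?B"
      then have w: "w \<in> N" using topB by simp
      have "(\<sigma> f (rb w), w) \<in> AD" using sig[OF f w] w NZ by (auto simp: AD_iff)
      from rb_act[OF this] show "(act (\<sigma> f (rb w), w), \<sigma> f (rb w) \<cdot> iv (\<sigma> e (rb w))) \<in> {(z, \<gamma>). rb z = r \<gamma>}"
        using sig[OF f w] sig[OF e w] by simp
    qed
    from continuous_map_compose[OF this t] show ?thesis by (simp add: o_def)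
  qed
  have oK: "openin (gtop H) (A - K)" using K Hausdorff compactin_imp_closedin by blast
  \<comment> \<open>The points near z for which the deformed configurations are still K-apart: an
    open condition, since K is closed and only finitely many pairs occur.\<close>
  define M where "M = {w \<in> N. \<forall>p\<in>E \<times> F. \<sigma> (snd p) (rb w) \<cdot> iv (\<sigma> (fst p) (rb w)) \<in> A - K \<and> \<sigma> (fst p) (rb w) \<cdot> iv (\<sigma> (snd p) (rb w)) \<in> A - K}"
  have oM: "openin (beta_r H) M"
  proof -
    have "openin ?B ({w \<in> topspace ?B. \<sigma> f (rb w) \<cdot> iv (\<sigma> e (rb w)) \<in> A - K} \<inter> {w \<in> topspace ?B. \<sigma> e (rb w) \<cdot> iv (\<sigma> f (rb w)) \<in> A - K})"
      if "e \<in> E" "f \<in> F" for e f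
      by (rule openin_Int[OF openin_continuous_map_preimage[OF cq oK] openin_continuous_map_preimage[OF cq oK]]) (use that in auto)
    then have "openin ?B ((\<Inter>p\<in>E \<times> F. {w \<in> topspace ?B. \<sigma> (snd p) (rb w) \<cdot> iv (\<sigma> (fst p) (rb w)) \<in> A - K}
         \<inter> {w \<in> topspace ?B. \<sigma> (fst p) (rb w) \<cdot> iv (\<sigma> (snd p) (rb w)) \<in> A - K}) \<inter> topspace ?B)"
      by (intro openin_INT) (use E F in auto)
    moreover have "((\<Inter>p\<in>E \<times> F. {w \<in> topspace ?B. \<sigma> (snd p) (rb w) \<cdot> iv (\<sigma> (fst p) (rb w)) \<in> A - K}
         \<inter> {w \<in> topspace ?B. \<sigma> (fst p) (rb w) \<cdot> iv (\<sigma> (snd p) (rb w)) \<in> A - K}) \<inter> topspace ?B) = M"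
      unfolding M_def topB by auto
    ultimately have "openin ?B M" by simp
    then show ?thesis using oN openin_trans_full by blast
  qed
  have zN: "z \<in> N" using z V'(2) by (simp add: N_def)
  have s0: "\<sigma> e (rb z) = e" if "e \<in> E \<union> F" for e using V'(5) that by blast
  have zM: "z \<in> M"
    unfolding M_def
  proof (intro CollectI conjI zN ballI)
    fix p assume p: "p \<in> E \<times> F"
    then have m: "fst p \<in> E" "snd p \<in> F" by auto
    then have "fst p \<in> fib (rb z)" "snd p \<in> fib (rb z)" using E F by auto
    then show "\<sigma> (snd p) (rb z) \<cdot> iv (\<sigma> (fst p) (rb z)) \<in> A - K" "\<sigma> (fst p) (rb z) \<cdot> iv (\<sigma> (snd p) (rb z)) \<in> A - K"
      using s0 m sp unfolding apart_def by (auto simp: fibre_iff)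
  qed
  have bound: "L2_set (\<lambda>f. cmod (\<Sum>a\<in>E'. t (act (f, z), f \<cdot> iv a) * c a)) F' \<le> C * L2_set (\<lambda>a. cmod (c a)) E'"
    if E': "E' \<subseteq> E" and F': "F' \<subseteq> F" for E' F' and c :: "'a \<Rightarrow> complex"
  proof (rule ccontr)
    assume neg: "\<not> ?thesis"
    have fin: "finite E'" "finite F'" using E' F' E F finite_subset by blast+
    \<comment> \<open>The norm in question as a continuous function of the unit, with the
      configuration deformed along the sections. If it exceeded the bound at z, it would do so on an
      open set and hence at some point evaluation.\<close>
    define \<Phi> where "\<Phi> w = L2_set (\<lambda>f. cmod (\<Sum>a\<in>E'. t (act (\<sigma> f (rb w), w), \<sigma> f (rb w) \<cdot> iv (\<sigma> a (rb w))) * c a)) F'" for w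
    have c\<Phi>: "continuous_map ?B euclidean \<Phi>"
      unfolding \<Phi>_def L2_set_def
      by (intro continuous_map_sqrt continuous_map_sum continuous_map_real_pow continuous_map_norm
          continuous_map_complex_mult ct) (use fin E' F' in auto)
    define D where "D = C * L2_set (\<lambda>a. cmod (c a)) E'"
    have "openin ?B {w \<in> topspace ?B. \<Phi> w \<in> {D<..}}" by (rule openin_continuous_map_preimage[OF c\<Phi>]) simp
    then have "openin (beta_r H) {w \<in> N. \<Phi> w \<in> {D<..}}" using oN openin_trans_full topB by metis
    then have o: "openin (beta_r H) (M \<inter> {w \<in> N. \<Phi> w \<in> {D<..}})" using oM by blast
    have "\<Phi> z = L2_set (\<lambda>f. cmod (\<Sum>a\<in>E'. t (act (f, z), f \<cdot> iv a) * c a)) F'"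
      unfolding \<Phi>_def
    proof (intro L2_set_cong arg_cong[where f=cmod] sum.cong refl)
      fix f a assume "f \<in> F'" "a \<in> E'"
      then have "f \<in> E \<union> F" "a \<in> E \<union> F" using E' F' by auto
      then show "t (act (\<sigma> f (rb z), z), \<sigma> f (rb z) \<cdot> iv (\<sigma> a (rb z))) * c a = t (act (f, z), f \<cdot> iv a) * c a"
        by (simp add: s0)
    qed
    then have "z \<in> M \<inter> {w \<in> N. \<Phi> w \<in> {D<..}}" using neg zM zN by (simp add: D_def)
    from ev_dense[OF o this] obtain \<gamma> where g: "\<gamma> \<in> A" "ev H \<gamma> \<in> M" "ev H \<gamma> \<in> N" "D < \<Phi> (ev H \<gamma>)" by auto
    have rg: "rb (ev H \<gamma>) = r \<gamma>" by (rule rb_ev[OF g(1)])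
    \<comment> \<open>At ev \<gamma> the deformed configuration lies in the fibre over r \<gamma>;
      right translation by \<gamma> moves it to the fibre over s \<gamma>. Quotients are unchanged,
      and \<open>\<sigma> f (r \<gamma>)\<close> applied to ev \<gamma> is the evaluation at
      \<open>j f\<close>, so the hypothesis \<open>bd\<close> applies.\<close>
    define j where "j e = \<sigma> e (r \<gamma>) \<cdot> \<gamma>" for e
    have sg: "\<sigma> e (r \<gamma>) \<in> A" "s (\<sigma> e (r \<gamma>)) = r \<gamma>" if "e \<in> E \<union> F" for e
      using sig[OF that g(3)] unfolding rg by auto
    have jf: "j e \<in> fib (s \<gamma>)" if "e \<in> E \<union> F" for e using sg[OF that] g(1) by (simp add: j_def fibre_iff)
    have inj: "inj_on j (E \<union> F)"
    proof (rule inj_onI)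
      fix a b assume ab: "a \<in> E \<union> F" "b \<in> E \<union> F" "j a = j b"
      have "\<sigma> a (r \<gamma>) = \<sigma> b (r \<gamma>)"
        by (rule right_cancel[OF g(1) sg(1)[OF ab(1)] sg(1)[OF ab(2)] sg(2)[OF ab(1)] sg(2)[OF ab(2)]])
          (use ab(3) in \<open>simp add: j_def\<close>)
      moreover have "r \<gamma> \<in> V" using g(3) rg by (simp add: N_def)
      ultimately show "a = b" using V'(6) ab by (auto simp: inj_on_def)
    qed
    have quot: "j f \<cdot> iv (j e) = \<sigma> f (r \<gamma>) \<cdot> iv (\<sigma> e (r \<gamma>))" if "e \<in> E \<union> F" "f \<in> E \<union> F" for e f
    proof -
      have "j f \<cdot> iv (j e) = (\<sigma> f (r \<gamma>) \<cdot> \<gamma>) \<cdot> (iv \<gamma> \<cdot> iv (\<sigma> e (r \<gamma>)))"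
        using sg[OF that(1)] g(1) by (simp add: j_def inverse_mul)
      also have "\<dots> = \<sigma> f (r \<gamma>) \<cdot> (\<gamma> \<cdot> (iv \<gamma> \<cdot> iv (\<sigma> e (r \<gamma>))))"
        by (rule mul_assoc) (use sg[OF that(1)] sg[OF that(2)] g(1) in auto)
      also have "\<gamma> \<cdot> (iv \<gamma> \<cdot> iv (\<sigma> e (r \<gamma>))) = iv (\<sigma> e (r \<gamma>))"
        using sg[OF that(1)] g(1) by simp
      finally show ?thesis .
    qed
    have evj: "ev H (j f) = act (\<sigma> f (r \<gamma>), ev H \<gamma>)" if "f \<in> E \<union> F" for f
      using act_ev[OF sg(1)[OF that] g(1) sg(2)[OF that]] by (simp add: j_def)
    have sepj: "apart K (j ` E') (j ` F')"
      unfolding apart_def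
    proof (intro ballI)
      fix a b assume "a \<in> j ` E'" "b \<in> j ` F'"
      then obtain e f where ef: "e \<in> E" "a = j e" "f \<in> F" "b = j f" using E' F' by auto
      have q: "b \<cdot> iv a = \<sigma> f (r \<gamma>) \<cdot> iv (\<sigma> e (r \<gamma>))" "a \<cdot> iv b = \<sigma> e (r \<gamma>) \<cdot> iv (\<sigma> f (r \<gamma>))"
        using quot[of e f] quot[of f e] ef by auto
      have "(e, f) \<in> E \<times> F" using ef by simp
      with g(2) have "\<sigma> (snd (e, f)) (rb (ev H \<gamma>)) \<cdot> iv (\<sigma> (fst (e, f)) (rb (ev H \<gamma>))) \<in> A - K \<and>
          \<sigma> (fst (e, f)) (rb (ev H \<gamma>)) \<cdot> iv (\<sigma> (snd (e, f)) (rb (ev H \<gamma>))) \<in> A - K"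
        unfolding M_def mem_Collect_eq by (elim conjE) (rule bspec)
      then show "b \<cdot> iv a \<notin> K \<and> a \<cdot> iv b \<notin> K" unfolding q rg by simp
    qed
    have jE: "inj_on j E'" "inj_on j F'" using inj E' F' by (meson Un_upper1 Un_upper2 inj_on_subset subset_trans)+
    have "formbd (\<lambda>f a. t (ev H f, f \<cdot> iv a)) (j ` E') (j ` F') C"
      by (rule bd[where x="s \<gamma>"]) (use fin sepj jf E' F' in auto)
    then have "formbd (\<lambda>f a. t (ev H (j f), j f \<cdot> iv (j a))) E' F' C"
      unfolding formbd_reindex[OF jE] .
    from formbdD[OF this fin(1) order_refl fin(2) order_refl, of c]
    have "L2_set (\<lambda>f. cmod (\<Sum>a\<in>E'. t (ev H (j f), j f \<cdot> iv (j a)) * c a)) F' \<le> D" unfolding D_def .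
    moreover have "\<Phi> (ev H \<gamma>) = L2_set (\<lambda>f. cmod (\<Sum>a\<in>E'. t (ev H (j f), j f \<cdot> iv (j a)) * c a)) F'"
      unfolding \<Phi>_def rg
    proof (intro L2_set_cong arg_cong[where f=cmod] sum.cong refl)
      fix f a assume "f \<in> F'" "a \<in> E'"
      then have "f \<in> E \<union> F" "a \<in> E \<union> F" using E' F' by auto
      then show "t (act (\<sigma> f (r \<gamma>), ev H \<gamma>), \<sigma> f (r \<gamma>) \<cdot> iv (\<sigma> a (r \<gamma>))) * c a = t (ev H (j f), j f \<cdot> iv (j a)) * c a"
        by (simp add: quot evj)
    qed
    ultimately show False using g(4) by simp
  qed
  show ?thesis by (rule formbdI) (rule bound)
qed

section \<open>Invariant kernels as functions of one arrow, and the isometry\<close>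

lemma apart_empty: "apart {} X Y"
  by (simp add: apart_def)

text \<open>The function t of the overview: the kernel at g and the unit at its source, to which
  every pair is moved by a translation.\<close>

definition quotient_kernel :: "('a beta \<times> 'a) L2_op \<Rightarrow> 'a beta \<times> 'a \<Rightarrow> complex" where
  "quotient_kernel T g = E.kernel T g (sr BS g)"

text \<open>Invariance is applied to the translation of the pair (g h\<inverse>, h h\<inverse>) by
  h, whose second entry is a unit.\<close>

lemma kernel_quotient_kernel:
  assumes "E.invariant_kernel (E.kernel T)" "g \<in> arr BS" "h \<in> arr BS" "sr BS g = sr BS h"
  shows "E.kernel T g h = quotient_kernel T (gmul BS g (ginv BS h))"
proof -
  have "E.kernel T (gmul BS g (ginv BS h)) (gmul BS h (ginv BS h)) = E.kernel T g h"
    by (rule E.invariant_kernelD[OF assms(1-3)]) (use assms in simp_all)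
  then show ?thesis using assms(2-4) by (simp add: quotient_kernel_def)
qed

lemma continuous_quotient_kernel:
  assumes T: "T \<in> adjointable BS"
  shows "continuous_map (gtop BS) euclidean (quotient_kernel T)"
proof -
  have "continuous_map (gtop BS) (subtopology (prod_topology (gtop BS) (gtop BS)) {(\<gamma>, \<beta>). sr BS \<gamma> = sr BS \<beta>}) (\<lambda>g. (g, sr BS g))"
    unfolding continuous_map_in_subtopology
  proof (intro conjI funcsetI)
    show "continuous_map (gtop BS) (prod_topology (gtop BS) (gtop BS)) (\<lambda>g. (g, sr BS g))"
      using E.continuous_source_arr continuous_map_id[of "gtop BS"] by (simp add: continuous_map_paired id_def)
  qed simp
  from continuous_map_compose[OF this E.kernel_continuous[OF T]] show ?thesis by (simp add: o_def quotient_kernel_def[abs_def])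
qed

lemma kernel_Theta_quotient_kernel:
  assumes T: "T \<in> adjointable BS" "E.invariant_kernel (E.kernel T)" and h: "f \<in> fib x" "a \<in> fib x"
  shows "kernel (Theta H T) f a = quotient_kernel T (ev H f, f \<cdot> iv a)"
proof -
  have A: "f \<in> A" "a \<in> A" "s f = s a" using h by (auto simp: fibre_iff)
  have "kernel (Theta H T) f a = E.kernel T (evp f) (evp a)" by (rule kernel_Theta[OF T(1) A])
  also have "\<dots> = quotient_kernel T (gmul BS (evp f) (ginv BS (evp a)))"
    by (rule kernel_quotient_kernel[OF T(2) evp_arr[OF A(1)] evp_arr[OF A(2)]]) (simp add: evp_source A)
  also have "\<dots> = quotient_kernel T (ev H f, f \<cdot> iv a)" by (simp add: BS_ops)
  finally show ?thesis .
qed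

lemma formbd_evp:
  assumes T: "T \<in> adjointable BS" and b: "formbd (E.kernel T) (evp ` X) (evp ` Y) C"
    and h: "X \<subseteq> fib x" "Y \<subseteq> fib x"
  shows "formbd (kernel (Theta H T)) X Y C"
proof (rule formbd_cong)
  have "inj_on evp X" "inj_on evp Y" by (auto simp: inj_on_def)
  then show "formbd (\<lambda>y x. E.kernel T (evp y) (evp x)) X Y C" using b formbd_reindex by blast
  fix k g assume "k \<in> X" "g \<in> Y"
  then have "k \<in> fib x" "g \<in> fib x" using h by auto
  then show "kernel (Theta H T) g k = E.kernel T (evp g) (evp k)" by (intro kernel_Theta[OF T]) (simp_all add: fibre_iff)
qed

text \<open>The matrices of Theta T are those of T on the fibres over the units (ev x, x), which are
  only some of the fibres of the semi-direct product.\<close>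

lemma Theta_op_norm_le:
  assumes T: "T \<in> adjointable BS"
  shows "op_norm H (Theta H T) \<le> op_norm BS T"
  unfolding op_norm_le_iff[OF Theta_adjointable[OF T] E.op_norm_formbd(1)[OF T]]
proof
  fix x
  show "formbd (kernel (Theta H T)) (fib x) (fib x) (op_norm BS T)"
  proof (cases "x \<in> units H")
    case True
    show ?thesis
      by (rule formbd_evp[OF T _ order_refl order_refl])
        (use E.op_norm_formbd(2)[OF T, of "(ev H x, x)"] fib_ev(1)[OF True] in simp)
  next
    case False
    then have "fib x = {}" using range_in_units(2) by (auto simp: fibre_iff)
    then show ?thesis by (simp add: formbd_def)
  qed
qed

lemma formbd_kernel:
  assumes m: "\<And>g h. g \<in> arr BS \<Longrightarrow> h \<in> arr BS \<Longrightarrow> sr BS g = sr BS h \<Longrightarrow> m g h = t (gmul BS g (ginv BS h))"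
    and z: "z \<in> Z" and X: "X \<subseteq> fib (rb z)" and Y: "Y \<subseteq> fib (rb z)"
    and b: "formbd (\<lambda>f a. t (act (f, z), f \<cdot> iv a)) X Y C"
  shows "formbd m (jw z ` X) (jw z ` Y) C"
  unfolding formbd_reindex[OF inj_jw inj_jw]
proof (rule formbd_cong[OF b])
  fix a f assume h: "a \<in> X" "f \<in> Y"
  then have h': "a \<in> fib (rb z)" "f \<in> fib (rb z)" using X Y by auto
  have "m (jw z f) (jw z a) = t (gmul BS (jw z f) (ginv BS (jw z a)))"
    by (rule m) (simp_all add: jw_arr[OF z h'(1)] jw_arr[OF z h'(2)])
  then show "m (jw z f) (jw z a) = t (act (f, z), f \<cdot> iv a)" by (simp add: jw_quot[OF z h'(2,1)])
qed

lemma Theta_isometric: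
  assumes T: "T \<in> adjointable BS" "E.invariant_kernel (E.kernel T)"
  shows "op_norm H (Theta H T) = op_norm BS T"
proof (rule antisym[OF Theta_op_norm_le[OF T(1)]])
  define C where "C = op_norm H (Theta H T)"
  note fb = op_norm_formbd[OF Theta_adjointable[OF T(1)]]
  have "formbd (E.kernel T) (E.fib y) (E.fib y) C" for y
  proof (rule formbd_fib_BS)
    fix z assume z: "z \<in> Z"
    have b: "formbd (\<lambda>f a. quotient_kernel T (act (f, z), f \<cdot> iv a)) (fib (rb z)) (fib (rb z)) C"
    proof (rule formbdI)
      fix E F c assume h: "finite E" "E \<subseteq> fib (rb z)" "finite F" "F \<subseteq> fib (rb z)"
      have "formbd (\<lambda>f a. quotient_kernel T (act (f, z), f \<cdot> iv a)) E F C"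
      \<comment> \<open>With the empty compact set being apart is vacuous, so the transfer concerns
        the full matrices and hence the norm.\<close>
      proof (rule formbd_transfer[OF continuous_quotient_kernel[OF T(1)] compactin_empty _ z h apart_empty])
        fix x E F assume EF: "E \<subseteq> fib x" "F \<subseteq> fib x"
        show "formbd (\<lambda>f a. quotient_kernel T (ev H f, f \<cdot> iv a)) E F C"
        proof (rule formbd_cong)
          show "formbd (kernel (Theta H T)) E F C" by (rule formbd_mono[OF fb(2) _ EF]) (simp add: C_def)
          fix a f assume "a \<in> E" "f \<in> F"
          then have "f \<in> fib x" "a \<in> fib x" using EF by auto
          then show "quotient_kernel T (ev H f, f \<cdot> iv a) = kernel (Theta H T) f a" by (rule kernel_Theta_quotient_kernel[OF T, symmetric])
        qed
      qed
      then show "L2_set (\<lambda>f. cmod (\<Sum>a\<in>E. quotient_kernel T (act (f, z), f \<cdot> iv a) * c a)) F \<le> C * L2_set (\<lambda>a. cmod (c a)) E"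
        by (rule formbdD) (use h in auto)
    qed
    have "formbd (E.kernel T) (jw z ` fib (rb z)) (jw z ` fib (rb z)) C"
      by (rule formbd_kernel[where t="quotient_kernel T" and m="E.kernel T", OF _ z order_refl order_refl b]) (rule kernel_quotient_kernel[OF T(2)])
    then show "formbd (\<lambda>f a. E.kernel T (jw z f) (jw z a)) (fib (rb z)) (fib (rb z)) C"
      unfolding formbd_reindex[OF inj_jw inj_jw] .
  qed
  then have "op_norm BS T \<le> C"
    using E.op_norm_le_iff[OF T(1)] fb(1) unfolding C_def by blast
  then show "op_norm BS T \<le> op_norm H (Theta H T)" by (simp add: C_def)
qed

text \<open>A compact set for T is projected to its second coordinates: if the quotients in H avoid
  the projection, the quotients of the corresponding arrows (ev \<gamma>, \<gamma>) avoid the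
  original set.\<close>

lemma Theta_ql_kernel:
  assumes T: "T \<in> adjointable BS" and q: "E.ql_kernel (E.kernel T)"
  shows "ql_kernel (kernel (Theta H T))"
proof (rule ql_kernelI)
  fix \<epsilon> :: real assume "\<epsilon> > 0"
  from E.ql_kernelD[OF q this] obtain K where K: "compactin (gtop BS) K"
    "\<And>x E F. E \<subseteq> E.fib x \<Longrightarrow> F \<subseteq> E.fib x \<Longrightarrow> E.apart K E F \<Longrightarrow> formbd (E.kernel T) E F \<epsilon>" by metis
  have "formbd (kernel (Theta H T)) E F \<epsilon>" if h: "E \<subseteq> fib x" "F \<subseteq> fib x" "apart (snd ` K) E F" for x E F
  proof (cases "E = {}")
    case True
    then show ?thesis by (simp add: formbd_def L2_set_def)
  next
    case False
    then obtain e where "e \<in> fib x" using h by blast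
    then have x: "x \<in> units H" using range_in_units(2) by (auto simp: fibre_iff)
    have sub: "evp ` E \<subseteq> E.fib (ev H x, x)" "evp ` F \<subseteq> E.fib (ev H x, x)" unfolding fib_ev(1)[OF x] using h by auto
    have "E.apart K (evp ` E) (evp ` F)"
      unfolding E.apart_def
    proof (intro ballI conjI notI; elim imageE)
      show False if "gmul BS v (ginv BS u) \<in> K" "u = evp e" "e \<in> E" "v = evp f" "f \<in> F" for u v e f
        using that h(3) unfolding apart_def by (force simp: BS_ops)
      show False if "gmul BS u (ginv BS v) \<in> K" "u = evp e" "e \<in> E" "v = evp f" "f \<in> F" for u v e f
        using that h(3) unfolding apart_def by (force simp: BS_ops)
    qed
    then show ?thesis using formbd_evp[OF T K(2)[OF sub] h(1,2)] by blast
  qed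
  then show "\<exists>K. compactin (gtop H) K \<and> (\<forall>x E F. finite E \<and> E \<subseteq> fib x \<and> finite F \<and> F \<subseteq> fib x \<and> apart K E F
    \<longrightarrow> formbd (kernel (Theta H T)) E F \<epsilon>)"
    using image_compactin[OF K(1) continuous_BS_snd] by blast
qed

lemma Theta_surj:
  assumes S: "S \<in> adjointable H" and q: "ql_kernel (kernel S)"
  obtains T where "T \<in> adjointable BS" "E.ql_kernel (E.kernel T)" "E.invariant_kernel (E.kernel T)" "Theta H T = S"
proof -
  \<comment> \<open>The required function must satisfy t(\<gamma>, \<gamma> \<beta>\<inverse>) =
    kernel at (\<gamma>, \<beta>). With u = \<beta> \<gamma>\<inverse>, the inverse of the quotient,
    \<beta> becomes u \<gamma> and (u, \<gamma>) is a composable pair, so that \<open>ext\<close>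
    can be applied.\<close>
  define F where "F u \<gamma> = kernel S \<gamma> (u \<cdot> \<gamma>)" for u \<gamma>
  define B where "B = op_norm H S"
  note fb = op_norm_formbd[OF S, folded B_def]
  have Fc: "continuous_map CP euclidean (\<lambda>(u, \<gamma>). F u \<gamma>)"
  proof -
    have c1: "continuous_map CP (gtop H) fst" and c2: "continuous_map CP (gtop H) snd"
      by (auto intro: continuous_map_from_subtopology continuous_map_fst continuous_map_snd)
    have c3: "continuous_map CP (gtop H) (\<lambda>p. fst p \<cdot> snd p)"
      by (rule continuous_mul[OF c1 c2]) (auto simp: composable_def)
    have "continuous_map CP pair_top (\<lambda>p. (snd p, fst p \<cdot> snd p))"
      unfolding continuous_map_in_subtopology
      by (intro conjI funcsetI) (use c2 c3 in \<open>auto simp: continuous_map_paired composable_def\<close>)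
    from continuous_map_compose[OF this kernel_continuous[OF S]]
    show ?thesis by (simp add: o_def case_prod_unfold F_def)
  qed
  have Fb: "cmod (F u \<gamma>) \<le> B" if "u \<in> A" "\<gamma> \<in> A" "s u = r \<gamma>" for u \<gamma>
  proof -
    have "le2 (fib (s \<gamma>)) (kernel S \<gamma>) B" by (rule formbd_row[OF fb(2,1)]) (use that in \<open>simp add: fibre_iff\<close>)
    then show ?thesis unfolding F_def by (rule le2_point) (use that in \<open>simp add: fibre_iff\<close>)
  qed
  have c_ext: "continuous_map AZ euclidean (ext F)" by (rule continuous_ext[OF Fc Fb])
  \<comment> \<open>Arrows (z, \<gamma>) satisfy r \<gamma> = \<open>rb z\<close>, while the domain
    of \<open>ext F\<close> asks for the source of the first entry to be \<open>rb z\<close>;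
    inversion turns one condition into the other.\<close>
  define t where "t x = ext F (iv (snd x), fst x)" for x :: "'a beta \<times> 'a"
  have ct: "continuous_map (gtop BS) euclidean t"
  proof -
    have "continuous_map (gtop BS) AZ (\<lambda>x. (iv (snd x), fst x))"
      unfolding continuous_map_in_subtopology
    proof (intro conjI funcsetI)
      show "continuous_map (gtop BS) (prod_topology (gtop H) (beta_r H)) (\<lambda>x. (iv (snd x), fst x))"
        using continuous_inverse_comp[OF continuous_BS_snd] continuous_BS_fst by (simp add: continuous_map_paired)
    qed (auto simp: arrE AD_iff)
    from continuous_map_compose[OF this c_ext] show ?thesis by (simp add: o_def t_def[abs_def])
  qed
  have t_ev: "t (ev H f, f \<cdot> iv a) = kernel S f a" if h: "f \<in> fib x" "a \<in> fib x" for f a x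
  proof -
    have A: "f \<in> A" "a \<in> A" "s f = s a" using h by (auto simp: fibre_iff)
    have i: "iv (f \<cdot> iv a) = a \<cdot> iv f" by (rule mul_inverse_inverse[OF A])
    have "t (ev H f, f \<cdot> iv a) = F (a \<cdot> iv f) f"
      unfolding t_def fst_conv snd_conv i by (rule ext_ev[OF Fc Fb]) (use A in auto)
    also have "\<dots> = kernel S f a" unfolding F_def using A by simp
    finally show ?thesis .
  qed
  have tr: "formbd (\<lambda>f a. t (act (f, z), f \<cdot> iv a)) E F C"
    if K: "compactin (gtop H) K" and b: "\<And>x E F. E \<subseteq> fib x \<Longrightarrow> F \<subseteq> fib x \<Longrightarrow> apart K E F \<Longrightarrow> formbd (kernel S) E F C"
      and z: "z \<in> Z" and h: "finite E" "E \<subseteq> fib (rb z)" "finite F" "F \<subseteq> fib (rb z)" "apart K E F" for K C z E F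
  proof (rule formbd_transfer[OF ct K _ z h])
    fix x E F assume EF: "E \<subseteq> fib x" "F \<subseteq> fib x" "apart K E F"
    show "formbd (\<lambda>f a. t (ev H f, f \<cdot> iv a)) E F C"
    proof (rule formbd_cong[OF b[OF EF]])
      fix a f assume "a \<in> E" "f \<in> F"
      then have "f \<in> fib x" "a \<in> fib x" using EF by auto
      then show "t (ev H f, f \<cdot> iv a) = kernel S f a" by (rule t_ev)
    qed
  qed
  define m where "m g h = t (gmul BS g (ginv BS h))" for g h
  have mb: "formbd m (E.fib y) (E.fib y) B" for y
  proof (rule formbd_fib_BS)
    fix z assume z: "z \<in> Z"
    have "formbd (\<lambda>f a. t (act (f, z), f \<cdot> iv a)) (fib (rb z)) (fib (rb z)) B"
    proof (rule formbdI)
      fix E F c assume h: "finite E" "E \<subseteq> fib (rb z)" "finite F" "F \<subseteq> fib (rb z)"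
      have "formbd (\<lambda>f a. t (act (f, z), f \<cdot> iv a)) E F B"
        by (rule tr[OF compactin_empty _ z h apart_empty]) (rule formbd_mono[OF fb(2) order_refl])
      then show "L2_set (\<lambda>f. cmod (\<Sum>a\<in>E. t (act (f, z), f \<cdot> iv a) * c a)) F \<le> B * L2_set (\<lambda>a. cmod (c a)) E"
        by (rule formbdD) (use h in auto)
    qed
    then have "formbd m (jw z ` fib (rb z)) (jw z ` fib (rb z)) B"
      by (rule formbd_kernel[where t=t and m=m, OF m_def z order_refl order_refl])
    then show "formbd (\<lambda>f a. m (jw z f) (jw z a)) (fib (rb z)) (fib (rb z)) B"
      unfolding formbd_reindex[OF inj_jw inj_jw] .
  qed
  have mq: "E.ql_kernel m"
  proof (rule E.ql_kernelI)
    fix \<epsilon> :: real assume "\<epsilon> > 0"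
    from ql_kernelD[OF q this] obtain K where K: "compactin (gtop H) K"
      "\<And>x E F. E \<subseteq> fib x \<Longrightarrow> F \<subseteq> fib x \<Longrightarrow> apart K E F \<Longrightarrow> formbd (kernel S) E F \<epsilon>" by metis
    \<comment> \<open>The lift of the scale K of S. Quotients in the fibre over any z lie in L
      exactly if their second coordinates lie in K.\<close>
    define L where "L = {x \<in> arr BS. snd x \<in> K}"
    have "formbd m E F \<epsilon>" if h: "finite E" "E \<subseteq> E.fib y" "finite F" "F \<subseteq> E.fib y" "E.apart L E F" for y E F
    proof (cases "E = {}")
      case True
      then show ?thesis by (simp add: formbd_def L2_set_def)
    next
      case False
      then obtain e where "e \<in> E.fib y" using h by blast
      then obtain z where z: "z \<in> Z" "y = (z, rb z)" using fib_BS_cases by metis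
      obtain X where X: "X \<subseteq> fib (rb z)" "finite X" "E = jw z ` X"
        using finite_subset_image[OF h(1)] h(2) unfolding z(2) fib_BS[OF z(1)] by metis
      obtain Y where Y: "Y \<subseteq> fib (rb z)" "finite Y" "F = jw z ` Y"
        using finite_subset_image[OF h(3)] h(4) unfolding z(2) fib_BS[OF z(1)] by metis
      have "apart K X Y"
        unfolding apart_def
      proof (intro ballI conjI notI)
        fix a f assume af: "a \<in> X" "f \<in> Y"
        have fa: "a \<in> fib (rb z)" "f \<in> fib (rb z)" using af X Y by auto
        have arr: "gmul BS (jw z u) (ginv BS (jw z v)) \<in> arr BS" if "u \<in> fib (rb z)" "v \<in> fib (rb z)" for u v
          using jw_arr[OF z(1) that(1)] jw_arr[OF z(1) that(2)] by simp
        have inL: "gmul BS (jw z u) (ginv BS (jw z v)) \<in> L" if "u \<in> fib (rb z)" "v \<in> fib (rb z)" "u \<cdot> iv v \<in> K" for u v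
          using arr[OF that(1,2)] jw_quot[OF z(1) that(1,2)] that(3) by (simp add: L_def)
        have n: "gmul BS (jw z f) (ginv BS (jw z a)) \<notin> L" "gmul BS (jw z a) (ginv BS (jw z f)) \<notin> L"
          using h(5) af unfolding E.apart_def X(3) Y(3) by auto
        show False if "f \<cdot> iv a \<in> K" using inL[OF fa(2,1) that] n by blast
        show False if "a \<cdot> iv f \<in> K" using inL[OF fa(1,2) that] n by blast
      qed
      from tr[OF K z(1) X(2,1) Y(2,1) this] show ?thesis
        unfolding X(3) Y(3) by (rule formbd_kernel[where t=t and m=m, OF m_def z(1) X(1) Y(1)])
    qed
    then show "\<exists>K. compactin (gtop BS) K \<and> (\<forall>x E F. finite E \<and> E \<subseteq> E.fib x \<and> finite F \<and> F \<subseteq> E.fib x \<and> E.apart K E F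
      \<longrightarrow> formbd m E F \<epsilon>)" using compact_lift[OF K(1)] unfolding L_def by blast
  qed
  have mc: "continuous_map E.pair_top euclidean (\<lambda>(g, h). m g h)"
  proof -
    have c1: "continuous_map E.pair_top (gtop BS) fst" and c2: "continuous_map E.pair_top (gtop BS) snd"
      by (auto intro: continuous_map_from_subtopology continuous_map_fst continuous_map_snd)
    have "continuous_map E.pair_top (gtop BS) (\<lambda>p. gmul BS (fst p) (ginv BS (snd p)))"
      by (rule E.continuous_mul[OF c1 E.continuous_inverse_comp[OF c2]]) auto
    from continuous_map_compose[OF this ct] show ?thesis by (simp add: o_def case_prod_unfold m_def)
  qed
  note ko = E.kernel_op_adjointable[OF mc mb fb(1) mq]
  show thesis
  proof (rule that[of "E.kernel_op m"])
    show T: "E.kernel_op m \<in> adjointable BS" by (rule ko(1))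
    show "E.ql_kernel (E.kernel (E.kernel_op m))" by (rule E.ql_kernel_cong[OF mq]) (rule ko(2); simp add: E.fibre_iff)
    show "E.invariant_kernel (E.kernel (E.kernel_op m))"
      unfolding E.invariant_kernel_def
    proof (intro ballI impI)
      fix g h b assume x: "g \<in> arr BS" "h \<in> arr BS" "b \<in> arr BS" "sr BS g = rg BS b \<and> sr BS h = rg BS b"
      \<comment> \<open>The kernel m depends only on g h\<inverse>, and (g b)(h b)\<inverse> = g
        h\<inverse>.\<close>
      have "gmul BS (gmul BS g b) (ginv BS (gmul BS h b)) = gmul BS (gmul BS g b) (gmul BS (ginv BS b) (ginv BS h))"
        using x by (simp add: E.inverse_mul)
      also have "\<dots> = gmul BS g (gmul BS b (gmul BS (ginv BS b) (ginv BS h)))"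
        by (rule E.mul_assoc) (use x in simp_all)
      also have "gmul BS b (gmul BS (ginv BS b) (ginv BS h)) = ginv BS h" using x by simp
      finally have "m (gmul BS g b) (gmul BS h b) = m g h" by (simp add: m_def)
      then show "E.kernel (E.kernel_op m) (gmul BS g b) (gmul BS h b) = E.kernel (E.kernel_op m) g h"
        using ko(2)[of "gmul BS g b" "gmul BS h b"] ko(2)[of g h] x by simp
    qed
    show "Theta H (E.kernel_op m) = S"
    proof (rule adjointable_eqI[OF Theta_adjointable[OF T] S])
      fix f a assume A: "f \<in> A" "a \<in> A" "s f = s a"
      have "kernel (Theta H (E.kernel_op m)) f a = E.kernel (E.kernel_op m) (evp f) (evp a)" by (rule kernel_Theta[OF T A])
      also have "\<dots> = m (evp f) (evp a)" by (rule ko(2)) (simp_all add: evp_arr evp_source A)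
      also have "\<dots> = t (ev H f, f \<cdot> iv a)" by (simp add: m_def BS_ops)
      also have "\<dots> = kernel S f a" by (rule t_ev[of _ "s a"]) (use A in \<open>simp_all add: fibre_iff\<close>)
      finally show "kernel (Theta H (E.kernel_op m)) f a = kernel S f a" .
    qed
  qed
qed

section \<open>Compatibility with the C*-operations, and the isomorphism\<close>

lemma Theta_add:
  assumes "S \<in> adjointable BS" "T \<in> adjointable BS"
  shows "Theta H (op_add BS S T) = op_add H (Theta H S) (Theta H T)"
  by (rule adjointable_eqI)
    (simp_all add: assms Theta_adjointable op_add_adjointable E.op_add_adjointable kernel_Theta kernel_add E.kernel_add evp_arr)

lemma Theta_scale:
  assumes "T \<in> adjointable BS"
  shows "Theta H (op_scale BS c T) = op_scale H c (Theta H T)"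
  by (rule adjointable_eqI)
    (simp_all add: assms Theta_adjointable op_scale_adjointable E.op_scale_adjointable kernel_Theta kernel_scale E.kernel_scale evp_arr)

lemma Theta_adj:
  assumes T: "T \<in> adjointable BS"
  shows "Theta H (op_adj BS T) = op_adj H (Theta H T)"
proof (rule adjointable_eqI)
  note \<Theta> = Theta_adjointable[OF T]
  show "Theta H (op_adj BS T) \<in> adjointable H" by (rule Theta_adjointable[OF E.op_adj(2)[OF T]])
  show "op_adj H (Theta H T) \<in> adjointable H" by (rule op_adj(2)[OF \<Theta>])
  fix \<gamma> \<beta> assume A: "\<gamma> \<in> A" "\<beta> \<in> A" "s \<gamma> = s \<beta>"
  have "kernel (Theta H (op_adj BS T)) \<gamma> \<beta> = E.kernel (op_adj BS T) (evp \<gamma>) (evp \<beta>)"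
    by (rule kernel_Theta[OF E.op_adj(2)[OF T] A])
  also have "\<dots> = cnj (E.kernel T (evp \<beta>) (evp \<gamma>))"
    by (rule E.op_adj(3)[OF T]) (simp_all add: evp_arr evp_source A)
  also have "\<dots> = cnj (kernel (Theta H T) \<beta> \<gamma>)" by (simp add: kernel_Theta[OF T A(2,1) A(3)[symmetric]])
  also have "\<dots> = kernel (op_adj H (Theta H T)) \<gamma> \<beta>" by (rule op_adj(3)[OF \<Theta> A(2,1) A(3)[symmetric], symmetric])
  finally show "kernel (Theta H (op_adj BS T)) \<gamma> \<beta> = kernel (op_adj H (Theta H T)) \<gamma> \<beta>" .
qed

text \<open>Multiplicativity is not formal, as iota after kappa need not be the identity. It holds
  because the product of kernels at (ev \<gamma>, \<gamma>) and (ev \<beta>, \<beta>) sums only over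
  the same fibre, and all points of that fibre have the form (ev k, k), where Theta keeps the
  kernels of both factors.\<close>

lemma Theta_mul:
  assumes S: "S \<in> adjointable BS" and T: "T \<in> adjointable BS"
  shows "Theta H (op_mul BS S T) = op_mul H (Theta H S) (Theta H T)"
proof (rule adjointable_eqI)
  note \<Theta> = Theta_adjointable[OF S] Theta_adjointable[OF T]
  note ST = E.op_mul_adjointable[OF S T]
  show "Theta H (op_mul BS S T) \<in> adjointable H" by (rule Theta_adjointable[OF ST])
  show "op_mul H (Theta H S) (Theta H T) \<in> adjointable H" by (rule op_mul_adjointable[OF \<Theta>])
  fix \<gamma> \<beta> assume A: "\<gamma> \<in> A" "\<beta> \<in> A" "s \<gamma> = s \<beta>"
  have x: "s \<gamma> \<in> units H" using A by simp
  have "kernel (Theta H (op_mul BS S T)) \<gamma> \<beta> = E.kernel (op_mul BS S T) (evp \<gamma>) (evp \<beta>)" by (rule kernel_Theta[OF ST A])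
  also have "\<dots> = (\<Sum>\<^sub>\<infinity>k\<in>E.fib (sr BS (evp \<gamma>)). E.kernel S (evp \<gamma>) k * E.kernel T k (evp \<beta>))"
    using E.kernel_mul[OF S T evp_arr[OF A(1)] evp_arr[OF A(2)]] by (simp add: app_def)
  also have "\<dots> = (\<Sum>\<^sub>\<infinity>k\<in>fib (s \<gamma>). E.kernel S (evp \<gamma>) (evp k) * E.kernel T (evp k) (evp \<beta>))"
    unfolding evp_source[OF A(1)] by (rule infsum_reindex_bij_betw[OF bij_evp[OF x], symmetric])
  also have "\<dots> = (\<Sum>\<^sub>\<infinity>k\<in>fib (s \<gamma>). kernel (Theta H S) \<gamma> k * kernel (Theta H T) k \<beta>)"
    by (intro infsum_cong) (use A in \<open>simp add: fibre_iff kernel_Theta S T\<close>)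
  also have "\<dots> = kernel (op_mul H (Theta H S) (Theta H T)) \<gamma> \<beta>"
    using kernel_mul[OF \<Theta> A(1,2)] by (simp add: app_def)
  finally show "kernel (Theta H (op_mul BS S T)) \<gamma> \<beta> = kernel (op_mul H (Theta H S) (Theta H T)) \<gamma> \<beta>" .
qed

text \<open>The difference of S and T is again in the equivariant algebra, so the isometry applies
  to it; a matrix bound 0 then forces all kernel entries to agree.\<close>

lemma Theta_inj:
  assumes S: "S \<in> Cuq_equivariant BS" and T: "T \<in> Cuq_equivariant BS" and eq: "Theta H S = Theta H T"
  shows "S = T"
proof -
  have adj: "S \<in> adjointable BS" "T \<in> adjointable BS" using S T by (auto simp: E.Cuq_equivariant_iff)
  define D where "D = op_add BS S (op_scale BS (-1) T)"
  have "D \<in> Cuq_equivariant BS"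
    using E.Cuq_equivariant_cstar_subalgebra S T unfolding cstar_subalgebra_def D_def by blast
  then have D: "D \<in> adjointable BS" "E.invariant_kernel (E.kernel D)" by (auto simp: E.Cuq_equivariant_iff)
  have "op_norm H (Theta H D) \<le> 0"
    unfolding op_norm_le_iff[OF Theta_adjointable[OF D(1)] order_refl]
  proof
    fix x
    show "formbd (kernel (Theta H D)) (fib x) (fib x) 0"
    proof (rule formbd_cong)
      show "formbd (\<lambda>_ _. 0::complex) (fib x) (fib x) 0" by (simp add: formbd_def L2_set_def)
      fix \<beta> \<gamma> assume h: "\<beta> \<in> fib x" "\<gamma> \<in> fib x"
      have "Theta H D = op_add H (Theta H S) (op_scale H (-1) (Theta H T))"
        unfolding D_def Theta_add[OF adj(1) E.op_scale_adjointable[OF adj(2)]] Theta_scale[OF adj(2)] ..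
      then show "kernel (Theta H D) \<gamma> \<beta> = 0" using eq h by (simp add: kernel_add kernel_scale fibre_iff)
    qed
  qed
  then have n: "op_norm BS D \<le> 0" using Theta_isometric[OF D] by simp
  show ?thesis
  proof (rule E.adjointable_eqI[OF adj])
    fix g h assume gh: "g \<in> arr BS" "h \<in> arr BS" "sr BS g = sr BS h"
    have "formbd (\<lambda>g h. E.kernel S g h - E.kernel T g h) (E.fib (sr BS g)) (E.fib (sr BS g)) 0"
      by (rule E.op_norm_diff_formbd[OF adj(2,1)]) (use n D_def in auto)
    then have "le2 (E.fib (sr BS g)) (\<lambda>h. E.kernel S g h - E.kernel T g h) 0"
      by (rule formbd_row) (use gh in \<open>simp_all add: E.fibre_iff\<close>)
    from le2_point[OF this, of h] show "E.kernel S g h = E.kernel T g h" using gh by (simp add: E.fibre_iff)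
  qed
qed

theorem Theta_isomorphism:
  "Theta H \<in> adjointable_equivariant BS \<rightarrow> adjointable H \<and>
    cstar_isomorphism BS (Cuq_equivariant BS) H (Cuq H) (Theta H)"
proof
  show "Theta H \<in> adjointable_equivariant BS \<rightarrow> adjointable H"
    using Theta_adjointable by (auto simp: adjointable_equivariant_def)
  have C: "T \<in> adjointable BS" "E.ql_kernel (E.kernel T)" "E.invariant_kernel (E.kernel T)" if "T \<in> Cuq_equivariant BS" for T
    using that by (auto simp: E.Cuq_equivariant_iff)
  show "cstar_isomorphism BS (Cuq_equivariant BS) H (Cuq H) (Theta H)"
    unfolding cstar_isomorphism_def
  proof (intro conjI ballI allI)
    show "cstar_subalgebra BS (Cuq_equivariant BS)" by (rule E.Cuq_equivariant_cstar_subalgebra)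
    show "cstar_subalgebra H (Cuq H)" by (rule Cuq_cstar_subalgebra)
    show "bij_betw (Theta H) (Cuq_equivariant BS) (Cuq H)"
    proof (rule bij_betw_imageI)
      show "inj_on (Theta H) (Cuq_equivariant BS)" by (rule inj_onI) (rule Theta_inj)
      show "Theta H ` Cuq_equivariant BS = Cuq H"
      proof (intro equalityI subsetI)
        fix S assume "S \<in> Theta H ` Cuq_equivariant BS"
        then show "S \<in> Cuq H" using C Theta_adjointable Theta_ql_kernel by (auto simp: Cuq_iff)
      next
        fix S assume "S \<in> Cuq H"
        then have "S \<in> adjointable H" "ql_kernel (kernel S)" by (auto simp: Cuq_iff)
        from Theta_surj[OF this] obtain T where "T \<in> adjointable BS" "E.ql_kernel (E.kernel T)" "E.invariant_kernel (E.kernel T)" "Theta H T = S"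
          by metis
        then show "S \<in> Theta H ` Cuq_equivariant BS" by (auto simp: E.Cuq_equivariant_iff)
      qed
    qed
  qed (simp_all add: C Theta_add Theta_scale Theta_mul Theta_adj Theta_isometric)
qed

end

theorem proposition7p11:
  fixes G :: "'a groupoid"
  assumes "locally_compact_etale_groupoid G"
  shows "Theta G \<in> adjointable_equivariant (beta_semidirect G) \<rightarrow> adjointable G \<and>
    cstar_isomorphism (beta_semidirect G) (Cuq_equivariant (beta_semidirect G)) G (Cuq G) (Theta G)"
  by (rule etale.Theta_isomorphism[OF etale.intro[OF assms]])

end
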